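(* Let $q\in(0,1)$, let $n$ be a positive integer and $A\in\mathfrak{gl}_n(\mathbb C)$, with $\lambda^{(k)}_i,\mu_i,\nu_i,\nu_n$, $A_{n-1}$, $a_i^{(n-1)},b_i^{(n-1)}$ as in the context. Suppose $\mu_i-\mu_j\notin\mathbb Z$ for $1\le i\ne j\le n$, $\nu_i-\nu_j\notin\mathbb Z$ for $1\le i\ne j\le n-1$, and $\lambda^{(n-1)}_j\ne\lambda^{(n-2)}_l$ for $1\le j\le n-1$, $1\le l\le n-2$. Let $\lambda\in\mathbb C^*$ with $\lambda\notin-\frac{1-q}{q^{\nu_l}}q^{\mathbb Z}$ for $1\le l\le n-1$, and $z\in\mathbb C^*$ with $z\notin\frac{q^{\nu_n}}{1-q}q^{\mathbb Z}$, $z\notin-\frac1\lambda q^{\mathbb Z}$. Then the connection matrix $U_q(z,\lambda;E_{nn},A_{n-1})$ of the system $D_qF_q(z)=\left(E_{nn}+\frac{A_{n-1}}z\right)F_q(z)$ has entries, for $1\le i\le n-1$ and $1\le j\le n$, \begin{align*} U_q(z,\lambda;E_{nn},A_{n-1})_{ij}=&\frac{a_i^{(n-1)}}{\lambda_j^{(n)}-\lambda_i^{(n-1)}}\,\frac{\prod_{l=1,l\ne i}^{n-1}(q^{1+\mu_j-\nu_l};q)_\infty\prod_{l=1,l\ne j}^n(q^{1+\nu_i-\mu_l};q)_\infty}{\prod_{l=1,l\ne j}^n(q^{1+\mu_j-\mu_l};q)_\infty\prod_{l=1,l\ne i}^{n-1}(q^{1+\nu_i-\nu_l};q)_\infty}\\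 &\times\frac{\theta_q(-q^{\mu_j-\nu_i-\nu_n}(1-q)z)}{\theta_q(-q^{-\nu_n}(1-q)z)}\,z^{\mu_j-\nu_i}, \end{align*} and for $1\le j\le n$ $$U_q(z,\lambda;E_{nn},A_{n-1})_{nj}=\frac{\prod_{l=1}^{n-1}(q^{1+\mu_j-\nu_l};q)_\infty}{\prod_{l=1,l\ne j}^n(q^{1+\mu_j-\mu_l};q)_\infty}\,\frac{\prod_{l=1,l\ne j}^n\theta_q((1-q)q^{1-\mu_l}/\lambda)}{\prod_{l=1}^{n-1}\theta_q((1-q)q^{1-\nu_l}/\lambda)}\,\frac{\theta_q(q^{\mu_j-\nu_n}\lambda z)}{\theta_q(\lambda z)}\,z^{\mu_j-\nu_n}.$$
   Context: Notation: $(a;q)_k=\prod_{l=0}^{k-1}(1-aq^l)$, $(a;q)_\infty=\prod_{l\ge0}(1-aq^l)$; $\theta_q(z)=\sum_{m\in\mathbb Z}q^{m(m-1)/2}z^m$; $e_q(z)=1/((1-q)z;q)_\infty$; $D_qF(z)=\frac{F(qz)-F(z)}{qz-z}$; $E_{nn}=\mathrm{diag}(0,\dots,0,1)$; $\delta_{il}$ is the Kronecker delta. A branch of $\log z$ is fixed and used for all powers of $z$. ${}_n\varphi_{n-1}(a_1,\dots,a_n;b_1,\dots,b_{n-1};q,z)=\sum_{k\ge0}\frac{\prod_{l=1}^n(a_l;q)_k}{(q;q)_k\prod_{l=1}^{n-1}(b_l;q)_k}z^k$, continued meromorphically. Spectral data: $\lambda^{(k)}_1,\dots,\lambda^{(k)}_k$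 are the eigenvalues of the upper left $k\times k$ submatrix $A^{(k)}$ of $A=(a_{ij})$; $\mu_i=\log_q(1-(1-q)\lambda^{(n)}_i)$ $(1\le i\le n)$, $\nu_i=\log_q(1-(1-q)\lambda^{(n-1)}_i)$ $(1\le i\le n-1)$, where $\log_qx=\log x/\log q$ with principal logarithm, and $\nu_n=\sum_{l=1}^n\mu_l-\sum_{l=1}^{n-1}\nu_l$. Diagonalization: $\Delta^I_J(M)$ is the minor of $M$ with rows $I$ and columns $J$. Let $P_{n-1}$ be the invertible $(n-1)\times(n-1)$ matrix $(P_{n-1})_{ij}=\frac{(-1)^{i+j}\Delta^{1,\dots,n-2}_{1,\dots,\hat i,\dots,n-1}(A-\lambda_j^{(n-1)}\mathrm{Id}_n)}{r_j}$ (a hat means omission), where $r_j$ is a fixed square root of $\prod_{l\ne j}(\lambda_l^{(n-1)}-\lambda_j^{(n-1)})\prod_{l=1}^{n-2}(\lambda_l^{(n-2)}-\lambda_j^{(n-1)})$. Then $P_{n-1}^{-1}A^{(n-1)}P_{n-1}=\mathrm{diag}(\lambda_1^{(n-1)},\dots,\lambda_{n-1}^{(n-1)})$, and $A_{n-1}:=\mathrm{diag}(P_{n-1}^{-1},1)\,A\,\mathrm{diag}(P_{n-1},1)$ has this diagonal upper left block, last column $(a_1^{(n-1)},\dots,a_{n-1}^{(n-1)},a_{nn})^T$ and last row $(b_1^{(n-1)},\dots,b_{n-1}^{(n-1)},a_{nn})$. Solution at infinity: for $\hat f=\sum_{m\ge0}c_mz^{-m}$ put $(\hat{\mathcal B}_{q;1}\hat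 f)(\xi)=\sum_mc_mq^{m(m-1)/2}\xi^m$; with this continued analytically along the direction of $\lambda$, the $[\lambda;q]$-sum of $\hat f$ is $\sum_{m\in\mathbb Z}\frac{(\hat{\mathcal B}_{q;1}\hat f)(\lambda q^m)}{\theta_q(\lambda q^mz)}$ (for $|z|$ large, then continued meromorphically; for convergent $\hat f$ it is the ordinary sum). The system has a unique formal fundamental solution $\hat H_q(z)\,z^{\mathrm{diag}(\nu_1,\dots,\nu_n)}\,\mathrm{diag}(1,\dots,1,e_q(q^{-\nu_n}z))$ with $\hat H_q=\mathrm{Id}_n+\sum_{m\ge1}H_mz^{-m}$, and $F_q^{(\infty)}(z,\lambda;E_{nn},A_{n-1})$ is obtained by replacing each entry of $\hat H_q$ by its $[\lambda;q]$-sum. Solution at the origin: $F_q^{(0)}(z;E_{nn},A_{n-1})=H_q^{(0)}(z)\,z^{\mathrm{diag}(\mu_1,\dots,\mu_n)}$ with, for $1\le j\le n$, $H_q^{(0)}(z)_{nj}={}_n\varphi_{n-1}\big((q^{1+\mu_j-\nu_l})_{1\le l\le n-1},0;(q^{1+\mu_j-\mu_l})_{l\ne j};q,\tfrac{(1-q)z}{q^{\nu_n}}\big)$ and, for $1\le i\le n-1$, $H_q^{(0)}(z)_{ij}=\frac{a_i^{(n-1)}}{\lambda_j^{(n)}-\lambda_i^{(n-1)}}\,{}_n\varphi_{n-1}\big((q^{1+\mu_j-\nu_l-\delta_{il}})_{1\le l\le n-1},0;(q^{1+\mu_j-\mu_l})_{l\ne j};q,\tfrac{(1-q)z}{q^{\nu_n}}\big)$.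 The connection matrix is defined by $F_q^{(\infty)}(z,\lambda;E_{nn},A_{n-1})\,U_q(z,\lambda;E_{nn},A_{n-1})=F_q^{(0)}(z;E_{nn},A_{n-1})$. *)

theory Defs
  imports
    "HOL-Complex_Analysis.Complex_Analysis"
    "HOL-Computational_Algebra.Computational_Algebra"
    "Jordan_Normal_Form.Char_Poly"
    "Jordan_Normal_Form.Gauss_Jordan_Elimination"
    "Jordan_Normal_Form.DL_Submatrix"
begin

text \<open>
  All row, column, eigenvalue and exponent indices are shifted by one, so they run over
  \<open>0, \<dots>, n - 1\<close>; in particular the index \<open>n\<close> of the literature is \<open>n - 1\<close> here.
\<close>

section \<open>q-special functions\<close>

definition q_poch :: "complex \<Rightarrow> real \<Rightarrow> nat \<Rightarrow> complex" where
  "q_poch a q k = (\<Prod>l<k. 1 - a * of_real q ^ l)"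

definition q_poch_inf :: "complex \<Rightarrow> real \<Rightarrow> complex" where
  "q_poch_inf a q = (\<Prod>l. 1 - a * of_real q ^ l)"

definition theta_q :: "real \<Rightarrow> complex \<Rightarrow> complex" where
  "theta_q q z = (\<Sum>\<^sub>\<infinity>m::int. of_real q powi (m * (m - 1) div 2) * z powi m)"

definition exp_q :: "real \<Rightarrow> complex \<Rightarrow> complex" where
  "exp_q q z = 1 / q_poch_inf ((1 - of_real q) * z) q"

definition log_q :: "real \<Rightarrow> complex \<Rightarrow> complex" where
  "log_q q x = Ln x / of_real (ln q)"

definition q_hyp_coeff :: "complex list \<Rightarrow> complex list \<Rightarrow> real \<Rightarrow> nat \<Rightarrow> complex" where
  "q_hyp_coeff as bs q k =
     (\<Prod>a\<leftarrow>as. q_poch a q k) / (q_poch (of_real q) q k * (\<Prod>b\<leftarrow>bs. q_poch b q k))"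

text \<open>
  Meromorphic continuation to the plane. \<open>nicely_meromorphic_on\<close> fixes the values at removable
  singularities and (as \<open>0\<close>) at poles, so that the continuation is unique as a function.
\<close>

definition q_hyp :: "complex list \<Rightarrow> complex list \<Rightarrow> real \<Rightarrow> complex \<Rightarrow> complex" where
  "q_hyp as bs q =
     (THE F. F nicely_meromorphic_on UNIV \<and>
             (\<forall>x. norm x < 1 \<longrightarrow> (\<lambda>k. q_hyp_coeff as bs q k * x ^ k) sums F x))"

section \<open>Spectral data and diagonalization\<close>

text \<open>\<open>ev k i\<close>, \<open>i < k\<close>, are the eigenvalues (with multiplicity) of the upper left
  \<open>k \<times> k\<close> submatrix.\<close>

definition minor :: "complex mat \<Rightarrow> nat set \<Rightarrow> nat set \<Rightarrow> complex" where
  "minor M I J = det (submatrix M I J)"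

definition is_corner_spectrum :: "nat \<Rightarrow> complex mat \<Rightarrow> (nat \<Rightarrow> nat \<Rightarrow> complex) \<Rightarrow> bool" where
  "is_corner_spectrum n A ev \<longleftrightarrow>
     (\<forall>k\<le>n. char_poly (submatrix A {..<k} {..<k}) = (\<Prod>i<k. [:- ev k i, 1:]))"

definition mu_exp :: "real \<Rightarrow> nat \<Rightarrow> (nat \<Rightarrow> nat \<Rightarrow> complex) \<Rightarrow> nat \<Rightarrow> complex" where
  "mu_exp q n ev i = log_q q (1 - (1 - of_real q) * ev n i)"

definition nu_exp :: "real \<Rightarrow> nat \<Rightarrow> (nat \<Rightarrow> nat \<Rightarrow> complex) \<Rightarrow> nat \<Rightarrow> complex" where
  "nu_exp q n ev i =
     (if i < n - 1 then log_q q (1 - (1 - of_real q) * ev (n - 1) i)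
      else (\<Sum>l<n. mu_exp q n ev l)
             - (\<Sum>l<n - 1. log_q q (1 - (1 - of_real q) * ev (n - 1) l)))"

definition diag_sqrt ::
  "nat \<Rightarrow> (nat \<Rightarrow> nat \<Rightarrow> complex) \<Rightarrow> (nat \<Rightarrow> complex) \<Rightarrow> bool" where
  "diag_sqrt n ev r \<longleftrightarrow>
     (\<forall>j<n - 1. (r j)\<^sup>2 = (\<Prod>l\<in>{..<n - 1} - {j}. ev (n - 1) l - ev (n - 1) j)
                        * (\<Prod>l<n - 2. ev (n - 2) l - ev (n - 1) j))"

definition diag_P ::
  "nat \<Rightarrow> complex mat \<Rightarrow> (nat \<Rightarrow> nat \<Rightarrow> complex) \<Rightarrow> (nat \<Rightarrow> complex) \<Rightarrow> complex mat" where
  "diag_P n A ev r = mat (n - 1) (n - 1) (\<lambda>(i, j).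
     (- 1) ^ (i + j) * minor (A - ev (n - 1) j \<cdot>\<^sub>m 1\<^sub>m n) {..<n - 2} ({..<n - 1} - {i}) / r j)"

text \<open>\<open>diag_extend n M\<close> is the block diagonal matrix \<open>diag(M, 1)\<close>.\<close>

definition diag_extend :: "nat \<Rightarrow> complex mat \<Rightarrow> complex mat" where
  "diag_extend n M = four_block_mat M (0\<^sub>m (n - 1) 1) (0\<^sub>m 1 (n - 1)) (1\<^sub>m 1)"

definition diag_A ::
  "nat \<Rightarrow> complex mat \<Rightarrow> (nat \<Rightarrow> nat \<Rightarrow> complex) \<Rightarrow> (nat \<Rightarrow> complex) \<Rightarrow> complex mat" where
  "diag_A n A ev r =
     diag_extend n (the (mat_inverse (diag_P n A ev r))) * A * diag_extend n (diag_P n A ev r)"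

definition E_last :: "nat \<Rightarrow> complex mat" where
  "E_last n = mat n n (\<lambda>(i, j). if i = n - 1 \<and> j = n - 1 then 1 else 0)"

section \<open>The formal solution at infinity\<close>

text \<open>
  The solution at infinity has the form \<open>H(z) \<Theta>(z)\<close> with a formal power series matrix \<open>H\<close> in
  \<open>1/z\<close> and the diagonal matrix \<open>\<Theta>\<close> of the functions \<open>norm_factor\<close>. Powers of \<open>z\<close> are formed
  with a given logarithm \<open>lg\<close>.
\<close>

definition norm_factor ::
  "real \<Rightarrow> nat \<Rightarrow> (nat \<Rightarrow> complex) \<Rightarrow> (complex \<Rightarrow> complex) \<Rightarrow> nat \<Rightarrow> complex \<Rightarrow> complex" where
  "norm_factor q n nu lg j z =
     exp (nu j * lg z) * (if j < n - 1 then 1 else exp_q q (of_real q powr (- nu j) * z))"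

text \<open>
  Formal Laurent series are in the variable \<open>1/z\<close>, so \<open>z\<close> is \<open>fls_X_inv\<close> and the shift
  \<open>f(z) \<mapsto> f(q z)\<close> substitutes \<open>(1/q) X\<close> for \<open>X\<close>.
\<close>

definition fls_qshift :: "real \<Rightarrow> complex fls \<Rightarrow> complex fls" where
  "fls_qshift q f = fls_compose_fps f (fps_const (inverse (of_real q)) * fps_X)"

text \<open>
  \<open>\<theta>(q z) / \<theta>(z)\<close> for \<open>\<theta>\<close> the \<open>j\<close>-th \<open>norm_factor\<close>, as a Laurent polynomial; see the lemma
  \<open>norm_factor_qshift\<close> below.
\<close>

definition norm_multiplier :: "real \<Rightarrow> nat \<Rightarrow> (nat \<Rightarrow> complex) \<Rightarrow> nat \<Rightarrow> complex fls" where
  "norm_multiplier q n nu j =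
     fls_const (of_real q powr nu j) *
       (if j < n - 1 then 1
        else 1 - fls_const ((1 - of_real q) * of_real q powr (- nu j)) * fls_X_inv)"

lemma q_poch_inf_step:
  assumes "0 < q" "q < 1"
  shows "q_poch_inf a q = (1 - a) * q_poch_inf (a * of_real q) q"
proof -
  let ?f = "\<lambda>l. 1 - a * complex_of_real q ^ l"
  have "summable (\<lambda>l. norm (- (a * complex_of_real q ^ l)))"
    using assms by (simp add: norm_mult norm_power summable_mult summable_geometric)
  then have "abs_convergent_prod ?f"
    by (intro summable_imp_abs_convergent_prod) simp
  then have conv: "convergent_prod ?f"
    by (rule abs_convergent_prod_imp_convergent_prod)
  have "?f has_prod ((\<Prod>l<1. ?f l) * (\<Prod>l. ?f (l + 1)))"
    using conv by (rule has_prod_ignore_initial_segment')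
  then have "prodinf ?f = (1 - a) * (\<Prod>l. ?f (Suc l))"
    by (simp add: has_prod_unique[symmetric])
  then show ?thesis
    by (simp add: q_poch_inf_def mult.assoc)
qed

lemma norm_factor_qshift:
  assumes "0 < q" "q < 1"
    and "lg (of_real q * z) = lg z + of_real (ln q)"
    and "j < n - 1 \<or> q_poch_inf ((1 - of_real q) * (of_real q powr (- nu j) * z)) q \<noteq> 0"
  shows "norm_factor q n nu lg j (of_real q * z) =
     of_real q powr nu j *
       (if j < n - 1 then 1 else 1 - (1 - of_real q) * of_real q powr (- nu j) * z) *
     norm_factor q n nu lg j z"
proof -
  have e: "exp (nu j * lg (of_real q * z)) = of_real q powr nu j * exp (nu j * lg z)"
    using assms(1,3) by (simp add: powr_def Ln_of_real distrib_left exp_add mult.commute)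
  let ?a = "(1 - of_real q) * (of_real q powr (- nu j) * z)"
  have s: "q_poch_inf ?a q = (1 - ?a) * q_poch_inf (?a * of_real q) q"
    by (rule q_poch_inf_step) fact+
  show ?thesis
  proof (cases "j < n - 1")
    case True
    then show ?thesis by (simp add: norm_factor_def e)
  next
    case False
    with assms(4) s have "1 - ?a \<noteq> 0" "q_poch_inf (?a * of_real q) q \<noteq> 0" by auto
    then have "exp_q q (of_real q powr (- nu j) * (of_real q * z))
        = (1 - ?a) * exp_q q (of_real q powr (- nu j) * z)"
      using s by (simp add: exp_q_def mult_ac)
    with False show ?thesis
      unfolding norm_factor_def e by (simp add: mult.assoc)
  qed
qed

text \<open>
  Formal counterpart of \<open>D\<^sub>q (f \<theta>) / \<theta>\<close> where \<open>\<theta>(q z) = k(z) \<theta>(z)\<close>.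
\<close>

definition twisted_q_deriv :: "real \<Rightarrow> complex fls \<Rightarrow> complex fls \<Rightarrow> complex fls" where
  "twisted_q_deriv q k f =
     (fls_qshift q f * k - f) / (fls_const (of_real q) * fls_X_inv - fls_X_inv)"

text \<open>
  \<open>H \<Theta>\<close> is a formal solution of \<open>D\<^sub>q F = (E\<^sub>n\<^sub>n + M / z) F\<close> with \<open>H = Id + O(1/z)\<close>; the \<open>j\<close>-th
  column of the equation has been divided by \<open>\<theta>\<^sub>j\<close>.
\<close>

definition is_formal_solution ::
  "real \<Rightarrow> nat \<Rightarrow> complex mat \<Rightarrow> (nat \<Rightarrow> complex) \<Rightarrow> complex fps mat \<Rightarrow> bool" where
  "is_formal_solution q n M nu H \<longleftrightarrow>
     H \<in> carrier_mat n n \<and>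
     map_mat (\<lambda>f. fps_nth f 0) H = 1\<^sub>m n \<and>
     mat n n (\<lambda>(i, j). twisted_q_deriv q (norm_multiplier q n nu j) (fps_to_fls (H $$ (i, j))))
       = (map_mat fls_const (E_last n) + inverse fls_X_inv \<cdot>\<^sub>m map_mat fls_const M)
           * map_mat fps_to_fls H"

definition formal_H :: "real \<Rightarrow> nat \<Rightarrow> complex mat \<Rightarrow> (nat \<Rightarrow> complex) \<Rightarrow> complex fps mat" where
  "formal_H q n M nu = (THE H. is_formal_solution q n M nu H)"

section \<open>q-Borel summation\<close>

definition q_borel :: "real \<Rightarrow> complex fps \<Rightarrow> complex fps" where
  "q_borel q f = Abs_fps (\<lambda>m. fps_nth f m * of_real q ^ (m * (m - 1) div 2))"

text \<open>
  Continuation of the q-Borel transform along the direction of \<open>lam\<close>: to an open neighbourhood of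
  the ray from \<open>0\<close> through \<open>lam\<close>, star-shaped about \<open>0\<close> (which makes it unique). Since \<open>q\<close> is
  real, the points \<open>lam q\<^sup>m\<close> at which it is evaluated all lie on this ray; poles are
  permitted elsewhere, also on the ray, but not at these points.
\<close>

definition is_borel_continuation ::
  "real \<Rightarrow> complex \<Rightarrow> complex fps \<Rightarrow> (complex \<Rightarrow> complex) \<Rightarrow> bool" where
  "is_borel_continuation q lam f g \<longleftrightarrow>
     (\<exists>S. open S \<and> (\<forall>t\<ge>0. of_real t * lam \<in> S) \<and> (\<forall>x\<in>S. closed_segment 0 x \<subseteq> S) \<and>
          g meromorphic_on S) \<and>
     (\<forall>\<^sub>F x in nhds 0. (\<lambda>m. fps_nth (q_borel q f) m * x ^ m) sums g x) \<and>
     (\<forall>m::int. g analytic_on {lam * of_real q powi m})"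

text \<open>
  \<open>F\<close> is the \<open>[lam; q]\<close>-sum of the series \<open>f\<close> in \<open>1/z\<close>. The excluded points are the zeros of
  \<open>\<theta>\<^sub>q(lam q\<^sup>m z)\<close>.
\<close>

definition is_q_sum ::
  "real \<Rightarrow> complex \<Rightarrow> complex fps \<Rightarrow> (complex \<Rightarrow> complex) \<Rightarrow> bool" where
  "is_q_sum q lam f F \<longleftrightarrow>
     F nicely_meromorphic_on (- {0}) \<and>
     (\<exists>g. is_borel_continuation q lam f g \<and>
        (\<forall>\<^sub>F z in at_infinity.
           (\<forall>k::int. z \<noteq> - 1 / lam * of_real q powi k) \<longrightarrow>
           ((\<lambda>m::int. g (lam * of_real q powi m) / theta_q q (lam * of_real q powi m * z))
              has_sum F z) UNIV))"

text \<open>Only for \<open>z \<noteq> 0\<close>: the value of \<open>F\<close> at \<open>0\<close> is not determined by \<open>is_q_sum\<close>.\<close>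

definition q_sum :: "real \<Rightarrow> complex \<Rightarrow> complex fps \<Rightarrow> complex \<Rightarrow> complex" where
  "q_sum q lam f z = (THE v. \<exists>F. is_q_sum q lam f F \<and> v = F z)"

section \<open>Fundamental solutions and connection matrix\<close>

definition F_inf ::
  "real \<Rightarrow> nat \<Rightarrow> complex mat \<Rightarrow> (nat \<Rightarrow> complex) \<Rightarrow> (complex \<Rightarrow> complex) \<Rightarrow>
     complex \<Rightarrow> complex \<Rightarrow> complex mat" where
  "F_inf q n M nu lg lam z = mat n n (\<lambda>(i, j).
     q_sum q lam (formal_H q n M nu $$ (i, j)) z * norm_factor q n nu lg j z)"

text \<open>The case distinction \<open>l = i\<close> never applies in the last row \<open>i = n - 1\<close>.\<close>

definition H_zero ::
  "real \<Rightarrow> nat \<Rightarrow> complex mat \<Rightarrow> (nat \<Rightarrow> nat \<Rightarrow> complex) \<Rightarrow> (nat \<Rightarrow> complex) \<Rightarrow>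
     (nat \<Rightarrow> complex) \<Rightarrow> complex \<Rightarrow> complex mat" where
  "H_zero q n M ev mu nu z = mat n n (\<lambda>(i, j).
     (if i = n - 1 then 1 else M $$ (i, n - 1) / (ev n j - ev (n - 1) i)) *
     q_hyp (map (\<lambda>l. of_real q powr (1 + mu j - nu l - (if l = i then 1 else 0))) [0..<n - 1] @ [0])
           (map (\<lambda>l. of_real q powr (1 + mu j - mu l)) (filter (\<lambda>l. l \<noteq> j) [0..<n]))
           q ((1 - of_real q) * z / of_real q powr nu (n - 1)))"

definition F_zero ::
  "real \<Rightarrow> nat \<Rightarrow> complex mat \<Rightarrow> (nat \<Rightarrow> nat \<Rightarrow> complex) \<Rightarrow> (nat \<Rightarrow> complex) \<Rightarrow>
     (nat \<Rightarrow> complex) \<Rightarrow> (complex \<Rightarrow> complex) \<Rightarrow> complex \<Rightarrow> complex mat" where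
  "F_zero q n M ev mu nu lg z =
     H_zero q n M ev mu nu z * mat n n (\<lambda>(i, j). if i = j then exp (mu j * lg z) else 0)"

definition connection_matrix ::
  "real \<Rightarrow> nat \<Rightarrow> complex mat \<Rightarrow> (nat \<Rightarrow> nat \<Rightarrow> complex) \<Rightarrow> (nat \<Rightarrow> complex) \<Rightarrow>
     (nat \<Rightarrow> complex) \<Rightarrow> (complex \<Rightarrow> complex) \<Rightarrow> complex \<Rightarrow> complex \<Rightarrow> complex mat" where
  "connection_matrix q n M ev mu nu lg lam z =
     (THE U. U \<in> carrier_mat n n \<and> F_inf q n M nu lg lam z * U = F_zero q n M ev mu nu lg z)"

end

theory Submission
  imports Defs
begin

text \<open>
  In the variable \<open>u = (1 - q) z\<close> the system reads \<open>F(q u) = (B - u E) F(u)\<close> with an arrow matrix \<open>B\<close>.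
  The pairing of a Laurent series solution of the transposed system with a column solution satisfies a
  first order scalar recursion, so it is a constant multiple of a theta function. Product formulas
  give \<open>N\<close> rows \<open>\<eta>\<^sub>k\<close> and one further row depending on the direction \<open>lam\<close>; together they invert, up
  to theta factors, the fundamental matrix at infinity. Hence the connection coefficients are the pairings of
  these rows with the solution at the origin. Their constants come from the pole at \<open>u = q\<^bsup>\<nu>\<^sub>n\<^esup>\<close>, that is,
  from the asymptotics of the coefficients on both sides. The pairings converge only on the annulus
  \<open>q \<bar>q\<^bsup>\<nu>\<^sub>n\<^esup>\<bar> < \<bar>u\<bar> < \<bar>q\<^bsup>\<nu>\<^sub>n\<^esup>\<bar>\<close>; the resulting identity continues analytically.
\<close>

section \<open>Bilateral Laurent series\<close>

text \<open>The three kinds of solutions live on different domains: the formal columns at infinity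
  diverge in general, the rows converge for large \<open>u\<close>, the solution at the origin for
  small \<open>u\<close>. Multiplying a \<open>[lam; q]\<close>-sum by theta(lam z) turns it into a
  Laurent series that converges on the whole punctured plane, so every object becomes a bilateral
  coefficient sequence with a two-term relation in \<open>m\<close>. Against such a column the
  pairing recursion is homogeneous and one coefficient decides. Against the solution at the origin
  it is not: the growth rates of the two factors compensate exactly, a boundary term survives, and
  the pairing is Kronecker's series with coefficients c / (v - w q^m), fixed by its pole at x = 1.
  The hypotheses leave room for mu_j - nu_i to be a nonzero integer and for al_j lam / (1 - q) to
  lie in - q^Z. In these cases the pole condition reads 0 = 0; the series is then a single monomial
  whose coefficient has to be computed by hand, which is the purpose of the degenerate
  lemmas.\<close>

definition laurent_summable :: "(int \<Rightarrow> complex) \<Rightarrow> complex \<Rightarrow> bool" where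
  "laurent_summable c u \<longleftrightarrow> (\<lambda>m. c m * u powi m) summable_on UNIV"

definition laurent_sum :: "(int \<Rightarrow> complex) \<Rightarrow> complex \<Rightarrow> complex" where
  "laurent_sum c u = (\<Sum>\<^sub>\<infinity>m. c m * u powi m)"

definition laurent_conv :: "(int \<Rightarrow> complex) \<Rightarrow> (int \<Rightarrow> complex) \<Rightarrow> int \<Rightarrow> complex" where
  "laurent_conv a b m = (\<Sum>\<^sub>\<infinity>p. a p * b (m - p))"

lemma laurent_has_sum:
  "laurent_summable c u \<Longrightarrow> ((\<lambda>m. c m * u powi m) has_sum laurent_sum c u) UNIV"
  by (simp add: laurent_summable_def laurent_sum_def)

lemma laurent_sumI:
  "((\<lambda>m. c m * u powi m) has_sum s) UNIV \<Longrightarrow> laurent_summable c u \<and> laurent_sum c u = s"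
  by (auto simp: laurent_summable_def laurent_sum_def has_sum_iff)

lemma summable_on_int:
  fixes f :: "int \<Rightarrow> complex"
  assumes "(\<lambda>k::nat. f (int k)) summable_on UNIV" "(\<lambda>k::nat. f (- int k)) summable_on UNIV"
  shows "f summable_on UNIV"
proof -
  have 1: "f summable_on (range int)"
    by (subst summable_on_reindex) (use assms(1) in \<open>auto simp: inj_on_def o_def\<close>)
  have 2: "f summable_on (range (\<lambda>k. - int k))"
    by (subst summable_on_reindex) (use assms(2) in \<open>auto simp: inj_on_def o_def\<close>)
  have "f summable_on (range (\<lambda>k. - int k) - range int)"
    using 2 by (rule summable_on_subset_banach) auto
  with 1 have "f summable_on (range int \<union> (range (\<lambda>k. - int k) - range int))"
    by (rule summable_on_Un_disjoint) auto
  moreover have "x \<in> range int \<union> (range (\<lambda>k. - int k) - range int)" for x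
  proof (cases "x \<ge> 0")
    case True then have "x = int (nat x)" by simp then show ?thesis by blast
  next
    case False then have "x = - int (nat (- x))" by simp
    then show ?thesis using False by blast
  qed
  then have "range int \<union> (range (\<lambda>k. - int k) - range int) = UNIV" by blast
  ultimately show ?thesis by simp
qed

lemma summable_on_geometric_bound:
  fixes f :: "nat \<Rightarrow> complex"
  assumes "\<And>k. norm (f k) \<le> C * s ^ k" "0 \<le> s" "s < 1"
  shows "f summable_on UNIV"
proof (rule norm_summable_imp_summable_on)
  have "summable (\<lambda>k. C * s ^ k)" using assms(2,3) by (intro summable_mult summable_geometric) auto
  then show "summable (\<lambda>k. norm (f k))"
    by (rule summable_comparison_test') (use assms(1) in auto)
qed

lemma laurent_summableI:
  assumes "\<And>k::nat. norm (c (int k)) \<le> C * s ^ k" "0 \<le> s" "s * norm u < 1"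
    and "\<And>k::nat. norm (c (- int k)) \<le> C * r ^ k" "0 \<le> r" "r < norm u"
  shows "laurent_summable c u"
  unfolding laurent_summable_def
proof (rule summable_on_int)
  have u: "u \<noteq> 0" using assms(5,6) by auto
  show "(\<lambda>k. c (int k) * u powi int k) summable_on UNIV"
  proof (rule summable_on_geometric_bound)
    fix k :: nat
    show "norm (c (int k) * u powi int k) \<le> C * (s * norm u) ^ k"
      using mult_right_mono[OF assms(1)[of k], of "norm u ^ k"]
      by (simp add: norm_mult norm_power power_mult_distrib mult.assoc)
  qed (use assms in auto)
  show "(\<lambda>k. c (- int k) * u powi (- int k)) summable_on UNIV"
  proof (rule summable_on_geometric_bound)
    fix k :: nat
    show "norm (c (- int k) * u powi (- int k)) \<le> C * (r / norm u) ^ k"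
      using mult_right_mono[OF assms(4)[of k], of "inverse (norm u ^ k)"]
      by (simp add: norm_mult norm_divide norm_power norm_inverse power_divide power_int_minus field_simps)
  qed (use assms u in auto)
qed

lemma summable_on_times:
  fixes f :: "'a \<Rightarrow> complex" and g :: "'b \<Rightarrow> complex"
  assumes "f summable_on A" "g summable_on B"
  shows "(\<lambda>(x, y). f x * g y) summable_on A \<times> B"
proof -
  have f: "(\<lambda>x. norm (f x)) summable_on A" and g: "(\<lambda>x. norm (g x)) summable_on B"
    using assms by (simp_all add: summable_on_iff_abs_summable_on_complex)
  have "(\<lambda>x. norm (case x of (x, y) \<Rightarrow> f x * g y)) summable_on A \<times> B"
    unfolding Infinite_Sum.abs_summable_on_Sigma_iff
  proof (intro conjI ballI)
    fix x show "(\<lambda>y. norm (case (x, y) of (x, y) \<Rightarrow> f x * g y)) summable_on B"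
      using g by (simp add: norm_mult summable_on_cmult_right)
    have "(\<lambda>x. norm (f x) * infsum (\<lambda>y. norm (g y)) B) summable_on A"
      using f by (intro summable_on_cmult_left) auto
    moreover have "norm (f x) * infsum (\<lambda>y. norm (g y)) B \<ge> 0" for x
      by (intro mult_nonneg_nonneg infsum_nonneg) auto
    ultimately show "(\<lambda>x. norm (infsum (\<lambda>y. norm (case (x, y) of (x, y) \<Rightarrow> f x * g y)) B)) summable_on A"
      by (simp add: norm_mult infsum_cmult_right' abs_of_nonneg infsum_nonneg)
  qed
  then show ?thesis by (simp add: summable_on_iff_abs_summable_on_complex)
qed

lemma has_sum_times:
  fixes f :: "'a \<Rightarrow> complex" and g :: "'b \<Rightarrow> complex"
  assumes "(f has_sum a) A" "(g has_sum b) B"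
  shows "((\<lambda>(x, y). f x * g y) has_sum (a * b)) (A \<times> B)"
proof -
  have *: "(\<lambda>(x, y). f x * g y) summable_on A \<times> B"
    using assms by (intro summable_on_times) (auto simp: summable_on_def)
  show ?thesis
  proof (rule has_sum_SigmaI[OF _ _ *])
    show "((\<lambda>y. case (x, y) of (x, y) \<Rightarrow> f x * g y) has_sum (f x * b)) B" for x
      using assms(2) by (auto intro: has_sum_cmult_right)
    show "((\<lambda>x. f x * b) has_sum (a * b)) A"
      using assms(1) by (rule has_sum_cmult_left)
  qed
qed

text \<open>The double family over \<open>(p, r)\<close> is absolutely summable, so it may be
  regrouped along \<open>m = p + r\<close>; the inner sums are then the convolution coefficients,
  and their convergence is obtained on the way.\<close>

lemma laurent_sum_mult:
  assumes a: "laurent_summable a u" and b: "laurent_summable b u" and u: "u \<noteq> 0"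
  shows "(\<lambda>p. a p * b (m - p)) summable_on UNIV"
    and "laurent_summable (laurent_conv a b) u"
    and "laurent_sum (laurent_conv a b) u = laurent_sum a u * laurent_sum b u"
proof -
  let ?F = "\<lambda>(p, r). (a p * u powi p) * (b r * u powi r)"
  let ?G = "\<lambda>(m, p). (a p * b (m - p)) * u powi m"
  have "(?F has_sum (laurent_sum a u * laurent_sum b u)) (UNIV \<times> UNIV)"
    using has_sum_times[OF laurent_has_sum[OF a] laurent_has_sum[OF b]] .
  also have "?this \<longleftrightarrow> (?G has_sum (laurent_sum a u * laurent_sum b u)) (UNIV \<times> UNIV)"
  proof (rule has_sum_reindex_bij_witness[of _ "\<lambda>(m, p). (p, m - p)" "\<lambda>(p, r). (p + r, p)"])
    fix x :: "int \<times> int"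
    obtain p r where x: "x = (p, r)" by (cases x)
    have "u powi (p + r) = u powi p * u powi r" using u by (simp add: power_int_add)
    then show "?G (case x of (p, r) \<Rightarrow> (p + r, p)) = ?F x" by (simp add: x)
  qed auto
  finally have G: "(?G has_sum (laurent_sum a u * laurent_sum b u)) (UNIV \<times> UNIV)" .
  then have "?G summable_on UNIV \<times> UNIV" by (auto simp: summable_on_def)
  then have *: "(\<lambda>p. (a p * b (m - p)) * u powi m) summable_on UNIV" for m
    by (rule summable_on_SigmaD1) auto
  show s: "(\<lambda>p. a p * b (m - p)) summable_on UNIV" for m
    using summable_on_cmult_left[OF *[of m], of "inverse (u powi m)"] u by (simp add: mult.assoc)
  have "((\<lambda>m. laurent_conv a b m * u powi m) has_sum (laurent_sum a u * laurent_sum b u)) UNIV"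
  proof (rule has_sum_SigmaD[OF G])
    fix m :: int
    show "((\<lambda>y. case (m, y) of (m, p) \<Rightarrow> a p * b (m - p) * u powi m) has_sum
           laurent_conv a b m * u powi m) UNIV"
      unfolding laurent_conv_def using s[of m] by (auto intro: has_sum_cmult_left)
  qed
  from laurent_sumI[OF this]
  show "laurent_summable (laurent_conv a b) u"
    "laurent_sum (laurent_conv a b) u = laurent_sum a u * laurent_sum b u" by auto
qed

lemma laurent_sum_cmult:
  assumes "laurent_summable c u"
  shows "laurent_summable (\<lambda>m. k * c m) u" "laurent_sum (\<lambda>m. k * c m) u = k * laurent_sum c u"
  using laurent_sumI[of "\<lambda>m. k * c m" u "k * laurent_sum c u"]
    has_sum_cmult_right[OF laurent_has_sum[OF assms], of k]
  by (simp_all add: mult.assoc)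

lemma laurent_sum_add:
  assumes "laurent_summable c u" "laurent_summable d u"
  shows "laurent_summable (\<lambda>m. c m + d m) u"
    "laurent_sum (\<lambda>m. c m + d m) u = laurent_sum c u + laurent_sum d u"
  using laurent_sumI[of "\<lambda>m. c m + d m" u "laurent_sum c u + laurent_sum d u"]
    has_sum_add[OF laurent_has_sum[OF assms(1)] laurent_has_sum[OF assms(2)]]
  by (simp_all add: algebra_simps)

lemma laurent_sum_diff:
  assumes "laurent_summable c u" "laurent_summable d u"
  shows "laurent_summable (\<lambda>m. c m - d m) u"
    "laurent_sum (\<lambda>m. c m - d m) u = laurent_sum c u - laurent_sum d u"
  using laurent_sum_add[OF assms(1) laurent_sum_cmult(1)[OF assms(2), of "-1"]]
    laurent_sum_cmult(2)[OF assms(2), of "-1"] by simp_all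

lemma laurent_sum_sum:
  assumes "\<And>i. i \<in> I \<Longrightarrow> laurent_summable (c i) u"
  shows "laurent_summable (\<lambda>m. \<Sum>i\<in>I. c i m) u"
    "laurent_sum (\<lambda>m. \<Sum>i\<in>I. c i m) u = (\<Sum>i\<in>I. laurent_sum (c i) u)"
proof -
  have "laurent_summable (\<lambda>m. \<Sum>i\<in>I. c i m) u \<and>
    laurent_sum (\<lambda>m. \<Sum>i\<in>I. c i m) u = (\<Sum>i\<in>I. laurent_sum (c i) u)"
    using assms
  proof (induction I rule: infinite_finite_induct)
    case (insert x F)
    then show ?case using laurent_sum_add[of "c x" u "\<lambda>m. \<Sum>i\<in>F. c i m"] by auto
  qed (auto simp: laurent_summable_def laurent_sum_def)
  then show "laurent_summable (\<lambda>m. \<Sum>i\<in>I. c i m) u"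
    "laurent_sum (\<lambda>m. \<Sum>i\<in>I. c i m) u = (\<Sum>i\<in>I. laurent_sum (c i) u)" by auto
qed

lemma laurent_sum_shift:
  assumes "laurent_summable c u" "u \<noteq> 0"
  shows "laurent_summable (\<lambda>m. c (m - 1)) u" "laurent_sum (\<lambda>m. c (m - 1)) u = u * laurent_sum c u"
proof -
  have "((\<lambda>m. u * (c m * u powi m)) has_sum (u * laurent_sum c u)) UNIV"
    by (intro has_sum_cmult_right laurent_has_sum assms)
  also have "?this \<longleftrightarrow> ((\<lambda>m. c (m - 1) * u powi m) has_sum (u * laurent_sum c u)) UNIV"
    by (rule has_sum_reindex_bij_witness[of _ "\<lambda>m. m - 1" "\<lambda>m. m + 1"])
      (use assms in \<open>auto simp: power_int_add\<close>)
  finally show "laurent_summable (\<lambda>m. c (m - 1)) u"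
    "laurent_sum (\<lambda>m. c (m - 1)) u = u * laurent_sum c u"
    using laurent_sumI[of "\<lambda>m. c (m - 1)"] by blast+
qed

lemma laurent_sum_scale:
  "laurent_summable (\<lambda>m. c m * w powi m) u \<longleftrightarrow> laurent_summable c (w * u)"
  "laurent_sum (\<lambda>m. c m * w powi m) u = laurent_sum c (w * u)"
  by (simp_all add: laurent_summable_def laurent_sum_def power_int_mult_distrib mult.assoc)

text \<open>On an annulus a monomial is largest on the outer circle for nonnegative exponents and on
  the inner circle for negative ones. Adding both boundary values gives one majorant for the
  Weierstrass test.\<close>

lemma power_int_le_sum_radii:
  fixes x r1 r2 :: real
  assumes "0 < r1" "r1 \<le> x" "x \<le> r2"
  shows "x powi m \<le> r1 powi m + r2 powi m"
proof (cases "m \<ge> 0")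
  case True
  then have "x powi m \<le> r2 powi m" using assms by (simp add: power_int_def power_mono)
  then show ?thesis using assms by (simp add: add_increasing)
next
  case False
  then have "x powi m \<le> r1 powi m"
    using assms by (simp add: power_int_def power_mono le_imp_inverse_le)
  then show ?thesis using assms by (simp add: add_increasing2)
qed

lemma laurent_sum_holomorphic:
  assumes "laurent_summable c (of_real r1)" "laurent_summable c (of_real r2)" "0 < r1"
  shows "laurent_sum c holomorphic_on {u. r1 < norm u \<and> norm u < r2}"
proof -
  have "open ({u :: complex. r1 < norm u} \<inter> {u. norm u < r2})"
    by (intro open_Int open_Collect_less continuous_intros)
  then have op: "open {u :: complex. r1 < norm u \<and> norm u < r2}"
    by (simp add: Collect_conj_eq)
  define M where "M = (\<lambda>m. norm (c m) * r1 powi m + norm (c m) * r2 powi m)"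
  show ?thesis
    unfolding holomorphic_on_open[OF op]
  proof (intro ballI)
    fix u :: complex assume u: "u \<in> {u. r1 < norm u \<and> norm u < r2}"
    then have r2: "r2 > 0" using assms(3) by auto
    have summ: "M summable_on UNIV"
      unfolding M_def
    proof (rule summable_on_add)
      show "(\<lambda>m. norm (c m) * r1 powi m) summable_on UNIV"
        using assms(1,3) unfolding laurent_summable_def summable_on_iff_abs_summable_on_complex
        by (simp add: norm_mult norm_power_int)
      show "(\<lambda>m. norm (c m) * r2 powi m) summable_on UNIV"
        using assms(2) r2 unfolding laurent_summable_def summable_on_iff_abs_summable_on_complex
        by (simp add: norm_mult norm_power_int)
    qed
    from op u obtain e where e: "e > 0" "cball u e \<subseteq> {u. r1 < norm u \<and> norm u < r2}"
      using open_contains_cball by blast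
    have lim: "uniform_limit (cball u e) (\<lambda>X y. \<Sum>m\<in>X. c m * y powi m) (laurent_sum c)
        (finite_subsets_at_top UNIV)"
      unfolding laurent_sum_def[abs_def]
    proof (rule Weierstrass_m_test_general[OF _ summ])
      fix m y assume "y \<in> cball u e"
      then have "r1 < norm y \<and> norm y < r2" using e by auto
      then have "norm y powi m \<le> r1 powi m + r2 powi m"
        using assms(3) by (intro power_int_le_sum_radii) auto
      then have "norm (c m) * norm y powi m \<le> norm (c m) * (r1 powi m + r2 powi m)"
        by (intro mult_left_mono) auto
      then show "norm (c m * y powi m) \<le> M m"
        by (simp add: M_def norm_mult norm_power_int distrib_left)
    qed
    have nz: "y \<noteq> 0" if "y \<in> cball u e" for y
    proof -
      have "r1 < norm y" using e(2) that by blast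
      then show ?thesis using assms(3) by auto
    qed
    have hol: "(\<lambda>y. \<Sum>m\<in>X. c m * y powi m) holomorphic_on cball u e" for X
      by (intro holomorphic_intros) (use nz in auto)
    have "laurent_sum c holomorphic_on ball u e"
    proof (rule holomorphic_uniform_limit[OF _ lim])
      show "\<forall>\<^sub>F X in finite_subsets_at_top UNIV.
         continuous_on (cball u e) (\<lambda>y. \<Sum>m\<in>X. c m * y powi m) \<and>
         (\<lambda>y. \<Sum>m\<in>X. c m * y powi m) holomorphic_on ball u e"
        using hol holomorphic_on_imp_continuous_on holomorphic_on_subset[OF hol ball_subset_cball]
        by (intro always_eventually) blast
    qed auto
    then have "laurent_sum c holomorphic_on ball u e" .
    with e(1) show "\<exists>f'. (laurent_sum c has_field_derivative f') (at u)"
      unfolding holomorphic_on_open[OF open_ball] by auto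
  qed
qed

lemma laurent_sum_holomorphic_punctured:
  assumes "\<And>u. u \<noteq> 0 \<Longrightarrow> laurent_summable c u"
  shows "laurent_sum c holomorphic_on (- {0})"
proof -
  have "laurent_sum c analytic_on {u}" if "u \<noteq> 0" for u
  proof -
    have "open ({v :: complex. norm u / 2 < norm v} \<inter> {v. norm v < 2 * norm u})"
      by (intro open_Int open_Collect_less continuous_intros)
    then have "open {v :: complex. norm u / 2 < norm v \<and> norm v < 2 * norm u}"
      by (simp add: Collect_conj_eq)
    moreover have "laurent_sum c holomorphic_on {v. norm u / 2 < norm v \<and> norm v < 2 * norm u}"
      by (rule laurent_sum_holomorphic) (use that in \<open>auto intro!: assms\<close>)
    ultimately show ?thesis unfolding analytic_at using that by auto
  qed
  then have "laurent_sum c analytic_on (- {0})"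
    by (subst analytic_on_analytic_at) auto
  then show ?thesis by (rule analytic_imp_holomorphic)
qed

section \<open>q-Pochhammer symbols and theta functions\<close>

lemma q_poch_inf_convergent:
  assumes "0 < q" "q < 1"
  shows "convergent_prod (\<lambda>l. 1 - a * complex_of_real q ^ l)"
proof -
  have "summable (\<lambda>l. norm (- (a * complex_of_real q ^ l)))"
    using assms by (simp add: norm_mult norm_power summable_mult summable_geometric)
  then have "abs_convergent_prod (\<lambda>l. 1 - a * complex_of_real q ^ l)"
    by (intro summable_imp_abs_convergent_prod) simp
  then show ?thesis by (rule abs_convergent_prod_imp_convergent_prod)
qed

lemma q_poch_Suc: "q_poch a q (Suc k) = q_poch a q k * (1 - a * of_real q ^ k)"
  by (simp add: q_poch_def)

lemma q_poch_0 [simp]: "q_poch a q 0 = 1"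
  by (simp add: q_poch_def)

lemma q_poch_zero [simp]: "q_poch 0 q k = 1"
  by (simp add: q_poch_def)

lemma q_poch_inf_zero [simp]: "q_poch_inf 0 q = 1"
  by (simp add: q_poch_inf_def)

lemma q_poch_tendsto:
  assumes "0 < q" "q < 1"
  shows "(\<lambda>k. q_poch a q k) \<longlonglongrightarrow> q_poch_inf a q"
proof -
  have "(\<lambda>n. \<Prod>i\<le>n. 1 - a * complex_of_real q ^ i) \<longlonglongrightarrow> q_poch_inf a q"
    unfolding q_poch_inf_def by (intro convergent_prod_LIMSEQ q_poch_inf_convergent assms)
  then have "(\<lambda>n. q_poch a q (Suc n)) \<longlonglongrightarrow> q_poch_inf a q"
    unfolding q_poch_def lessThan_Suc_atMost .
  then show ?thesis by (rule LIMSEQ_imp_Suc)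
qed

lemma q_poch_inf_split:
  assumes "0 < q" "q < 1"
  shows "q_poch_inf a q = q_poch a q k * q_poch_inf (a * of_real q ^ k) q"
proof (induction k)
  case (Suc k)
  then show ?case
    using q_poch_inf_step[OF assms, of "a * of_real q ^ k"] by (simp add: q_poch_Suc mult_ac)
qed simp

lemma q_poch_inf_eq_0_iff:
  assumes "0 < q" "q < 1"
  shows "q_poch_inf a q = 0 \<longleftrightarrow> (\<exists>l. a * of_real q ^ l = 1)"
proof -
  have "(\<lambda>n. \<Prod>i\<le>n. 1 - a * complex_of_real q ^ i) \<longlonglongrightarrow> q_poch_inf a q"
    unfolding q_poch_inf_def by (intro convergent_prod_LIMSEQ q_poch_inf_convergent assms)
  then have "q_poch_inf a q = 0 \<longleftrightarrow> (\<exists>i. 1 - a * complex_of_real q ^ i = 0)"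
    using convergent_prod_to_zero_iff[OF q_poch_inf_convergent[OF assms, of a]]
      LIMSEQ_unique by metis
  then show ?thesis by auto
qed

lemma q_poch_inf_q_nonzero:
  assumes "0 < q" "q < 1"
  shows "q_poch_inf (of_real q) q \<noteq> 0"
proof
  assume "q_poch_inf (of_real q) q = 0"
  then obtain l where "complex_of_real q * of_real q ^ l = 1"
    using q_poch_inf_eq_0_iff[OF assms] by auto
  then have "complex_of_real (q ^ Suc l) = of_real 1" by simp
  then have "q ^ Suc l = 1" unfolding of_real_eq_iff .
  moreover have "q ^ Suc l < 1" using assms by (intro power_Suc_less_one) auto
  ultimately show False by simp
qed

subsection \<open>Euler's expansion\<close>

definition tri :: "int \<Rightarrow> int" where "tri m = m * (m - 1) div 2"

lemma tri_0 [simp]: "tri 0 = 0" and tri_1 [simp]: "tri 1 = 0"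
  by (simp_all add: tri_def)

lemma tri_plus1: "tri (m + 1) = tri m + m"
proof -
  have "(m + 1) * (m + 1 - 1) = m * (m - 1) + 2 * m" by (simp add: algebra_simps)
  then show ?thesis unfolding tri_def by (metis div_mult_self2 zero_neq_numeral add.commute)
qed

lemma tri_uminus: "tri (- m) = tri m + m"
proof -
  have "(- m) * (- m - 1) = m * (m - 1) + 2 * m" by (simp add: algebra_simps)
  then show ?thesis unfolding tri_def by (metis div_mult_self2 zero_neq_numeral add.commute)
qed

lemma tri_double: "2 * tri m = m * (m - 1)"
  unfolding tri_def by (cases "even m") auto

lemma tri_add: "tri (m + n) = tri m + tri n + m * n"
proof -
  have "2 * tri (m + n) = 2 * (tri m + tri n + m * n)"
    unfolding distrib_left tri_double by (simp add: algebra_simps)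
  then show ?thesis by simp
qed

lemma tri_minus1: "tri (m - 1) = tri m - m + 1"
  using tri_plus1[of "m - 1"] by simp

lemma tri_nonneg: "tri m \<ge> 0"
proof -
  have "m * (m - 1) \<ge> 0" by (cases "m \<ge> 1") (auto simp: mult_nonpos_nonpos)
  then show ?thesis by (simp add: tri_def)
qed

lemma tri_nat: "tri (int k) = int (k * (k - 1) div 2)"
  by (cases k) (simp_all add: tri_def zdiv_int algebra_simps)

definition euler_coeff :: "real \<Rightarrow> nat \<Rightarrow> complex" where
  "euler_coeff q m = of_real q powi tri (int m) / q_poch (of_real q) q m"

lemma q_poch_q_nonzero:
  assumes "0 < q" "q < 1"
  shows "q_poch (of_real q) q k \<noteq> 0"
  using q_poch_inf_split[OF assms, of "of_real q" k] q_poch_inf_q_nonzero[OF assms] by auto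

lemma euler_coeff_Suc:
  assumes "0 < q" "q < 1"
  shows "euler_coeff q (Suc m) * (1 - of_real q ^ Suc m) = of_real q ^ m * euler_coeff q m"
proof -
  have "1 - complex_of_real q * of_real q ^ m \<noteq> 0" "q_poch (of_real q) q m \<noteq> 0"
    using q_poch_q_nonzero[OF assms, of "Suc m"] by (auto simp: q_poch_Suc)
  moreover have "tri (1 + int m) = tri (int m) + int m" using tri_plus1[of "int m"] by (simp add: add.commute)
  ultimately show ?thesis
    using assms by (simp add: euler_coeff_def q_poch_Suc power_int_add field_simps)
qed

lemma summable_euler:
  assumes "0 < q" "q < 1"
  shows "summable (\<lambda>m. norm (euler_coeff q m * a ^ m))"
proof -
  have "(\<lambda>n. q ^ n * (norm a / (1 - q))) \<longlonglongrightarrow> 0 * (norm a / (1 - q))"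
    using assms by (intro tendsto_intros LIMSEQ_realpow_zero) auto
  then have "\<forall>\<^sub>F n in sequentially. q ^ n * (norm a / (1 - q)) < 1 / 2"
    by (intro order_tendstoD) auto
  then obtain N where N: "\<And>n. n \<ge> N \<Longrightarrow> q ^ n * (norm a / (1 - q)) < 1 / 2"
    unfolding eventually_sequentially by auto
  show ?thesis
  proof (rule summable_ratio_test[of "1/2" N])
    fix n assume n: "n \<ge> N"
    have le: "1 - q \<le> 1 - q ^ Suc n"
      using assms power_le_one[of q n] by (simp add: mult_left_le)
    have "1 - complex_of_real q ^ Suc n = of_real (1 - q ^ Suc n)" by simp
    then have nrm: "norm (1 - complex_of_real q ^ Suc n) = 1 - q ^ Suc n"
      unfolding norm_of_real using le assms by (metis norm_of_real abs_of_nonneg diff_ge_0_iff_ge less_imp_le order_trans)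
    have "norm (euler_coeff q (Suc n)) * (1 - q ^ Suc n) = q ^ n * norm (euler_coeff q n)"
      using arg_cong[OF euler_coeff_Suc[OF assms, of n], of norm] assms
      unfolding norm_mult nrm by (simp add: norm_power)
    moreover have "norm (euler_coeff q (Suc n)) * (1 - q) \<le> norm (euler_coeff q (Suc n)) * (1 - q ^ Suc n)"
      using le by (intro mult_left_mono) auto
    ultimately have "norm (euler_coeff q (Suc n)) \<le> q ^ n * norm (euler_coeff q n) / (1 - q)"
      using assms by (simp add: pos_le_divide_eq)
    from mult_right_mono[OF this, of "norm a ^ Suc n"]
    have "norm (euler_coeff q (Suc n) * a ^ Suc n) \<le> q ^ n * norm (euler_coeff q n) / (1 - q) * norm a ^ Suc n"
      unfolding norm_mult norm_power by simp
    also have "\<dots> = (q ^ n * (norm a / (1 - q))) * norm (euler_coeff q n * a ^ n)"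
      by (simp add: norm_mult norm_power)
    also have "\<dots> \<le> 1 / 2 * norm (euler_coeff q n * a ^ n)"
      using N[OF n] by (intro mult_right_mono) auto
    finally show "norm (norm (euler_coeff q (Suc n) * a ^ Suc n)) \<le> 1 / 2 * norm (norm (euler_coeff q n * a ^ n))"
      by simp
  qed auto
qed

text \<open>The series satisfies \<open>E a = (1 + a) * E (a * q)\<close> and
  \<open>E 0 = 1\<close>. Iteration splits off the finite products and pushes the argument to 0,
  where the power series is continuous.\<close>

lemma euler_sums:
  assumes q: "0 < q" "q < 1"
  shows "(\<lambda>m. euler_coeff q m * a ^ m) sums q_poch_inf (- a) q"
proof -
  define E where "E = (\<lambda>a. \<Sum>m. euler_coeff q m * a ^ m)"
  have summ: "summable (\<lambda>m. euler_coeff q m * a ^ m)" for a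
    using summable_euler[OF q] by (rule summable_norm_cancel)
  have E0: "E 0 = 1" unfolding E_def powser_zero by (simp add: euler_coeff_def)
  have step: "E a = (1 + a) * E (a * of_real q)" for a
  proof -
    let ?c = "euler_coeff q"
    have s: "(\<lambda>m. ?c m * (a * of_real q) ^ m) sums E (a * of_real q)"
      unfolding E_def using summ by (rule summable_sums)
    have s1: "(\<lambda>m. case m of 0 \<Rightarrow> 0 | Suc m \<Rightarrow> a * (?c m * (a * of_real q) ^ m)) sums (a * E (a * of_real q))"
      using sums_mult[OF s, of a]
        iffD1[OF sums_Suc_iff, of "\<lambda>m. case m of 0 \<Rightarrow> 0 | Suc m \<Rightarrow> a * (?c m * (a * of_real q) ^ m)"]
      by simp
    have eq: "?c m * (a * of_real q) ^ m + (case m of 0 \<Rightarrow> 0 | Suc m \<Rightarrow> a * (?c m * (a * of_real q) ^ m))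
        = ?c m * a ^ m" for m
    proof (cases m)
      case (Suc k)
      have "?c m * a ^ m = (?c (Suc k) * (1 - of_real q ^ Suc k)) * a ^ Suc k + ?c (Suc k) * (a * of_real q) ^ Suc k"
        by (simp add: Suc algebra_simps power_mult_distrib)
      also have "\<dots> = (of_real q ^ k * ?c k) * a ^ Suc k + ?c (Suc k) * (a * of_real q) ^ Suc k"
        by (simp only: euler_coeff_Suc[OF q])
      finally show ?thesis by (simp add: Suc algebra_simps power_mult_distrib)
    qed simp
    have "(\<lambda>m. ?c m * a ^ m) sums (E (a * of_real q) + a * E (a * of_real q))"
      using sums_add[OF s s1] unfolding eq .
    then show ?thesis unfolding E_def by (simp add: sums_iff algebra_simps)
  qed
  have it: "E a = q_poch (- a) q k * E (a * of_real q ^ k)" for k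
  proof (induction k)
    case (Suc k)
    then show ?case using step[of "a * of_real q ^ k"] by (simp add: q_poch_Suc mult_ac)
  qed simp
  have "isCont E 0"
    unfolding E_def by (rule isCont_powser[where K = 1]) (use summ[of 1] in auto)
  moreover have "(\<lambda>k. a * complex_of_real q ^ k) \<longlonglongrightarrow> 0"
    using q by (intro tendsto_mult_right_zero LIMSEQ_power_zero) auto
  ultimately have "(\<lambda>k. E (a * complex_of_real q ^ k)) \<longlonglongrightarrow> E 0"
    by (rule isCont_tendsto_compose)
  then have "(\<lambda>k. q_poch (- a) q k * E (a * of_real q ^ k)) \<longlonglongrightarrow> q_poch_inf (- a) q * E 0"
    by (intro tendsto_mult q_poch_tendsto q)
  then have "E a = q_poch_inf (- a) q"
    unfolding it[symmetric] E0 by (simp add: LIMSEQ_const_iff)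
  with summable_sums[OF summ[of a]] show ?thesis unfolding E_def by simp
qed

text \<open>Euler's expansion is an everywhere convergent power series, so holomorphy of the
  infinite product comes for free.\<close>

lemma q_poch_inf_holomorphic:
  assumes "0 < q" "q < 1"
  shows "(\<lambda>a. q_poch_inf a q) holomorphic_on UNIV"
proof -
  have "(\<lambda>a. q_poch_inf (- a) q) holomorphic_on ball 0 r" for r
    by (rule power_series_holomorphic[of 0 r "euler_coeff q"]) (use euler_sums[OF assms] in auto)
  then have "(\<lambda>a. q_poch_inf (- a) q) analytic_on {a}" for a
    unfolding analytic_at by (intro exI[of _ "ball 0 (norm a + 1)"]) auto
  then have "(\<lambda>a. q_poch_inf (- a) q) holomorphic_on UNIV"
    by (metis analytic_on_analytic_at analytic_imp_holomorphic)
  then have "((\<lambda>a. q_poch_inf (- a) q) \<circ> uminus) holomorphic_on UNIV"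
    by (intro holomorphic_on_compose holomorphic_intros) (auto intro: holomorphic_on_subset)
  then show ?thesis by (simp add: o_def)
qed

lemma q_poch_inf_holomorphic' [holomorphic_intros]:
  assumes "0 < q" "q < 1" "f holomorphic_on A"
  shows "(\<lambda>z. q_poch_inf (f z) q) holomorphic_on A"
  using holomorphic_on_compose_gen[OF assms(3) q_poch_inf_holomorphic[OF assms(1,2)]]
  by (auto simp: o_def)

lemma q_poch_inf_isCont:
  assumes "0 < q" "q < 1"
  shows "isCont (\<lambda>a. q_poch_inf a q) a"
  using holomorphic_on_imp_continuous_on[OF q_poch_inf_holomorphic[OF assms]]
  by (simp add: continuous_on_eq_continuous_at)

subsection \<open>Theta functions\<close>

text \<open>Consecutive terms of the left side have ratio \<open>K * q ^ k\<close>, which tends to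
  0; a quadratic exponent therefore beats every geometric sequence. All convergence on the whole
  punctured plane rests on this estimate.\<close>

lemma gauss_bound:
  fixes q K s :: real
  assumes q: "0 < q" "q < 1" and s: "0 < s" and K: "0 \<le> K"
  obtains C where "C \<ge> 0" "\<And>k. K ^ k * q powi tri (int k) \<le> C * s ^ k"
proof -
  define t where "t = (\<lambda>k. (K / s) ^ k * q powi tri (int k))"
  have t_Suc: "t (Suc k) = (q ^ k * (K / s)) * t k" for k
    using tri_plus1[of "int k"] q by (simp add: t_def add.commute power_int_add)
  have t_pos: "t k \<ge> 0" for k using q s K by (simp add: t_def)
  have "(\<lambda>n. q ^ n * (K / s)) \<longlonglongrightarrow> 0 * (K / s)"
    using q by (intro tendsto_intros LIMSEQ_realpow_zero) auto
  then have "\<forall>\<^sub>F n in sequentially. q ^ n * (K / s) < 1 / 2"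
    by (intro order_tendstoD) auto
  then obtain N where N: "\<And>n. n \<ge> N \<Longrightarrow> q ^ n * (K / s) < 1 / 2"
    unfolding eventually_sequentially by auto
  have "summable t"
  proof (rule summable_ratio_test[of "1/2" N])
    fix n assume n: "n \<ge> N"
    have "norm (t (Suc n)) = t (Suc n)" using t_pos[of "Suc n"] by simp
    also have "\<dots> = (q ^ n * (K / s)) * t n" by (rule t_Suc)
    also have "\<dots> \<le> 1 / 2 * t n"
      using N[OF n] t_pos by (intro mult_right_mono) auto
    finally show "norm (t (Suc n)) \<le> 1 / 2 * norm (t n)" using t_pos[of n] by simp
  qed auto
  then obtain C where C: "\<And>k. norm (t k) \<le> C"
    using summable_imp_Bseq unfolding Bseq_def by blast
  have "C \<ge> 0" using order_trans[OF norm_ge_zero C[of 0]] .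
  moreover have "K ^ k * q powi tri (int k) \<le> C * s ^ k" for k
  proof -
    have "K ^ k * q powi tri (int k) = t k * s ^ k" using s by (simp add: t_def power_divide)
    also have "\<dots> \<le> C * s ^ k" using C[of k] s by (intro mult_right_mono) auto
    finally show ?thesis .
  qed
  ultimately show ?thesis using that by blast
qed

lemma laurent_summable_theta_type:
  assumes q: "0 < q" "q < 1"
    and c: "\<And>m. norm (c m) \<le> C * K ^ nat \<bar>m\<bar> * q powi tri m" and "0 \<le> C" "0 \<le> K" and u: "u \<noteq> 0"
  shows "laurent_summable c u"
proof -
  obtain C1 where C1: "C1 \<ge> 0" "\<And>k. K ^ k * q powi tri (int k) \<le> C1 * (1 / (2 * norm u)) ^ k"
    by (rule gauss_bound[of q "1 / (2 * norm u)" K]) (use assms in auto)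
  obtain C2 where C2: "C2 \<ge> 0" "\<And>k. K ^ k * q powi tri (int k) \<le> C2 * (norm u / 2) ^ k"
    by (rule gauss_bound[of q "norm u / 2" K]) (use assms in auto)
  show ?thesis
  proof (rule laurent_summableI[where C = "C * (C1 + C2)" and s = "1 / (2 * norm u)" and r = "norm u / 2"])
    fix k :: nat
    have "norm (c (int k)) \<le> C * (K ^ k * q powi tri (int k))" using c[of "int k"] by (simp add: mult.assoc)
    also have "\<dots> \<le> C * (C1 * (1 / (2 * norm u)) ^ k)" using C1 assms by (intro mult_left_mono) auto
    also have "\<dots> \<le> C * ((C1 + C2) * (1 / (2 * norm u)) ^ k)" using C2 assms by (intro mult_left_mono mult_right_mono) auto
    finally show "norm (c (int k)) \<le> C * (C1 + C2) * (1 / (2 * norm u)) ^ k" by (simp add: mult.assoc)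
    \<comment> \<open>Negative indices are no worse than positive ones: tri(-k) = tri(k) + k only
      makes the weight smaller.\<close>
    have "q powi tri (- int k) = q powi tri (int k) * q ^ k"
      using q by (simp add: tri_uminus power_int_add)
    also have "\<dots> \<le> q powi tri (int k) * 1" using q by (intro mult_left_mono power_le_one) auto
    finally have le: "q powi tri (- int k) \<le> q powi tri (int k)" by simp
    have "norm (c (- int k)) \<le> C * (K ^ k * q powi tri (- int k))" using c[of "- int k"] by (simp add: mult.assoc)
    also have "\<dots> \<le> C * (K ^ k * q powi tri (int k))" using le assms by (intro mult_left_mono) auto
    also have "\<dots> \<le> C * (C2 * (norm u / 2) ^ k)" using C2 assms by (intro mult_left_mono) auto
    also have "\<dots> \<le> C * ((C1 + C2) * (norm u / 2) ^ k)" using C1 assms by (intro mult_left_mono mult_right_mono) auto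
    finally show "norm (c (- int k)) \<le> C * (C1 + C2) * (norm u / 2) ^ k" by (simp add: mult.assoc)
  qed (use u in auto)
qed

definition theta_coeff :: "real \<Rightarrow> int \<Rightarrow> complex" where
  "theta_coeff q m = of_real q powi tri m"

lemma theta_q_laurent: "theta_q q z = laurent_sum (theta_coeff q) z"
  by (simp add: theta_q_def laurent_sum_def theta_coeff_def tri_def)

lemma theta_summable:
  assumes "0 < q" "q < 1" "u \<noteq> 0"
  shows "laurent_summable (theta_coeff q) u"
  by (rule laurent_summable_theta_type[where C = 1 and K = 1])
    (use assms in \<open>auto simp: theta_coeff_def norm_power_int\<close>)

lemma theta_q_holomorphic:
  assumes "0 < q" "q < 1"
  shows "theta_q q holomorphic_on (- {0})"
proof -
  have "laurent_sum (theta_coeff q) holomorphic_on (- {0})"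
    by (rule laurent_sum_holomorphic_punctured) (use theta_summable[OF assms] in auto)
  moreover have "theta_q q = laurent_sum (theta_coeff q)" by (simp add: fun_eq_iff theta_q_laurent)
  ultimately show ?thesis by simp
qed

lemma theta_q_shift:
  assumes "0 < q" "q < 1" "z \<noteq> 0"
  shows "theta_q q (of_real q * z) = theta_q q z / z"
proof -
  have "theta_q q z = laurent_sum (\<lambda>m. theta_coeff q (m - 1) * of_real q powi (m - 1)) z"
  proof -
    have "theta_coeff q m = theta_coeff q (m - 1) * of_real q powi (m - 1)" for m
      using tri_plus1[of "m - 1"] assms by (simp add: theta_coeff_def power_int_add)
    then show ?thesis unfolding theta_q_laurent by (metis (no_types, lifting) ext)
  qed
  also have "\<dots> = z * laurent_sum (\<lambda>m. theta_coeff q m * of_real q powi m) z"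
    by (rule laurent_sum_shift(2)[of "\<lambda>m. theta_coeff q m * of_real q powi m"])
      (use assms in \<open>auto simp: laurent_sum_scale intro!: theta_summable\<close>)
  also have "\<dots> = z * theta_q q (of_real q * z)"
    by (simp add: laurent_sum_scale theta_q_laurent)
  finally show ?thesis using assms by simp
qed

lemma theta_q_shift_powi:
  assumes "0 < q" "q < 1" "z \<noteq> 0"
  shows "theta_q q (of_real q powi k * z) = of_real q powi (- tri k) * z powi (- k) * theta_q q z"
proof (induction k rule: int_induct[of _ 0])
  case (step1 k)
  have "theta_q q (of_real q powi (k + 1) * z) = theta_q q (of_real q * (of_real q powi k * z))"
    using assms by (simp add: power_int_add mult_ac)
  also have "\<dots> = theta_q q (of_real q powi k * z) / (of_real q powi k * z)"
    by (rule theta_q_shift) (use assms in auto)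
  also have "\<dots> = of_real q powi (- tri k) * z powi (- k) * theta_q q z / (of_real q powi k * z)"
    using step1 by simp
  also have "\<dots> = of_real q powi (- tri (k + 1)) * z powi (- (k + 1)) * theta_q q z"
    unfolding tri_plus1 using assms by (simp add: power_int_add power_int_diff power_int_minus field_simps)
  finally show ?case .
next
  case (step2 k)
  have "theta_q q (of_real q powi k * z) = theta_q q (of_real q * (of_real q powi (k - 1) * z))"
    using assms by (simp add: power_int_diff mult_ac)
  also have "\<dots> = theta_q q (of_real q powi (k - 1) * z) / (of_real q powi (k - 1) * z)"
    by (rule theta_q_shift) (use assms in auto)
  finally have "theta_q q (of_real q powi (k - 1) * z)
      = of_real q powi (- tri k) * z powi (- k) * theta_q q z * (of_real q powi (k - 1) * z)"
    using step2 assms by (simp add: field_simps)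
  also have "\<dots> = of_real q powi (- tri (k - 1)) * z powi (- (k - 1)) * theta_q q z"
    using assms by (simp add: tri_minus1 power_int_add power_int_diff power_int_minus field_simps)
  finally show ?case .
qed simp

lemma theta_q_inversion:
  assumes "0 < q" "q < 1" "z \<noteq> 0"
  shows "theta_q q (of_real q / z) = theta_q q z"
proof -
  have "((\<lambda>m. theta_coeff q m * z powi m) has_sum theta_q q z) UNIV"
    unfolding theta_q_laurent by (intro laurent_has_sum theta_summable assms)
  also have "?this \<longleftrightarrow> ((\<lambda>m. theta_coeff q m * (of_real q / z) powi m) has_sum theta_q q z) UNIV"
    by (rule has_sum_reindex_bij_witness[of _ uminus uminus])
      (use assms in \<open>auto simp: theta_coeff_def tri_uminus power_int_add power_int_divide_distrib power_int_minus field_simps\<close>)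
  finally show ?thesis
    using laurent_sumI[of "theta_coeff q"] by (simp add: theta_q_laurent)
qed

subsection \<open>The Jacobi triple product\<close>

text \<open>The product of the two Euler expansions has coefficients \<open>c m\<close> obeying the
  theta recursion, hence it is \<open>c 0\<close> times theta. To find \<open>c 0\<close>, write it
  as \<open>c M\<close> divided by its theta weight and let \<open>M\<close> tend to infinity: one
  term tends to 1 / (q; q)_inf and the others vanish.\<close>

theorem jacobi_triple_product:
  assumes q: "0 < q" "q < 1" and z: "z \<noteq> 0"
  shows "theta_q q z = q_poch_inf (of_real q) q * q_poch_inf (- z) q * q_poch_inf (- (of_real q / z)) q"
proof -
  let ?Q = "complex_of_real q"
  define A where "A = (\<lambda>p. if p \<ge> 0 then euler_coeff q (nat p) else 0)"
  define B where "B = (\<lambda>p. if p \<le> 0 then euler_coeff q (nat (- p)) * ?Q powi (- p) else 0)"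
  have A_sum: "((\<lambda>m. A m * z powi m) has_sum q_poch_inf (- z) q) UNIV" if z: "z \<noteq> 0" for z
  proof -
    have "((\<lambda>m. euler_coeff q m * z ^ m) has_sum q_poch_inf (- z) q) UNIV"
      using summable_euler[OF q] euler_sums[OF q] by (rule norm_summable_imp_has_sum)
    also have "?this \<longleftrightarrow> ((\<lambda>m. A m * z powi m) has_sum q_poch_inf (- z) q) {0..}"
      by (rule has_sum_reindex_bij_witness[of _ nat int]) (auto simp: A_def)
    also have "\<dots> \<longleftrightarrow> ((\<lambda>m. A m * z powi m) has_sum q_poch_inf (- z) q) UNIV"
      by (rule has_sum_cong_neutral) (auto simp: A_def)
    finally show ?thesis .
  qed
  have B_sum: "((\<lambda>m. B m * z powi m) has_sum q_poch_inf (- (?Q / z)) q) UNIV" if z: "z \<noteq> 0" for z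
  proof -
    have "((\<lambda>m. A m * (?Q / z) powi m) has_sum q_poch_inf (- (?Q / z)) q) UNIV"
      using z q by (intro A_sum) auto
    also have "?this \<longleftrightarrow> ((\<lambda>m. B m * z powi m) has_sum q_poch_inf (- (?Q / z)) q) UNIV"
      by (rule has_sum_reindex_bij_witness[of _ uminus uminus])
        (auto simp: A_def B_def power_int_divide_distrib power_int_minus field_simps)
    finally show ?thesis .
  qed
  define c where "c = laurent_conv A B"
  have summ: "(\<lambda>p. A p * B (m - p)) summable_on UNIV" for m
    by (rule laurent_sum_mult(1)[of A 1 B]) (use A_sum[of 1] B_sum[of 1] laurent_sumI in auto)
  have prod: "laurent_sum c z = q_poch_inf (- z) q * q_poch_inf (- (?Q / z)) q"
    unfolding c_def using laurent_sum_mult(3)[of A z B] laurent_sumI[OF A_sum[OF z]] laurent_sumI[OF B_sum[OF z]] z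
    by auto
  \<comment> \<open>Coefficient form of A(z) = (1 + z) A(q z); \<open>recB\<close> below is likewise
    B(q z) = (1 + 1/z) B(z).\<close>
  have recA: "A p = ?Q powi p * A p + ?Q powi (p - 1) * A (p - 1)" for p
  proof (cases "p \<ge> 1")
    case True
    then obtain k where k: "p = int (Suc k)" by (metis nat_0_le not_one_le_zero of_nat_Suc zero_le_imp_eq_int Suc_pred add.commute le_add_diff_inverse int_nat_eq zle_iff_zadd)
    then have "A p = euler_coeff q (Suc k)" "A (p - 1) = euler_coeff q k" by (simp_all add: A_def nat_add_distrib)
    moreover have "?Q powi p = ?Q ^ Suc k" "?Q powi (p - 1) = ?Q ^ k" unfolding k by (simp_all add: power_int_def nat_add_distrib)
    ultimately show ?thesis using euler_coeff_Suc[OF q, of k] by (simp add: algebra_simps)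
  qed (cases "p = 0"; auto simp: A_def)
  have recB: "?Q powi s * B s = B s + B (s + 1)" for s
  proof -
    have B: "B r = A (- r) * ?Q powi (- r)" for r by (simp add: A_def B_def)
    have "A (- s) = ?Q powi (- s) * A (- s) + ?Q powi (- s - 1) * A (- s - 1)" by (rule recA)
    moreover have "?Q powi s * (A (- s) * ?Q powi (- s)) = A (- s)"
      using q by (simp add: power_int_minus)
    moreover have "- (s + 1) = - s - 1" by simp
    ultimately show ?thesis unfolding B by (simp add: mult.commute)
  qed
  have rec: "c m = ?Q powi (m - 1) * c (m - 1)" for m
  proof -
    have s: "(\<lambda>p. A p * B (m - p)) summable_on UNIV" by (rule summ)
    have s1: "(\<lambda>p. A p * B (m - 1 - p)) summable_on UNIV" by (rule summ)
    have s2: "(\<lambda>p. ?Q powi (m - 1) * (A p * B (m - 1 - p))) summable_on UNIV"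
      using s1 by (rule summable_on_cmult_right)
    \<comment> \<open>The power q^(m-1) is split as q^p q^(m-1-p). The second part is absorbed by
      \<open>recB\<close> here, the first by \<open>recA\<close> after the index shift
      \<open>sh\<close>.\<close>
    have e: "?Q powi (m - 1) * (A p * B (m - 1 - p)) = ?Q powi p * A p * B (m - p) + ?Q powi p * A p * B (m - 1 - p)" for p
    proof -
      have "?Q powi (m - 1) = ?Q powi p * ?Q powi (m - 1 - p)"
        using q by (simp add: power_int_add[symmetric])
      then have "?Q powi (m - 1) * (A p * B (m - 1 - p)) = ?Q powi p * A p * (?Q powi (m - 1 - p) * B (m - 1 - p))"
        by simp
      also have "\<dots> = ?Q powi p * A p * (B (m - 1 - p) + B (m - p))" using recB[of "m - 1 - p"] by simp
      finally show ?thesis by (simp add: algebra_simps)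
    qed
    have qA: "A p \<noteq> 0 \<Longrightarrow> norm (?Q powi p) \<le> 1" for p
      using q by (auto simp: A_def norm_power power_int_def power_le_one split: if_splits)
    have bd: "(\<lambda>p. ?Q powi p * A p * B (k - p)) summable_on UNIV" for k
    proof -
      have "(\<lambda>p. norm (A p * B (k - p))) summable_on UNIV"
        using summ[of k] by (simp add: summable_on_iff_abs_summable_on_complex)
      then have "(\<lambda>p. norm (?Q powi p * A p * B (k - p))) summable_on UNIV"
      proof (rule Infinite_Sum.abs_summable_on_comparison_test')
        fix p show "norm (?Q powi p * A p * B (k - p)) \<le> norm (A p * B (k - p))"
          using qA[of p] mult_right_mono[of "norm (?Q powi p)" 1 "norm (A p * B (k - p))"]
          by (cases "A p = 0") (auto simp: norm_mult mult.assoc)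
      qed
      then show ?thesis by (simp add: summable_on_iff_abs_summable_on_complex)
    qed
    have sh: "(\<Sum>\<^sub>\<infinity>p. ?Q powi p * A p * B (m - 1 - p)) = (\<Sum>\<^sub>\<infinity>p. ?Q powi (p - 1) * A (p - 1) * B (m - p))"
      by (rule infsum_reindex_bij_witness[of _ "\<lambda>p. p - 1" "\<lambda>p. p + 1"]) (auto simp: diff_diff_eq add.commute)
    have sh': "(\<lambda>p. ?Q powi (p - 1) * A (p - 1) * B (m - p)) summable_on UNIV"
    proof -
      have "(\<lambda>p. ?Q powi p * A p * B (m - 1 - p)) summable_on UNIV" by (rule bd)
      also have "?this \<longleftrightarrow> (\<lambda>p. ?Q powi (p - 1) * A (p - 1) * B (m - p)) summable_on UNIV"
        by (rule summable_on_reindex_bij_witness[of _ "\<lambda>p. p - 1" "\<lambda>p. p + 1"])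
          (auto simp: diff_diff_eq add.commute)
      finally show ?thesis .
    qed
    have "?Q powi (m - 1) * c (m - 1) = (\<Sum>\<^sub>\<infinity>p. ?Q powi (m - 1) * (A p * B (m - 1 - p)))"
      unfolding c_def laurent_conv_def by (rule infsum_cmult_right'[symmetric])
    also have "\<dots> = (\<Sum>\<^sub>\<infinity>p. ?Q powi p * A p * B (m - p)) + (\<Sum>\<^sub>\<infinity>p. ?Q powi p * A p * B (m - 1 - p))"
      unfolding e by (rule infsum_add[OF bd bd])
    also have "\<dots> = (\<Sum>\<^sub>\<infinity>p. ?Q powi p * A p * B (m - p) + ?Q powi (p - 1) * A (p - 1) * B (m - p))"
      unfolding sh by (rule infsum_add[OF bd sh', symmetric])
    also have "\<dots> = (\<Sum>\<^sub>\<infinity>p. A p * B (m - p))"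
      by (intro infsum_cong) (metis distrib_right recA)
    finally show ?thesis by (simp add: c_def laurent_conv_def)
  qed
  have c: "c m = c 0 * ?Q powi tri m" for m
  proof (induction m rule: int_induct[of _ 0])
    case (step1 k)
    have "c (k + 1) = ?Q powi k * c k" using rec[of "k + 1"] by simp
    then show ?case using q by (simp add: step1 tri_plus1 power_int_add mult_ac)
  next
    case (step2 k)
    have "c k = ?Q powi (k - 1) * c (k - 1)" by (rule rec)
    then have "c (k - 1) = c 0 * ?Q powi tri k / ?Q powi (k - 1)" using step2 q by simp
    then show ?case using q by (simp add: tri_minus1 power_int_add power_int_diff field_simps)
  qed simp
  have c0: "c 0 = 1 / q_poch_inf ?Q q"
  proof -
    have conv: "(\<lambda>k. 1 / q_poch ?Q q k) \<longlonglongrightarrow> 1 / q_poch_inf ?Q q"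
      by (intro tendsto_intros q_poch_tendsto q q_poch_inf_q_nonzero)
    then have "Bseq (\<lambda>k. 1 / q_poch ?Q q k)" by (rule convergent_imp_Bseq[OF convergentI])
    then obtain D where D: "D > 0" "\<And>k. norm (1 / q_poch ?Q q k) \<le> D" unfolding Bseq_def by auto
    \<comment> \<open>In the shifted sum the term \<open>r\<close> carries the power q^(M r + 2
      tri(r) + r), so all terms with \<open>r > 0\<close> together are O(q^M), while
      \<open>r = 0\<close> gives 1 / (q; q)_M.\<close>
    have bound: "norm (c 0 - 1 / q_poch ?Q q M) \<le> q ^ M * (D * D / (1 - q))" for M
    proof -
      let ?f = "\<lambda>p. A p * B (int M - p) / ?Q powi tri (int M)"
      let ?g = "\<lambda>r. ?f (int M + int r)"
      have fs: "(?f has_sum c 0) UNIV"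
      proof -
        have "((\<lambda>p. A p * B (int M - p)) has_sum c (int M)) UNIV"
          unfolding c_def laurent_conv_def using summ[of "int M"] by simp
        from has_sum_divide_const[OF this, of "?Q powi tri (int M)"] show ?thesis
          using q c[of "int M"] by simp
      qed
      also have "(?f has_sum c 0) UNIV \<longleftrightarrow> (?f has_sum c 0) {int M..}"
        by (rule has_sum_cong_neutral) (auto simp: B_def)
      also have "\<dots> \<longleftrightarrow> (?g has_sum c 0) UNIV"
        by (rule has_sum_reindex_bij_witness[of _ "\<lambda>r. int M + int r" "\<lambda>p. nat (p - int M)"]) auto
      finally have gs: "(?g has_sum c 0) UNIV" .
      have gval: "?g r = ?Q powi (int M * int r + 2 * tri (int r) + int r) / (q_poch ?Q q (M + r) * q_poch ?Q q r)" for r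
      proof -
        have "nat (int M + int r) = M + r" by simp
        then have A: "A (int M + int r) = ?Q powi (tri (int M) + tri (int r) + int M * int r) / q_poch ?Q q (M + r)"
          by (simp add: A_def euler_coeff_def tri_add)
        have B: "B (int M - (int M + int r)) = ?Q powi tri (int r) / q_poch ?Q q r * ?Q powi int r"
          by (simp add: B_def euler_coeff_def)
        have e: "?Q powi (int M * int r + 2 * tri (int r) + int r)
          = ?Q powi (tri (int M) + tri (int r) + int M * int r) * ?Q powi tri (int r) * ?Q powi int r / ?Q powi tri (int M)"
          using q by (simp only: power_int_add[symmetric] power_int_diff[symmetric] of_real_eq_0_iff less_imp_neq[symmetric] simp_thms)
            (simp add: algebra_simps)
        show ?thesis unfolding A B e by (simp add: mult_ac)
      qed
      have g0: "?g 0 = 1 / q_poch ?Q q M" unfolding gval by simp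
      have "(?g has_sum (c 0 - ?g 0)) (UNIV - {0})"
        by (rule has_sum_Diff[OF gs]) (auto intro: has_sum_finiteI)
      also have "?this \<longleftrightarrow> ((\<lambda>r. ?g (Suc r)) has_sum (c 0 - ?g 0)) UNIV"
        by (rule has_sum_reindex_bij_witness[of _ Suc "\<lambda>r. r - 1"]) auto
      finally have hs: "((\<lambda>r. ?g (Suc r)) has_sum (c 0 - ?g 0)) UNIV" .
      have gb: "norm (?g (Suc r)) \<le> (q ^ M * (D * D)) * q ^ r" for r
      proof -
        have "int M + int r \<le> int M * int (Suc r) + 2 * tri (int (Suc r)) + int (Suc r)"
          using tri_nonneg[of "int (Suc r)"] by (simp add: algebra_simps)
        then have "q powi (int M * int (Suc r) + 2 * tri (int (Suc r)) + int (Suc r)) \<le> q powi (int M + int r)"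
          using q by (intro power_int_decreasing) auto
        also have "\<dots> = q ^ M * q ^ r" using q by (simp add: power_int_add)
        finally have le: "q powi (int M * int (Suc r) + 2 * tri (int (Suc r)) + int (Suc r)) \<le> q ^ M * q ^ r" .
        have "norm (?g (Suc r)) = q powi (int M * int (Suc r) + 2 * tri (int (Suc r)) + int (Suc r))
            * (norm (1 / q_poch ?Q q (M + Suc r)) * norm (1 / q_poch ?Q q (Suc r)))"
          unfolding gval using q by (simp add: norm_divide norm_mult norm_power_int field_simps)
        also have "\<dots> \<le> (q ^ M * q ^ r) * (D * D)"
          using le D q by (intro mult_mono) auto
        finally show ?thesis by (simp add: mult_ac)
      qed
      have "((\<lambda>r. (q ^ M * (D * D)) * q ^ r) has_sum ((q ^ M * (D * D)) * (1 / (1 - q)))) UNIV"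
        using q by (intro sums_nonneg_imp_has_sum sums_mult geometric_sums) auto
      then have "norm (c 0 - ?g 0) \<le> (q ^ M * (D * D)) * (1 / (1 - q))"
        by (rule norm_infsum_le[OF hs]) (use gb in auto)
      then show ?thesis unfolding g0 by simp
    qed
    have "(\<lambda>M. q ^ M * (D * D / (1 - q))) \<longlonglongrightarrow> 0"
      using q by (intro tendsto_mult_left_zero LIMSEQ_realpow_zero) auto
    then have "(\<lambda>M. c 0 - 1 / q_poch ?Q q M) \<longlonglongrightarrow> 0"
      by (rule Lim_null_comparison[OF always_eventually, rotated]) (use bound in auto)
    moreover have "(\<lambda>M. c 0 - 1 / q_poch ?Q q M) \<longlonglongrightarrow> c 0 - 1 / q_poch_inf ?Q q"
      by (intro tendsto_intros conv)
    ultimately show ?thesis using LIMSEQ_unique by fastforce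
  qed
  have "c = (\<lambda>m. c 0 * theta_coeff q m)"
    unfolding theta_coeff_def by (rule ext) (rule c)
  moreover have "laurent_sum (\<lambda>m. c 0 * theta_coeff q m) z = c 0 * theta_q q z"
    unfolding theta_q_laurent by (rule laurent_sum_cmult(2)[OF theta_summable[OF q z]])
  ultimately have "laurent_sum c z = c 0 * theta_q q z" by metis
  with prod c0 q_poch_inf_q_nonzero[OF q] show ?thesis by (simp add: field_simps)
qed

lemma theta_q_eq_0_iff:
  assumes q: "0 < q" "q < 1" and z: "z \<noteq> 0"
  shows "theta_q q z = 0 \<longleftrightarrow> (\<exists>k::int. z = - (of_real q powi k))"
proof -
  have "theta_q q z = 0 \<longleftrightarrow> (\<exists>l. - z * of_real q ^ l = 1) \<or> (\<exists>l. - (of_real q / z) * of_real q ^ l = 1)"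
    unfolding jacobi_triple_product[OF assms] using q_poch_inf_q_nonzero[OF q]
    by (simp add: q_poch_inf_eq_0_iff[OF q])
  also have "\<dots> \<longleftrightarrow> (\<exists>k::int. z = - (of_real q powi k))"
  proof
    assume "(\<exists>l. - z * of_real q ^ l = 1) \<or> (\<exists>l. - (of_real q / z) * of_real q ^ l = 1)"
    then show "\<exists>k::int. z = - (of_real q powi k)"
    proof (elim disjE exE)
      fix l assume "- z * complex_of_real q ^ l = 1"
      then have "z * complex_of_real q ^ l = - 1" by (metis minus_mult_left minus_minus)
      then have "z = - (of_real q powi (- int l))" using q by (simp add: power_int_minus field_simps)
      then show ?thesis by blast
    next
      fix l assume "- (complex_of_real q / z) * of_real q ^ l = 1"
      then have "z = - (complex_of_real q * of_real q ^ l)" using z by (simp add: field_simps)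
      then have "z = - (of_real q powi (int (Suc l)))" by (simp only: power_int_of_nat power_Suc)
      then show ?thesis by blast
    qed
  next
    assume "\<exists>k::int. z = - (of_real q powi k)"
    then obtain k :: int where k: "z = - (of_real q powi k)" by auto
    show "(\<exists>l. - z * of_real q ^ l = 1) \<or> (\<exists>l. - (of_real q / z) * of_real q ^ l = 1)"
    proof (cases "k \<le> 0")
      case True
      then have "- z * of_real q ^ nat (- k) = 1"
        using q by (simp add: k power_int_def power_inverse field_simps)
      then show ?thesis by blast
    next
      case False
      then have "complex_of_real q powi k = of_real q ^ Suc (nat (k - 1))"
        by (simp add: power_int_def Suc_nat_eq_nat_zadd1)
      then have "- (of_real q / z) * of_real q ^ nat (k - 1) = 1"
        using q by (simp add: k)
      then show ?thesis by blast
    qed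
  qed
  finally show ?thesis .
qed

section \<open>Pairings of row and column solutions\<close>

lemma has_sum_finite_sum:
  fixes f :: "'a \<Rightarrow> 'b \<Rightarrow> complex"
  assumes "\<And>i. i \<in> I \<Longrightarrow> (f i has_sum s i) A"
  shows "((\<lambda>x. \<Sum>i\<in>I. f i x) has_sum (\<Sum>i\<in>I. s i)) A"
  using assms by (induction I rule: infinite_finite_induct) (auto intro: has_sum_add)

lemma has_sum_subtract:
  fixes f :: "'a \<Rightarrow> complex"
  assumes "(f has_sum s) A" "(g has_sum t) A"
  shows "((\<lambda>x. f x - g x) has_sum (s - t)) A"
  using has_sum_add[OF assms(1) has_sum_uminusI[OF assms(2)]] by simp

text \<open>
  The matrix of the system at \<open>z\<close> is \<open>1 - (1 - q) (z E + M) = B - u E\<close> with \<open>u = (1 - q) z\<close>. Here \<open>B\<close> has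
  the block form with diagonal part \<open>be\<close>, last column \<open>- a\<close>, last row \<open>- b\<close> and corner \<open>d\<close>. In the
  application \<open>al l = q powr \<mu> l\<close>, \<open>be i = q powr \<nu> i\<close>. The last index of the vectors is \<open>N\<close>.
\<close>

locale q_system =
  fixes q :: real and N :: nat and al be a b :: "nat \<Rightarrow> complex" and d :: complex
  assumes q: "0 < q" "q < 1"
    and al_nonzero: "\<And>l. l \<le> N \<Longrightarrow> al l \<noteq> 0"
    and be_nonzero: "\<And>i. i < N \<Longrightarrow> be i \<noteq> 0"
    and al_nonres: "\<And>l l' (k::int). l \<le> N \<Longrightarrow> l' \<le> N \<Longrightarrow> l \<noteq> l' \<Longrightarrow> al l \<noteq> al l' * of_real q powi k"
    and be_nonres: "\<And>i j (k::int). i < N \<Longrightarrow> j < N \<Longrightarrow> i \<noteq> j \<Longrightarrow> be i \<noteq> be j * of_real q powi k"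
    and al_neq_be: "\<And>l i. l \<le> N \<Longrightarrow> i < N \<Longrightarrow> al l \<noteq> be i"
    and char_identity: "\<And>v. (d - v) * (\<Prod>i<N. be i - v)
        - (\<Sum>i<N. a i * b i * (\<Prod>j\<in>{..<N} - {i}. be j - v)) = (\<Prod>l\<le>N. al l - v)"
begin

abbreviation Q :: complex where "Q \<equiv> of_real q"

lemma q_nonzero [simp]: "q \<noteq> 0" using q by simp

lemma Q_power_tendsto: "(\<lambda>k. Q ^ k) \<longlonglongrightarrow> 0"
  using q by (intro LIMSEQ_power_zero) auto

text \<open>The Schur complement of the diagonal block in \<open>B - v\<close>: the quotient of
  det(B - v) by the determinant of that block. All scalar recursions below multiply or divide by
  values of this function.\<close>

definition D :: "complex \<Rightarrow> complex" where
  "D v = (\<Prod>l\<le>N. al l - v) / (\<Prod>i<N. be i - v)"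

text \<open>Equals \<open>D 0\<close>. In the application it is \<open>q powr\<close> the last
  exponent nu_n, by the very definition of nu_n. As a limiting ratio it determines where the rows
  and the solution at the origin converge.\<close>

definition beN :: complex where "beN = (\<Prod>l\<le>N. al l) / (\<Prod>i<N. be i)"

lemma beN_nonzero [simp]: "beN \<noteq> 0"
  using al_nonzero be_nonzero by (simp add: beN_def)

lemma D_eq:
  assumes "\<And>i. i < N \<Longrightarrow> be i \<noteq> v"
  shows "D v = d - v - (\<Sum>i<N. a i * b i / (be i - v))"
proof -
  have nz: "(\<Prod>i<N. be i - v) \<noteq> 0" using assms by simp
  have "(\<Sum>i<N. a i * b i / (be i - v)) * (\<Prod>i<N. be i - v)
      = (\<Sum>i<N. a i * b i * (\<Prod>j\<in>{..<N} - {i}. be j - v))"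
    unfolding sum_distrib_right
  proof (intro sum.cong refl)
    fix i assume i: "i \<in> {..<N}"
    have "(\<Prod>i<N. be i - v) = (be i - v) * (\<Prod>j\<in>{..<N} - {i}. be j - v)"
      using i by (intro prod.remove) auto
    then show "a i * b i / (be i - v) * (\<Prod>i<N. be i - v) = a i * b i * (\<Prod>j\<in>{..<N} - {i}. be j - v)"
      using assms i by simp
  qed
  then have "(d - v - (\<Sum>i<N. a i * b i / (be i - v))) * (\<Prod>i<N. be i - v) = (\<Prod>l\<le>N. al l - v)"
    unfolding left_diff_distrib using char_identity[of v] by (simp add: algebra_simps)
  then show ?thesis unfolding D_def using nz by (simp add: field_simps)
qed

lemma D_0: "D 0 = beN" by (simp add: D_def beN_def)

text \<open>At \<open>v = be i\<close> only one summand of \<open>char_identity\<close> survives.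
  Together with \<open>al_neq_be\<close> this makes all \<open>a i\<close> and \<open>b i\<close>
  nonzero.\<close>

lemma ab_eq:
  assumes "i < N"
  shows "a i * b i * (\<Prod>j\<in>{..<N} - {i}. be j - be i) = - (\<Prod>l\<le>N. al l - be i)"
proof -
  have 1: "(\<Prod>j<N. be j - be i) = 0" using assms by (auto intro!: prod_zero)
  have "(\<Prod>j\<in>{..<N} - {k}. be j - be i) = 0" if "k < N" "k \<noteq> i" for k
    using assms that by (intro prod_zero) auto
  then have "(\<Sum>k<N. a k * b k * (\<Prod>j\<in>{..<N} - {k}. be j - be i))
      = (\<Sum>k<N. if k = i then a i * b i * (\<Prod>j\<in>{..<N} - {i}. be j - be i) else 0)"
    by (intro sum.cong) auto
  also have "\<dots> = a i * b i * (\<Prod>j\<in>{..<N} - {i}. be j - be i)" using assms by simp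
  finally have 2: "(\<Sum>k<N. a k * b k * (\<Prod>j\<in>{..<N} - {k}. be j - be i))
      = a i * b i * (\<Prod>j\<in>{..<N} - {i}. be j - be i)" .
  have "- (a i * b i * (\<Prod>j\<in>{..<N} - {i}. be j - be i)) = (\<Prod>l\<le>N. al l - be i)"
    using char_identity[of "be i"] unfolding 1 2 by simp
  then show ?thesis by (metis minus_minus)
qed

lemma a_nonzero: "i < N \<Longrightarrow> a i \<noteq> 0" and b_nonzero: "i < N \<Longrightarrow> b i \<noteq> 0"
  using ab_eq[of i] al_neq_be by force+

text \<open>Moving the arrow matrix \<open>B\<close> from the row to the column costs nothing; what
  remains comes from the rank one part \<open>u E\<close> and is recorded by the defects
  \<open>s\<close> and \<open>e\<close>. Both are left free because the identity serves complete,
  truncated and purely formal pairings alike.\<close>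

lemma bilinear_identity:
  assumes "\<And>i. i < N \<Longrightarrow> v * r i = t * (be i * r i - b i * r N)"
    and "v * r N = t * (d * r N - (\<Sum>i<N. a i * r i)) - s"
    and "\<And>i. i < N \<Longrightarrow> w * l' i = be i * l i - a i * l N"
    and "w * l' N = d * l N - (\<Sum>i<N. b i * l i) - e"
  shows "v * (\<Sum>i\<le>N. r i * l i) = t * w * (\<Sum>i\<le>N. r i * l' i) + t * r N * e - s * l N"
proof -
  have sp: "(\<Sum>i\<le>N. f i) = (\<Sum>i<N. f i) + f N" for f :: "nat \<Rightarrow> complex"
    by (simp add: lessThan_Suc_atMost[symmetric])
  have "v * (\<Sum>i\<le>N. r i * l i) = (\<Sum>i<N. (v * r i) * l i) + (v * r N) * l N"
    by (simp add: sp sum_distrib_left algebra_simps)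
  also have "\<dots> = (\<Sum>i<N. t * (be i * r i - b i * r N) * l i) + (t * (d * r N - (\<Sum>i<N. a i * r i)) - s) * l N"
    using assms(1,2) by simp
  also have "\<dots> = t * ((\<Sum>i<N. r i * (be i * l i - a i * l N)) + r N * (d * l N - (\<Sum>i<N. b i * l i))) - s * l N"
    by (simp add: algebra_simps sum_distrib_left sum_distrib_right sum_subtractf)
  also have "(\<Sum>i<N. r i * (be i * l i - a i * l N)) = (\<Sum>i<N. r i * (w * l' i))"
    using assms(3) by simp
  also have "d * l N - (\<Sum>i<N. b i * l i) = w * l' N + e" using assms(4) by simp
  finally show ?thesis
    by (simp add: sp algebra_simps sum_distrib_left)
qed

text \<open>Coefficient form of v R(u) = R(q u) (B - u E) for the row of Laurent series R.\<close>

definition row_solution :: "complex \<Rightarrow> (nat \<Rightarrow> int \<Rightarrow> complex) \<Rightarrow> bool" where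
  "row_solution v r \<longleftrightarrow>
     (\<forall>m. (\<forall>i<N. v * r i m = Q powi m * (be i * r i m - b i * r N m)) \<and>
          v * r N m = Q powi m * (d * r N m - (\<Sum>i<N. a i * r i m)) - Q powi (m - 1) * r N (m - 1))"

text \<open>Coefficient form of w u C(q u) = (B - u E) C(u). The factor u is the trace of a theta
  function by which a solution of the system has been multiplied to make its Laurent series converge
  on the punctured plane.\<close>

definition col_solution :: "complex \<Rightarrow> (nat \<Rightarrow> int \<Rightarrow> complex) \<Rightarrow> bool" where
  "col_solution w c \<longleftrightarrow>
     (\<forall>m. (\<forall>i<N. w * Q powi (m - 1) * c i (m - 1) = be i * c i m - a i * c N m) \<and>
          w * Q powi (m - 1) * c N (m - 1) = d * c N m - (\<Sum>i<N. b i * c i m) - c N (m - 1))"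

definition pairing :: "(nat \<Rightarrow> int \<Rightarrow> complex) \<Rightarrow> (nat \<Rightarrow> int \<Rightarrow> complex) \<Rightarrow> int \<Rightarrow> complex" where
  "pairing r c m = (\<Sum>i\<le>N. laurent_conv (r i) (c i) m)"

lemma pairing_summable:
  assumes "\<And>i. i \<le> N \<Longrightarrow> laurent_summable (r i) u" "\<And>i. i \<le> N \<Longrightarrow> laurent_summable (c i) u" "u \<noteq> 0"
  shows "((\<lambda>p. \<Sum>i\<le>N. r i p * c i (m - p)) has_sum pairing r c m) UNIV"
    and "laurent_summable (pairing r c) u"
    and "laurent_sum (pairing r c) u = (\<Sum>i\<le>N. laurent_sum (r i) u * laurent_sum (c i) u)"
proof -
  note m = laurent_sum_mult[OF assms(1) assms(2) assms(3)]
  show "((\<lambda>p. \<Sum>i\<le>N. r i p * c i (m - p)) has_sum pairing r c m) UNIV"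
    unfolding pairing_def laurent_conv_def using m(1) by (intro has_sum_finite_sum has_sum_infsum) auto
  show "laurent_summable (pairing r c) u"
    unfolding pairing_def[abs_def] using m(2) by (intro laurent_sum_sum) auto
  show "laurent_sum (pairing r c) u = (\<Sum>i\<le>N. laurent_sum (r i) u * laurent_sum (c i) u)"
    unfolding pairing_def[abs_def] using m(2,3) by (subst laurent_sum_sum) auto
qed

text \<open>In terms of functions, v R(u) C(u) = R(q u) (B - u E) C(u) = w u R(q u) C(q u). On
  coefficients the two contributions of \<open>u E\<close> form the difference
  \<open>T (p + 1) - T p\<close>, which sums to 0 over all integers because \<open>T\<close> is
  summable.\<close>

lemma pairing_step:
  assumes r: "row_solution v r" and c: "col_solution w c"
    and rs: "\<And>i. i \<le> N \<Longrightarrow> laurent_summable (r i) u"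
    and cs: "\<And>i u. i \<le> N \<Longrightarrow> u \<noteq> 0 \<Longrightarrow> laurent_summable (c i) u" and u: "u \<noteq> 0"
  shows "v * pairing r c m = w * Q powi (m - 1) * pairing r c (m - 1)"
proof -
  define T where "T = (\<lambda>p. Q powi (p - 1) * r N (p - 1) * c N (m - p))"
  \<comment> \<open>The additional power of \<open>Q\<close> in \<open>T\<close> moves the
    evaluation point to \<open>u / Q\<close>. Rows may be taken there after rescaling, columns
    because they converge at every nonzero point.\<close>
  have "laurent_summable (\<lambda>p. r N p * Q powi p) (u / Q)"
    unfolding laurent_sum_scale using rs[of N] by simp
  from laurent_sum_mult(1)[OF this cs[of N "u / Q"], of "m - 1"] u
  have "(\<lambda>p. r N p * Q powi p * c N (m - 1 - p)) summable_on UNIV" by simp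
  also have "(\<lambda>p. r N p * Q powi p * c N (m - 1 - p)) = (\<lambda>p. T (p + 1))"
    by (simp add: T_def fun_eq_iff diff_diff_eq add.commute mult_ac)
  finally have T1: "(\<lambda>p. T (p + 1)) summable_on UNIV" .
  then have T1': "((\<lambda>p. T (p + 1)) has_sum infsum (\<lambda>p. T (p + 1)) UNIV) UNIV" by simp
  also have "?this \<longleftrightarrow> (T has_sum infsum (\<lambda>p. T (p + 1)) UNIV) UNIV"
    by (rule has_sum_reindex_bij_witness[of _ "\<lambda>p. p - 1" "\<lambda>p. p + 1"]) auto
  finally have T0: "(T has_sum infsum (\<lambda>p. T (p + 1)) UNIV) UNIV" .
  have pw: "v * (\<Sum>i\<le>N. r i p * c i (m - p))
      = w * Q powi (m - 1) * (\<Sum>i\<le>N. r i p * c i (m - 1 - p)) + (T (p + 1) - T p)" for p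
  proof -
    have e: "m - p - 1 = m - 1 - p" by simp
    have "v * (\<Sum>i\<le>N. r i p * c i (m - p))
      = Q powi p * (w * Q powi (m - p - 1)) * (\<Sum>i\<le>N. r i p * c i (m - p - 1))
        + Q powi p * r N p * c N (m - p - 1) - Q powi (p - 1) * r N (p - 1) * c N (m - p)"
      by (rule bilinear_identity)
        (use r c in \<open>auto simp: row_solution_def col_solution_def\<close>)
    also have "Q powi p * (w * Q powi (m - p - 1)) = w * Q powi (m - 1)"
      by (simp add: power_int_add[symmetric])
    finally show ?thesis unfolding T_def e by (simp add: diff_diff_eq add.commute)
  qed
  have ps: "((\<lambda>p. \<Sum>i\<le>N. r i p * c i (k - p)) has_sum pairing r c k) UNIV" for k
    by (rule pairing_summable(1)[where u = u]) (use rs cs u in auto)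
  have "((\<lambda>p. v * (\<Sum>i\<le>N. r i p * c i (m - p))) has_sum v * pairing r c m) UNIV"
    using ps by (rule has_sum_cmult_right)
  moreover have "((\<lambda>p. v * (\<Sum>i\<le>N. r i p * c i (m - p))) has_sum
      (w * Q powi (m - 1) * pairing r c (m - 1) + (infsum (\<lambda>p. T (p + 1)) UNIV - infsum (\<lambda>p. T (p + 1)) UNIV))) UNIV"
    unfolding pw by (intro has_sum_add has_sum_subtract has_sum_cmult_right ps T1' T0)
  ultimately show ?thesis using has_sum_unique by fastforce
qed

lemma pairing_eq:
  assumes "row_solution v r" "col_solution w c"
    and "\<And>i. i \<le> N \<Longrightarrow> laurent_summable (r i) u"
    and "\<And>i u. i \<le> N \<Longrightarrow> u \<noteq> 0 \<Longrightarrow> laurent_summable (c i) u" and "u \<noteq> 0" "v \<noteq> 0" "w \<noteq> 0"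
  shows "pairing r c m = pairing r c 0 * (w / v) powi m * Q powi tri m"
proof -
  have rec: "pairing r c m = (w / v) * Q powi (m - 1) * pairing r c (m - 1)" for m
    using pairing_step[OF assms(1-5), of m] assms(6) by (simp add: field_simps)
  show ?thesis
  proof (induction m rule: int_induct[of _ 0])
    case (step1 k)
    have "pairing r c (k + 1) = (w / v) * Q powi k * pairing r c k" using rec[of "k + 1"] by simp
    also have "\<dots> = pairing r c 0 * ((w / v) powi k * (w / v)) * (Q powi tri k * Q powi k)"
      unfolding step1 by simp
    also have "(w / v) powi k * (w / v) = (w / v) powi (k + 1)"
      using assms by (simp add: power_int_add)
    also have "Q powi tri k * Q powi k = Q powi tri (k + 1)"
      by (simp add: tri_plus1 power_int_add)
    finally show ?case .
  next
    case (step2 k)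
    have "(w / v) * Q powi (k - 1) * pairing r c (k - 1) = pairing r c k" using rec[of k] by simp
    also have "\<dots> = pairing r c 0 * (w / v) powi (k - 1 + 1) * Q powi tri (k - 1 + 1)" using step2 by simp
    also have "(w / v) powi (k - 1 + 1) = (w / v) powi (k - 1) * (w / v)"
      by (subst power_int_add) (use assms in auto)
    also have "Q powi tri (k - 1 + 1) = Q powi tri (k - 1) * Q powi (k - 1)"
      unfolding tri_plus1 by (subst power_int_add) auto
    also have "pairing r c 0 * ((w / v) powi (k - 1) * (w / v)) * (Q powi tri (k - 1) * Q powi (k - 1))
        = (w / v) * Q powi (k - 1) * (pairing r c 0 * (w / v) powi (k - 1) * Q powi tri (k - 1))"
      by (simp only: mult_ac)
    finally show ?case using assms by simp
  qed simp
qed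

lemma pairing_laurent_sum:
  assumes "row_solution v r" "col_solution w c"
    and "\<And>i. i \<le> N \<Longrightarrow> laurent_summable (r i) u"
    and "\<And>i u. i \<le> N \<Longrightarrow> u \<noteq> 0 \<Longrightarrow> laurent_summable (c i) u" and "u \<noteq> 0" "v \<noteq> 0" "w \<noteq> 0"
  shows "(\<Sum>i\<le>N. laurent_sum (r i) u * laurent_sum (c i) u) = pairing r c 0 * theta_q q (w / v * u)"
proof -
  have e: "pairing r c = (\<lambda>m. pairing r c 0 * (theta_coeff q m * (w / v) powi m))"
  proof (rule ext)
    fix m
    have "pairing r c m = pairing r c 0 * (w / v) powi m * Q powi tri m" by (rule pairing_eq[OF assms])
    also have "\<dots> = pairing r c 0 * (theta_coeff q m * (w / v) powi m)"
      unfolding theta_coeff_def by (simp only: mult_ac)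
    finally show "pairing r c m = pairing r c 0 * (theta_coeff q m * (w / v) powi m)" .
  qed
  have "(\<Sum>i\<le>N. laurent_sum (r i) u * laurent_sum (c i) u) = laurent_sum (pairing r c) u"
    by (rule pairing_summable(3)[symmetric]) (use assms in auto)
  also have "\<dots> = laurent_sum (\<lambda>m. pairing r c 0 * (theta_coeff q m * (w / v) powi m)) u"
    by (rule arg_cong2[OF e refl])
  also have "\<dots> = pairing r c 0 * laurent_sum (\<lambda>m. theta_coeff q m * (w / v) powi m) u"
    by (rule laurent_sum_cmult(2)) (use assms q in \<open>auto simp: laurent_sum_scale intro!: theta_summable\<close>)
  finally show ?thesis by (simp add: laurent_sum_scale theta_q_laurent)
qed

end

section \<open>The solution at the origin and its pairings\<close>

text \<open>The assumption says that v e(x) - w e(q x) is c times the formal series of all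
  monomials. The coefficients of theta(-x) sum to 0, since theta(-1) = 0, so multiplication by
  theta(-x) kills this inhomogeneity and leaves a theta recursion. Without its constant this is
  Kronecker's formula for a bilateral series with denominators v - w q^m.\<close>

lemma kronecker_product:
  assumes q: "0 < q" "q < 1" and e: "\<And>m. (v - w * of_real q powi m) * e m = c"
    and "laurent_summable e x" "x \<noteq> 0" "v \<noteq> 0" "w \<noteq> 0"
  shows "laurent_sum e x * theta_q q (- x)
      = laurent_conv e (\<lambda>m. theta_coeff q m * (- 1) powi m) 0 * theta_q q (- (w / v) * x)"
proof -
  let ?Q = "complex_of_real q"
  define th where "th = (\<lambda>m. theta_coeff q m * (- 1) powi m)"
  define t where "t = laurent_conv e th"
  have qn: "q \<noteq> 0" using q by simp
  have th_summ: "laurent_summable th u" if "u \<noteq> 0" for u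
    unfolding th_def laurent_sum_scale using that q by (intro theta_summable) auto
  have th_sum: "laurent_sum th u = theta_q q (- u)" for u
    unfolding th_def laurent_sum_scale by (simp add: theta_q_laurent)
  have th_rec: "th k = - (?Q powi (k - 1) * th (k - 1))" for k
  proof -
    have "theta_coeff q k = theta_coeff q (k - 1) * ?Q powi (k - 1)"
      using tri_plus1[of "k - 1"] qn by (simp add: theta_coeff_def power_int_add)
    moreover have "(- 1 :: complex) powi k = (- 1) powi (k - 1) * (- 1)"
      using power_int_add[of "- 1 :: complex" "k - 1" 1] by simp
    ultimately show ?thesis by (simp add: th_def)
  qed
  have summ: "(\<lambda>p. e p * th (m - p)) summable_on UNIV" for m
    by (rule laurent_sum_mult(1)[OF assms(4) th_summ assms(5)]) (use assms in auto)
  have zero: "((\<lambda>p. th (m - p)) has_sum 0) UNIV" for m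
  proof -
    have "theta_q q (- 1) = 0"
      using theta_q_eq_0_iff[OF q, of "- 1"] by (auto intro!: exI[of _ 0])
    then have "(th has_sum 0) UNIV"
      using laurent_has_sum[OF th_summ[of 1]] th_sum[of 1] by simp
    also have "?this \<longleftrightarrow> ((\<lambda>p. th (m - p)) has_sum 0) UNIV"
      by (rule has_sum_reindex_bij_witness[of _ "\<lambda>p. m - p" "\<lambda>p. m - p"]) auto
    finally show ?thesis .
  qed
  have rec: "v * t m = - (w * ?Q powi (m - 1)) * t (m - 1)" for m
  proof -
    have pw: "v * (e p * th (m - p)) = c * th (m - p) + (- (w * ?Q powi (m - 1))) * (e p * th (m - 1 - p))" for p
    proof -
      have "?Q powi p * th (m - p) = - (?Q powi p * ?Q powi (m - p - 1) * th (m - p - 1))"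
        by (subst th_rec) simp
      also have "?Q powi p * ?Q powi (m - p - 1) = ?Q powi (m - 1)"
        using qn by (simp add: power_int_add[symmetric])
      also have "m - p - 1 = m - 1 - p" by simp
      finally have h: "?Q powi p * th (m - p) = - (?Q powi (m - 1) * th (m - 1 - p))" .
      have "v * (e p * th (m - p)) = ((v - w * ?Q powi p) * e p) * th (m - p) + w * e p * (?Q powi p * th (m - p))"
        by (simp add: algebra_simps)
      also have "\<dots> = c * th (m - p) + w * e p * (- (?Q powi (m - 1) * th (m - 1 - p)))"
        unfolding e h ..
      finally show ?thesis by (simp add: algebra_simps)
    qed
    have ts: "((\<lambda>p. e p * th (k - p)) has_sum t k) UNIV" for k
      unfolding t_def laurent_conv_def using summ by simp
    have "((\<lambda>p. v * (e p * th (m - p))) has_sum v * t m) UNIV"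
      using ts by (rule has_sum_cmult_right)
    moreover have "((\<lambda>p. v * (e p * th (m - p))) has_sum (c * 0 + (- (w * ?Q powi (m - 1))) * t (m - 1))) UNIV"
      unfolding pw by (intro has_sum_add has_sum_cmult_right zero ts)
    ultimately show ?thesis using has_sum_unique by fastforce
  qed
  have t: "t m = t 0 * (theta_coeff q m * (- (w / v)) powi m)" for m
  proof -
    have r: "t m = - (w / v) * ?Q powi (m - 1) * t (m - 1)" for m
      using rec[of m] assms(6) by (simp add: field_simps)
    have nz: "- (w / v) \<noteq> 0" using assms by simp
    show ?thesis
    proof (induction m rule: int_induct[of _ 0])
      case (step1 k)
      have "t (k + 1) = - (w / v) * ?Q powi k * t k" using r[of "k + 1"] by simp
      also have "\<dots> = t 0 * ((?Q powi tri k * ?Q powi k) * ((- (w / v)) powi k * (- (w / v))))"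
        unfolding step1 theta_coeff_def by simp
      also have "?Q powi tri k * ?Q powi k = theta_coeff q (k + 1)"
        unfolding theta_coeff_def tri_plus1 by (subst power_int_add) (use qn in auto)
      also have "(- (w / v)) powi k * (- (w / v)) = (- (w / v)) powi (k + 1)"
        by (subst power_int_add) (use nz in auto)
      finally show ?case .
    next
      case (step2 k)
      have "(- (w / v) * ?Q powi (k - 1)) * t (k - 1) = t k" using r[of k] by simp
      also have "\<dots> = t 0 * (theta_coeff q (k - 1 + 1) * (- (w / v)) powi (k - 1 + 1))" using step2 by simp
      also have "theta_coeff q (k - 1 + 1) = theta_coeff q (k - 1) * ?Q powi (k - 1)"
        unfolding theta_coeff_def tri_plus1 by (subst power_int_add) (use qn in auto)
      also have "(- (w / v)) powi (k - 1 + 1) = (- (w / v)) powi (k - 1) * (- (w / v))"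
        by (subst power_int_add) (use nz in auto)
      also have "t 0 * (theta_coeff q (k - 1) * ?Q powi (k - 1) * ((- (w / v)) powi (k - 1) * (- (w / v))))
        = (- (w / v) * ?Q powi (k - 1)) * (t 0 * (theta_coeff q (k - 1) * (- (w / v)) powi (k - 1)))"
        by (simp only: mult_ac)
      finally have "(- (w / v) * ?Q powi (k - 1)) * t (k - 1)
        = (- (w / v) * ?Q powi (k - 1)) * (t 0 * (theta_coeff q (k - 1) * (- (w / v)) powi (k - 1)))" .
      moreover have "- (w / v) * ?Q powi (k - 1) \<noteq> 0" using nz qn by simp
      ultimately show ?case using mult_left_cancel by blast
    qed (simp add: theta_coeff_def)
  qed
  have "laurent_sum e x * theta_q q (- x) = laurent_sum t x"
    unfolding t_def using laurent_sum_mult(3)[OF assms(4) th_summ assms(5)] th_sum assms(5) by simp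
  also have "\<dots> = laurent_sum (\<lambda>m. t 0 * (theta_coeff q m * (- (w / v)) powi m)) x"
    by (rule arg_cong2[of _ _ _ _ laurent_sum, OF _ refl]) (rule ext, rule t)
  also have "\<dots> = t 0 * laurent_sum (\<lambda>m. theta_coeff q m * (- (w / v)) powi m) x"
    by (rule laurent_sum_cmult(2)) (use assms q in \<open>auto simp: laurent_sum_scale intro!: theta_summable\<close>)
  finally show ?thesis unfolding t_def th_def by (simp add: laurent_sum_scale theta_q_laurent)
qed

text \<open>As x increases to 1 the series behaves like (c / v) / (1 - x), and theta(-x) has a zero
  there. By the triple product theta(-x) / (1 - x) tends to (q; q)_inf cubed, which is where the
  third power comes from.\<close>

lemma kronecker_constant:
  assumes q: "0 < q" "q < 1" and nz: "\<And>m::int. v - w * of_real q powi m \<noteq> 0" and v: "v \<noteq> 0" and w: "w \<noteq> 0"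
    and prod: "\<And>x. q < x \<Longrightarrow> x < 1 \<Longrightarrow>
       laurent_sum (\<lambda>m. c / (v - w * of_real q powi m)) (of_real x) * theta_q q (- of_real x)
         = t * theta_q q (- (w / v) * of_real x)"
  shows "t * theta_q q (- (w / v)) = c / v * q_poch_inf (of_real q) q ^ 3"
proof -
  let ?Q = "complex_of_real q"
  define e where "e = (\<lambda>m. c / (v - w * ?Q powi m))"
  \<comment> \<open>The coefficients tend to \<open>c / v\<close> at plus infinity. Without this
    constant tail they decay like q^|m| in both directions, so the remainder is continuous at 1 and
    the whole pole sits in the geometric series.\<close>
  define R where "R = (\<lambda>m. e m - (if m \<ge> 0 then c / v else 0))"
  have qn: "q \<noteq> 0" using q by simp
  have Qk: "(\<lambda>k. ?Q ^ k) \<longlonglongrightarrow> 0" using q by (intro LIMSEQ_power_zero) auto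
  have "(\<lambda>k. c * w / (v * (v - w * ?Q ^ k))) \<longlonglongrightarrow> c * w / (v * (v - w * 0))"
    by (intro tendsto_intros Qk) (use v in auto)
  then have "Bseq (\<lambda>k. c * w / (v * (v - w * ?Q ^ k)))" by (rule convergent_imp_Bseq[OF convergentI])
  then obtain C1 where C1: "C1 > 0" "\<And>k. norm (c * w / (v * (v - w * ?Q ^ k))) \<le> C1" unfolding Bseq_def by auto
  have "(\<lambda>k. c / (v * ?Q ^ k - w)) \<longlonglongrightarrow> c / (v * 0 - w)"
    by (intro tendsto_intros Qk) (use w in auto)
  then have "Bseq (\<lambda>k. c / (v * ?Q ^ k - w))" by (rule convergent_imp_Bseq[OF convergentI])
  then obtain C2 where C2: "C2 > 0" "\<And>k. norm (c / (v * ?Q ^ k - w)) \<le> C2" unfolding Bseq_def by auto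
  have Rpos: "R (int k) = c * w / (v * (v - w * ?Q ^ k)) * ?Q ^ k" for k
    using nz[of "int k"] v by (simp add: R_def e_def field_simps)
  have eneg: "e (- int k) = c / (v * ?Q ^ k - w) * ?Q ^ k" for k
  proof -
    have "(v - w * ?Q powi (- int k)) * ?Q ^ k = v * ?Q ^ k - w"
      using qn by (simp add: power_int_minus algebra_simps)
    then have "c / (v - w * ?Q powi (- int k)) = c * ?Q ^ k / (v * ?Q ^ k - w)"
      using qn by (metis mult_divide_mult_cancel_right of_real_eq_0_iff power_not_zero)
    then show ?thesis by (simp add: e_def)
  qed
  have b1: "norm (R (int k)) \<le> (C1 + C2 + norm (c / v)) * q ^ k" for k
  proof -
    have "norm (R (int k)) = norm (c * w / (v * (v - w * ?Q ^ k))) * q ^ k"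
      unfolding Rpos norm_mult norm_power using q by simp
    also have "\<dots> \<le> (C1 + C2 + norm (c / v)) * q ^ k"
      using C1(2)[of k] C2(1) q norm_ge_zero[of "c / v"] by (intro mult_right_mono) (linarith | simp)+
    finally show ?thesis .
  qed
  have b2': "norm (e (- int k)) \<le> C2 * q ^ k" for k
    using C2(2)[of k] less_imp_le[OF C2(1)] q unfolding eneg norm_mult norm_power by (intro mult_mono) auto
  have b2: "norm (R (- int k)) \<le> (C1 + C2 + norm (c / v)) * q ^ k" for k
  proof (cases "k = 0")
    case True then show ?thesis using b1[of 0] by simp
  next
    case False
    then have "norm (R (- int k)) \<le> C2 * q ^ k" using b2'[of k] by (simp add: R_def)
    also have "\<dots> \<le> (C1 + C2 + norm (c / v)) * q ^ k"
      using C1(1) q norm_ge_zero[of "c / v"] by (intro mult_right_mono) (linarith | simp)+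
    finally show ?thesis .
  qed
  have Rs: "laurent_summable R u" if "q < norm u" "norm u < 1 / q" for u
    by (rule laurent_summableI[OF b1 _ _ b2]) (use that q in \<open>auto simp: field_simps\<close>)
  have R_cont: "isCont (laurent_sum R) 1"
  proof -
    let ?r = "(1 + q) / 2"
    have "laurent_sum R holomorphic_on {u. ?r < norm u \<and> norm u < 1 / ?r}"
    proof (rule laurent_sum_holomorphic)
      show "laurent_summable R (of_real ?r)"
      proof (rule Rs)
        show "q < norm (complex_of_real ?r)" unfolding norm_of_real using q by auto
        have "?r < 1" "1 < 1 / q" using q by (auto simp: field_simps)
        then have "?r < 1 / q" by linarith
        then show "norm (complex_of_real ?r) < 1 / q" unfolding norm_of_real using q by auto
      qed
      show "laurent_summable R (of_real (1 / ?r))"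
      proof (rule Rs)
        have r: "0 < ?r" "?r < 1" "q < ?r" using q by auto
        then have "1 < 1 / ?r" by (simp add: less_divide_eq)
        then have "q < 1 / ?r" using q by linarith
        moreover have nr: "norm (complex_of_real (1 / ?r)) = 1 / ?r"
          using r by (simp only: norm_of_real abs_of_pos zero_less_divide_1_iff)
        ultimately show "q < norm (complex_of_real (1 / ?r))" by simp
        have "1 / ?r < 1 / q" using r q by (intro divide_strict_left_mono) auto
        then show "norm (complex_of_real (1 / ?r)) < 1 / q" unfolding nr .
      qed
    qed (use q in auto)
    moreover have "open ({u :: complex. ?r < norm u} \<inter> {u. norm u < 1 / ?r})"
      by (intro open_Int open_Collect_less continuous_intros)
    then have "open {u :: complex. ?r < norm u \<and> norm u < 1 / ?r}" by (simp add: Collect_conj_eq)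
    moreover have "1 \<in> {u :: complex. ?r < norm u \<and> norm u < 1 / ?r}" using q by (auto simp: field_simps)
    ultimately show ?thesis
      using continuous_on_eq_continuous_at holomorphic_on_imp_continuous_on by blast
  qed
  have eq: "q_poch_inf ?Q q * q_poch_inf (of_real x * ?Q) q * q_poch_inf (?Q / of_real x) q
      * (c / v + (1 - of_real x) * laurent_sum R (of_real x)) = t * theta_q q (- (w / v) * of_real x)"
    if x: "q < x" "x < 1" for x
  proof -
    let ?x = "complex_of_real x"
    have x0: "x > 0" using x q by linarith
    have x1: "1 - ?x \<noteq> 0" using x by (metis eq_iff_diff_eq_0 less_irrefl of_real_1 of_real_eq_iff)
    have "((\<lambda>k. c / v * ?x ^ k) has_sum (c / v * (1 / (1 - ?x)))) UNIV"
    proof (rule norm_summable_imp_has_sum)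
      show "summable (\<lambda>k. norm (c / v * ?x ^ k))"
        unfolding norm_mult norm_power by (intro summable_mult summable_geometric) (use x x0 in auto)
      show "(\<lambda>k. c / v * ?x ^ k) sums (c / v * (1 / (1 - ?x)))"
        using x x0 by (intro sums_mult geometric_sums) auto
    qed
    also have "?this \<longleftrightarrow> ((\<lambda>m. (if m \<ge> 0 then c / v else 0) * ?x powi m) has_sum (c / v * (1 / (1 - ?x)))) {0..}"
      by (rule has_sum_reindex_bij_witness[of _ nat int]) (auto simp: power_int_def)
    also have "\<dots> \<longleftrightarrow> ((\<lambda>m. (if m \<ge> 0 then c / v else 0) * ?x powi m) has_sum (c / v * (1 / (1 - ?x)))) UNIV"
      by (rule has_sum_cong_neutral) auto
    finally have g: "((\<lambda>m. (if m \<ge> 0 then c / v else 0) * ?x powi m) has_sum (c / v * (1 / (1 - ?x)))) UNIV" .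
    have "laurent_summable R ?x"
      using x x0 q by (intro Rs) (auto intro: less_trans[of x 1])
    then have "((\<lambda>m. R m * ?x powi m + (if m \<ge> 0 then c / v else 0) * ?x powi m) has_sum
        (laurent_sum R ?x + c / v * (1 / (1 - ?x)))) UNIV"
      by (intro has_sum_add g laurent_has_sum)
    also have "(\<lambda>m. R m * ?x powi m + (if m \<ge> 0 then c / v else 0) * ?x powi m) = (\<lambda>m. e m * ?x powi m)"
      by (auto simp: R_def fun_eq_iff algebra_simps)
    finally have "laurent_sum e ?x = laurent_sum R ?x + c / v * (1 / (1 - ?x))"
      using laurent_sumI by blast
    then have "laurent_sum e ?x * (1 - ?x) = laurent_sum R ?x * (1 - ?x) + c / v * (1 / (1 - ?x) * (1 - ?x))"
      by (simp only: distrib_right mult.assoc)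
    then have L: "laurent_sum e ?x * (1 - ?x) = c / v + (1 - ?x) * laurent_sum R ?x"
      using x1 by simp
    have "theta_q q (- ?x) = q_poch_inf ?Q q * ((1 - ?x) * q_poch_inf (?x * ?Q) q) * q_poch_inf (?Q / ?x) q"
      using jacobi_triple_product[OF q, of "- ?x"] x0 q_poch_inf_step[OF q, of ?x] by simp
    then have "laurent_sum e ?x * theta_q q (- ?x)
        = q_poch_inf ?Q q * q_poch_inf (?x * ?Q) q * q_poch_inf (?Q / ?x) q * (laurent_sum e ?x * (1 - ?x))"
      by (simp only: mult_ac)
    then show ?thesis using prod[OF x] unfolding L e_def[symmetric] by simp
  qed
  have ox: "((\<lambda>x. complex_of_real x) \<longlongrightarrow> 1) (at_left (1::real))"
    by (rule tendsto_eq_intros refl | simp)+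
  have pc: "((\<lambda>x. q_poch_inf (f x) q) \<longlongrightarrow> q_poch_inf l q) F" if "(f \<longlongrightarrow> l) F" for f l and F :: "real filter"
    using isCont_tendsto_compose[OF q_poch_inf_isCont[OF q] that] .
  have th: "((\<lambda>x. theta_q q (- (w / v) * of_real x)) \<longlongrightarrow> theta_q q (- (w / v) * 1)) (at_left (1::real))"
  proof (rule isCont_tendsto_compose[of _ "theta_q q"])
    show "isCont (theta_q q) (- (w / v) * 1)"
      using holomorphic_on_imp_continuous_on[OF theta_q_holomorphic[OF q]] v w
      by (subst (asm) continuous_on_eq_continuous_at) auto
  qed (intro tendsto_intros ox)
  have lim: "((\<lambda>x. q_poch_inf ?Q q * q_poch_inf (of_real x * ?Q) q * q_poch_inf (?Q / of_real x) q
      * (c / v + (1 - of_real x) * laurent_sum R (of_real x)))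
      \<longlongrightarrow> q_poch_inf ?Q q * q_poch_inf (1 * ?Q) q * q_poch_inf (?Q / 1) q * (c / v + (1 - 1) * laurent_sum R 1)) (at_left (1::real))"
    by (intro tendsto_intros pc ox isCont_tendsto_compose[OF R_cont]) auto
  have ev: "\<forall>\<^sub>F x in at_left (1::real). q < x \<and> x < 1"
    using eventually_at_left_real[of q 1] q by (auto elim: eventually_mono)
  have A: "((\<lambda>x. t * theta_q q (- (w / v) * of_real x))
      \<longlongrightarrow> q_poch_inf ?Q q * q_poch_inf (1 * ?Q) q * q_poch_inf (?Q / 1) q * (c / v + (1 - 1) * laurent_sum R 1)) (at_left (1::real))"
    by (rule Lim_transform_eventually[OF lim]) (use ev eq in \<open>auto elim: eventually_mono\<close>)
  have B: "((\<lambda>x. t * theta_q q (- (w / v) * of_real x)) \<longlongrightarrow> t * theta_q q (- (w / v) * 1)) (at_left (1::real))"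
    by (intro tendsto_mult tendsto_const th)
  have "t * theta_q q (- (w / v) * 1) = q_poch_inf ?Q q * q_poch_inf (1 * ?Q) q * q_poch_inf (?Q / 1) q * (c / v + (1 - 1) * laurent_sum R 1)"
    by (rule tendsto_unique[OF _ B A]) simp
  then show ?thesis by (simp add: power3_eq_cube)
qed

context q_system
begin

text \<open>The product of the reciprocals of D(al_j q^t) for t = 1, ..., p: the Frobenius recursion
  at the origin after elimination of the upper components.\<close>

definition psi_last :: "nat \<Rightarrow> nat \<Rightarrow> complex" where
  "psi_last j p = (\<Prod>t<p. (\<Prod>i<N. be i - al j * Q ^ Suc t) / (\<Prod>l\<le>N. al l - al j * Q ^ Suc t))"

text \<open>For \<open>i < N\<close> and \<open>p > 0\<close> the factor
  \<open>be i - al j * Q ^ p\<close> is omitted from the product in the numerator instead of being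
  divided out of \<open>psi_last\<close>, since it may vanish. The resonant case depends on this
  form.\<close>

definition psi :: "nat \<Rightarrow> nat \<Rightarrow> nat \<Rightarrow> complex" where
  "psi j i p = (if i = N then psi_last j p
     else a i * (case p of 0 \<Rightarrow> 1 / (be i - al j)
       | Suc k \<Rightarrow> (\<Prod>i'\<in>{..<N} - {i}. be i' - al j * Q ^ Suc k) / (\<Prod>l\<le>N. al l - al j * Q ^ Suc k) * psi_last j k))"

definition psi_limit :: "nat \<Rightarrow> complex" where
  "psi_limit j = (\<Prod>i<N. q_poch_inf (Q * al j / be i) q) / (\<Prod>l\<le>N. q_poch_inf (Q * al j / al l) q)"

lemma Q_power_neq_1: "k > 0 \<Longrightarrow> Q ^ k \<noteq> 1"
proof -
  assume "k > 0"
  then have "q ^ k < 1" using q by (simp add: power_less_one_iff)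
  then show ?thesis by (metis less_irrefl of_real_1 of_real_eq_iff of_real_power)
qed

lemma al_power_neq: "l \<le> N \<Longrightarrow> j \<le> N \<Longrightarrow> k > 0 \<Longrightarrow> al l \<noteq> al j * Q ^ k"
  using al_nonres[of l j "int k"] Q_power_neq_1[of k] al_nonzero[of j] by (cases "l = j") auto

lemma al_prod_nonzero: "j \<le> N \<Longrightarrow> (\<Prod>l\<le>N. al l - al j * Q ^ Suc k) \<noteq> 0"
  using al_power_neq[of _ j "Suc k"] by (simp del: power_Suc)

lemma psi_last_Suc:
  "psi_last j (Suc p) = psi_last j p * ((\<Prod>i<N. be i - al j * Q ^ Suc p) / (\<Prod>l\<le>N. al l - al j * Q ^ Suc p))"
  by (simp add: psi_last_def)

lemma psi_last_0 [simp]: "psi_last j 0 = 1" by (simp add: psi_last_def)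

lemma psi_N [simp]: "psi j N p = psi_last j p" by (simp add: psi_def)

lemma psi_top:
  assumes "j \<le> N" "i < N"
  shows "al j * Q ^ p * psi j i p = be i * psi j i p - a i * psi j N p"
proof (cases p)
  case 0
  then show ?thesis using assms al_neq_be[of j i] by (simp add: psi_def field_simps)
next
  case (Suc k)
  have "(\<Prod>i<N. be i - al j * Q ^ Suc k) = (be i - al j * Q ^ Suc k) * (\<Prod>i'\<in>{..<N} - {i}. be i' - al j * Q ^ Suc k)"
    using assms by (intro prod.remove) auto
  then have "(be i - al j * Q ^ p) * psi j i p = a i * psi j N p"
    unfolding Suc psi_N psi_last_Suc using assms by (simp add: psi_def del: power_Suc)
  then show ?thesis by (simp add: algebra_simps)
qed

text \<open>For \<open>p = 0\<close> this is the eigenvalue condition \<open>D (al j) = 0\<close>.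
  For \<open>p > 0\<close>, over the common denominator it becomes \<open>char_identity\<close> at
  al_j q^p.\<close>

lemma psi_bottom:
  assumes "j \<le> N"
  shows "al j * Q ^ p * psi j N p = d * psi j N p - (\<Sum>i<N. b i * psi j i p) - (case p of 0 \<Rightarrow> 0 | Suc k \<Rightarrow> psi j N k)"
proof (cases p)
  case 0
  have "D (al j) = 0" using assms by (auto simp: D_def intro!: prod_zero)
  then have "d - al j - (\<Sum>i<N. a i * b i / (be i - al j)) = 0"
    using D_eq[of "al j"] al_neq_be[of j] assms by metis
  moreover have "(\<Sum>i<N. b i * psi j i 0) = (\<Sum>i<N. a i * b i / (be i - al j))"
    by (intro sum.cong refl) (simp add: psi_def)
  ultimately show ?thesis using 0 by (simp add: algebra_simps)
next
  case (Suc k)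
  let ?v = "al j * Q ^ Suc k"
  let ?A = "\<Prod>l\<le>N. al l - ?v"
  have A: "?A \<noteq> 0" using assms by (rule al_prod_nonzero)
  have "(\<Sum>i<N. b i * psi j i p) = (\<Sum>i<N. a i * b i * (\<Prod>i'\<in>{..<N} - {i}. be i' - ?v)) / ?A * psi_last j k"
    unfolding sum_divide_distrib sum_distrib_right Suc
    by (intro sum.cong refl) (auto simp: psi_def)
  moreover have "psi j N p = (\<Prod>i<N. be i - ?v) / ?A * psi_last j k"
    unfolding Suc psi_N psi_last_Suc by simp
  moreover have "x * (P / A * s) - S / A * s = (x * P - S) / A * s" for x P A s S :: complex
    by (simp add: diff_divide_distrib left_diff_distrib)
  ultimately have "(d - ?v) * psi j N p - (\<Sum>i<N. b i * psi j i p)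
    = ((d - ?v) * (\<Prod>i<N. be i - ?v) - (\<Sum>i<N. a i * b i * (\<Prod>i'\<in>{..<N} - {i}. be i' - ?v))) / ?A * psi_last j k"
    by presburger
  also have "\<dots> = psi_last j k" unfolding char_identity using A by simp
  finally show ?thesis using Suc by (simp add: algebra_simps)
qed

lemma D_quotient: "(\<Prod>l\<le>N. al l - v) / (\<Prod>i<N. be i - v) = beN * ((\<Prod>l\<le>N. 1 - v / al l) / (\<Prod>i<N. 1 - v / be i))"
proof -
  have "(\<Prod>l\<le>N. al l - v) = (\<Prod>l\<le>N. al l) * (\<Prod>l\<le>N. 1 - v / al l)"
    unfolding prod.distrib[symmetric] using al_nonzero by (intro prod.cong) (auto simp: right_diff_distrib)
  moreover have "(\<Prod>i<N. be i - v) = (\<Prod>i<N. be i) * (\<Prod>i<N. 1 - v / be i)"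
    unfolding prod.distrib[symmetric] using be_nonzero by (intro prod.cong) (auto simp: right_diff_distrib)
  ultimately show ?thesis by (simp add: beN_def)
qed

lemma psi_last_poch:
  "psi_last j p * beN ^ p = (\<Prod>i<N. q_poch (Q * al j / be i) q p) / (\<Prod>l\<le>N. q_poch (Q * al j / al l) q p)"
proof (induction p)
  case (Suc p)
  have "(\<Prod>i<N. be i - al j * Q ^ Suc p) / (\<Prod>l\<le>N. al l - al j * Q ^ Suc p)
      = inverse (beN * ((\<Prod>l\<le>N. 1 - al j * Q ^ Suc p / al l) / (\<Prod>i<N. 1 - al j * Q ^ Suc p / be i)))"
    unfolding D_quotient[symmetric] by simp
  then have "psi_last j (Suc p) * beN ^ Suc p = (psi_last j p * beN ^ p) *
      ((\<Prod>i<N. 1 - al j * Q ^ Suc p / be i) / (\<Prod>l\<le>N. 1 - al j * Q ^ Suc p / al l))"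
    unfolding psi_last_Suc by (simp add: mult_ac)
  also have "\<dots> = (\<Prod>i<N. q_poch (Q * al j / be i) q (Suc p)) / (\<Prod>l\<le>N. q_poch (Q * al j / al l) q (Suc p))"
    unfolding Suc q_poch_Suc prod.distrib by (simp add: mult_ac)
  finally show ?case .
qed simp

lemma psi_limit_denom_nonzero:
  assumes "j \<le> N"
  shows "(\<Prod>l\<le>N. q_poch_inf (Q * al j / al l) q) \<noteq> 0"
proof -
  have "q_poch_inf (Q * al j / al l) q \<noteq> 0" if "l \<le> N" for l
  proof
    assume "q_poch_inf (Q * al j / al l) q = 0"
    then obtain k where "Q * al j / al l * Q ^ k = 1" using q_poch_inf_eq_0_iff[OF q] by auto
    then have "al l = al j * Q ^ Suc k" using al_nonzero[OF that] by (simp add: field_simps)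
    then show False using al_power_neq[OF that assms, of "Suc k"] by blast
  qed
  then show ?thesis by simp
qed

lemma psi_last_tendsto:
  assumes "j \<le> N"
  shows "(\<lambda>p. psi_last j p * beN ^ p) \<longlonglongrightarrow> psi_limit j"
  unfolding psi_last_poch psi_limit_def
  by (intro tendsto_intros q_poch_tendsto q psi_limit_denom_nonzero assms)

lemma psi_bounded:
  assumes "j \<le> N" "i \<le> N"
  obtains C where "C > 0" "\<And>p. norm (psi j i p) \<le> C * (1 / norm beN) ^ p"
proof -
  have "convergent (\<lambda>p. psi j i p * beN ^ p)"
  proof (cases "i = N")
    case True
    then show ?thesis using psi_last_tendsto[OF assms(1)] by (auto intro: convergentI)
  next
    case False
    then have i: "i < N" using assms by simp
    note Qk = Q_power_tendsto
    have l0: "(\<lambda>p. be i - al j * Q ^ p) \<longlonglongrightarrow> be i - al j * 0"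
      by (intro tendsto_intros Qk)
    then have ev: "\<forall>\<^sub>F p in sequentially. be i - al j * Q ^ p \<noteq> 0"
      using tendsto_imp_eventually_ne[of _ _ sequentially 0] be_nonzero[OF i] by fastforce
    have "(\<lambda>p. a i * (psi_last j p * beN ^ p) / (be i - al j * Q ^ p)) \<longlonglongrightarrow> a i * psi_limit j / (be i - al j * 0)"
      by (intro tendsto_intros psi_last_tendsto assms Qk) (use be_nonzero[OF i] in auto)
    then have "(\<lambda>p. psi j i p * beN ^ p) \<longlonglongrightarrow> a i * psi_limit j / (be i - al j * 0)"
    proof (rule Lim_transform_eventually)
      show "\<forall>\<^sub>F p in sequentially. a i * (psi_last j p * beN ^ p) / (be i - al j * Q ^ p) = psi j i p * beN ^ p"
        using ev
      proof eventually_elim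
        case (elim p)
        have "(be i - al j * Q ^ p) * psi j i p = a i * psi_last j p"
          using psi_top[OF assms(1) i, of p] by (simp add: algebra_simps)
        then show ?case using elim by (simp add: field_simps)
      qed
    qed
    then show ?thesis by (rule convergentI)
  qed
  then have "Bseq (\<lambda>p. psi j i p * beN ^ p)" by (rule convergent_imp_Bseq)
  then obtain C where C: "C > 0" "\<And>p. norm (psi j i p * beN ^ p) \<le> C" unfolding Bseq_def by auto
  show ?thesis
  proof (rule that[OF C(1)])
    fix p show "norm (psi j i p) \<le> C * (1 / norm beN) ^ p"
      using C(2)[of p] by (simp add: norm_mult norm_power power_divide pos_le_divide_eq)
  qed
qed

definition psi_ext :: "nat \<Rightarrow> nat \<Rightarrow> int \<Rightarrow> complex" where
  "psi_ext j i m = (if m \<ge> 0 then psi j i (nat m) else 0)"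

lemma psi_ext_summable:
  assumes "j \<le> N" "i \<le> N" "u \<noteq> 0" "norm u < norm beN"
  shows "laurent_summable (psi_ext j i) u"
proof -
  obtain C where C: "C > 0" "\<And>p. norm (psi j i p) \<le> C * (1 / norm beN) ^ p"
    using psi_bounded[OF assms(1,2)] by blast
  show ?thesis
  proof (rule laurent_summableI[where C = C and s = "1 / norm beN" and r = "norm u / 2"])
    fix k :: nat
    show "norm (psi_ext j i (int k)) \<le> C * (1 / norm beN) ^ k" using C by (simp add: psi_ext_def)
    have "norm (psi_ext j i (- int k)) \<le> C * (norm u / 2) ^ k" if "k = 0"
      using C(2)[of 0] that by (simp add: psi_ext_def)
    then show "norm (psi_ext j i (- int k)) \<le> C * (norm u / 2) ^ k"
      using C by (cases "k = 0") (auto simp: psi_ext_def)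
  qed (use assms in \<open>auto simp: field_simps\<close>)
qed

text \<open>Cutting the pairing off at \<open>K\<close> makes the defects telescope up to one
  boundary term. The term is kept because it does not tend to 0 in general: its limit carries the
  connection constant.\<close>

lemma psi_partial_pairing:
  assumes r: "row_solution v r" and j: "j \<le> N"
  shows "v * (\<Sum>k\<le>K. \<Sum>i\<le>N. r i (m - int k) * psi j i k)
    = al j * Q powi m * (\<Sum>k\<le>K. \<Sum>i\<le>N. r i (m - int k) * psi j i k)
      - Q powi (m - int K - 1) * r N (m - int K - 1) * psi j N K"
proof -
  define e where "e = (\<lambda>k. case k of 0 \<Rightarrow> 0 | Suc k \<Rightarrow> psi j N k)"
  have step: "v * (\<Sum>i\<le>N. r i (m - int k) * psi j i k)
    = Q powi (m - int k) * (al j * Q ^ k) * (\<Sum>i\<le>N. r i (m - int k) * psi j i k)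
      + Q powi (m - int k) * r N (m - int k) * e k
      - Q powi (m - int k - 1) * r N (m - int k - 1) * psi j N k" for k
    by (rule bilinear_identity)
      (use r psi_top[OF j] psi_bottom[OF j] in \<open>auto simp: row_solution_def e_def\<close>)
  have step': "v * (\<Sum>i\<le>N. r i (m - int k) * psi j i k)
    = al j * Q powi m * (\<Sum>i\<le>N. r i (m - int k) * psi j i k)
      + Q powi (m - int k) * r N (m - int k) * e k
      - Q powi (m - int k - 1) * r N (m - int k - 1) * psi j N k" for k
  proof -
    have "Q powi (m - int k) * (al j * Q ^ k) = al j * Q powi m"
      by (simp add: power_int_diff)
    then show ?thesis using step[of k] by simp
  qed
  show ?thesis
  proof (induction K)
    case 0
    show ?case using step'[of 0] by (simp add: e_def)
  next
    case (Suc K)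
    show ?case
      using Suc step'[of "Suc K"] by (simp add: e_def distrib_left diff_diff_eq add.commute)
  qed
qed

text \<open>The row coefficients behave like (q beN)^k and those of the solution at the origin like
  beN^(-k). In the boundary term of the truncated pairing these rates cancel, leaving the product of
  the two limits as inhomogeneity.\<close>

lemma psi_pairing:
  assumes r: "row_solution v r" and j: "j \<le> N"
    and rs: "\<And>i. i \<le> N \<Longrightarrow> laurent_summable (r i) u" and u: "u \<noteq> 0" "norm u < norm beN"
    and lim: "(\<lambda>k. r N (- int k) / (Q * beN) ^ k) \<longlonglongrightarrow> rlim"
  shows "(v - al j * Q powi m) * pairing r (psi_ext j) m = - (beN powi (1 - m) * rlim * psi_limit j)"
proof -
  let ?P = "\<lambda>k. \<Sum>i\<le>N. r i (m - int k) * psi j i k"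
  have "((\<lambda>p. \<Sum>i\<le>N. r i p * psi_ext j i (m - p)) has_sum pairing r (psi_ext j) m) UNIV"
    by (rule pairing_summable(1)[where u = u]) (use rs psi_ext_summable[OF j] u in auto)
  also have "?this \<longleftrightarrow> ((\<lambda>p. \<Sum>i\<le>N. r i p * psi_ext j i (m - p)) has_sum pairing r (psi_ext j) m) {..m}"
    by (rule has_sum_cong_neutral) (auto simp: psi_ext_def)
  also have "\<dots> \<longleftrightarrow> (?P has_sum pairing r (psi_ext j) m) UNIV"
    by (rule has_sum_reindex_bij_witness[of _ "\<lambda>k. m - int k" "\<lambda>p. nat (m - p)"]) (auto simp: psi_ext_def)
  finally have "?P sums pairing r (psi_ext j) m" by (rule has_sum_imp_sums)
  then have S: "(\<lambda>K. \<Sum>k\<le>K. ?P k) \<longlonglongrightarrow> pairing r (psi_ext j) m" by (simp add: sums_def_le)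
  have nt: "filterlim (\<lambda>K. nat (int K + 1 - m)) at_top sequentially"
    unfolding filterlim_at_top
  proof
    fix Z
    show "\<forall>\<^sub>F K in sequentially. Z \<le> nat (int K + 1 - m)"
      using eventually_ge_at_top[of "Z + nat \<bar>m\<bar>"] by eventually_elim auto
  qed
  have "(\<lambda>K. beN powi (1 - m) * (r N (- int (nat (int K + 1 - m))) / (Q * beN) ^ nat (int K + 1 - m)) * (psi_last j K * beN ^ K))
      \<longlonglongrightarrow> beN powi (1 - m) * rlim * psi_limit j"
    by (intro tendsto_intros psi_last_tendsto[OF j] filterlim_compose[OF lim nt])
  then have T: "(\<lambda>K. Q powi (m - int K - 1) * r N (m - int K - 1) * psi j N K) \<longlonglongrightarrow> beN powi (1 - m) * rlim * psi_limit j"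
  proof (rule Lim_transform_eventually)
    show "\<forall>\<^sub>F K in sequentially.
      beN powi (1 - m) * (r N (- int (nat (int K + 1 - m))) / (Q * beN) ^ nat (int K + 1 - m)) * (psi_last j K * beN ^ K)
      = Q powi (m - int K - 1) * r N (m - int K - 1) * psi j N K"
      using eventually_ge_at_top[of "nat \<bar>m\<bar>"]
    proof eventually_elim
      case (elim K)
      then have k: "int (nat (int K + 1 - m)) = int K + 1 - m" by auto
      have "(Q * beN) ^ nat (int K + 1 - m) = (Q * beN) powi (int K + 1 - m)"
        using k by (metis power_int_of_nat)
      then have p: "(Q * beN) ^ nat (int K + 1 - m) = Q powi (int K + 1 - m) * beN powi (int K + 1 - m)"
        by (simp add: power_int_mult_distrib)
      have b: "beN powi (1 - m) * beN ^ K = beN powi (int K + 1 - m)"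
        unfolding power_int_of_nat[symmetric] by (subst power_int_add[symmetric]) (auto simp: algebra_simps)
      have qq: "Q powi (m - int K - 1) = inverse (Q powi (int K + 1 - m))"
        by (subst power_int_minus[symmetric]) (simp add: algebra_simps)
      have "m - int K - 1 = - (int K + 1 - m)" by simp
      then show ?case unfolding k p qq
        using b by (simp add: field_simps)
    qed
  qed
  have "(\<lambda>K. v * (\<Sum>k\<le>K. ?P k)) \<longlonglongrightarrow> v * pairing r (psi_ext j) m"
    by (intro tendsto_intros S)
  moreover have "(\<lambda>K. v * (\<Sum>k\<le>K. ?P k)) \<longlonglongrightarrow> al j * Q powi m * pairing r (psi_ext j) m - beN powi (1 - m) * rlim * psi_limit j"
    unfolding psi_partial_pairing[OF r j] by (intro tendsto_intros S T)
  ultimately have "v * pairing r (psi_ext j) m = al j * Q powi m * pairing r (psi_ext j) m - beN powi (1 - m) * rlim * psi_limit j"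
    by (rule LIMSEQ_unique)
  then show ?thesis by (simp add: algebra_simps)
qed

text \<open>In the variable x = u / beN the pairing satisfies the assumption of
  \<open>kronecker_product\<close>. If v is not in al_j q^Z, then \<open>kronecker_constant\<close>
  identifies the factor \<open>X\<close>. If v = al_j q^m, the inhomogeneity vanishes, the recursion
  says nothing about the coefficient m and kills all others; therefore \<open>X\<close> has to be
  tied to this coefficient through \<open>deg\<close>.\<close>

lemma psi_pairing_value:
  assumes r: "row_solution v r" and j: "j \<le> N" and v: "v \<noteq> 0"
    and rs: "\<And>i u. i \<le> N \<Longrightarrow> q * norm beN < norm u \<Longrightarrow> laurent_summable (r i) u"
    and lim: "(\<lambda>k. r N (- int k) / (Q * beN) ^ k) \<longlonglongrightarrow> rlim"
    and nondeg: "(\<And>m::int. v \<noteq> al j * Q powi m) \<Longrightarrow>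
      X * theta_q q (- (al j / v)) = - (beN * rlim * psi_limit j) / v * q_poch_inf Q q ^ 3"
    and deg: "\<And>m::int. v = al j * Q powi m \<Longrightarrow>
      X = pairing r (psi_ext j) m * beN powi m * Q powi tri (- m) * (- 1) powi m"
    and u: "q * norm beN < norm u" "norm u < norm beN"
  shows "(\<Sum>i\<le>N. laurent_sum (r i) u * laurent_sum (psi_ext j i) u) * theta_q q (- (u / beN))
    = X * theta_q q (- (al j / v) * (u / beN))"
proof -
  define c where "c = - (beN * rlim * psi_limit j)"
  define e where "e = (\<lambda>m. pairing r (psi_ext j) m * beN powi m)"
  have pos: "q * norm beN > 0" using q by simp
  have alj: "al j \<noteq> 0" using al_nonzero j by blast
  have e_summ: "laurent_summable e x" "x \<noteq> 0"
    "laurent_sum e x = (\<Sum>i\<le>N. laurent_sum (r i) (x * beN) * laurent_sum (psi_ext j i) (x * beN))"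
    if "q < norm x" "norm x < 1" for x
  proof -
    have x0: "x \<noteq> 0" using that q by auto
    have 1: "q * norm beN < norm (x * beN)" "norm (x * beN) < norm beN"
      using that by (simp_all add: norm_mult)
    have 2: "x * beN \<noteq> 0" using x0 by simp
    note ps = pairing_summable[of r "x * beN" "psi_ext j", OF rs[OF _ 1(1)] psi_ext_summable[OF j _ 2 1(2)] 2]
    show "x \<noteq> 0" by fact
    show "laurent_summable e x" unfolding e_def laurent_sum_scale using ps(2) by (simp add: mult.commute)
    show "laurent_sum e x = (\<Sum>i\<le>N. laurent_sum (r i) (x * beN) * laurent_sum (psi_ext j i) (x * beN))"
      unfolding e_def laurent_sum_scale using ps(3) by (simp add: mult.commute)
  qed
  have u0: "u \<noteq> 0" using u pos by auto
  have x: "q < norm (u / beN)" "norm (u / beN) < 1"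
    using u by (simp_all add: norm_divide field_simps)
  have rec: "(v - al j * Q powi m) * e m = c" for m
  proof -
    have "(v - al j * Q powi m) * pairing r (psi_ext j) m = - (beN powi (1 - m) * rlim * psi_limit j)"
      by (rule psi_pairing[OF r j rs[OF _ u(1)] u0 u(2) lim])
    then have "(v - al j * Q powi m) * e m = - (beN powi (1 - m) * rlim * psi_limit j) * beN powi m"
      unfolding e_def by (metis mult.assoc)
    also have "\<dots> = - (beN powi (1 - m + m) * rlim * psi_limit j)"
      by (subst power_int_add) auto
    finally show ?thesis by (simp add: c_def)
  qed
  define t where "t = laurent_conv e (\<lambda>m. theta_coeff q m * (- 1) powi m) 0"
  have main: "laurent_sum e x * theta_q q (- x) = t * theta_q q (- (al j / v) * x)"
    if "q < norm x" "norm x < 1" for x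
    unfolding t_def by (rule kronecker_product[OF q rec e_summ(1,2)[OF that] v alj])
  have e_sum: "laurent_sum e (u / beN) = (\<Sum>i\<le>N. laurent_sum (r i) u * laurent_sum (psi_ext j i) u)"
    using e_summ(3)[OF x] by simp
  show ?thesis
  proof (cases "\<exists>m::int. v = al j * Q powi m")
    case False
    then have ne: "v - al j * Q powi m \<noteq> 0" for m by simp
    have e: "e = (\<lambda>m. c / (v - al j * Q powi m))"
    proof (rule ext)
      fix m show "e m = c / (v - al j * Q powi m)"
        using rec[of m] ne[of m] by (metis nonzero_mult_div_cancel_left)
    qed
    have "t * theta_q q (- (al j / v)) = c / v * q_poch_inf Q q ^ 3"
    proof (rule kronecker_constant[OF q ne v alj])
      fix y :: real assume y: "q < y" "y < 1"
      show "laurent_sum (\<lambda>m. c / (v - al j * Q powi m)) (complex_of_real y) * theta_q q (- complex_of_real y)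
        = t * theta_q q (- (al j / v) * complex_of_real y)"
        unfolding e[symmetric] by (rule main) (use y q in auto)
    qed
    moreover have "theta_q q (- (al j / v)) \<noteq> 0"
    proof
      assume "theta_q q (- (al j / v)) = 0"
      moreover have "- (al j / v) \<noteq> 0" using alj v by simp
      ultimately obtain k :: int where "- (al j / v) = - (Q powi k)"
        using theta_q_eq_0_iff[OF q, of "- (al j / v)"] by blast
      then have "v = al j * Q powi (- k)" using v by (simp add: power_int_minus field_simps)
      then show False using False by blast
    qed
    moreover have "X * theta_q q (- (al j / v)) = c / v * q_poch_inf Q q ^ 3"
      unfolding c_def by (rule nondeg) (use False in blast)
    ultimately have "t = X" by (metis mult_right_cancel)
    then show ?thesis using main[OF x] e_sum by simp
  next
    case True
    then obtain m :: int where m: "v = al j * Q powi m" by blast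
    have c0: "c = 0" using rec[of m] m by simp
    have ez: "e k = 0" if "k \<noteq> m" for k
    proof -
      have "Q powi m \<noteq> Q powi k"
      proof
        assume "Q powi m = Q powi k"
        then have "complex_of_real (q powi m) = of_real (q powi k)" by simp
        then have "q powi m = q powi k" unfolding of_real_eq_iff .
        then show False
          using that q power_int_strict_decreasing[of m k q] power_int_strict_decreasing[of k m q] by linarith
      qed
      then show ?thesis using rec[of k] c0 m alj by simp
    qed
    have "((\<lambda>k. e k * (u / beN) powi k) has_sum (e m * (u / beN) powi m)) {m}"
      by (rule has_sum_finiteI) auto
    also have "?this \<longleftrightarrow> ((\<lambda>k. e k * (u / beN) powi k) has_sum (e m * (u / beN) powi m)) UNIV"
      by (rule has_sum_cong_neutral) (use ez in auto)
    finally have s: "laurent_sum e (u / beN) = e m * (u / beN) powi m" using laurent_sumI by blast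
    have xn: "- (u / beN) \<noteq> 0" using u0 by simp
    \<comment> \<open>In the resonant case the quotient of the two theta functions is a monomial of
      degree m, which matches the single surviving coefficient.\<close>
    have "- (al j / v) * (u / beN) = Q powi (- m) * (- (u / beN))"
      using alj by (simp add: m power_int_minus field_simps)
    then have "theta_q q (- (al j / v) * (u / beN)) = Q powi (- tri (- m)) * (- (u / beN)) powi m * theta_q q (- (u / beN))"
      using theta_q_shift_powi[OF q xn, of "- m"] by simp
    also have "(- (u / beN)) powi m = (- 1) powi m * (u / beN) powi m"
      by (metis mult_minus1 power_int_mult_distrib)
    finally have th: "theta_q q (- (al j / v) * (u / beN))
      = Q powi (- tri (- m)) * ((- 1) powi m * (u / beN) powi m) * theta_q q (- (u / beN))" .
    have "X = e m * Q powi tri (- m) * (- 1) powi m" unfolding deg[OF m] e_def ..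
    then have "X * theta_q q (- (al j / v) * (u / beN))
      = e m * (Q powi tri (- m) * Q powi (- tri (- m))) * ((- 1) powi m * (- 1) powi m)
        * (u / beN) powi m * theta_q q (- (u / beN))"
      unfolding th by (simp only: mult_ac)
    moreover have "(- 1 :: complex) powi m * (- 1) powi m = 1"
      by (simp add: power_int_mult_distrib[symmetric])
    moreover have "Q powi tri (- m) * Q powi (- tri (- m)) = 1" by (simp add: power_int_minus)
    ultimately show ?thesis unfolding e_sum[symmetric] s by simp
  qed
qed

text \<open>Only the leading coefficient of the row meets the leading coefficient of
  \<open>psi\<close>. They are a left and a right eigenvector of \<open>B\<close> for the eigenvalue
  \<open>al j\<close>, and, with last entries scaled to 1, their product is minus the derivative of
  the Schur complement \<open>D\<close> at its zero \<open>al j\<close>.\<close>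

lemma pairing_psi_terminating:
  assumes r: "row_solution v r" and j: "j \<le> N" and v: "v = al j * Q powi m"
    and z: "\<And>i p. i \<le> N \<Longrightarrow> p < m \<Longrightarrow> r i p = 0"
  shows "pairing r (psi_ext j) m = r N m * ((\<Prod>l\<in>{..N} - {j}. al l - al j) / (\<Prod>i<N. be i - al j))"
proof -
  let ?S = "\<Sum>i<N. a i * b i / (be i - al j)\<^sup>2"
  have bz: "be i - al j \<noteq> 0" if "i < N" for i using al_neq_be[OF j that] by auto
  have t: "laurent_conv (r i) (psi_ext j i) m = r i m * psi j i 0" if "i \<le> N" for i
  proof -
    have "((\<lambda>p. r i p * psi_ext j i (m - p)) has_sum (r i m * psi j i 0)) {m}"
      by (rule has_sum_finiteI) (auto simp: psi_ext_def)
    also have "?this \<longleftrightarrow> ((\<lambda>p. r i p * psi_ext j i (m - p)) has_sum (r i m * psi j i 0)) UNIV"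
      by (rule has_sum_cong_neutral) (use z[OF that] in \<open>auto simp: psi_ext_def not_less\<close>)
    finally show ?thesis unfolding laurent_conv_def by (rule infsumI)
  qed
  have ri: "r i m = b i / (be i - al j) * r N m" if "i < N" for i
  proof -
    have "al j * Q powi m * r i m = Q powi m * (be i * r i m - b i * r N m)"
      using r that v by (auto simp: row_solution_def)
    then have "Q powi m * (al j * r i m) = Q powi m * (be i * r i m - b i * r N m)" by (simp only: mult_ac)
    then have "al j * r i m = be i * r i m - b i * r N m" by simp
    then show ?thesis using bz[OF that] by (simp add: field_simps)
  qed
  have "pairing r (psi_ext j) m = (\<Sum>i<N. r i m * psi j i 0) + r N m * psi j N 0"
    unfolding pairing_def using t by (simp add: lessThan_Suc_atMost[symmetric])
  also have "(\<Sum>i<N. r i m * psi j i 0) = r N m * ?S"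
    unfolding sum_distrib_left by (intro sum.cong refl) (use ri in \<open>auto simp: psi_def power2_eq_square\<close>)
  finally have s: "pairing r (psi_ext j) m = r N m * (1 + ?S)"
    by (simp add: algebra_simps)
  \<comment> \<open>Splitting off the zero, D(v) = (al_j - v) E(v), gives the derivative - E(al_j);
    differentiating \<open>D_eq\<close> term by term gives - 1 - \<open>?S\<close>.\<close>
  define E where "E = (\<lambda>v. (\<Prod>l\<in>{..N} - {j}. al l - v) / (\<Prod>i<N. be i - v))"
  have DE: "D v = (al j - v) * E v" for v
    unfolding D_def E_def using j by (subst prod.remove[of "{..N}" j]) auto
  have op: "open (- (be ` {..<N}))" by (intro open_Compl finite_imp_closed) auto
  have S: "al j \<in> - (be ` {..<N})" using al_neq_be[OF j] by auto
  have "E holomorphic_on (- (be ` {..<N}))"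
    unfolding E_def by (intro holomorphic_intros) auto
  then have "E field_differentiable (at (al j))"
    using holomorphic_on_imp_differentiable_at[OF _ op S] by blast
  then obtain E' where E': "(E has_field_derivative E') (at (al j))"
    unfolding field_differentiable_def by blast
  have l: "((\<lambda>v. al j - v) has_field_derivative - 1) (at (al j))"
    by (auto intro!: derivative_eq_intros)
  have d1: "(D has_field_derivative - E (al j)) (at (al j))"
    using DERIV_mult[OF l E'] unfolding DE[abs_def] by simp
  have "((\<lambda>v. a i * b i / (be i - v)) has_field_derivative a i * b i / (be i - al j)\<^sup>2) (at (al j))"
    if "i < N" for i
  proof -
    have "((\<lambda>v. be i - v) has_field_derivative - 1) (at (al j))"
      by (auto intro!: derivative_eq_intros)
    from DERIV_divide[OF DERIV_const this bz[OF that], of "a i * b i"]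
    show ?thesis by (simp add: power2_eq_square)
  qed
  then have "((\<lambda>v. \<Sum>i<N. a i * b i / (be i - v)) has_field_derivative ?S) (at (al j))"
    by (intro DERIV_sum) auto
  moreover have "((\<lambda>v. d - v) has_field_derivative - 1) (at (al j))"
    by (auto intro!: derivative_eq_intros)
  ultimately have d2: "((\<lambda>v. d - v - (\<Sum>i<N. a i * b i / (be i - v))) has_field_derivative
      (- 1 - ?S)) (at (al j))" by (intro DERIV_diff)
  have "(D has_field_derivative (- 1 - ?S)) (at (al j))"
  proof (rule has_field_derivative_transform_within_open[OF d2 op S])
    fix x assume "x \<in> - (be ` {..<N})"
    then have "be i \<noteq> x" if "i < N" for i using that by auto
    then show "d - x - (\<Sum>i<N. a i * b i / (be i - x)) = D x" by (rule D_eq[symmetric])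
  qed
  then have "- E (al j) = - 1 - ?S" by (rule DERIV_unique[OF d1])
  then have "1 + ?S = E (al j)"
    by (metis add_uminus_conv_diff minus_add_distrib minus_minus)
  then show ?thesis unfolding s E_def by simp
qed

end

section \<open>Row solutions\<close>

text \<open>The factors are 1 - q^(-j) for j = 1, ..., k in reverse order; pulling - q^(-j) out of
  each produces the sign and the triangular power.\<close>

lemma q_poch_reflect:
  assumes "0 < q"
  shows "q_poch (inverse (of_real q) ^ k) q k = (- 1) ^ k * of_real q powi (- tri (int (Suc k))) * q_poch (of_real q) q k"
proof -
  let ?Q = "complex_of_real q"
  have "q_poch (inverse ?Q ^ k) q k = (\<Prod>l<k. 1 - inverse ?Q ^ (k - l))"
    unfolding q_poch_def
  proof (intro prod.cong refl)
    fix l assume "l \<in> {..<k}"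
    then have "inverse ?Q ^ k = inverse ?Q ^ (k - l) * inverse ?Q ^ l" by (simp add: power_add[symmetric])
    moreover have "inverse ?Q ^ l * ?Q ^ l = 1" using assms by (simp add: power_mult_distrib[symmetric])
    ultimately show "1 - inverse ?Q ^ k * ?Q ^ l = 1 - inverse ?Q ^ (k - l)" by (simp add: mult.assoc)
  qed
  also have "\<dots> = (\<Prod>l<k. 1 - inverse ?Q ^ Suc l)"
    by (subst prod.nat_diff_reindex[symmetric]) (auto intro!: prod.cong simp: Suc_diff_Suc)
  also have "\<dots> = (- 1) ^ k * ?Q powi (- tri (int (Suc k))) * q_poch ?Q q k"
  proof (induction k)
    case (Suc k)
    have "tri (int (Suc (Suc k))) = tri (int (Suc k)) + int (Suc k)"
      using tri_plus1[of "int (Suc k)"] by (simp add: add.commute)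
    then have "?Q powi (- tri (int (Suc (Suc k)))) = ?Q powi (- tri (int (Suc k))) * inverse (?Q ^ Suc k)"
      using assms by (simp add: power_int_diff power_int_minus divide_inverse del: power_Suc of_nat_Suc)
    moreover have "1 - inverse ?Q ^ Suc k = - (inverse (?Q ^ Suc k)) * (1 - ?Q * ?Q ^ k)"
      using assms by (simp add: field_simps)
    ultimately show ?case unfolding prod.lessThan_Suc Suc q_poch_Suc by (simp add: mult_ac)
  qed simp
  finally show ?thesis .
qed

context q_system
begin

section \<open>The rows \<open>eta k\<close>, which do not depend on the direction\<close>

lemma D_product:
  "(\<Prod>s<r. D (v * Q ^ s)) = beN ^ r * ((\<Prod>l\<le>N. q_poch (v / al l) q r) / (\<Prod>i<N. q_poch (v / be i) q r))"
proof (induction r)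
  case (Suc r)
  have "D (v * Q ^ r) = beN * ((\<Prod>l\<le>N. 1 - v / al l * Q ^ r) / (\<Prod>i<N. 1 - v / be i * Q ^ r))"
    unfolding D_def D_quotient by simp
  then show ?case unfolding prod.lessThan_Suc Suc q_poch_Suc prod.distrib by (simp add: mult_ac)
qed simp

text \<open>Each step multiplies by \<open>Q\<close> times a value of \<open>D\<close> at be_k q^r.
  These arguments tend to 0, so the ratio tends to q beN and the row converges for |u| > q |beN|.
  This is the advantage over the columns, where \<open>D\<close> is evaluated at be_l
  q^(-r).\<close>

definition eta_last :: "nat \<Rightarrow> nat \<Rightarrow> complex" where
  "eta_last k r = (case r of 0 \<Rightarrow> 0 | Suc r' \<Rightarrow> - (Q * a k) * (\<Prod>s<r'. Q * D (be k * Q * Q ^ s)))"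

text \<open>A series in nonpositive powers of u, normalized to the k-th unit vector at infinity; its
  last component begins with u^(-1).\<close>

definition eta :: "nat \<Rightarrow> nat \<Rightarrow> int \<Rightarrow> complex" where
  "eta k i m = (if m > 0 then 0 else if i = N then eta_last k (nat (- m))
     else if m = 0 then (if i = k then 1 else 0)
     else b i * eta_last k (nat (- m)) / (be i - be k * Q ^ nat (- m)))"

definition eta_limit :: "nat \<Rightarrow> complex" where
  "eta_limit k = - (a k / beN) *
     ((\<Prod>l\<le>N. q_poch_inf (Q * be k / al l) q) / (\<Prod>i<N. q_poch_inf (Q * be k / be i) q))"

lemma be_power_neq: "i < N \<Longrightarrow> k < N \<Longrightarrow> r > 0 \<Longrightarrow> be i \<noteq> be k * Q ^ r"
  using be_nonres[of i k "int r"] Q_power_neq_1[of r] be_nonzero[of k] by (cases "i = k") auto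

lemma eta_last_Suc: "r > 0 \<Longrightarrow> eta_last k (Suc r) = eta_last k r * (Q * D (be k * Q ^ r))"
  by (cases r) (auto simp: eta_last_def mult_ac)

lemma eta_row:
  assumes k: "k < N"
  shows "row_solution (be k) (eta k)"
  unfolding row_solution_def
proof (intro allI conjI impI)
  fix m i assume i: "i < N"
  show "be k * eta k i m = Q powi m * (be i * eta k i m - b i * eta k N m)"
  proof (cases "m < 0")
    case True
    define r where "r = nat (- m)"
    have r: "r > 0" "m = - int r" using True by (auto simp: r_def)
    have e: "eta k i m = b i * eta_last k r / (be i - be k * Q ^ r)" "eta k N m = eta_last k r"
      using r i by (auto simp: eta_def)
    have "(be i - be k * Q ^ r) * eta k i m = b i * eta k N m"
      unfolding e using be_power_neq[OF i k r(1)] by simp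
    then have "be k * Q ^ r * eta k i m = be i * eta k i m - b i * eta k N m" by (simp add: algebra_simps)
    then have "Q powi m * (be i * eta k i m - b i * eta k N m) = (Q powi m * Q ^ r) * (be k * eta k i m)"
      by (simp add: mult_ac)
    also have "Q powi m * Q ^ r = 1" by (simp add: r power_int_minus)
    finally show ?thesis by simp
  next
    case False
    then show ?thesis using i k by (cases "m = 0") (auto simp: eta_def eta_last_def)
  qed
next
  fix m
  have z: "eta k i p = 0" if "p > 0" for i p using that by (simp add: eta_def)
  show "be k * eta k N m = Q powi m * (d * eta k N m - (\<Sum>i<N. a i * eta k i m)) - Q powi (m - 1) * eta k N (m - 1)"
  proof (cases "m < 0")
    case True
    define r where "r = nat (- m)"
    have r: "r > 0" "m = - int r" using True by (auto simp: r_def)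
    have "nat (- (m - 1)) = Suc r" using r by auto
    then have e: "eta k N m = eta_last k r" "eta k N (m - 1) = eta_last k r * (Q * D (be k * Q ^ r))"
      using r by (auto simp: eta_def eta_last_Suc)
    have s: "(\<Sum>i<N. a i * eta k i m) = eta_last k r * (\<Sum>i<N. a i * b i / (be i - be k * Q ^ r))"
      unfolding sum_distrib_left by (intro sum.cong refl) (use r in \<open>auto simp: eta_def\<close>)
    have De: "D (be k * Q ^ r) = d - be k * Q ^ r - (\<Sum>i<N. a i * b i / (be i - be k * Q ^ r))"
      by (rule D_eq) (use be_power_neq[OF _ k r(1)] in blast)
    have "d * eta k N m - (\<Sum>i<N. a i * eta k i m) = eta_last k r * (D (be k * Q ^ r) + be k * Q ^ r)"
      unfolding e s De by (simp add: algebra_simps)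
    then have "Q powi m * (d * eta k N m - (\<Sum>i<N. a i * eta k i m)) - Q powi (m - 1) * eta k N (m - 1)
      = eta_last k r * (Q powi m * D (be k * Q ^ r) + be k * (Q powi m * Q ^ r) - (Q powi (m - 1) * Q) * D (be k * Q ^ r))"
      unfolding e by (simp add: algebra_simps)
    also have "Q powi m * Q ^ r = 1" by (simp add: r power_int_minus)
    also have "Q powi (m - 1) * Q = Q powi m" by (simp add: power_int_diff)
    finally show ?thesis unfolding e by (simp add: mult_ac)
  next
    case False
    show ?thesis
    proof (cases "m = 0")
      case True
      \<comment> \<open>At index 0 the contribution \<open>a k\<close> of the unit vector can only
        be balanced by the coefficient of u^(-1) in the last component. This forces the starting
        value - q a_k of \<open>eta_last\<close>.\<close>
      have "(\<Sum>i<N. a i * eta k i 0) = (\<Sum>i<N. if i = k then a k else 0)"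
        by (intro sum.cong refl) (auto simp: eta_def)
      also have "\<dots> = a k" using k by simp
      finally have 1: "(\<Sum>i<N. a i * eta k i 0) = a k" .
      have 2: "eta k N (- 1) = - (Q * a k)" "eta k N 0 = 0" by (auto simp: eta_def eta_last_def)
      show ?thesis unfolding True using 1 2 by (simp add: power_int_minus)
    next
      case m: False
      then have "eta k N m = 0" "eta k N (m - 1) = 0" "(\<Sum>i<N. a i * eta k i m) = 0"
        using False z[of m] by (auto simp: eta_def eta_last_def)
      then show ?thesis by simp
    qed
  qed
qed

lemma eta_last_poch:
  "eta_last k (Suc r) = - a k / beN * (Q * beN) ^ Suc r *
    ((\<Prod>l\<le>N. q_poch (Q * be k / al l) q r) / (\<Prod>i<N. q_poch (Q * be k / be i) q r))"
  unfolding eta_last_def nat.case prod.distrib D_product mult.commute[of "be k" Q]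
  by (simp add: power_mult_distrib)

lemma eta_denom_nonzero:
  assumes "k < N"
  shows "(\<Prod>i<N. q_poch_inf (Q * be k / be i) q) \<noteq> 0"
proof -
  have "q_poch_inf (Q * be k / be i) q \<noteq> 0" if "i < N" for i
  proof
    assume "q_poch_inf (Q * be k / be i) q = 0"
    then obtain r where "Q * be k / be i * Q ^ r = 1" using q_poch_inf_eq_0_iff[OF q] by auto
    then have "be i = be k * Q ^ Suc r" using be_nonzero[OF that] by (simp add: field_simps)
    then show False using be_power_neq[OF that assms, of "Suc r"] by blast
  qed
  then show ?thesis by simp
qed

lemma eta_tendsto:
  assumes k: "k < N"
  shows "(\<lambda>r. eta k N (- int r) / (Q * beN) ^ r) \<longlonglongrightarrow> eta_limit k"
proof (rule LIMSEQ_imp_Suc)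
  have "(\<lambda>r. - (a k / beN) * ((\<Prod>l\<le>N. q_poch (Q * be k / al l) q r) / (\<Prod>i<N. q_poch (Q * be k / be i) q r)))
      \<longlonglongrightarrow> eta_limit k"
    unfolding eta_limit_def by (intro tendsto_intros q_poch_tendsto q eta_denom_nonzero k)
  moreover have "eta k N (- int (Suc r)) / (Q * beN) ^ Suc r
    = - (a k / beN) * ((\<Prod>l\<le>N. q_poch (Q * be k / al l) q r) / (\<Prod>i<N. q_poch (Q * be k / be i) q r))" for r
  proof -
    have "eta k N (- int (Suc r)) = eta_last k (Suc r)" by (simp add: eta_def nat_add_distrib)
    moreover have "(Q * beN) ^ Suc r \<noteq> 0" by simp
    ultimately show ?thesis unfolding eta_last_poch by (simp del: power_Suc)
  qed
  ultimately show "(\<lambda>r. eta k N (- int (Suc r)) / (Q * beN) ^ Suc r) \<longlonglongrightarrow> eta_limit k" by simp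
qed

text \<open>The row equations express each upper component through the last one by division by be_i
  - v q^k, which tends to be_i and is nonzero from some index on. Thus the limit of the last
  component controls the growth of all.\<close>

lemma row_bounded:
  assumes r: "row_solution v r" and v: "v \<noteq> 0" and i: "i \<le> N"
    and lim: "(\<lambda>k. r N (- int k) / (Q * beN) ^ k) \<longlonglongrightarrow> rlim"
  obtains C where "C > 0" "\<And>k. norm (r i (- int k)) \<le> C * (q * norm beN) ^ k"
proof -
  have "convergent (\<lambda>k. r i (- int k) / (Q * beN) ^ k)"
  proof (cases "i = N")
    case True then show ?thesis using lim by (auto intro: convergentI)
  next
    case False
    then have i: "i < N" using i by simp
    note Qk = Q_power_tendsto
    have "(\<lambda>k. be i - v * Q ^ k) \<longlonglongrightarrow> be i - v * 0" by (intro tendsto_intros Qk)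
    then have ev: "\<forall>\<^sub>F k in sequentially. be i - v * Q ^ k \<noteq> 0"
      using tendsto_imp_eventually_ne[of _ _ sequentially 0] be_nonzero[OF i] by fastforce
    have "(\<lambda>k. b i * (r N (- int k) / (Q * beN) ^ k) / (be i - v * Q ^ k)) \<longlonglongrightarrow> b i * rlim / (be i - v * 0)"
      by (intro tendsto_intros lim Qk) (use be_nonzero[OF i] in auto)
    then have "(\<lambda>k. r i (- int k) / (Q * beN) ^ k) \<longlonglongrightarrow> b i * rlim / (be i - v * 0)"
    proof (rule Lim_transform_eventually)
      show "\<forall>\<^sub>F k in sequentially. b i * (r N (- int k) / (Q * beN) ^ k) / (be i - v * Q ^ k) = r i (- int k) / (Q * beN) ^ k"
        using ev
      proof eventually_elim
        case (elim k)
        have "v * r i (- int k) = Q powi (- int k) * (be i * r i (- int k) - b i * r N (- int k))"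
          using r i by (auto simp: row_solution_def)
        then have "v * Q ^ k * r i (- int k) = be i * r i (- int k) - b i * r N (- int k)"
          by (simp add: power_int_minus field_simps)
        then have "(be i - v * Q ^ k) * r i (- int k) = b i * r N (- int k)" by (simp add: algebra_simps)
        then have "r i (- int k) = b i * r N (- int k) / (be i - v * Q ^ k)" using elim by (simp add: field_simps)
        then show ?case by simp
      qed
    qed
    then show ?thesis by (rule convergentI)
  qed
  then have "Bseq (\<lambda>k. r i (- int k) / (Q * beN) ^ k)" by (rule convergent_imp_Bseq)
  then obtain C where C: "C > 0" "\<And>k. norm (r i (- int k) / (Q * beN) ^ k) \<le> C" unfolding Bseq_def by auto
  show ?thesis
  proof (rule that[OF C(1)])
    fix k show "norm (r i (- int k)) \<le> C * (q * norm beN) ^ k"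
      using C(2)[of k] q by (simp add: norm_divide norm_mult norm_power pos_divide_le_eq)
  qed
qed

lemma eta_summable:
  assumes k: "k < N" and i: "i \<le> N" and u: "q * norm beN < norm u"
  shows "laurent_summable (eta k i) u"
proof -
  obtain C where C: "C > 0" "\<And>r. norm (eta k i (- int r)) \<le> C * (q * norm beN) ^ r"
    using row_bounded[OF eta_row[OF k] be_nonzero[OF k] i eta_tendsto[OF k]] by blast
  have u0: "norm u > 0" using u q by (metis le_less_trans mult_nonneg_nonneg less_imp_le norm_ge_zero)
  show ?thesis
  proof (rule laurent_summableI[where C = C and s = "1 / (2 * norm u)" and r = "q * norm beN"])
    fix m :: nat
    show "norm (eta k i (int m)) \<le> C * (1 / (2 * norm u)) ^ m"
      using C(1) C(2)[of 0] u0 by (cases "m = 0") (auto simp: eta_def)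
  qed (use C u u0 q in auto)
qed

text \<open>The constant in the first formula of the theorem, without theta quotient and power of z,
  in terms of al = q^mu and be = q^nu.\<close>

definition conn_top :: "nat \<Rightarrow> nat \<Rightarrow> complex" where
  "conn_top k j = a k / (be k - al j)
    * (((\<Prod>i\<in>{..<N} - {k}. q_poch_inf (Q * al j / be i) q) * (\<Prod>l\<in>{..N} - {j}. q_poch_inf (Q * be k / al l) q))
     / ((\<Prod>l\<in>{..N} - {j}. q_poch_inf (Q * al j / al l) q) * (\<Prod>i\<in>{..<N} - {k}. q_poch_inf (Q * be k / be i) q)))"

text \<open>The triple product for theta(- al_j / be_k) supplies exactly the factors
  \<open>i = k\<close> and \<open>l = j\<close> that are missing in the numerators of
  \<open>conn_top\<close>. Of the three factors (q; q)_inf on the right, two cancel against the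
  terms \<open>l = j\<close> and \<open>i = k\<close> of the denominators, and the third is the one
  in theta.\<close>

lemma conn_top_generic:
  assumes k: "k < N" and j: "j \<le> N"
  shows "conn_top k j * theta_q q (- (al j / be k)) = - (beN * eta_limit k * psi_limit j) / be k * q_poch_inf Q q ^ 3"
proof -
  have nz: "be k \<noteq> 0" "al j \<noteq> 0" "be k - al j \<noteq> 0" using be_nonzero k al_nonzero j al_neq_be[OF j k] by auto
  have th: "theta_q q (- (al j / be k)) = q_poch_inf Q q * ((1 - al j / be k) * q_poch_inf (Q * al j / be k) q) * q_poch_inf (Q * be k / al j) q"
    using jacobi_triple_product[OF q, of "- (al j / be k)"] q_poch_inf_step[OF q, of "al j / be k"] nz
    by (simp add: mult.commute)
  have r1: "(\<Prod>i<N. q_poch_inf (Q * al j / be i) q) = q_poch_inf (Q * al j / be k) q * (\<Prod>i\<in>{..<N} - {k}. q_poch_inf (Q * al j / be i) q)"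
    using k by (intro prod.remove) auto
  have r2: "(\<Prod>l\<le>N. q_poch_inf (Q * be k / al l) q) = q_poch_inf (Q * be k / al j) q * (\<Prod>l\<in>{..N} - {j}. q_poch_inf (Q * be k / al l) q)"
    using j by (intro prod.remove) auto
  have r3: "(\<Prod>l\<le>N. q_poch_inf (Q * al j / al l) q) = q_poch_inf Q q * (\<Prod>l\<in>{..N} - {j}. q_poch_inf (Q * al j / al l) q)"
    using j nz by (subst prod.remove[of _ j]) auto
  have r4: "(\<Prod>i<N. q_poch_inf (Q * be k / be i) q) = q_poch_inf Q q * (\<Prod>i\<in>{..<N} - {k}. q_poch_inf (Q * be k / be i) q)"
    using k nz by (subst prod.remove[of _ k]) auto
  have "(\<Prod>l\<in>{..N} - {j}. q_poch_inf (Q * al j / al l) q) \<noteq> 0" "(\<Prod>i\<in>{..<N} - {k}. q_poch_inf (Q * be k / be i) q) \<noteq> 0"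
    "q_poch_inf Q q \<noteq> 0"
    using psi_limit_denom_nonzero[OF j] eta_denom_nonzero[OF k] unfolding r3 r4 by auto
  moreover have "1 - al j / be k = (be k - al j) / be k" using nz by (simp add: field_simps)
  moreover have "x / w * ((X * Y) / (Z * W)) * (p * ((w / y) * s) * t)
      = - (z * (- (x / z) * ((t * Y) / (p * W))) * ((s * X) / (p * Z))) / y * p ^ 3"
    if "p \<noteq> 0" "Z \<noteq> 0" "W \<noteq> 0" "w \<noteq> 0" "y \<noteq> 0" "z \<noteq> 0" for x w X Y Z W p y s t z :: complex
    using that by (simp add: power3_eq_cube mult_ac)
  ultimately show ?thesis
    unfolding conn_top_def th eta_limit_def psi_limit_def r1 r2 r3 r4
    using nz beN_nonzero by metis
qed

lemma beN_remove:
  assumes k: "k < N" and j: "j \<le> N"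
  shows "beN * (be k * (\<Prod>i\<in>{..<N} - {k}. be i)) = al j * (\<Prod>l\<in>{..N} - {j}. al l)"
proof -
  have "(\<Prod>i<N. be i) = be k * (\<Prod>i\<in>{..<N} - {k}. be i)" using k by (intro prod.remove) auto
  moreover have "(\<Prod>l\<le>N. al l) = al j * (\<Prod>l\<in>{..N} - {j}. al l)" using j by (intro prod.remove) auto
  moreover have "beN * (\<Prod>i<N. be i) = (\<Prod>l\<le>N. al l)" using be_nonzero by (simp add: beN_def)
  ultimately show ?thesis by simp
qed

text \<open>Here \<open>D\<close> vanishes at be_k q^R, so the row \<open>eta k\<close> stops at the
  index \<open>- R\<close> and \<open>pairing_psi_terminating\<close> applies. The finite products
  are compared with \<open>conn_top\<close> by splitting R factors off its infinite
  products.\<close>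

lemma conn_top_degenerate_neg:
  assumes k: "k < N" and j: "j \<le> N" and R: "R > 0" "al j = be k * Q ^ R"
  shows "conn_top k j = pairing (eta k) (psi_ext j) (- int R) * beN powi (- int R) * Q powi tri (int R) * (- 1) powi (- int R)"
proof -
  obtain S where S: "R = Suc S" using R(1) by (cases R) auto
  have nz: "be k \<noteq> 0" "al j \<noteq> 0" "be k - al j \<noteq> 0" "1 - Q ^ R \<noteq> 0"
    using be_nonzero k al_nonzero j al_neq_be[OF j k] Q_power_neq_1[OF R(1)] by auto
  have v: "be k = al j * Q powi (- int R)" using R(2) by (simp add: power_int_minus)
  have Dz: "D (be k * Q ^ R) = 0" unfolding R(2)[symmetric] D_def using j by (auto intro!: prod_zero)
  have el: "eta_last k r = 0" if "r > R" for r
    using that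
  proof (induction r rule: less_induct)
    case (less r)
    then obtain s where s: "r = Suc s" by (cases r) auto
    show ?case
    proof (cases "s = R")
      case True then show ?thesis using eta_last_Suc[OF R(1), of k] Dz s by simp
    next
      case False
      then have "eta_last k s = 0" "s > 0" using less s by auto
      then show ?thesis using eta_last_Suc[of s k] s by simp
    qed
  qed
  have z: "eta k i p = 0" if "p < - int R" for i p
    using that el[of "nat (- p)"] by (auto simp: eta_def)
  have pr: "pairing (eta k) (psi_ext j) (- int R)
      = eta k N (- int R) * ((\<Prod>l\<in>{..N} - {j}. al l - al j) / (\<Prod>i<N. be i - al j))"
    by (rule pairing_psi_terminating[OF eta_row[OF k] j v z])
  define PL where "PL = (\<lambda>r. \<Prod>l\<in>{..N} - {j}. q_poch (Q * be k / al l) q r)"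
  define PI where "PI = (\<lambda>r. \<Prod>i\<in>{..<N} - {k}. q_poch (Q * be k / be i) q r)"
  have p1: "(\<Prod>l\<le>N. q_poch (Q * be k / al l) q S) = q_poch (inverse Q ^ S) q S * PL S"
  proof -
    have "(\<Prod>l\<le>N. q_poch (Q * be k / al l) q S) = q_poch (Q * be k / al j) q S * PL S"
      unfolding PL_def using j by (intro prod.remove) auto
    moreover have "Q * be k / al j = inverse Q ^ S"
      using nz by (simp add: R(2) S field_simps power_mult_distrib[symmetric])
    ultimately show ?thesis by simp
  qed
  have p2: "(\<Prod>i<N. q_poch (Q * be k / be i) q S) = q_poch Q q S * PI S"
    unfolding PI_def using k nz by (subst prod.remove[of _ k]) auto
  \<comment> \<open>The factor with \<open>l = j\<close> has argument q^(-S) and length S = R - 1,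
    one short of vanishing. Its reflection is the source of the sign and of the triangular
    power.\<close>
  have rf: "q_poch (inverse Q ^ S) q S = (- 1) ^ S * Q powi (- tri (int R)) * q_poch Q q S"
    unfolding S by (rule q_poch_reflect) (rule q(1))
  have qS: "q_poch Q q S \<noteq> 0" by (rule q_poch_q_nonzero[OF q])
  have e: "eta k N (- int R) = - a k / beN * (Q * beN) ^ R * ((- 1) ^ S * Q powi (- tri (int R)) * (PL S / PI S))"
  proof -
    have "eta k N (- int R) = eta_last k (Suc S)" by (simp add: eta_def S nat_add_distrib)
    then show ?thesis unfolding eta_last_poch p1 p2 rf S using qS by simp
  qed
  \<comment> \<open>Because al_j = be_k q^R, the difference al_l - al_j is al_l times the next
    Pochhammer factor, so the length grows from S to R; \<open>PIS\<close> is the same for the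
    denominators.\<close>
  have PLS: "(\<Prod>l\<in>{..N} - {j}. al l - al j) * PL S = (\<Prod>l\<in>{..N} - {j}. al l) * PL R"
    unfolding PL_def prod.distrib[symmetric]
  proof (intro prod.cong refl)
    fix l assume "l \<in> {..N} - {j}"
    then have "al l \<noteq> 0" using al_nonzero by auto
    then have "al l - al j = al l * (1 - Q * be k / al l * Q ^ S)" by (simp add: R(2) S field_simps)
    then show "(al l - al j) * q_poch (Q * be k / al l) q S = al l * q_poch (Q * be k / al l) q R"
      unfolding S q_poch_Suc by simp
  qed
  have PIS: "(\<Prod>i\<in>{..<N} - {k}. be i - al j) * PI S = (\<Prod>i\<in>{..<N} - {k}. be i) * PI R"
    unfolding PI_def prod.distrib[symmetric]
  proof (intro prod.cong refl)
    fix i assume "i \<in> {..<N} - {k}"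
    then have "be i \<noteq> 0" using be_nonzero by auto
    then have "be i - al j = be i * (1 - Q * be k / be i * Q ^ S)" by (simp add: R(2) S field_simps)
    then show "(be i - al j) * q_poch (Q * be k / be i) q S = be i * q_poch (Q * be k / be i) q R"
      unfolding S q_poch_Suc by simp
  qed
  note beN' = beN_remove[OF k j]
  have bd: "(\<Prod>i<N. be i - al j) = (be k - al j) * (\<Prod>i\<in>{..<N} - {k}. be i - al j)"
    using k by (intro prod.remove) auto
  define AL where "AL = (\<Prod>l\<in>{..N} - {j}. q_poch_inf (Q * al j / al l) q)"
  define BE where "BE = (\<Prod>i\<in>{..<N} - {k}. q_poch_inf (Q * al j / be i) q)"
  have i1: "(\<Prod>l\<in>{..N} - {j}. q_poch_inf (Q * be k / al l) q) = PL R * AL"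
    unfolding PL_def AL_def prod.distrib[symmetric]
    by (intro prod.cong refl, subst q_poch_inf_split[OF q, of _ R]) (simp add: R(2) mult_ac)
  have i2: "(\<Prod>i\<in>{..<N} - {k}. q_poch_inf (Q * be k / be i) q) = PI R * BE"
    unfolding PI_def BE_def prod.distrib[symmetric]
    by (intro prod.cong refl, subst q_poch_inf_split[OF q, of _ R]) (simp add: R(2) mult_ac)
  have AL: "AL \<noteq> 0" unfolding AL_def using psi_limit_denom_nonzero[OF j] j by (auto simp: prod_zero_iff)
  have "PI R * BE \<noteq> 0" unfolding i2[symmetric] using eta_denom_nonzero[OF k] by (auto simp: prod_zero_iff)
  then have PB: "PI R \<noteq> 0" "BE \<noteq> 0" by auto
  have bn': "(\<Prod>i\<in>{..<N} - {k}. be i) \<noteq> 0" using be_nonzero by (auto simp: prod_zero_iff)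
  have c: "conn_top k j = a k / (be k - al j) * (PL R / PI R)"
    unfolding conn_top_def i1 i2 AL_def[symmetric] BE_def[symmetric] using AL PB by simp
  have frac: "PL S / PI S * ((\<Prod>l\<in>{..N} - {j}. al l - al j) / (\<Prod>i<N. be i - al j))
      = beN * be k / al j * (PL R / PI R) / (be k - al j)"
  proof -
    have "PL S / PI S * ((\<Prod>l\<in>{..N} - {j}. al l - al j) / (\<Prod>i<N. be i - al j))
       = ((\<Prod>l\<in>{..N} - {j}. al l - al j) * PL S) / ((\<Prod>i\<in>{..<N} - {k}. be i - al j) * PI S) / (be k - al j)"
      unfolding bd by (simp add: mult_ac)
    also have "\<dots> = (\<Prod>l\<in>{..N} - {j}. al l) / (\<Prod>i\<in>{..<N} - {k}. be i) * (PL R / PI R) / (be k - al j)"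
      unfolding PLS PIS by simp
    also have "(\<Prod>l\<in>{..N} - {j}. al l) / (\<Prod>i\<in>{..<N} - {k}. be i) = beN * be k / al j"
      using beN' nz bn' by (simp add: field_simps)
    finally show ?thesis .
  qed
  have "(- 1 :: complex) powi (- int R) = (- 1) ^ R" by (simp add: power_int_minus flip: power_inverse)
  then have s: "(- 1 :: complex) ^ S * (- 1) powi (- int R) = - 1"
    unfolding S by (simp add: power_mult_distrib[symmetric])
  have "pairing (eta k) (psi_ext j) (- int R) * beN powi (- int R) * Q powi tri (int R) * (- 1) powi (- int R)
    = - a k / beN * (Q * beN) ^ R * beN powi (- int R) * (Q powi (- tri (int R)) * Q powi tri (int R))
      * ((- 1) ^ S * (- 1) powi (- int R)) * (PL S / PI S * ((\<Prod>l\<in>{..N} - {j}. al l - al j) / (\<Prod>i<N. be i - al j)))"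
    unfolding pr e by (simp only: mult_ac)
  also have "\<dots> = a k / beN * Q ^ R * (beN * be k / al j * (PL R / PI R) / (be k - al j))"
    unfolding s frac by (simp add: power_int_minus power_mult_distrib)
  also have "\<dots> = conn_top k j" unfolding c using nz by (simp add: R(2))
  finally show ?thesis by simp
qed

text \<open>Now the solution at the origin is a polynomial: \<open>psi_last\<close> is 0 from index
  R on. Component k still has a coefficient at R, since the vanishing factor was left out in the
  definition of \<open>psi\<close>, and this coefficient meets the unit vector at index 0 of
  \<open>eta k\<close>. Nothing else contributes.\<close>

lemma conn_top_degenerate_pos:
  assumes k: "k < N" and j: "j \<le> N" and R: "R > 0" "be k = al j * Q ^ R"
  shows "conn_top k j = pairing (eta k) (psi_ext j) (int R) * beN powi int R * Q powi tri (- int R) * (- 1) powi int R"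
proof -
  obtain S where S: "R = Suc S" using R(1) by (cases R) auto
  have nz: "be k \<noteq> 0" "al j \<noteq> 0" "be k - al j \<noteq> 0" "al j - be k \<noteq> 0"
    using be_nonzero k al_nonzero j al_neq_be[OF j k] by auto
  have pl: "psi_last j p = 0" if "p \<ge> R" for p
  proof -
    have "(\<Prod>i<N. be i - al j * Q ^ Suc S) = 0"
      using k by (intro prod_zero bexI[of _ k]) (auto simp: R(2) S)
    then show ?thesis unfolding psi_last_def using that S by (intro prod_zero) auto
  qed
  have psz: "psi j i p = 0" if "p > R" "i \<le> N" for i p
    using pl[of p] pl[of "p - 1"] that by (cases p) (auto simp: psi_def)
  have psR: "psi j i R = 0" if "i \<noteq> k" "i \<le> N" for i
  proof (cases "i = N")
    case True then show ?thesis using pl[of R] by simp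
  next
    case False
    then have "(\<Prod>i'\<in>{..<N} - {i}. be i' - al j * Q ^ Suc S) = 0"
      using k that by (intro prod_zero bexI[of _ k]) (auto simp: R(2) S)
    then show ?thesis using False unfolding psi_def S by simp
  qed
  have t: "laurent_conv (eta k i) (psi_ext j i) (int R) = (if i = k then psi j k R else 0)" if "i \<le> N" for i
  proof -
    have "((\<lambda>p. eta k i p * psi_ext j i (int R - p)) has_sum (eta k i 0 * psi j i R)) {0}"
      by (rule has_sum_finiteI) (auto simp: psi_ext_def)
    also have "?this \<longleftrightarrow> ((\<lambda>p. eta k i p * psi_ext j i (int R - p)) has_sum (eta k i 0 * psi j i R)) UNIV"
    proof (rule has_sum_cong_neutral)
      fix p :: int assume "p \<in> UNIV - {0}"
      then show "eta k i p * psi_ext j i (int R - p) = 0"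
        using psz[OF _ that, of "nat (int R - p)"] by (cases "p > 0") (auto simp: eta_def psi_ext_def)
    qed auto
    finally have "laurent_conv (eta k i) (psi_ext j i) (int R) = eta k i 0 * psi j i R"
      unfolding laurent_conv_def by (rule infsumI)
    also have "\<dots> = (if i = k then psi j k R else 0)"
      using psR[of i] that k by (auto simp: eta_def eta_last_def)
    finally show ?thesis .
  qed
  have pr: "pairing (eta k) (psi_ext j) (int R) = psi j k R"
    unfolding pairing_def using t k by simp
  define PL where "PL = (\<lambda>r. \<Prod>l\<in>{..N} - {j}. q_poch (Q * al j / al l) q r)"
  define PI where "PI = (\<lambda>r. \<Prod>i\<in>{..<N} - {k}. q_poch (Q * al j / be i) q r)"
  have p1: "(\<Prod>i<N. q_poch (Q * al j / be i) q S) = q_poch (inverse Q ^ S) q S * PI S"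
  proof -
    have "(\<Prod>i<N. q_poch (Q * al j / be i) q S) = q_poch (Q * al j / be k) q S * PI S"
      unfolding PI_def using k by (intro prod.remove) auto
    moreover have "Q * al j / be k = inverse Q ^ S"
      using nz by (simp add: R(2) S field_simps power_mult_distrib[symmetric])
    ultimately show ?thesis by simp
  qed
  have p2: "(\<Prod>l\<le>N. q_poch (Q * al j / al l) q S) = q_poch Q q S * PL S"
    unfolding PL_def using j nz by (subst prod.remove[of _ j]) auto
  have rf: "q_poch (inverse Q ^ S) q S = (- 1) ^ S * Q powi (- tri (int R)) * q_poch Q q S"
    unfolding S by (rule q_poch_reflect) (rule q(1))
  have qS: "q_poch Q q S \<noteq> 0" by (rule q_poch_q_nonzero[OF q])
  have e: "psi_last j S * beN ^ S = (- 1) ^ S * Q powi (- tri (int R)) * (PI S / PL S)"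
    unfolding psi_last_poch p1 p2 rf using qS by simp
  have PLS: "(\<Prod>l\<in>{..N} - {j}. al l - be k) * PL S = (\<Prod>l\<in>{..N} - {j}. al l) * PL R"
    unfolding PL_def prod.distrib[symmetric]
  proof (intro prod.cong refl)
    fix l assume "l \<in> {..N} - {j}"
    then have "al l \<noteq> 0" using al_nonzero by auto
    then have "al l - be k = al l * (1 - Q * al j / al l * Q ^ S)" by (simp add: R(2) S field_simps)
    then show "(al l - be k) * q_poch (Q * al j / al l) q S = al l * q_poch (Q * al j / al l) q R"
      unfolding S q_poch_Suc by simp
  qed
  have PIS: "(\<Prod>i\<in>{..<N} - {k}. be i - be k) * PI S = (\<Prod>i\<in>{..<N} - {k}. be i) * PI R"
    unfolding PI_def prod.distrib[symmetric]
  proof (intro prod.cong refl)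
    fix i assume "i \<in> {..<N} - {k}"
    then have "be i \<noteq> 0" using be_nonzero by auto
    then have "be i - be k = be i * (1 - Q * al j / be i * Q ^ S)" by (simp add: R(2) S field_simps)
    then show "(be i - be k) * q_poch (Q * al j / be i) q S = be i * q_poch (Q * al j / be i) q R"
      unfolding S q_poch_Suc by simp
  qed
  note beN' = beN_remove[OF k j]
  have ad: "(\<Prod>l\<le>N. al l - be k) = (al j - be k) * (\<Prod>l\<in>{..N} - {j}. al l - be k)"
    using j by (intro prod.remove) auto
  define AL where "AL = (\<Prod>l\<in>{..N} - {j}. q_poch_inf (Q * be k / al l) q)"
  define BE where "BE = (\<Prod>i\<in>{..<N} - {k}. q_poch_inf (Q * be k / be i) q)"
  have i1: "(\<Prod>l\<in>{..N} - {j}. q_poch_inf (Q * al j / al l) q) = PL R * AL"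
    unfolding PL_def AL_def prod.distrib[symmetric]
    by (intro prod.cong refl, subst q_poch_inf_split[OF q, of _ R]) (simp add: R(2) mult_ac)
  have i2: "(\<Prod>i\<in>{..<N} - {k}. q_poch_inf (Q * al j / be i) q) = PI R * BE"
    unfolding PI_def BE_def prod.distrib[symmetric]
    by (intro prod.cong refl, subst q_poch_inf_split[OF q, of _ R]) (simp add: R(2) mult_ac)
  have BE: "BE \<noteq> 0" unfolding BE_def using eta_denom_nonzero[OF k] by (auto simp: prod_zero_iff)
  have "PL R * AL \<noteq> 0" unfolding i1[symmetric] using psi_limit_denom_nonzero[OF j] by (auto simp: prod_zero_iff)
  then have PA: "PL R \<noteq> 0" "AL \<noteq> 0" by auto
  have an: "(\<Prod>l\<in>{..N} - {j}. al l) \<noteq> 0" using al_nonzero by (auto simp: prod_zero_iff)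
  have c: "conn_top k j = a k / (be k - al j) * (PI R / PL R)"
    unfolding conn_top_def i1 i2 AL_def[symmetric] BE_def[symmetric] using BE PA by simp
  have frac: "(\<Prod>i\<in>{..<N} - {k}. be i - be k) / (\<Prod>l\<le>N. al l - be k) * (PI S / PL S) * beN
      = al j / be k * (PI R / PL R) / (al j - be k)"
  proof -
    have "(\<Prod>i\<in>{..<N} - {k}. be i - be k) / (\<Prod>l\<le>N. al l - be k) * (PI S / PL S) * beN
       = beN * (((\<Prod>i\<in>{..<N} - {k}. be i - be k) * PI S) / ((\<Prod>l\<in>{..N} - {j}. al l - be k) * PL S)) / (al j - be k)"
      unfolding ad by (simp add: mult_ac)
    also have "\<dots> = beN * ((\<Prod>i\<in>{..<N} - {k}. be i) / (\<Prod>l\<in>{..N} - {j}. al l)) * (PI R / PL R) / (al j - be k)"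
      unfolding PLS PIS by simp
    also have "beN * ((\<Prod>i\<in>{..<N} - {k}. be i) / (\<Prod>l\<in>{..N} - {j}. al l)) = al j / be k"
      using beN' nz an by (simp add: field_simps)
    finally show ?thesis .
  qed
  have ps: "psi j k R = a k * ((\<Prod>i\<in>{..<N} - {k}. be i - be k) / (\<Prod>l\<le>N. al l - be k) * psi_last j S)"
  proof -
    have "al j * Q ^ Suc S = be k" using R(2) S by simp
    then show ?thesis unfolding psi_def S using k by simp
  qed
  have s: "(- 1 :: complex) ^ S * (- 1) powi (int R) = - 1"
    by (simp add: S power_int_def nat_add_distrib power_mult_distrib[symmetric])
  have tr: "Q powi tri (- int R) = Q powi tri (int R) * Q ^ R"
    unfolding tri_uminus by (simp add: power_int_add)
  have bp: "beN powi int R = beN ^ S * beN" by (simp add: S power_int_def nat_add_distrib)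
  have "pairing (eta k) (psi_ext j) (int R) * beN powi int R * Q powi tri (- int R) * (- 1) powi int R
    = a k * ((\<Prod>i\<in>{..<N} - {k}. be i - be k) / (\<Prod>l\<le>N. al l - be k)) * (psi_last j S * beN ^ S) * beN
      * (Q powi tri (int R) * Q ^ R) * (- 1) powi int R"
    unfolding pr ps tr bp by (simp only: mult_ac)
  also have "\<dots> = a k * ((\<Prod>i\<in>{..<N} - {k}. be i - be k) / (\<Prod>l\<le>N. al l - be k) * (PI S / PL S) * beN)
      * (Q powi (- tri (int R)) * Q powi tri (int R)) * ((- 1) ^ S * (- 1) powi int R) * Q ^ R"
    unfolding e by (simp only: mult_ac)
  also have "\<dots> = - (a k * (al j / be k * (PI R / PL R) / (al j - be k)) * Q ^ R)"
    unfolding s frac by (simp add: power_int_minus)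
  also have "\<dots> = - (a k * ((al j * Q ^ R) / be k) * (PI R / PL R) / (al j - be k))" by simp
  also have "\<dots> = - (a k * (PI R / PL R) / (al j - be k))" unfolding R(2)[symmetric] using nz by simp
  also have "al j - be k = - (be k - al j)" by simp
  also have "- (a k * (PI R / PL R) / (- (be k - al j))) = conn_top k j"
    unfolding c divide_minus_right by simp
  finally show ?thesis by simp
qed

lemma eta_psi_pairing:
  assumes k: "k < N" and j: "j \<le> N" and u: "q * norm beN < norm u" "norm u < norm beN"
  shows "(\<Sum>i\<le>N. laurent_sum (eta k i) u * laurent_sum (psi_ext j i) u) * theta_q q (- (u / beN))
    = conn_top k j * theta_q q (- (al j / be k) * (u / beN))"
proof (rule psi_pairing_value[OF eta_row[OF k] j be_nonzero[OF k] eta_summable[OF k] eta_tendsto[OF k] _ _ u])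
  show "conn_top k j * theta_q q (- (al j / be k)) = - (beN * eta_limit k * psi_limit j) / be k * q_poch_inf Q q ^ 3"
    by (rule conn_top_generic[OF k j])
  fix m :: int assume m: "be k = al j * Q powi m"
  show "conn_top k j = pairing (eta k) (psi_ext j) m * beN powi m * Q powi tri (- m) * (- 1) powi m"
  proof (cases m "0 :: int" rule: linorder_cases)
    case less
    define R where "R = nat (- m)"
    have R: "R > 0" "m = - int R" using less by (auto simp: R_def)
    have "al j = be k * Q ^ R" using m by (simp add: R(2) power_int_minus field_simps)
    then show ?thesis using conn_top_degenerate_neg[OF k j R(1)] by (simp add: R(2))
  next
    case equal then show ?thesis using m al_neq_be[OF j k] by simp
  next
    case greater
    define R where "R = nat m"
    have R: "R > 0" "m = int R" using greater by (auto simp: R_def)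
    then show ?thesis using conn_top_degenerate_pos[OF k j R(1)] m by simp
  qed
qed auto

end

section \<open>The additional row attached to a direction\<close>

lemma prod_power_int:
  fixes f :: "'a \<Rightarrow> complex"
  shows "(\<Prod>x\<in>A. f x powi m) = (\<Prod>x\<in>A. f x) powi m"
  by (induction A rule: infinite_finite_induct) (auto simp: power_int_mult_distrib)

text \<open>Reversing the order turns the factors into 1 + c q^(-l) for l = 0, ..., k - 1, and c
  q^(-l) is pulled out of each. This moves the argument from a point running to infinity to the
  fixed point - 1/c.\<close>

lemma q_poch_neg_shift:
  assumes q: "0 < q" and c: "c \<noteq> 0"
  shows "q_poch (- (of_real q * c * inverse (of_real q) ^ k)) q k
    = c ^ k * of_real q powi (- tri (int k)) * q_poch (- (1 / c)) q k"
proof -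
  let ?Q = "complex_of_real q"
  have "q_poch (- (?Q * c * inverse ?Q ^ k)) q k = (\<Prod>l<k. 1 + c * inverse ?Q ^ (k - Suc l))"
    unfolding q_poch_def
  proof (intro prod.cong refl)
    fix l assume "l \<in> {..<k}"
    then have "k = k - Suc l + l + 1" by auto
    then have "inverse ?Q ^ k = inverse ?Q ^ (k - Suc l) * inverse ?Q ^ l * inverse ?Q"
      by (metis power_add power_one_right)
    moreover have "inverse ?Q ^ l * ?Q ^ l = 1" using q by (simp add: power_mult_distrib[symmetric])
    ultimately show "1 - - (?Q * c * inverse ?Q ^ k) * ?Q ^ l = 1 + c * inverse ?Q ^ (k - Suc l)"
      using q by (simp add: mult.assoc) (simp add: mult.left_commute)
  qed
  also have "\<dots> = (\<Prod>l<k. 1 + c * inverse ?Q ^ l)"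
    by (rule prod.nat_diff_reindex)
  also have "\<dots> = c ^ k * ?Q powi (- tri (int k)) * q_poch (- (1 / c)) q k"
  proof (induction k)
    case (Suc k)
    have "tri (int (Suc k)) = tri (int k) + int k"
      using tri_plus1[of "int k"] by (simp add: add.commute)
    then have "?Q powi (- tri (int (Suc k))) = ?Q powi (- tri (int k)) * inverse ?Q ^ k"
      using q by (simp add: power_int_diff power_int_minus power_inverse divide_inverse del: of_nat_Suc)
    moreover have "1 + c * inverse ?Q ^ k = c * inverse ?Q ^ k * (1 - - (1 / c) * ?Q ^ k)"
      using q c by (simp add: power_inverse field_simps)
    ultimately show ?case unfolding prod.lessThan_Suc Suc q_poch_Suc by (simp add: mult_ac)
  qed simp
  finally show ?thesis .
qed

context q_system
begin

text \<open>The solution with value 1 at 0 of the first order equation \<open>mgen_step\<close>, to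
  which the row equations reduce in the variable x = L q^m.\<close>

definition mgen :: "complex \<Rightarrow> complex" where
  "mgen x = (\<Prod>l\<le>N. q_poch_inf (- (Q * al l * x)) q) / (\<Prod>i<N. q_poch_inf (- (Q * be i * x)) q)"

text \<open>A function of x sampled on the spiral L q^Z, with the weights that occur in a q-Laplace
  sum multiplied by its theta function. The direction enters only through the sample points and the
  eigenvalue - 1/L.\<close>

definition mrow :: "complex \<Rightarrow> nat \<Rightarrow> int \<Rightarrow> complex" where
  "mrow L i m = (if i = N then 1 else b i * (L * Q powi m) / (1 + be i * (L * Q powi m)))
     * (mgen (L * Q powi m) * Q powi tri m * L powi m)"

text \<open>Excludes the Stokes directions.\<close>

definition admissible :: "complex \<Rightarrow> bool" where
  "admissible L \<longleftrightarrow> L \<noteq> 0 \<and> (\<forall>i<N. \<forall>m::int. 1 + be i * (L * Q powi m) \<noteq> 0)"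

lemma admissible_nonzero: "admissible L \<Longrightarrow> L \<noteq> 0"
  by (simp add: admissible_def)

lemma mgen_step:
  "mgen (x / Q) = mgen x * ((\<Prod>l\<le>N. 1 + al l * x) / (\<Prod>i<N. 1 + be i * x))"
proof -
  have s: "q_poch_inf (- (Q * c * (x / Q))) q = (1 + c * x) * q_poch_inf (- (Q * c * x)) q" for c
    using q_poch_inf_step[OF q, of "- (c * x)"] by (simp add: mult_ac)
  show ?thesis unfolding mgen_def s prod.distrib by (simp add: mult_ac)
qed

text \<open>The upper equations determine the upper components. Inserting them into the last one
  leaves the Schur complement at - 1/x with x = L q^m, and x D(- 1/x) is the quotient of products by
  which \<open>mgen\<close> changes under x -> x / q.\<close>

lemma mrow_row:
  assumes L: "admissible L"
  shows "row_solution (- (1 / L)) (mrow L)"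
  unfolding row_solution_def
proof (intro allI conjI impI)
  note L0 = admissible_nonzero[OF L]
  fix m i assume i: "i < N"
  define x where "x = L * Q powi m"
  have nz: "1 + be i * x \<noteq> 0" using L i by (simp add: admissible_def x_def)
  have "mrow L i m = b i * x / (1 + be i * x) * mrow L N m" using i by (simp add: mrow_def x_def)
  then have "mrow L i m * (1 + be i * x) = b i * x * mrow L N m" using nz by simp
  then have "- mrow L i m = x * (be i * mrow L i m - b i * mrow L N m)" by (simp add: algebra_simps)
  then show "- (1 / L) * mrow L i m = Q powi m * (be i * mrow L i m - b i * mrow L N m)"
    using L0 by (simp add: x_def field_simps)
next
  note L0 = admissible_nonzero[OF L]
  fix m
  define x where "x = L * Q powi m"
  have x0: "x \<noteq> 0" using L0 by (simp add: x_def)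
  have nz: "1 + be i * x \<noteq> 0" if "i < N" for i using L that by (simp add: admissible_def x_def)
  define g where "g = mrow L N m"
  have v: "be i \<noteq> - (1 / x)" if "i < N" for i using nz[OF that] x0 by (auto simp: field_simps)
  have "D (- (1 / x)) * x = (\<Prod>l\<le>N. 1 + al l * x) / (\<Prod>i<N. 1 + be i * x)"
  proof -
    \<comment> \<open>Clearing 1/x takes N + 1 factors in the numerator and N in the denominator, so
      one power of x is left over.\<close>
    have h: "(A * x ^ Suc N) / (B * x ^ N) = A / B * x" for A B using x0 by simp
    have "(\<Prod>l\<le>N. al l - - (1 / x)) * x ^ Suc N = (\<Prod>l\<le>N. 1 + al l * x)"
    proof -
      have "(\<Prod>l\<le>N. al l - - (1 / x)) * (\<Prod>l\<le>N. x) = (\<Prod>l\<le>N. 1 + al l * x)"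
        unfolding prod.distrib[symmetric] using x0 by (intro prod.cong) (auto simp: field_simps)
      then show ?thesis by simp
    qed
    moreover have "(\<Prod>i<N. be i - - (1 / x)) * x ^ N = (\<Prod>i<N. 1 + be i * x)"
    proof -
      have "(\<Prod>l<N. be l - - (1 / x)) * (\<Prod>l<N. x) = (\<Prod>l<N. 1 + be l * x)"
        unfolding prod.distrib[symmetric] using x0 by (intro prod.cong) (auto simp: field_simps)
      then show ?thesis by simp
    qed
    ultimately show ?thesis unfolding D_def using x0 by (metis h)
  qed
  moreover have "D (- (1 / x)) = d + 1 / x - (\<Sum>i<N. a i * b i / (be i + 1 / x))"
    using D_eq[OF v] by simp
  moreover have "(\<Sum>i<N. a i * b i / (be i + 1 / x)) = (\<Sum>i<N. a i * (b i * x / (1 + be i * x)))"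
    by (intro sum.cong refl) (use x0 nz in \<open>auto simp: field_simps\<close>)
  ultimately have id: "(d + 1 / x - (\<Sum>i<N. a i * (b i * x / (1 + be i * x)))) * x
      = (\<Prod>l\<le>N. 1 + al l * x) / (\<Prod>i<N. 1 + be i * x)" by simp
  have s: "(\<Sum>i<N. a i * mrow L i m) = g * (\<Sum>i<N. a i * (b i * x / (1 + be i * x)))"
    unfolding sum_distrib_left by (intro sum.cong refl) (auto simp: mrow_def x_def g_def)
  have p: "Q powi (m - 1) * mrow L N (m - 1) * L = g * ((\<Prod>l\<le>N. 1 + al l * x) / (\<Prod>i<N. 1 + be i * x))"
  proof -
    have "L * Q powi (m - 1) = x / Q" by (simp add: x_def power_int_diff)
    then have "mrow L N (m - 1) = mgen x * ((\<Prod>l\<le>N. 1 + al l * x) / (\<Prod>i<N. 1 + be i * x)) * Q powi tri (m - 1) * L powi (m - 1)"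
      by (simp add: mrow_def mgen_step)
    then have "Q powi (m - 1) * mrow L N (m - 1) * L
      = mgen x * (Q powi (m - 1) * Q powi tri (m - 1)) * (L powi (m - 1) * L) * ((\<Prod>l\<le>N. 1 + al l * x) / (\<Prod>i<N. 1 + be i * x))"
      by (simp only: mult_ac)
    also have "Q powi (m - 1) * Q powi tri (m - 1) = Q powi tri m"
      by (subst power_int_add[symmetric]) (auto simp: tri_minus1)
    also have "L powi (m - 1) * L = L powi m" using L0 by (simp add: power_int_diff)
    also have "mgen x * Q powi tri m * L powi m = g" by (simp add: g_def mrow_def x_def)
    finally show ?thesis .
  qed
  have "(Q powi m * (d * g - (\<Sum>i<N. a i * mrow L i m)) - Q powi (m - 1) * mrow L N (m - 1)) * L
      = x * (d * g - (\<Sum>i<N. a i * mrow L i m)) - Q powi (m - 1) * mrow L N (m - 1) * L"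
    by (simp add: x_def algebra_simps)
  also have "\<dots> = g * (x * (d - (\<Sum>i<N. a i * (b i * x / (1 + be i * x)))) - (d + 1 / x - (\<Sum>i<N. a i * (b i * x / (1 + be i * x)))) * x)"
    unfolding p s id by (simp add: algebra_simps)
  also have "\<dots> = - g" using x0 by (simp add: algebra_simps)
  finally show "- (1 / L) * mrow L N m = Q powi m * (d * mrow L N m - (\<Sum>i<N. a i * mrow L i m)) - Q powi (m - 1) * mrow L N (m - 1)"
    using L0 unfolding g_def by (simp add: field_simps)
qed

definition mrow_limit :: "complex \<Rightarrow> complex" where
  "mrow_limit L = mgen L * ((\<Prod>l\<le>N. q_poch_inf (- (1 / (al l * L))) q) / (\<Prod>i<N. q_poch_inf (- (1 / (be i * L))) q))"

lemma admissible_poch: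
  assumes L: "admissible L" and i: "i < N"
  shows "q_poch_inf (- (1 / (be i * L))) q \<noteq> 0" "q_poch_inf (- (Q * be i * (L * Q powi m))) q \<noteq> 0"
proof -
  note L0 = admissible_nonzero[OF L]
  show "q_poch_inf (- (1 / (be i * L))) q \<noteq> 0"
  proof
    assume "q_poch_inf (- (1 / (be i * L))) q = 0"
    then obtain k where "- (1 / (be i * L)) * Q ^ k = 1" using q_poch_inf_eq_0_iff[OF q] by auto
    then have "1 + be i * (L * Q powi (- int k)) = 0"
      using L0 be_nonzero[OF i] by (simp add: power_int_minus field_simps) (metis add.left_inverse)
    then show False using L i unfolding admissible_def by blast
  qed
  show "q_poch_inf (- (Q * be i * (L * Q powi m))) q \<noteq> 0"
  proof
    assume "q_poch_inf (- (Q * be i * (L * Q powi m))) q = 0"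
    then obtain k where "- (Q * be i * (L * Q powi m)) * Q ^ k = 1" using q_poch_inf_eq_0_iff[OF q] by auto
    moreover have "Q powi (m + int (Suc k)) = Q powi m * (Q * Q ^ k)" by (simp add: power_int_add)
    ultimately have "be i * (L * Q powi (m + int (Suc k))) = - 1" by (simp add: mult_ac minus_equation_iff)
    then have "1 + be i * (L * Q powi (m + int (Suc k))) = 0" by simp
    then show False using L i unfolding admissible_def by blast
  qed
qed

text \<open>Every infinite product at L q^(-k) sheds k factors. There is one product more in the
  numerator than in the denominator, so one copy of L^k q^(-tri(k)) remains, and the leading
  constants combine to beN^k.\<close>

lemma mgen_neg:
  assumes L: "L \<noteq> 0"
  shows "mgen (L * inverse Q ^ k) = mgen L * ((beN * L) ^ k * Q powi (- tri (int k)))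
    * ((\<Prod>l\<le>N. q_poch (- (1 / (al l * L))) q k) / (\<Prod>i<N. q_poch (- (1 / (be i * L))) q k))"
proof -
  define T where "T = Q powi (- tri (int k))"
  have T: "T \<noteq> 0" by (simp add: T_def)
  have f: "q_poch_inf (- (Q * c * (L * inverse Q ^ k))) q
      = (c ^ k * (L ^ k * T)) * q_poch (- (1 / (c * L))) q k * q_poch_inf (- (Q * c * L)) q" if "c \<noteq> 0" for c
  proof -
    have "q_poch_inf (- (Q * c * (L * inverse Q ^ k))) q
      = q_poch (- (Q * (c * L) * inverse Q ^ k)) q k * q_poch_inf (- (Q * c * (L * inverse Q ^ k)) * Q ^ k) q"
      by (subst q_poch_inf_split[OF q, of _ k]) (simp add: mult_ac)
    also have "- (Q * c * (L * inverse Q ^ k)) * Q ^ k = - (Q * c * L)"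
      by (simp add: power_inverse)
    also have "q_poch (- (Q * (c * L) * inverse Q ^ k)) q k = (c * L) ^ k * T * q_poch (- (1 / (c * L))) q k"
      unfolding T_def by (rule q_poch_neg_shift) (use q that L in auto)
    finally show ?thesis by (simp add: power_mult_distrib mult_ac)
  qed
  have 1: "(\<Prod>l\<le>N. q_poch_inf (- (Q * al l * (L * inverse Q ^ k))) q)
    = (\<Prod>l\<le>N. al l) ^ k * (L ^ k * T) ^ Suc N * (\<Prod>l\<le>N. q_poch (- (1 / (al l * L))) q k) * (\<Prod>l\<le>N. q_poch_inf (- (Q * al l * L)) q)"
  proof -
    have "(\<Prod>l\<le>N. q_poch_inf (- (Q * al l * (L * inverse Q ^ k))) q)
      = (\<Prod>l\<le>N. (al l ^ k * (L ^ k * T)) * q_poch (- (1 / (al l * L))) q k * q_poch_inf (- (Q * al l * L)) q)"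
      using al_nonzero by (intro prod.cong refl f) auto
    then show ?thesis unfolding prod.distrib by (simp add: prod_power_distrib power_mult_distrib)
  qed
  have 2: "(\<Prod>l<N. q_poch_inf (- (Q * be l * (L * inverse Q ^ k))) q)
    = (\<Prod>l<N. be l) ^ k * (L ^ k * T) ^ N * (\<Prod>l<N. q_poch (- (1 / (be l * L))) q k) * (\<Prod>l<N. q_poch_inf (- (Q * be l * L)) q)"
  proof -
    have "(\<Prod>l<N. q_poch_inf (- (Q * be l * (L * inverse Q ^ k))) q)
      = (\<Prod>l<N. (be l ^ k * (L ^ k * T)) * q_poch (- (1 / (be l * L))) q k * q_poch_inf (- (Q * be l * L)) q)"
      using be_nonzero by (intro prod.cong refl f) auto
    then show ?thesis unfolding prod.distrib by (simp add: prod_power_distrib power_mult_distrib)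
  qed
  have nz: "L ^ k * T \<noteq> 0" using L T by simp
  have fr: "(A * w ^ Suc N * P * X) / (B * w ^ N * P' * X') = X / X' * (A / B * w) * (P / P')"
    if "w \<noteq> 0" for A P X B P' X' w :: complex
    using that by (simp add: mult_ac)
  have e: "(beN * L) ^ k * T = (\<Prod>l\<le>N. al l) ^ k / (\<Prod>l<N. be l) ^ k * (L ^ k * T)"
    by (simp add: beN_def power_mult_distrib power_divide)
  show ?thesis unfolding mgen_def 1 2 T_def[symmetric] fr[OF nz] e ..
qed

lemma mrow_tendsto:
  assumes L: "admissible L"
  shows "(\<lambda>k. mrow L N (- int k) / (Q * beN) ^ k) \<longlonglongrightarrow> mrow_limit L"
proof -
  let ?F = "\<lambda>k. (\<Prod>l\<le>N. q_poch (- (1 / (al l * L))) q k) / (\<Prod>i<N. q_poch (- (1 / (be i * L))) q k)"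
  note L0 = admissible_nonzero[OF L]
  have "mrow L N (- int k) / (Q * beN) ^ k
    = mgen L * ?F k" for k
  proof -
    have "Q powi (- int k) = inverse Q ^ k" by (simp add: power_int_minus power_inverse)
    moreover have "Q powi tri (- int k) = Q powi tri (int k) * Q ^ k" unfolding tri_uminus by (simp add: power_int_add)
    moreover have "L powi (- int k) = inverse L ^ k" by (simp add: power_int_minus power_inverse)
    ultimately have "mrow L N (- int k) = mgen (L * inverse Q ^ k) * (Q powi tri (int k) * Q ^ k) * inverse L ^ k"
      by (simp add: mrow_def)
    also have "\<dots> = (Q * beN) ^ k * (mgen L * ?F k)
        * ((Q powi tri (int k) * Q powi (- tri (int k))) * (L ^ k * inverse L ^ k))"
      unfolding mgen_neg[OF L0] by (simp add: power_mult_distrib mult_ac)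
    also have "(Q powi tri (int k) * Q powi (- tri (int k))) * (L ^ k * inverse L ^ k) = 1"
      using L0 by (simp add: power_int_minus power_inverse)
    finally show ?thesis by simp
  qed
  moreover have "(\<lambda>k. mgen L * ?F k)
      \<longlonglongrightarrow> mrow_limit L"
    unfolding mrow_limit_def
    by (intro tendsto_intros q_poch_tendsto q) (use admissible_poch(1)[OF L] in auto)
  ultimately show ?thesis by simp
qed

text \<open>For m to infinity the sample points tend to 0, where \<open>mgen\<close> is 1 and the
  upper components vanish. This normalization fixes the pairing with the last column.\<close>

lemma mrow_pos_tendsto:
  assumes L: "admissible L" and i: "i \<le> N"
  shows "(\<lambda>k. mrow L i (int k) / (Q powi tri (int k) * L ^ k)) \<longlonglongrightarrow> (if i = N then 1 else 0)"
proof -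
  note L0 = admissible_nonzero[OF L]
  note Qk = Q_power_tendsto
  define y where "y = (\<lambda>k. L * Q ^ k)"
  have x: "y \<longlonglongrightarrow> 0" unfolding y_def using tendsto_mult[OF tendsto_const Qk, of L] by simp
  have pc: "(\<lambda>k. q_poch_inf (- (Q * c * y k)) q) \<longlonglongrightarrow> q_poch_inf (- (Q * c * 0)) q" for c
    by (intro isCont_tendsto_compose[OF q_poch_inf_isCont[OF q]] tendsto_intros x)
  have "(\<lambda>k. mgen (y k)) \<longlonglongrightarrow> (\<Prod>l\<le>N. q_poch_inf (- (Q * al l * 0)) q) / (\<Prod>i<N. q_poch_inf (- (Q * be i * 0)) q)"
    unfolding mgen_def by (intro tendsto_divide tendsto_prod pc) simp
  then have G: "(\<lambda>k. mgen (y k)) \<longlonglongrightarrow> 1" by simp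
  have "(\<lambda>k. (if i = N then 1 else b i * y k / (1 + be i * y k))) \<longlonglongrightarrow> (if i = N then 1 else b i * 0 / (1 + be i * 0))"
  proof (cases "i = N")
    case False
    have "(\<lambda>k. b i * y k / (1 + be i * y k)) \<longlonglongrightarrow> b i * 0 / (1 + be i * 0)"
      by (intro tendsto_intros x) simp
    then show ?thesis using False by simp
  qed simp
  from tendsto_mult[OF this G]
  have "(\<lambda>k. (if i = N then 1 else b i * y k / (1 + be i * y k)) * mgen (y k)) \<longlonglongrightarrow> (if i = N then 1 else 0)"
    by (simp cong: if_cong)
  moreover have "mrow L i (int k) / (Q powi tri (int k) * L ^ k)
      = (if i = N then 1 else b i * y k / (1 + be i * y k)) * mgen (y k)" for k
    using L0 by (simp add: mrow_def y_def)
  ultimately show ?thesis by simp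
qed

lemma mrow_summable:
  assumes L: "admissible L" and i: "i \<le> N" and u: "q * norm beN < norm u"
  shows "laurent_summable (mrow L i) u"
proof -
  note L0 = admissible_nonzero[OF L]
  have v0: "- (1 / L) \<noteq> 0" using L0 by simp
  have u0: "norm u > 0" using u q by (metis le_less_trans mult_nonneg_nonneg less_imp_le norm_ge_zero)
  obtain C where C: "C > 0" "\<And>k. norm (mrow L i (- int k)) \<le> C * (q * norm beN) ^ k"
    using row_bounded[OF mrow_row[OF L] v0 i mrow_tendsto[OF L]] by blast
  have "Bseq (\<lambda>k. mrow L i (int k) / (Q powi tri (int k) * L ^ k))"
    by (rule convergent_imp_Bseq[OF convergentI[OF mrow_pos_tendsto[OF L i]]])
  then obtain C1 where C1: "C1 > 0" "\<And>k. norm (mrow L i (int k) / (Q powi tri (int k) * L ^ k)) \<le> C1"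
    unfolding Bseq_def by auto
  obtain C2 where C2: "C2 \<ge> 0" "\<And>k. norm L ^ k * q powi tri (int k) \<le> C2 * (1 / (2 * norm u)) ^ k"
    by (rule gauss_bound[of q "1 / (2 * norm u)" "norm L"]) (use q u0 in auto)
  show ?thesis
  proof (rule laurent_summableI[where C = "C + C1 * C2" and s = "1 / (2 * norm u)" and r = "q * norm beN"])
    fix k :: nat
    have "norm (mrow L i (int k)) \<le> C1 * (norm L ^ k * q powi tri (int k))"
      using C1(2)[of k] q L0 by (simp add: norm_divide norm_mult norm_power norm_power_int pos_divide_le_eq mult_ac)
    also have "\<dots> \<le> C1 * (C2 * (1 / (2 * norm u)) ^ k)" using C1 C2 by (intro mult_left_mono) auto
    also have "\<dots> \<le> (C + C1 * C2) * (1 / (2 * norm u)) ^ k"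
      using C by (simp add: distrib_right mult.assoc)
    finally show "norm (mrow L i (int k)) \<le> (C + C1 * C2) * (1 / (2 * norm u)) ^ k" .
    have "norm (mrow L i (- int k)) \<le> C * (q * norm beN) ^ k" by (rule C)
    also have "\<dots> \<le> (C + C1 * C2) * (q * norm beN) ^ k"
      using C1 C2 q by (intro mult_right_mono) auto
    finally show "norm (mrow L i (- int k)) \<le> (C + C1 * C2) * (q * norm beN) ^ k" .
  qed (use u u0 q in auto)
qed

definition conn_bot :: "complex \<Rightarrow> nat \<Rightarrow> complex" where
  "conn_bot L j = ((\<Prod>i<N. q_poch_inf (Q * al j / be i) q) / (\<Prod>l\<in>{..N} - {j}. q_poch_inf (Q * al j / al l) q))
     * ((\<Prod>l\<in>{..N} - {j}. theta_q q (al l * L)) / (\<Prod>i<N. theta_q q (be i * L)))"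

lemma admissible_theta:
  assumes "admissible L" "i < N"
  shows "theta_q q (be i * L) \<noteq> 0"
proof
  assume "theta_q q (be i * L) = 0"
  moreover have "be i * L \<noteq> 0" using assms be_nonzero by (auto simp: admissible_def)
  ultimately obtain k :: int where k: "be i * L = - (Q powi k)" using theta_q_eq_0_iff[OF q] by blast
  then have "be i * (L * Q powi (- k)) = - 1" by (simp add: mult.assoc[symmetric] power_int_minus)
  then show False using assms unfolding admissible_def by (metis add.right_inverse)
qed

text \<open>For each c among the \<open>al l\<close> and \<open>be i\<close> the factor at c in
  \<open>mgen L\<close> and the one left over in its asymptotics complete each other to theta(c L),
  up to 1 / (c L (q; q)_inf). The surplus of one factor in the numerator yields beN L (q; q)_inf,
  which cancels against the right side.\<close>

lemma conn_bot_generic: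
  assumes L: "admissible L" and j: "j \<le> N"
  shows "(q_poch_inf Q q * conn_bot L j) * theta_q q (- (al j / (- (1 / L))))
    = - (beN * mrow_limit L * psi_limit j) / (- (1 / L)) * q_poch_inf Q q ^ 3"
proof -
  note L0 = admissible_nonzero[OF L]
  have Qn: "q_poch_inf Q q \<noteq> 0" by (rule q_poch_inf_q_nonzero[OF q])
  have t: "q_poch_inf (- (Q * c * L)) q * q_poch_inf (- (1 / (c * L))) q = theta_q q (c * L) * (1 / c) * (1 / (L * q_poch_inf Q q))"
    if "c \<noteq> 0" for c
  proof -
    have cL: "c * L \<noteq> 0" "Q * (c * L) \<noteq> 0" using that L0 by auto
    have "theta_q q (c * L) / (c * L) = q_poch_inf Q q * q_poch_inf (- (Q * (c * L))) q * q_poch_inf (- (Q / (Q * (c * L)))) q"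
      unfolding theta_q_shift[OF q cL(1), symmetric] by (rule jacobi_triple_product[OF q cL(2)])
    then show ?thesis using Qn cL by (simp add: field_simps)
  qed
  have "mrow_limit L = (\<Prod>l\<le>N. q_poch_inf (- (Q * al l * L)) q * q_poch_inf (- (1 / (al l * L))) q)
     / (\<Prod>i<N. q_poch_inf (- (Q * be i * L)) q * q_poch_inf (- (1 / (be i * L))) q)"
    unfolding mrow_limit_def mgen_def prod.distrib by simp
  also have "(\<Prod>l\<le>N. q_poch_inf (- (Q * al l * L)) q * q_poch_inf (- (1 / (al l * L))) q)
     = (\<Prod>l\<le>N. theta_q q (al l * L) * (1 / al l) * (1 / (L * q_poch_inf Q q)))"
    using al_nonzero by (intro prod.cong refl t) auto
  also have "\<dots> = (\<Prod>l\<le>N. theta_q q (al l * L)) * (1 / (\<Prod>l\<le>N. al l)) * (1 / (L * q_poch_inf Q q)) ^ Suc N"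
    unfolding prod.distrib by (simp add: prod_dividef)
  also have "(\<Prod>i<N. q_poch_inf (- (Q * be i * L)) q * q_poch_inf (- (1 / (be i * L))) q)
     = (\<Prod>i<N. theta_q q (be i * L) * (1 / be i) * (1 / (L * q_poch_inf Q q)))"
    using be_nonzero by (intro prod.cong refl t) auto
  also have "\<dots> = (\<Prod>i<N. theta_q q (be i * L)) * (1 / (\<Prod>i<N. be i)) * (1 / (L * q_poch_inf Q q)) ^ N"
    unfolding prod.distrib by (simp add: prod_dividef)
  finally have ml: "mrow_limit L * (beN * (L * q_poch_inf Q q)) = (\<Prod>l\<le>N. theta_q q (al l * L)) / (\<Prod>i<N. theta_q q (be i * L))"
    using L0 Qn be_nonzero al_nonzero by (simp add: beN_def field_simps)
  have r1: "(\<Prod>l\<le>N. theta_q q (al l * L)) = theta_q q (al j * L) * (\<Prod>l\<in>{..N} - {j}. theta_q q (al l * L))"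
    using j by (intro prod.remove) auto
  have r3: "(\<Prod>l\<le>N. q_poch_inf (Q * al j / al l) q) = q_poch_inf Q q * (\<Prod>l\<in>{..N} - {j}. q_poch_inf (Q * al j / al l) q)"
    using j al_nonzero[OF j] by (subst prod.remove[of _ j]) auto
  have "- (beN * mrow_limit L * psi_limit j) / (- (1 / L)) * q_poch_inf Q q ^ 3
      = (mrow_limit L * (beN * (L * q_poch_inf Q q))) * psi_limit j * q_poch_inf Q q ^ 2"
    by (simp add: power3_eq_cube power2_eq_square)
  also have "\<dots> = (q_poch_inf Q q * conn_bot L j) * theta_q q (al j * L)"
    unfolding ml r1 psi_limit_def r3 conn_bot_def using Qn by (simp add: power2_eq_square mult_ac)
  finally show ?thesis by simp
qed

text \<open>If L q^m = - 1 / al_j, the Pochhammer factor of \<open>al j\<close> in the numerator of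
  \<open>mgen\<close> vanishes at all sample points with index below m. The row therefore begins at
  m and \<open>pairing_psi_terminating\<close> applies.\<close>

lemma conn_bot_degenerate:
  assumes L: "admissible L" and j: "j \<le> N" and m: "- (1 / L) = al j * Q powi m"
  shows "q_poch_inf Q q * conn_bot L j = pairing (mrow L) (psi_ext j) m * beN powi m * Q powi tri (- m) * (- 1) powi m"
proof -
  note L0 = admissible_nonzero[OF L]
  have aj: "al j \<noteq> 0" using al_nonzero j by blast
  have Qn: "q_poch_inf Q q \<noteq> 0" by (rule q_poch_inf_q_nonzero[OF q])
  have Leq: "L = - (Q powi (- m) / al j)"
    using m L0 aj by (simp add: power_int_minus field_simps)
  have Lx: "L * Q powi m = - (1 / al j)" unfolding Leq by (simp add: power_int_minus)
  have z: "mrow L i p = 0" if "p < m" for i p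
  proof -
    define k where "k = nat (m - 1 - p)"
    have k: "p = m - 1 - int k" using that by (simp add: k_def)
    have "Q powi p = Q powi m * Q powi (- int (Suc k))"
      by (subst power_int_add[symmetric]) (simp_all add: k algebra_simps)
    also have "Q powi (- int (Suc k)) = inverse (Q ^ Suc k)" by (simp only: power_int_minus power_int_of_nat)
    finally have "L * Q powi p = - (1 / al j) * inverse (Q ^ Suc k)" unfolding Lx[symmetric] by simp
    then have "- (Q * al j * (L * Q powi p)) * Q ^ k = 1" using aj by (simp add: field_simps)
    then have "q_poch_inf (- (Q * al j * (L * Q powi p))) q = 0"
      using q_poch_inf_eq_0_iff[OF q] by blast
    then have "mgen (L * Q powi p) = 0" unfolding mgen_def using j by (auto intro!: prod_zero)
    then show ?thesis by (simp add: mrow_def)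
  qed
  define A where "A = (\<lambda>c. q_poch_inf (Q * c / al j) q)"
  define E where "E = (\<Prod>l\<in>{..N} - {j}. al l - al j) / (\<Prod>i<N. be i - al j)"
  have pr: "pairing (mrow L) (psi_ext j) m = mrow L N m * E"
    unfolding E_def by (rule pairing_psi_terminating[OF mrow_row[OF L] j m z])
  have G: "mgen (L * Q powi m) = q_poch_inf Q q * ((\<Prod>l\<in>{..N} - {j}. A (al l)) / (\<Prod>i<N. A (be i)))"
  proof -
    have "mgen (L * Q powi m) = (\<Prod>l\<le>N. A (al l)) / (\<Prod>i<N. A (be i))"
      unfolding Lx mgen_def A_def by simp
    also have "(\<Prod>l\<le>N. A (al l)) = A (al j) * (\<Prod>l\<in>{..N} - {j}. A (al l))"
      using j by (intro prod.remove) auto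
    also have "A (al j) = q_poch_inf Q q" using aj by (simp add: A_def)
    finally show ?thesis by simp
  qed
  \<comment> \<open>All factors of theta(c L) that do not involve c, except for powers and
    differences listed separately. Numerator and denominator of \<open>conn_bot\<close> contain N
    theta values each, so \<open>K\<close> cancels.\<close>
  define K where "K = Q powi (- tri (- m)) * (- (1 / al j)) powi m * q_poch_inf Q q * (- (1 / al j))"
  have K: "K \<noteq> 0" using Qn aj by (simp add: K_def)
  have th: "theta_q q (c * L) = K * c powi m * (c - al j) * A c * q_poch_inf (Q * al j / c) q" if c: "c \<noteq> 0" for c
  proof -
    have cn: "- (c / al j) \<noteq> 0" using c aj by simp
    have "c * L = Q powi (- m) * (- (c / al j))" by (simp add: Leq)
    then have "theta_q q (c * L) = Q powi (- tri (- m)) * (- (c / al j)) powi m * theta_q q (- (c / al j))"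
      using theta_q_shift_powi[OF q cn, of "- m"] by simp
    also have "theta_q q (- (c / al j)) = q_poch_inf Q q * ((1 - c / al j) * A c) * q_poch_inf (Q * al j / c) q"
      using jacobi_triple_product[OF q cn] q_poch_inf_step[OF q, of "c / al j"] by (simp add: A_def mult.commute)
    also have "(- (c / al j)) powi m = (- (1 / al j)) powi m * c powi m"
      by (simp add: power_int_mult_distrib[symmetric])
    also have "1 - c / al j = - (1 / al j) * (c - al j)" using aj by (simp add: field_simps)
    finally show ?thesis by (simp add: K_def mult_ac)
  qed
  define PA PB where "PA = (\<Prod>l\<in>{..N} - {j}. q_poch_inf (Q * al j / al l) q)"
    and "PB = (\<Prod>i<N. q_poch_inf (Q * al j / be i) q)"
  have PA: "PA \<noteq> 0" unfolding PA_def using psi_limit_denom_nonzero[OF j] by (auto simp: prod_zero_iff)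
  have t1: "(\<Prod>l\<in>{..N} - {j}. theta_q q (al l * L))
      = K ^ N * (\<Prod>l\<in>{..N} - {j}. al l) powi m * (\<Prod>l\<in>{..N} - {j}. al l - al j) * (\<Prod>l\<in>{..N} - {j}. A (al l)) * PA"
  proof -
    have "(\<Prod>l\<in>{..N} - {j}. theta_q q (al l * L))
      = (\<Prod>l\<in>{..N} - {j}. K * al l powi m * (al l - al j) * A (al l) * q_poch_inf (Q * al j / al l) q)"
      using al_nonzero by (intro prod.cong refl th) auto
    moreover have "card ({..N} - {j}) = N" using j by simp
    ultimately show ?thesis unfolding prod.distrib prod_power_int PA_def by simp
  qed
  have t2: "(\<Prod>i<N. theta_q q (be i * L))
      = K ^ N * (\<Prod>i<N. be i) powi m * (\<Prod>i<N. be i - al j) * (\<Prod>i<N. A (be i)) * PB"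
  proof -
    have "(\<Prod>i<N. theta_q q (be i * L))
      = (\<Prod>i<N. K * be i powi m * (be i - al j) * A (be i) * q_poch_inf (Q * al j / be i) q)"
      using be_nonzero by (intro prod.cong refl th) auto
    then show ?thesis unfolding prod.distrib prod_power_int PB_def by simp
  qed
  have "(\<Prod>i<N. theta_q q (be i * L)) \<noteq> 0" using admissible_theta[OF L] by simp
  then have PB: "PB \<noteq> 0" unfolding t2 by auto
  have ratio: "(\<Prod>l\<in>{..N} - {j}. al l) powi m / (\<Prod>i<N. be i) powi m = (beN / al j) powi m"
  proof -
    have "(\<Prod>l\<le>N. al l) = al j * (\<Prod>l\<in>{..N} - {j}. al l)" using j by (intro prod.remove) auto
    then have "beN / al j = (\<Prod>l\<in>{..N} - {j}. al l) / (\<Prod>i<N. be i)" using aj by (simp add: beN_def)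
    then show ?thesis by (simp add: power_int_divide_distrib)
  qed
  have quot: "PB / PA * ((k * x * e * s * PA) / (k * x' * e' * s' * PB)) = x / x' * (e / e') * (s / s')"
    if "k \<noteq> 0" for k x e s x' e' s' using that PA PB by (simp add: mult_ac)
  have "q_poch_inf Q q * conn_bot L j = q_poch_inf Q q * (PB / PA *
      ((\<Prod>l\<in>{..N} - {j}. theta_q q (al l * L)) / (\<Prod>i<N. theta_q q (be i * L))))"
    unfolding conn_bot_def PA_def PB_def by simp
  also have "\<dots> = q_poch_inf Q q * ((beN / al j) powi m * E * ((\<Prod>l\<in>{..N} - {j}. A (al l)) / (\<Prod>i<N. A (be i))))"
    unfolding t1 t2 by (subst quot) (use K in \<open>auto simp: ratio E_def\<close>)
  also have "\<dots> = mgen (L * Q powi m) * E * (beN / al j) powi m" unfolding G by (simp add: mult_ac)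
  also have "(beN / al j) powi m = Q powi tri m * L powi m * beN powi m * Q powi tri (- m) * (- 1) powi m"
  proof -
    have "L = (- 1) * (Q powi (- m) * inverse (al j))" unfolding Leq by (simp add: divide_inverse)
    then have "L powi m = (- 1) powi m * (Q powi (- m * m) * inverse (al j powi m))"
      by (simp only: power_int_mult_distrib power_int_mult power_int_inverse)
    then have "Q powi tri m * L powi m * beN powi m * Q powi tri (- m) * (- 1) powi m
      = (Q powi tri m * Q powi tri (- m) * Q powi (- m * m)) * ((- 1) powi m * (- 1) powi m) * (beN powi m * inverse (al j powi m))"
      by (simp only: mult_ac)
    also have "Q powi tri m * Q powi tri (- m) * Q powi (- m * m) = Q powi (tri m + tri (- m) + - m * m)"
      by (subst power_int_add, simp, subst power_int_add, simp, simp)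
    also have "tri m + tri (- m) + - m * m = 0" using tri_double[of m] by (simp add: tri_uminus algebra_simps)
    also have "(- 1 :: complex) powi m * (- 1) powi m = 1" by (simp add: power_int_mult_distrib[symmetric])
    finally show ?thesis by (simp only: divide_inverse power_int_mult_distrib power_int_inverse mult_1_left power_int_0_right)
  qed
  finally show ?thesis unfolding pr mrow_def by (simp add: mult_ac)
qed

lemma mrow_psi_pairing:
  assumes L: "admissible L" and j: "j \<le> N" and u: "q * norm beN < norm u" "norm u < norm beN"
  shows "(\<Sum>i\<le>N. laurent_sum (mrow L i) u * laurent_sum (psi_ext j i) u) * theta_q q (- (u / beN))
    = (q_poch_inf Q q * conn_bot L j) * theta_q q (al j * L * (u / beN))"
proof -
  have L0: "- (1 / L) \<noteq> 0" using L by (simp add: admissible_def)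
  have "(\<Sum>i\<le>N. laurent_sum (mrow L i) u * laurent_sum (psi_ext j i) u) * theta_q q (- (u / beN))
    = (q_poch_inf Q q * conn_bot L j) * theta_q q (- (al j / (- (1 / L))) * (u / beN))"
    by (rule psi_pairing_value[OF mrow_row[OF L] j L0 mrow_summable[OF L] mrow_tendsto[OF L]
        conn_bot_generic[OF L j] conn_bot_degenerate[OF L j] u])
  then show ?thesis by simp
qed

end

section \<open>Column solutions\<close>

text \<open>The equation expresses values at x through values at q x, so each application enlarges
  the disc by the factor 1 / q. The successive extensions agree on the smaller discs and exhaust the
  plane.\<close>

lemma q_extension:
  fixes \<phi> :: "nat \<Rightarrow> complex \<Rightarrow> complex" and A :: "nat \<Rightarrow> nat \<Rightarrow> complex \<Rightarrow> complex"
  assumes q: "0 < q" "q < 1" and \<rho>: "\<rho> > 0"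
    and hol: "\<And>i. i \<le> N \<Longrightarrow> \<phi> i holomorphic_on ball 0 \<rho>"
    and A: "\<And>i k. i \<le> N \<Longrightarrow> k \<le> N \<Longrightarrow> A i k holomorphic_on UNIV"
    and eq: "\<And>i x. i \<le> N \<Longrightarrow> norm x < \<rho> \<Longrightarrow> \<phi> i x = (\<Sum>k\<le>N. A i k x * \<phi> k (of_real q * x))"
  obtains \<Phi> where "\<And>i. i \<le> N \<Longrightarrow> \<Phi> i holomorphic_on UNIV"
    and "\<And>i x. i \<le> N \<Longrightarrow> norm x < \<rho> \<Longrightarrow> \<Phi> i x = \<phi> i x"
    and "\<And>i x. i \<le> N \<Longrightarrow> \<Phi> i x = (\<Sum>k\<le>N. A i k x * \<Phi> k (of_real q * x))"
proof -
  define F where "F = rec_nat \<phi> (\<lambda>_ f i x. \<Sum>k\<le>N. A i k x * f k (complex_of_real q * x))"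
  have F0: "F 0 = \<phi>" and FS: "F (Suc n) i x = (\<Sum>k\<le>N. A i k x * F n k (of_real q * x))" for n i x
    by (simp_all add: F_def)
  have sc: "norm (complex_of_real q * x) < \<rho> / q ^ n" if "norm x < \<rho> / q ^ Suc n" for x n
    using that q by (simp add: norm_mult field_simps)
  have Fh: "F n i holomorphic_on ball 0 (\<rho> / q ^ n)" if "i \<le> N" for n i
    using that
  proof (induction n arbitrary: i)
    case 0 then show ?case using hol by (simp add: F0)
  next
    case (Suc n)
    have "(\<lambda>x. F n k (of_real q * x)) holomorphic_on ball 0 (\<rho> / q ^ Suc n)" if "k \<le> N" for k
    proof -
      have "(\<lambda>x. complex_of_real q * x) holomorphic_on ball 0 (\<rho> / q ^ Suc n)"
        by (intro holomorphic_intros)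
      moreover have "(\<lambda>x. complex_of_real q * x) ` ball 0 (\<rho> / q ^ Suc n) \<subseteq> ball 0 (\<rho> / q ^ n)"
      proof
        fix y assume "y \<in> (\<lambda>x. complex_of_real q * x) ` ball 0 (\<rho> / q ^ Suc n)"
        then obtain x where x: "y = complex_of_real q * x" "x \<in> ball 0 (\<rho> / q ^ Suc n)" by (rule imageE)
        then show "y \<in> ball 0 (\<rho> / q ^ n)" using sc[of x n] by (simp del: power_Suc)
      qed
      ultimately have "(F n k \<circ> (\<lambda>x. of_real q * x)) holomorphic_on ball 0 (\<rho> / q ^ Suc n)"
        by (rule holomorphic_on_compose_gen[OF _ Suc.IH[OF that]])
      then show ?thesis by (simp only: o_def)
    qed
    moreover have "A i k holomorphic_on ball 0 (\<rho> / q ^ Suc n)" if "k \<le> N" for k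
      by (rule holomorphic_on_subset[OF A[OF Suc.prems that]]) simp
    ultimately have "(\<lambda>x. \<Sum>k\<le>N. A i k x * F n k (of_real q * x)) holomorphic_on ball 0 (\<rho> / q ^ Suc n)"
      by (intro holomorphic_on_sum holomorphic_on_mult) auto
    then show ?case unfolding FS[abs_def] .
  qed
  have Fe: "F (Suc n) i x = F n i x" if "i \<le> N" "norm x < \<rho> / q ^ n" for n i x
    using that
  proof (induction n arbitrary: i x)
    case 0 then show ?case using eq by (simp add: FS F0)
  next
    case (Suc n)
    have "F (Suc (Suc n)) i x = (\<Sum>k\<le>N. A i k x * F (Suc n) k (of_real q * x))" by (rule FS)
    also have "\<dots> = (\<Sum>k\<le>N. A i k x * F n k (of_real q * x))"
      using Suc.IH sc[OF Suc.prems(2)] by (intro sum.cong) auto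
    finally show ?case unfolding FS .
  qed
  have mono: "\<rho> / q ^ n \<le> \<rho> / q ^ m" if "n \<le> m" for n m
    using q \<rho> that by (intro divide_left_mono) (auto simp: power_decreasing)
  have Fm: "F m i x = F n i x" if "i \<le> N" "norm x < \<rho> / q ^ n" "n \<le> m" for n m i x
    using that(3)
  proof (induction m rule: dec_induct)
    case (step k)
    then have "norm x < \<rho> / q ^ k" using mono[of n k] that(2) by linarith
    then show ?case using Fe[OF that(1)] step by simp
  qed simp
  have ex: "\<exists>n. norm x < \<rho> / q ^ n" for x :: complex
  proof -
    obtain n where "(1 / q) ^ n > norm x / \<rho>" using real_arch_pow[of "1 / q" "norm x / \<rho>"] q by auto
    then show ?thesis using q \<rho> by (intro exI[of _ n]) (simp add: field_simps)
  qed
  define \<Phi> where "\<Phi> = (\<lambda>i x. F (LEAST n. norm x < \<rho> / q ^ n) i x)"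
  have P: "\<Phi> i x = F n i x" if "i \<le> N" "norm x < \<rho> / q ^ n" for i x n
  proof -
    have a: "norm x < \<rho> / q ^ (LEAST n. norm x < \<rho> / q ^ n)" using ex by (rule LeastI_ex)
    have b: "(LEAST n. norm x < \<rho> / q ^ n) \<le> n" using that(2) by (rule Least_le)
    show ?thesis unfolding \<Phi>_def by (rule Fm[OF that(1) a b, symmetric])
  qed
  show ?thesis
  proof (rule that[of \<Phi>])
    fix i x assume i: "i \<le> N"
    show "\<Phi> i holomorphic_on UNIV"
    proof -
      have "\<Phi> i analytic_on {x}" for x
      proof -
        obtain n where n: "norm x < \<rho> / q ^ n" using ex by blast
        have "\<Phi> i holomorphic_on ball 0 (\<rho> / q ^ n)"
          by (rule holomorphic_transform[OF Fh[OF i, of n]]) (use P[OF i, of _ n] in simp)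
        then show ?thesis unfolding analytic_at using n by (intro exI[of _ "ball 0 (\<rho> / q ^ n)"]) auto
      qed
      then show ?thesis by (metis analytic_on_analytic_at analytic_imp_holomorphic)
    qed
    show "\<Phi> i x = (\<Sum>k\<le>N. A i k x * \<Phi> k (of_real q * x))"
    proof -
      obtain n where "norm (complex_of_real q * x) < \<rho> / q ^ n" using ex by blast
      moreover obtain n' where "norm x < \<rho> / q ^ n'" using ex by blast
      define m where "m = max n n'"
      ultimately have m: "norm (complex_of_real q * x) < \<rho> / q ^ m" using mono[of n m] by simp
      have "norm x < \<rho> / q ^ m" using mono[of n' m] \<open>norm x < \<rho> / q ^ n'\<close> by (auto simp: m_def)
      then have "norm x < \<rho> / q ^ Suc m" using mono[of m "Suc m"] by linarith
      then have "\<Phi> i x = F (Suc m) i x" by (rule P[OF i])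
      also have "\<dots> = (\<Sum>k\<le>N. A i k x * \<Phi> k (of_real q * x))"
        unfolding FS using P[of _ "of_real q * x" m] m by (intro sum.cong) simp_all
      finally show ?thesis .
    qed
  next
    fix i x assume i: "i \<le> N" "norm (x :: complex) < \<rho>"
    then show "\<Phi> i x = \<phi> i x" using P[OF i(1), of x 0] by (simp add: F0)
  qed
qed

context q_system
begin

section \<open>The last column, convergent on the punctured plane\<close>

text \<open>Solves - u Y(q u) = (B - u E) Y(u) in powers of 1/u, starting from the unit vector
  \<open>N\<close>. The series Y is the last formal column multiplied by (q beN / u; q)_inf, which
  removes its poles; \<open>zcol\<close> reverses this multiplication.\<close>

fun ycol :: "nat \<Rightarrow> nat \<Rightarrow> complex" where
  "ycol 0 i = (if i = N then 1 else 0)"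
| "ycol (Suc r) i = (if i = N
     then - (Q ^ Suc r / (1 - Q ^ Suc r)) * (d * ycol r N - (\<Sum>i<N. b i * ycol r i))
     else - (Q ^ Suc r) * (be i * ycol r i - a i * ycol r N))"

definition ycol_ext :: "nat \<Rightarrow> int \<Rightarrow> complex" where
  "ycol_ext i m = (if m \<le> 0 then ycol (nat (- m)) i else 0)"

lemma ycol_ext_col: "col_solution (- 1) ycol_ext"
  unfolding col_solution_def
proof (intro allI conjI impI)
  fix m i assume i: "i < N"
  show "- 1 * Q powi (m - 1) * ycol_ext i (m - 1) = be i * ycol_ext i m - a i * ycol_ext N m"
  proof (cases "m \<le> 0")
    case True
    define r where "r = nat (- m)"
    have r: "m = - int r" using True by (simp add: r_def)
    have "nat (- (m - 1)) = Suc r" using r by auto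
    then have e: "ycol_ext i (m - 1) = - (Q ^ Suc r) * (be i * ycol_ext i m - a i * ycol_ext N m)"
      using i r by (simp add: ycol_ext_def)
    have "Q powi (m - 1) = inverse (Q ^ Suc r)"
    proof -
      have "m - 1 = - int (Suc r)" using r by simp
      then show ?thesis by (simp only: power_int_minus power_int_of_nat)
    qed
    then show ?thesis unfolding e by (simp del: power_Suc)
  next
    case False
    then show ?thesis using i by (cases "m = 1") (auto simp: ycol_ext_def)
  qed
next
  fix m
  show "- 1 * Q powi (m - 1) * ycol_ext N (m - 1) = d * ycol_ext N m - (\<Sum>i<N. b i * ycol_ext i m) - ycol_ext N (m - 1)"
  proof (cases "m \<le> 0")
    case True
    define r where "r = nat (- m)"
    have r: "m = - int r" using True by (simp add: r_def)
    have "nat (- (m - 1)) = Suc r" using r by auto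
    then have e: "ycol_ext N (m - 1) = - (Q ^ Suc r / (1 - Q ^ Suc r)) * (d * ycol_ext N m - (\<Sum>i<N. b i * ycol_ext i m))"
      using r by (simp add: ycol_ext_def)
    have Qr: "Q powi (m - 1) = inverse (Q ^ Suc r)"
    proof -
      have "m - 1 = - int (Suc r)" using r by simp
      then show ?thesis by (simp only: power_int_minus power_int_of_nat)
    qed
    have "1 - Q ^ Suc r \<noteq> 0" using Q_power_neq_1[of "Suc r"] by simp
    moreover have "Q ^ Suc r \<noteq> 0" by simp
    moreover have "- 1 * inverse t * (- (t / (1 - t)) * X) = X - - (t / (1 - t)) * X" if "1 - t \<noteq> 0" "t \<noteq> 0" for t X :: complex
      using that by (simp add: divide_simps) (simp add: algebra_simps)
    ultimately show ?thesis unfolding e Qr by blast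
  next
    case False
    then show ?thesis by (cases "m = 1") (auto simp: ycol_ext_def)
  qed
qed

definition sys_bound :: real where
  "sys_bound = norm d + (\<Sum>i<N. norm (b i)) + (\<Sum>i<N. norm (be i) + norm (a i))"

lemma sys_bound_nonneg: "sys_bound \<ge> 0"
  by (simp add: sys_bound_def sum_nonneg add_nonneg_nonneg)

lemma sys_bound:
  assumes B: "\<And>i. i \<le> N \<Longrightarrow> norm (x i) \<le> B"
  shows "norm (d * x N - (\<Sum>i<N. b i * x i)) \<le> sys_bound * B"
    and "i < N \<Longrightarrow> norm (be i * x i - a i * x N) \<le> sys_bound * B"
proof -
  have B0: "B \<ge> 0" using B[of N] norm_ge_zero[of "x N"] by linarith
  have "norm (\<Sum>i<N. b i * x i) \<le> (\<Sum>i<N. norm (b i) * B)"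
    by (rule sum_norm_le) (use B in \<open>auto simp: norm_mult intro!: mult_left_mono\<close>)
  then have "norm (d * x N - (\<Sum>i<N. b i * x i)) \<le> norm d * B + (\<Sum>i<N. norm (b i) * B)"
    using B[of N] by (intro order.trans[OF norm_triangle_ineq4] add_mono) (auto simp: norm_mult intro!: mult_left_mono)
  also have "\<dots> = (norm d + (\<Sum>i<N. norm (b i))) * B" by (simp add: algebra_simps sum_distrib_left)
  also have "\<dots> \<le> sys_bound * B"
    using B0 by (intro mult_right_mono) (simp_all add: sys_bound_def sum_nonneg add_nonneg_nonneg)
  finally show "norm (d * x N - (\<Sum>i<N. b i * x i)) \<le> sys_bound * B" .
  assume i: "i < N"
  have "norm (be i * x i - a i * x N) \<le> norm (be i) * B + norm (a i) * B"
    using B[of i] B[of N] i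
    by (intro order.trans[OF norm_triangle_ineq4] add_mono) (auto simp: norm_mult intro!: mult_left_mono)
  also have "\<dots> = (norm (be i) + norm (a i)) * B" by (simp add: distrib_right)
  also have "\<dots> \<le> sys_bound * B"
    using member_le_sum[of i "{..<N}" "\<lambda>i. norm (be i) + norm (a i)"] i B0
    by (intro mult_right_mono) (simp_all add: sys_bound_def add_increasing sum_nonneg)
  finally show "norm (be i * x i - a i * x N) \<le> sys_bound * B" .
qed

text \<open>Each step contributes q^(r+1), and these powers multiply up to the triangular exponent
  of a negative index. The only denominator, 1 - q^(r+1), is at least 1 - q and is paid for by
  \<open>K\<close>.\<close>

lemma ycol_ext_bound:
  obtains K where "K \<ge> 0" "\<And>i m. i \<le> N \<Longrightarrow> norm (ycol_ext i m) \<le> 1 * K ^ nat \<bar>m\<bar> * q powi tri m"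
proof -
  define K where "K = sys_bound / (1 - q)"
  note S0 = sys_bound_nonneg
  have K: "K \<ge> 0" "sys_bound \<le> K" using S0 q by (auto simp: K_def field_simps)
  have bd: "norm (ycol r i) \<le> K ^ r * q powi tri (- int r)" if "i \<le> N" for r i
    using that
  proof (induction r arbitrary: i)
    case (Suc r)
    define B where "B = K ^ r * q powi tri (- int r)"
    have B: "norm (ycol r i) \<le> B" if "i \<le> N" for i using Suc.IH[OF that] by (simp add: B_def)
    have B0: "B \<ge> 0" using K q by (simp add: B_def)
    have "tri (- int (Suc r)) = tri (- int r) + int (Suc r)"
      using tri_plus1[of "- int (Suc r)"] by simp
    then have qp: "q powi tri (- int (Suc r)) = q powi tri (- int r) * q ^ Suc r"
      using q by (simp add: power_int_add del: of_nat_Suc power_Suc)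
    have goal: "K ^ Suc r * q powi tri (- int (Suc r)) = q ^ Suc r * (K * B)"
      unfolding qp B_def by simp
    show ?case
    proof (cases "i = N")
      case True
      have n1: "norm (d * ycol r N - (\<Sum>i<N. b i * ycol r i)) \<le> sys_bound * B" by (rule sys_bound(1)[OF B])
      have q1: "1 - q \<le> 1 - q ^ Suc r" "1 - q ^ Suc r > 0"
        using q power_Suc_less_one[of q r] by (auto simp: mult_left_le power_le_one)
      have "1 - Q ^ Suc r = of_real (1 - q ^ Suc r)" by simp
      then have n2: "norm (1 - Q ^ Suc r) = 1 - q ^ Suc r" using q1(2) by (metis norm_of_real abs_of_pos)
      have "norm (ycol (Suc r) i) = q ^ Suc r / (1 - q ^ Suc r) * norm (d * ycol r N - (\<Sum>i<N. b i * ycol r i))"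
        using True q by (simp add: norm_mult norm_divide norm_power n2[simplified])
      also have "\<dots> \<le> q ^ Suc r / (1 - q) * (sys_bound * B)"
        using n1 q q1 S0 B0 by (intro mult_mono divide_left_mono) auto
      also have "\<dots> = q ^ Suc r * (K * B)" by (simp add: K_def)
      finally show ?thesis unfolding goal .
    next
      case False
      then have i: "i < N" using Suc.prems by simp
      have "norm (be i * ycol r i - a i * ycol r N) \<le> sys_bound * B" by (rule sys_bound(2)[OF B i])
      also have "\<dots> \<le> K * B" using K B0 by (intro mult_right_mono) auto
      finally have "q ^ Suc r * norm (be i * ycol r i - a i * ycol r N) \<le> q ^ Suc r * (K * B)"
        using q by (intro mult_left_mono) auto
      moreover have "norm (ycol (Suc r) i) = q ^ Suc r * norm (be i * ycol r i - a i * ycol r N)"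
        using False q by (simp add: norm_mult norm_power)
      ultimately show ?thesis unfolding goal by simp
    qed
  qed simp
  show ?thesis
  proof (rule that[OF K(1)])
    fix i m assume i: "i \<le> N"
    show "norm (ycol_ext i m) \<le> 1 * K ^ nat \<bar>m\<bar> * q powi tri m"
    proof (cases "m \<le> 0")
      case True
      then show ?thesis using bd[OF i, of "nat (- m)"] by (simp add: ycol_ext_def)
    next
      case False
      then show ?thesis using K q by (simp add: ycol_ext_def)
    qed
  qed
qed

lemma ycol_ext_summable: "i \<le> N \<Longrightarrow> u \<noteq> 0 \<Longrightarrow> laurent_summable (ycol_ext i) u"
  using ycol_ext_bound laurent_summable_theta_type[OF q] by (metis zero_le_one)

section \<open>The formal columns and their q-Borel transforms\<close>

text \<open>The Schur complement is evaluated at be_l q^(-r), and \<open>D v\<close> behaves like -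
  v for large v. Hence the ratios grow like q^(-r): in general the column diverges, to exactly the
  order that the Borel weight q^(r(r-1)/2) compensates.\<close>

fun hlast :: "nat \<Rightarrow> nat \<Rightarrow> complex" where
  "hlast l 0 = 0"
| "hlast l (Suc r) = (if r = 0 then - b l else D (be l * inverse Q ^ r) * hlast l r)"

definition hcol :: "nat \<Rightarrow> nat \<Rightarrow> nat \<Rightarrow> complex" where
  "hcol l i r = (if i = N then hlast l r else if r = 0 then (if i = l then 1 else 0)
     else a i * hlast l r / (be i - be l * inverse Q ^ r))"

lemma be_power_neq': "i < N \<Longrightarrow> l < N \<Longrightarrow> r > 0 \<Longrightarrow> be i \<noteq> be l * inverse Q ^ r"
  using be_power_neq[of l i r] by (auto simp: power_inverse field_simps)

lemma hcol_top:
  assumes "l < N" "i < N"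
  shows "be l * inverse Q ^ r * hcol l i r = be i * hcol l i r - a i * hcol l N r"
proof (cases "r = 0")
  case False
  then have "(be i - be l * inverse Q ^ r) * hcol l i r = a i * hcol l N r"
    using be_power_neq'[OF assms(2,1), of r] assms by (simp add: hcol_def)
  then show ?thesis by (simp add: algebra_simps)
qed (use assms in \<open>auto simp: hcol_def\<close>)

lemma hcol_bottom:
  assumes l: "l < N"
  shows "be l * inverse Q ^ r * hcol l N r = d * hcol l N r - (\<Sum>i<N. b i * hcol l i r) - hcol l N (Suc r)"
proof (cases "r = 0")
  case True
  have "(\<Sum>i<N. b i * hcol l i 0) = (\<Sum>i<N. if i = l then b l else 0)"
    by (intro sum.cong refl) (auto simp: hcol_def)
  then show ?thesis using True l by (simp add: hcol_def)
next
  case False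
  define v where "v = be l * inverse Q ^ r"
  have De: "D v = d - v - (\<Sum>i<N. a i * b i / (be i - v))"
    unfolding v_def by (rule D_eq) (use be_power_neq'[OF _ l] False in auto)
  have s: "(\<Sum>i<N. b i * hcol l i r) = hlast l r * (\<Sum>i<N. a i * b i / (be i - v))"
    unfolding sum_distrib_left v_def by (intro sum.cong refl) (use False in \<open>auto simp: hcol_def\<close>)
  have n: "hcol l N (Suc r) = D v * hlast l r" "hcol l N r = hlast l r" using False by (auto simp: hcol_def v_def)
  show ?thesis unfolding s n v_def[symmetric] De by (simp add: algebra_simps)
qed

definition gcoeff :: "nat \<Rightarrow> nat \<Rightarrow> nat \<Rightarrow> complex" where
  "gcoeff l i r = hcol l i r * Q powi tri (int r)"

text \<open>The product q^r D(be_l q^(-r)) tends to - be_l. With the Borel weight included,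
  successive last coefficients therefore have bounded ratio, and the transform has a positive radius
  of convergence.\<close>

lemma gcoeff_bound:
  assumes l: "l < N"
  obtains C K where "C \<ge> 0" "K > 0" "\<And>i r. i \<le> N \<Longrightarrow> norm (gcoeff l i r) \<le> C * K ^ r"
proof -
  note Qk = Q_power_tendsto
  define R where "R = (\<lambda>r. (\<Prod>k\<le>N. al k * Q ^ r - be l) / (\<Prod>i<N. be i * Q ^ r - be l))"
  have "R \<longlonglongrightarrow> (\<Prod>k\<le>N. al k * 0 - be l) / (\<Prod>i<N. be i * 0 - be l)"
    unfolding R_def by (intro tendsto_intros Qk) (use be_nonzero[OF l] in auto)
  then have "Bseq R" by (rule convergent_imp_Bseq[OF convergentI])
  then obtain K0 where K0: "K0 > 0" "\<And>r. norm (R r) \<le> K0" unfolding Bseq_def by auto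
  define K where "K = max 1 K0"
  have K: "K \<ge> 1" "\<And>r. norm (R r) \<le> K" using K0(2) by (auto simp: K_def le_max_iff_disj)
  have step: "Q ^ r * D (be l * inverse Q ^ r) = R r" for r
  proof -
    have 1: "(\<Prod>k\<le>N. al k - be l * inverse Q ^ r) * (Q ^ r) ^ Suc N = (\<Prod>k\<le>N. al k * Q ^ r - be l)"
    proof -
      have "(\<Prod>k\<le>N. al k - be l * inverse Q ^ r) * (\<Prod>k\<le>N. Q ^ r) = (\<Prod>k\<le>N. al k * Q ^ r - be l)"
        unfolding prod.distrib[symmetric] by (intro prod.cong) (auto simp: power_inverse left_diff_distrib)
      then show ?thesis by simp
    qed
    have 2: "(\<Prod>k<N. be k - be l * inverse Q ^ r) * (Q ^ r) ^ N = (\<Prod>k<N. be k * Q ^ r - be l)"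
    proof -
      have "(\<Prod>k<N. be k - be l * inverse Q ^ r) * (\<Prod>k<N. Q ^ r) = (\<Prod>k<N. be k * Q ^ r - be l)"
        unfolding prod.distrib[symmetric] by (intro prod.cong) (auto simp: power_inverse left_diff_distrib)
      then show ?thesis by simp
    qed
    have "(A * t ^ Suc N) / (B * t ^ N) = t * (A / B)" if "t \<noteq> 0" for A B t :: complex using that by simp
    then show ?thesis unfolding R_def 1[symmetric] 2[symmetric] D_def by simp
  qed
  have gl: "norm (gcoeff l N r) \<le> norm (b l) * K ^ r" for r
  proof (induction r)
    case 0 then show ?case by (simp add: gcoeff_def hcol_def)
  next
    case (Suc r)
    have t: "Q powi tri (int (Suc r)) = Q powi tri (int r) * Q ^ r"
      using tri_plus1[of "int r"] by (simp add: add.commute power_int_add)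
    show ?case
    proof (cases "r = 0")
      case True
      then have "norm (gcoeff l N (Suc r)) = norm (b l)" by (simp add: gcoeff_def hcol_def)
      also have "\<dots> \<le> norm (b l) * K ^ Suc r" using K(1) True mult_left_mono[of 1 K "norm (b l)"] by simp
      finally show ?thesis .
    next
      case False
      then have "gcoeff l N (Suc r) = R r * gcoeff l N r"
        unfolding gcoeff_def t step[symmetric] by (simp add: hcol_def mult_ac)
      then have "norm (gcoeff l N (Suc r)) \<le> K * (norm (b l) * K ^ r)"
        unfolding norm_mult[of "R r"] using Suc K by (auto simp: norm_mult intro!: mult_mono)
      then show ?thesis by (simp add: mult_ac)
    qed
  qed
  have "\<exists>c. c \<ge> 0 \<and> (\<forall>r. norm (gcoeff l i r) \<le> c * K ^ r)" if i: "i < N" for i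
  proof -
    have "(\<lambda>r. a i * Q ^ r / (be i * Q ^ r - be l)) \<longlonglongrightarrow> a i * 0 / (be i * 0 - be l)"
      by (intro tendsto_intros Qk) (use be_nonzero[OF l] in auto)
    then have "Bseq (\<lambda>r. a i * Q ^ r / (be i * Q ^ r - be l))" by (rule convergent_imp_Bseq[OF convergentI])
    then obtain c where c: "c > 0" "\<And>r. norm (a i * Q ^ r / (be i * Q ^ r - be l)) \<le> c" unfolding Bseq_def by auto
    have "norm (gcoeff l i r) \<le> (c * norm (b l) + 1) * K ^ r" for r
    proof (cases "r = 0")
      case True
      then have "norm (gcoeff l i r) \<le> 1" using i by (simp add: gcoeff_def hcol_def)
      also have "\<dots> \<le> (c * norm (b l) + 1) * K ^ r" using True c by simp
      finally show ?thesis .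
    next
      case False
      have f: "a i / (be i - be l * inverse Q ^ r) = a i * Q ^ r / (be i * Q ^ r - be l)"
      proof -
        have "be i * Q ^ r - be l = (be i - be l * inverse Q ^ r) * Q ^ r" by (simp add: power_inverse left_diff_distrib)
        then show ?thesis by simp
      qed
      have "gcoeff l i r = a i / (be i - be l * inverse Q ^ r) * gcoeff l N r"
        using False i by (simp add: gcoeff_def hcol_def)
      then have "norm (gcoeff l i r) = norm (a i * Q ^ r / (be i * Q ^ r - be l)) * norm (gcoeff l N r)"
        by (simp only: f norm_mult)
      also have "\<dots> \<le> c * (norm (b l) * K ^ r)" using c(2)[of r] gl[of r] c(1) by (intro mult_mono) auto
      also have "\<dots> \<le> (c * norm (b l) + 1) * K ^ r" using K by (simp add: distrib_right)
      finally show ?thesis .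
    qed
    then show ?thesis using c by (intro exI[of _ "c * norm (b l) + 1"]) auto
  qed
  then obtain c where c: "\<And>i. i < N \<Longrightarrow> c i \<ge> 0 \<and> (\<forall>r. norm (gcoeff l i r) \<le> c i * K ^ r)" by metis
  define C where "C = norm (b l) + (\<Sum>i<N. c i)"
  have s0: "(\<Sum>i<N. c i) \<ge> 0" using c by (intro sum_nonneg) auto
  show ?thesis
  proof (rule that[of C K])
    show "C \<ge> 0" "K > 0" using s0 K by (auto simp: C_def)
    fix i r assume i: "i \<le> N"
    have "norm (gcoeff l i r) \<le> (if i = N then norm (b l) else c i) * K ^ r" using gl c i by auto
    also have "\<dots> \<le> C * K ^ r"
    proof (rule mult_right_mono)
      show "(if i = N then norm (b l) else c i) \<le> C"
        using s0 i c member_le_sum[of i "{..<N}" c] by (auto simp: C_def add_increasing)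
    qed (use K in auto)
    finally show "norm (gcoeff l i r) \<le> C * K ^ r" .
  qed
qed

text \<open>\<open>g\<close> continues the q-Borel transform of the \<open>l\<close>-th formal column.\<close>

definition borel_cont :: "nat \<Rightarrow> (nat \<Rightarrow> complex \<Rightarrow> complex) \<Rightarrow> bool" where
  "borel_cont l g \<longleftrightarrow>
     (\<forall>i\<le>N. g i meromorphic_on UNIV) \<and>
     (\<forall>i\<le>N. \<forall>x. q_poch_inf (- (be l * x)) q \<noteq> 0 \<longrightarrow> g i analytic_on {x}) \<and>
     (\<exists>\<rho>>0. \<forall>i\<le>N. \<forall>x. norm x < \<rho> \<longrightarrow> (\<lambda>r. gcoeff l i r * x ^ r) sums g i x) \<and>
     (\<forall>x. q_poch_inf (- (be l * x)) q \<noteq> 0 \<longrightarrow>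
        (\<forall>i<N. be l * g i x = be i * g i (Q * x) - a i * g N (Q * x)) \<and>
        (1 + be l * x) * g N x = x * (d * g N (Q * x) - (\<Sum>i<N. b i * g i (Q * x))))"

lemma gcoeff_top:
  assumes "l < N" "i < N"
  shows "be l * gcoeff l i r = Q ^ r * (be i * gcoeff l i r - a i * gcoeff l N r)"
proof -
  have "be l * gcoeff l i r = Q ^ r * Q powi tri (int r) * (be l * inverse Q ^ r * hcol l i r)"
    by (simp add: gcoeff_def power_inverse)
  then show ?thesis unfolding hcol_top[OF assms] by (simp add: gcoeff_def algebra_simps)
qed

lemma gcoeff_bottom:
  assumes "l < N"
  shows "gcoeff l N (Suc r) + be l * gcoeff l N r = Q ^ r * (d * gcoeff l N r - (\<Sum>i<N. b i * gcoeff l i r))"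
proof -
  have t: "Q powi tri (int (Suc r)) = Q powi tri (int r) * Q ^ r"
    using tri_plus1[of "int r"] by (simp add: add.commute power_int_add)
  have "be l * gcoeff l N r = Q ^ r * Q powi tri (int r) * (be l * inverse Q ^ r * hcol l N r)"
    by (simp add: gcoeff_def power_inverse)
  then show ?thesis unfolding hcol_bottom[OF assms] gcoeff_def t
    by (simp add: algebra_simps sum_distrib_left)
qed

text \<open>Solving the Borel equations for g(x) in terms of g(q x) introduces the single
  denominator 1 + be_l x. Since P(x) = (- be_l x; q)_inf satisfies P(x) = (1 + be_l x) P(q x), the
  product P g obeys an equation without denominators and extends to an entire function by
  \<open>q_extension\<close>. The poles of g are thus confined to the zeros of P.\<close>

lemma borel_cont_exists:
  assumes l: "l < N"
  shows "\<exists>g. borel_cont l g"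
proof -
  have bl: "be l \<noteq> 0" using be_nonzero[OF l] .
  obtain C K where CK: "C \<ge> 0" "K > 0" "\<And>i r. i \<le> N \<Longrightarrow> norm (gcoeff l i r) \<le> C * K ^ r"
    using gcoeff_bound[OF l] by blast
  \<comment> \<open>The first bound is the radius of convergence, the second keeps the disc free of
    zeros of the product \<open>P\<close>.\<close>
  define \<rho> where "\<rho> = min (1 / K) (1 / norm (be l))"
  have \<rho>: "\<rho> > 0" "\<rho> \<le> 1 / K" "\<rho> \<le> 1 / norm (be l)" using CK bl by (auto simp: \<rho>_def)
  define G where "G = (\<lambda>i x. \<Sum>r. gcoeff l i r * x ^ r)"
  have G: "(\<lambda>r. gcoeff l i r * x ^ r) sums G i x" if i: "i \<le> N" and x: "norm x < \<rho>" for i x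
  proof -
    have "summable (\<lambda>r. C * (K * norm x) ^ r)"
    proof (intro summable_mult summable_geometric)
      have "norm x < 1 / K" using x \<rho> by linarith
      then show "norm (K * norm x) < 1" using CK by (simp add: field_simps)
    qed
    then have "summable (\<lambda>r. gcoeff l i r * x ^ r)"
    proof (rule summable_comparison_test'[where N = 0])
      fix r show "norm (gcoeff l i r * x ^ r) \<le> C * (K * norm x) ^ r"
        using mult_right_mono[OF CK(3)[OF i, of r], of "norm x ^ r"]
        by (simp add: norm_mult norm_power power_mult_distrib mult.assoc)
    qed
    then show ?thesis unfolding G_def by (rule summable_sums)
  qed
  have Qx: "norm (Q * x) < \<rho>" if "norm x < \<rho>" for x
  proof -
    have "norm (Q * x) \<le> norm x" using q by (simp add: norm_mult mult_left_le_one_le)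
    then show ?thesis using that by linarith
  qed
  have Gt: "be l * G i x = be i * G i (Q * x) - a i * G N (Q * x)" if i: "i < N" and x: "norm x < \<rho>" for i x
  proof -
    have i': "i \<le> N" using i by simp
    have "(\<lambda>r. be l * (gcoeff l i r * x ^ r)) sums (be l * G i x)"
      by (intro sums_mult G i' x)
    moreover have "(\<lambda>r. be i * (gcoeff l i r * (Q * x) ^ r) - a i * (gcoeff l N r * (Q * x) ^ r)) sums
        (be i * G i (Q * x) - a i * G N (Q * x))"
      by (intro sums_diff sums_mult G i' Qx x) simp
    moreover have "be l * (gcoeff l i r * x ^ r) = be i * (gcoeff l i r * (Q * x) ^ r) - a i * (gcoeff l N r * (Q * x) ^ r)" for r
    proof -
      have "be l * (gcoeff l i r * x ^ r) = (be l * gcoeff l i r) * x ^ r" by simp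
      also have "\<dots> = be i * (gcoeff l i r * (Q * x) ^ r) - a i * (gcoeff l N r * (Q * x) ^ r)"
        unfolding gcoeff_top[OF l i] by (simp add: power_mult_distrib algebra_simps)
      finally show ?thesis .
    qed
    ultimately show ?thesis using sums_unique2 by fastforce
  qed
  have Gb: "(1 + be l * x) * G N x = x * (d * G N (Q * x) - (\<Sum>i<N. b i * G i (Q * x)))" if x: "norm x < \<rho>" for x
  proof -
    have s: "(\<lambda>r. gcoeff l N r * x ^ r) sums G N x" by (rule G) (use x in auto)
    have "gcoeff l N 0 = 0" by (simp add: gcoeff_def hcol_def)
    then have s1: "(\<lambda>r. gcoeff l N (Suc r) * x ^ Suc r) sums G N x"
      using s sums_Suc_iff[of "\<lambda>r. gcoeff l N r * x ^ r" "G N x"] by simp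
    have s2: "(\<lambda>r. be l * x * (gcoeff l N r * x ^ r)) sums (be l * x * G N x)" by (rule sums_mult[OF s])
    have "(\<lambda>r. x * (d * (gcoeff l N r * (Q * x) ^ r) - (\<Sum>i<N. b i * (gcoeff l i r * (Q * x) ^ r)))) sums
        (x * (d * G N (Q * x) - (\<Sum>i<N. b i * G i (Q * x))))"
      by (intro sums_mult sums_diff sums_sum G Qx x) auto
    moreover have "gcoeff l N (Suc r) * x ^ Suc r + be l * x * (gcoeff l N r * x ^ r)
        = x * (d * (gcoeff l N r * (Q * x) ^ r) - (\<Sum>i<N. b i * (gcoeff l i r * (Q * x) ^ r)))" for r
    proof -
      have "gcoeff l N (Suc r) * x ^ Suc r + be l * x * (gcoeff l N r * x ^ r)
        = (gcoeff l N (Suc r) + be l * gcoeff l N r) * (x * x ^ r)" by (simp add: algebra_simps)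
      also have "\<dots> = x * (d * (gcoeff l N r * (Q * x) ^ r) - (\<Sum>i<N. b i * (gcoeff l i r * (Q * x) ^ r)))"
        unfolding gcoeff_bottom[OF l] by (simp add: power_mult_distrib algebra_simps sum_distrib_left)
      finally show ?thesis .
    qed
    ultimately have "(\<lambda>r. gcoeff l N (Suc r) * x ^ Suc r + be l * x * (gcoeff l N r * x ^ r)) sums
        (x * (d * G N (Q * x) - (\<Sum>i<N. b i * G i (Q * x))))" by simp
    from sums_unique2[OF sums_add[OF s1 s2] this] show ?thesis by (simp add: algebra_simps)
  qed
  define P where "P = (\<lambda>x. q_poch_inf (- (be l * x)) q)"
  have Pst: "P x = (1 + be l * x) * P (Q * x)" for x
    using q_poch_inf_step[OF q, of "- (be l * x)"] by (simp add: P_def mult_ac)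
  have Ph: "P holomorphic_on A" for A
    unfolding P_def by (intro holomorphic_intros q)
  \<comment> \<open>The matrix of the equation for \<open>P\<close> times \<open>G\<close>. In the
    last row the factor 1 + be_l x is cancelled by the Borel equation; in the other rows it stays as
    part of the entry.\<close>
  define A where "A = (\<lambda>i k x. if i = N then x * (if k = N then d else - b k)
     else inverse (be l) * (1 + be l * x) * (if k = N then - a i else if k = i then be i else 0))"
  have Asum: "(\<Sum>k\<le>N. A i k x * f k) = (if i = N then x * (d * f N - (\<Sum>k<N. b k * f k))
     else inverse (be l) * (1 + be l * x) * (be i * f i - a i * f N))" if "i \<le> N" for i x f
  proof -
    have sp: "(\<Sum>k\<le>N. A i k x * f k) = (\<Sum>k<N. A i k x * f k) + A i N x * f N"
      by (simp add: lessThan_Suc_atMost[symmetric])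
    show ?thesis
    proof (cases "i = N")
      case True
      have "(\<Sum>k<N. A i k x * f k) = - (x * (\<Sum>k<N. b k * f k))"
        unfolding sum_distrib_left sum_negf[symmetric] by (intro sum.cong refl) (auto simp: A_def True)
      then show ?thesis unfolding sp using True by (simp add: A_def algebra_simps)
    next
      case False
      then have i: "i < N" using that by simp
      have "(\<Sum>k<N. A i k x * f k) = (\<Sum>k<N. if k = i then inverse (be l) * (1 + be l * x) * be i * f i else 0)"
        using False by (intro sum.cong refl) (auto simp: A_def)
      also have "\<dots> = inverse (be l) * (1 + be l * x) * be i * f i" using i by simp
      finally show ?thesis unfolding sp using False by (simp add: A_def algebra_simps)
    qed
  qed
  obtain \<Phi> where \<Phi>h: "\<And>i. i \<le> N \<Longrightarrow> \<Phi> i holomorphic_on UNIV"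
    and \<Phi>0: "\<And>i x. i \<le> N \<Longrightarrow> norm x < \<rho> \<Longrightarrow> \<Phi> i x = P x * G i x"
    and \<Phi>e: "\<And>i x. i \<le> N \<Longrightarrow> \<Phi> i x = (\<Sum>k\<le>N. A i k x * \<Phi> k (Q * x))"
  proof (rule q_extension[OF q \<rho>(1), of N "\<lambda>i x. P x * G i x" A])
    fix i assume i: "i \<le> N"
    have "G i holomorphic_on ball 0 \<rho>"
      by (rule power_series_holomorphic[of 0 \<rho> "gcoeff l i"]) (use G[OF i] in auto)
    then show "(\<lambda>x. P x * G i x) holomorphic_on ball 0 \<rho>" by (intro holomorphic_intros Ph)
    fix k
    show "A i k holomorphic_on UNIV"
      unfolding A_def by (cases "i = N"; cases "k = N"; cases "k = i") (auto intro!: holomorphic_intros)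
  next
    fix i x assume i: "i \<le> N" and x: "norm (x :: complex) < \<rho>"
    show "P x * G i x = (\<Sum>k\<le>N. A i k x * (P (Q * x) * G k (Q * x)))"
    proof (cases "i = N")
      case True
      have "P x * G N x = P (Q * x) * ((1 + be l * x) * G N x)" unfolding Pst[of x] by simp
      also have "\<dots> = x * (d * (P (Q * x) * G N (Q * x)) - (\<Sum>k<N. b k * (P (Q * x) * G k (Q * x))))"
        unfolding Gb[OF x] by (simp add: algebra_simps sum_distrib_left)
      finally show ?thesis unfolding Asum[OF i] using True by simp
    next
      case False
      then have i': "i < N" using i by simp
      have "P x * G i x = inverse (be l) * (1 + be l * x) * P (Q * x) * (be l * G i x)" unfolding Pst[of x] using bl by simp
      also have "\<dots> = inverse (be l) * (1 + be l * x) * (be i * (P (Q * x) * G i (Q * x)) - a i * (P (Q * x) * G N (Q * x)))"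
        unfolding Gt[OF i' x] by (simp add: algebra_simps)
      finally show ?thesis unfolding Asum[OF i] using False by simp
    qed
  qed blast
  define g where "g = (\<lambda>i x. \<Phi> i x / P x)"
  have Pnz: "P x \<noteq> 0" if "norm x < \<rho>" for x
  proof
    assume "P x = 0"
    then obtain k where k: "- (be l * x) * Q ^ k = 1" unfolding P_def using q_poch_inf_eq_0_iff[OF q] by auto
    have "1 = norm (- (be l * x) * Q ^ k)" unfolding k by simp
    also have "\<dots> = norm (be l) * norm x * q ^ k" using q by (simp add: norm_mult norm_power)
    also have "\<dots> \<le> norm (be l) * norm x" using q by (intro mult_left_le) (auto simp: power_le_one)
    also have "\<dots> < norm (be l) * (1 / norm (be l))" using that \<rho>(3) bl by (intro mult_strict_left_mono) auto
    finally show False using bl by simp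
  qed
  have P2: "P (Q * x) \<noteq> 0" "1 + be l * x \<noteq> 0" if "P x \<noteq> 0" for x using that Pst[of x] by auto
  have Pd: "q_poch_inf (- (be l * x)) q = P x" for x by (simp add: P_def)
  have "borel_cont l g"
    unfolding borel_cont_def Pd
  proof (intro conjI allI impI)
    fix i assume i: "i \<le> N"
    show "g i meromorphic_on UNIV"
      unfolding g_def by (intro meromorphic_intros analytic_on_imp_meromorphic_on)
        (use \<Phi>h[OF i] Ph[of UNIV] in \<open>auto simp: analytic_on_open\<close>)
    fix x assume x: "P x \<noteq> 0"
    have "\<Phi> i analytic_on {x}" "P analytic_on {x}"
      using \<Phi>h[OF i] Ph[of UNIV] by (auto simp: analytic_on_open[symmetric] intro: analytic_on_subset)
    then show "g i analytic_on {x}" unfolding g_def using x by (intro analytic_on_divide) auto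
  next
    show "\<exists>\<rho>>0. \<forall>i\<le>N. \<forall>x. norm x < \<rho> \<longrightarrow> (\<lambda>r. gcoeff l i r * x ^ r) sums g i x"
    proof (intro exI[of _ \<rho>] conjI allI impI)
      fix i x assume "i \<le> N" "norm (x :: complex) < \<rho>"
      then have "g i x = G i x" using \<Phi>0 Pnz by (simp add: g_def)
      then show "(\<lambda>r. gcoeff l i r * x ^ r) sums g i x" using G \<open>i \<le> N\<close> \<open>norm x < \<rho>\<close> by simp
    qed (rule \<rho>(1))
  next
    fix x i assume x: "P x \<noteq> 0" and i: "i < N"
    have "\<Phi> i x = inverse (be l) * (1 + be l * x) * (be i * \<Phi> i (Q * x) - a i * \<Phi> N (Q * x))"
      using \<Phi>e[of i x] Asum[of i x "\<lambda>k. \<Phi> k (Q * x)"] i by simp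
    moreover have "be l * (inverse (be l) * w * (s * X - t * Y) / (w * p)) = s * (X / p) - t * (Y / p)"
      if "w \<noteq> 0" for w s t X Y p
    proof -
      have 1: "be l * inverse (be l) = 1" "w / w = 1" using that bl by auto
      have "be l * (inverse (be l) * w * Z / (w * p)) = (be l * inverse (be l)) * (w / w) * (Z / p)" for Z by simp
      then have 2: "be l * (inverse (be l) * w * Z / (w * p)) = Z / p" for Z unfolding 1 by simp
      show ?thesis unfolding 2 by (simp only: diff_divide_distrib times_divide_eq_right)
    qed
    ultimately show "be l * g i x = be i * g i (Q * x) - a i * g N (Q * x)"
      unfolding g_def Pst[of x] using P2(2)[OF x] by simp
  next
    fix x assume x: "P x \<noteq> 0"
    have "\<Phi> N x = x * (d * \<Phi> N (Q * x) - (\<Sum>i<N. b i * \<Phi> i (Q * x)))"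
      using \<Phi>e[of N x] Asum[of N x "\<lambda>k. \<Phi> k (Q * x)"] by simp
    moreover have "(\<Sum>i<N. b i * g i (Q * x)) = (\<Sum>i<N. b i * \<Phi> i (Q * x)) / P (Q * x)"
      by (simp add: g_def sum_divide_distrib)
    ultimately show "(1 + be l * x) * g N x = x * (d * g N (Q * x) - (\<Sum>i<N. b i * g i (Q * x)))"
      using P2[OF x] by (simp add: g_def Pst[of x] diff_divide_distrib right_diff_distrib)
  qed
  then show ?thesis by blast
qed

definition gfun :: "nat \<Rightarrow> nat \<Rightarrow> complex \<Rightarrow> complex" where
  "gfun l = (SOME g. borel_cont l g)"

lemma gfun: "l < N \<Longrightarrow> borel_cont l (gfun l)"
  unfolding gfun_def using borel_cont_exists by (metis someI_ex)

text \<open>By the shift rule, 1 / theta(L q^m u) = q^(tri(m)) (L u)^m / theta(L u). Multiplying the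
  q-Laplace sum of \<open>gfun\<close> by theta(L u) therefore gives the Laurent series with these
  coefficients.\<close>

definition Lcol :: "complex \<Rightarrow> nat \<Rightarrow> nat \<Rightarrow> int \<Rightarrow> complex" where
  "Lcol L l i m = gfun l i (L * Q powi m) * Q powi tri m * L powi m"

lemma admissible_poch':
  assumes "admissible L" "l < N"
  shows "q_poch_inf (- (be l * (L * Q powi m))) q \<noteq> 0"
proof -
  have "Q powi m = Q * Q powi (m - 1)" by (simp add: power_int_diff)
  then show ?thesis using admissible_poch(2)[OF assms, of "m - 1"] by (simp add: mult_ac)
qed

lemma Lcol_col:
  assumes L: "admissible L" and l: "l < N"
  shows "col_solution (be l * L) (Lcol L l)"
  unfolding col_solution_def
proof (intro allI)
  fix m
  note L0 = admissible_nonzero[OF L]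
  define x where "x = L * Q powi (m - 1)"
  have x0: "x \<noteq> 0" using L0 by (simp add: x_def)
  have Qx: "L * Q powi m = Q * x" by (simp add: x_def power_int_diff)
  define T where "T = Q powi tri m * L powi m"
  have tm: "Q powi (tri m - m + 1) = Q powi tri m * inverse (Q powi (m - 1))"
    by (simp add: power_int_add power_int_diff divide_inverse)
  have prev: "Lcol L l i (m - 1) = gfun l i x * T / x" for i
    unfolding Lcol_def x_def[symmetric] T_def tri_minus1 tm using L0
    by (simp add: x_def power_int_diff field_simps)
  have cur: "Lcol L l i m = gfun l i (Q * x) * T" for i
    by (simp add: Lcol_def T_def Qx)
  have bl: "be l * L * Q powi (m - 1) = be l * x" by (simp add: x_def)
  have e: "(\<forall>i<N. be l * gfun l i x = be i * gfun l i (Q * x) - a i * gfun l N (Q * x)) \<and>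
        (1 + be l * x) * gfun l N x = x * (d * gfun l N (Q * x) - (\<Sum>i<N. b i * gfun l i (Q * x)))"
    using gfun[OF l] admissible_poch'[OF L l, of "m - 1"] unfolding borel_cont_def x_def by blast
  show "(\<forall>i<N. be l * L * Q powi (m - 1) * Lcol L l i (m - 1) = be i * Lcol L l i m - a i * Lcol L l N m) \<and>
      be l * L * Q powi (m - 1) * Lcol L l N (m - 1) = d * Lcol L l N m - (\<Sum>i<N. b i * Lcol L l i m) - Lcol L l N (m - 1)"
  proof (intro conjI allI impI)
    fix i assume "i < N"
    then have "be l * gfun l i x = be i * gfun l i (Q * x) - a i * gfun l N (Q * x)" using e by blast
    then have "(be l * gfun l i x) * T = (be i * gfun l i (Q * x) - a i * gfun l N (Q * x)) * T" by simp
    then show "be l * L * Q powi (m - 1) * Lcol L l i (m - 1) = be i * Lcol L l i m - a i * Lcol L l N m"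
      unfolding bl prev cur using x0 by (simp add: algebra_simps)
  next
    have "(1 + be l * x) * gfun l N x * (T / x) = x * (d * gfun l N (Q * x) - (\<Sum>i<N. b i * gfun l i (Q * x))) * (T / x)"
      using e by simp
    also have "\<dots> = d * (gfun l N (Q * x) * T) - (\<Sum>i<N. b i * (gfun l i (Q * x) * T))"
      using x0 by (simp add: algebra_simps sum_distrib_left)
    finally show "be l * L * Q powi (m - 1) * Lcol L l N (m - 1) = d * Lcol L l N m - (\<Sum>i<N. b i * Lcol L l i m) - Lcol L l N (m - 1)"
      unfolding bl prev cur by (simp add: algebra_simps)
  qed
qed

text \<open>Towards 0 the values converge, as the transform is analytic there. Outwards the
  functional equation is iterated, and each step costs only a bounded factor because x / (1 + be_l
  x) stays bounded along the spiral of an admissible direction.\<close>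

lemma gfun_spiral_bound:
  assumes L: "admissible L" and l: "l < N"
  obtains C K where "C \<ge> 0" "K \<ge> 0" "\<And>i m. i \<le> N \<Longrightarrow> norm (gfun l i (L * Q powi m)) \<le> C * K ^ nat \<bar>m\<bar>"
proof -
  note L0 = admissible_nonzero[OF L]
  have bl: "be l \<noteq> 0" using be_nonzero[OF l] .
  note g = gfun[OF l, unfolded borel_cont_def]
  note Qk = Q_power_tendsto
  have "\<exists>c. \<forall>k. norm (gfun l i (L * Q ^ k)) \<le> c" if i: "i \<le> N" for i
  proof -
    have "gfun l i analytic_on {0}" using g i by (metis mult_zero_right minus_zero q_poch_inf_zero zero_neq_one)
    then have "isCont (gfun l i) 0" by (rule analytic_at_imp_isCont)
    moreover have "(\<lambda>k. L * Q ^ k) \<longlonglongrightarrow> 0" using tendsto_mult[OF tendsto_const Qk, of L] by simp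
    ultimately have "(\<lambda>k. gfun l i (L * Q ^ k)) \<longlonglongrightarrow> gfun l i 0" by (rule isCont_tendsto_compose)
    then have "Bseq (\<lambda>k. gfun l i (L * Q ^ k))" by (rule convergent_imp_Bseq[OF convergentI])
    then show ?thesis unfolding Bseq_def by auto
  qed
  then obtain c where c: "\<And>i k. i \<le> N \<Longrightarrow> norm (gfun l i (L * Q ^ k)) \<le> c i" by metis
  define C where "C = (\<Sum>i\<le>N. c i)"
  have c0: "c i \<ge> 0" if "i \<le> N" for i using order.trans[OF norm_ge_zero c[OF that]] .
  have C: "C \<ge> 0" unfolding C_def using c0 by (intro sum_nonneg) auto
  have cC: "norm (gfun l i (L * Q ^ k)) \<le> C" if "i \<le> N" for i k
    using c[OF that, of k] member_le_sum[of i "{..N}" c] c0 that unfolding C_def by force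
  define x where "x = (\<lambda>k. L * inverse Q ^ k)"
  have xm: "x k = L * Q powi (- int k)" for k by (simp add: x_def power_int_minus power_inverse)
  have xS: "Q * x (Suc k) = x k" for k by (simp add: x_def)
  have nz: "1 + be l * x k \<noteq> 0" for k using L l unfolding admissible_def xm by blast
  have "(\<lambda>k. L / (Q ^ k + be l * L)) \<longlonglongrightarrow> L / (0 + be l * L)"
    by (intro tendsto_intros Qk) (use bl L0 in auto)
  then have "Bseq (\<lambda>k. L / (Q ^ k + be l * L))" by (rule convergent_imp_Bseq[OF convergentI])
  then obtain c1 where c1: "c1 > 0" "\<And>k. norm (L / (Q ^ k + be l * L)) \<le> c1" unfolding Bseq_def by auto
  have xq: "x k / (1 + be l * x k) = L / (Q ^ k + be l * L)" for k
  proof -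
    have "x k * Q ^ k = L" by (simp add: x_def power_inverse)
    moreover have "(1 + be l * x k) * Q ^ k = Q ^ k + be l * L" by (simp add: x_def power_inverse algebra_simps)
    moreover have "Q ^ k \<noteq> 0" by simp
    ultimately show ?thesis by (metis mult_divide_mult_cancel_right)
  qed
  define K where "K = c1 * sys_bound + sys_bound / norm (be l) + 1"
  note S0 = sys_bound_nonneg
  have K1: "c1 * sys_bound \<le> K" "sys_bound / norm (be l) \<le> K" "K \<ge> 1" using S0 c1 by (auto simp: K_def)
  have bd: "norm (gfun l i (x k)) \<le> C * K ^ k" if "i \<le> N" for i k
    using that
  proof (induction k arbitrary: i)
    case 0 then show ?case using cC[of i 0] by (simp add: x_def)
  next
    case (Suc k)
    define B where "B = C * K ^ k"
    have B: "norm (gfun l i (x k)) \<le> B" if "i \<le> N" for i using Suc.IH[OF that] by (simp add: B_def)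
    have B0: "B \<ge> 0" using C K1 by (simp add: B_def)
    have e: "(\<forall>i<N. be l * gfun l i (x (Suc k)) = be i * gfun l i (x k) - a i * gfun l N (x k)) \<and>
        (1 + be l * x (Suc k)) * gfun l N (x (Suc k)) = x (Suc k) * (d * gfun l N (x k) - (\<Sum>i<N. b i * gfun l i (x k)))"
      using g admissible_poch'[OF L l, of "- int (Suc k)"] unfolding xm[symmetric] xS[symmetric, of k] by blast
    show ?case
    proof (cases "i = N")
      case True
      have n1: "norm (d * gfun l N (x k) - (\<Sum>i<N. b i * gfun l i (x k))) \<le> sys_bound * B" by (rule sys_bound(1)[OF B])
      have "gfun l N (x (Suc k)) = (x (Suc k) / (1 + be l * x (Suc k))) * (d * gfun l N (x k) - (\<Sum>i<N. b i * gfun l i (x k)))"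
        using e nz[of "Suc k"] by (simp add: field_simps)
      then have "norm (gfun l N (x (Suc k))) = norm (L / (Q ^ Suc k + be l * L)) * norm (d * gfun l N (x k) - (\<Sum>i<N. b i * gfun l i (x k)))"
        unfolding xq by (simp only: norm_mult)
      also have "\<dots> \<le> c1 * (sys_bound * B)" using c1(2)[of "Suc k"] n1 c1(1) by (intro mult_mono) auto
      also have "\<dots> \<le> K * B" using K1(1) B0 by (simp add: mult.assoc[symmetric] mult_right_mono)
      finally show ?thesis using True by (simp add: B_def mult_ac)
    next
      case False
      then have i: "i < N" using Suc.prems by simp
      have "norm (be i * gfun l i (x k) - a i * gfun l N (x k)) \<le> sys_bound * B" by (rule sys_bound(2)[OF B i])
      then have "norm (be l) * norm (gfun l i (x (Suc k))) \<le> sys_bound * B"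
        using e i by (metis norm_mult)
      then have "norm (gfun l i (x (Suc k))) \<le> sys_bound / norm (be l) * B" using bl by (simp add: field_simps)
      also have "\<dots> \<le> K * B" using K1(2) B0 by (intro mult_right_mono) auto
      finally show ?thesis by (simp add: B_def mult_ac)
    qed
  qed
  show ?thesis
  proof (rule that[of C K])
    fix i m assume i: "i \<le> N"
    show "norm (gfun l i (L * Q powi m)) \<le> C * K ^ nat \<bar>m\<bar>"
    proof (cases "m \<ge> 0")
      case True
      then have "norm (gfun l i (L * Q powi m)) \<le> C" using cC[OF i, of "nat m"] by (simp add: power_int_def)
      also have "C \<le> C * K ^ nat \<bar>m\<bar>" using C K1(3) by (simp add: mult_le_cancel_left1 one_le_power)
      finally show ?thesis .
    next
      case False
      then have "L * Q powi m = x (nat \<bar>m\<bar>)" by (simp add: xm)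
      then show ?thesis using bd[OF i] by simp
    qed
  qed (use C K1 in auto)
qed

lemma Lcol_summable:
  assumes L: "admissible L" and l: "l < N" and i: "i \<le> N" and u: "u \<noteq> 0"
  shows "laurent_summable (Lcol L l i) u"
proof -
  note L0 = admissible_nonzero[OF L]
  obtain C K where CK: "C \<ge> 0" "K \<ge> 0" "\<And>i m. i \<le> N \<Longrightarrow> norm (gfun l i (L * Q powi m)) \<le> C * K ^ nat \<bar>m\<bar>"
    using gfun_spiral_bound[OF L l] by blast
  have "laurent_summable (\<lambda>m. gfun l i (L * Q powi m) * Q powi tri m) (L * u)"
  proof (rule laurent_summable_theta_type[OF q _ CK(1,2)])
    fix m show "norm (gfun l i (L * Q powi m) * Q powi tri m) \<le> C * K ^ nat \<bar>m\<bar> * q powi tri m"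
      using CK(3)[OF i, of m] q by (simp add: norm_mult norm_power_int mult_right_mono)
  qed (use u L0 in auto)
  then show ?thesis unfolding Lcol_def[abs_def] by (simp add: laurent_sum_scale)
qed

section \<open>The connection formula in normalized form\<close>

text \<open>Row and column are formal solutions with eigenvalues be_k and be_l. In degree p the
  defects telescope to 0, so the coefficient is annihilated by be_k - be_l q^(-p), which is nonzero
  for \<open>p > 0\<close>. In degree 0 two unit vectors meet.\<close>

lemma eta_hcol_formal:
  assumes k: "k < N" and l: "l < N"
  shows "(\<Sum>r\<le>p. \<Sum>i\<le>N. eta k i (- int r) * hcol l i (p - r)) = (if p = 0 \<and> k = l then 1 else 0)"
proof (cases "p = 0")
  case True
  have "(\<Sum>i\<le>N. eta k i 0 * hcol l i 0) = (\<Sum>i\<le>N. if i = k then (if k = l then 1 else 0) else 0)"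
    using k by (intro sum.cong refl) (auto simp: eta_def hcol_def eta_last_def)
  also have "\<dots> = (if k = l then 1 else 0)" using k by simp
  finally show ?thesis using True by simp
next
  case False
  define S where "S = (\<lambda>r. \<Sum>i\<le>N. eta k i (- int r) * hcol l i (p - r))"
  define T where "T = (\<lambda>r. Q powi (- int r) * eta k N (- int r) * hcol l N (Suc p - r))"
  have step: "be k * S r = be l * inverse Q ^ p * S r + (T r - T (Suc r))" if r: "r \<le> p" for r
  proof -
    have "be k * S r = Q powi (- int r) * (be l * inverse Q ^ (p - r)) * S r
        + Q powi (- int r) * eta k N (- int r) * hcol l N (Suc (p - r))
        - Q powi (- int r - 1) * eta k N (- int r - 1) * hcol l N (p - r)"
      unfolding S_def
      by (rule bilinear_identity)
        (use eta_row[OF k] hcol_top[OF l] hcol_bottom[OF l] in \<open>auto simp: row_solution_def\<close>)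
    moreover have "Q powi (- int r) * (be l * inverse Q ^ (p - r)) = be l * inverse Q ^ p"
    proof -
      have "inverse Q ^ p = inverse Q ^ r * inverse Q ^ (p - r)" using r by (simp add: power_add[symmetric])
      then show ?thesis by (simp add: power_int_minus power_inverse)
    qed
    moreover have "- int r - 1 = - int (Suc r)" by simp
    moreover have "Suc (p - r) = Suc p - r" "p - r = Suc p - Suc r" using r by auto
    ultimately show ?thesis unfolding T_def by (metis add_diff_eq)
  qed
  have "be k * (\<Sum>r\<le>p. S r) = (\<Sum>r\<le>p. be l * inverse Q ^ p * S r + (T r - T (Suc r)))"
    unfolding sum_distrib_left by (intro sum.cong refl step) auto
  also have "\<dots> = be l * inverse Q ^ p * (\<Sum>r\<le>p. S r) + (T 0 - T (Suc p))"
    unfolding sum.distrib sum_distrib_left using sum_telescope[of T p] by simp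
  also have "T 0 = 0" by (simp add: T_def eta_def eta_last_def)
  also have "T (Suc p) = 0" by (simp add: T_def hcol_def)
  finally have "(be k - be l * inverse Q ^ p) * (\<Sum>r\<le>p. S r) = 0" by (simp add: algebra_simps)
  moreover have "be k - be l * inverse Q ^ p \<noteq> 0" using be_power_neq'[OF k l, of p] False by simp
  ultimately show ?thesis using False unfolding S_def by simp
qed

lemma nonzero_if_large: "q * norm beN < norm u \<Longrightarrow> u \<noteq> 0"
  using q by (metis norm_zero not_le mult_nonneg_nonneg less_imp_le norm_ge_zero)

lemma norm_Q_powi_tri_le: "norm (Q powi tri m) \<le> 1"
proof -
  have "q powi tri m = q ^ nat (tri m)" using tri_nonneg[of m] by (simp add: power_int_def)
  then show ?thesis using q by (simp add: norm_power_int power_le_one)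
qed

text \<open>
  On the level of Borel transforms, multiplication by a convergent series \<open>\<Sum> \<eta>\<^sub>r u\<^sup>-\<^sup>r\<close> turns \<open>g\<close> into
  \<open>\<Sum> \<eta>\<^sub>r q\<^bsup>r(r-1)/2\<^esup> x\<^sup>r g(q\<^sup>r x)\<close>; near \<open>0\<close> the rearranged double series is the Borel transform
  of the formal product, which is constant.
\<close>

lemma eta_Lcol_pairing_large:
  assumes L: "admissible L" and k: "k < N" and l: "l < N"
  obtains M where "\<And>m. m \<ge> M \<Longrightarrow>
    pairing (eta k) (Lcol L l) (int m) = (if k = l then 1 else 0) * (Q powi tri (int m) * L powi int m)"
proof -
  note L0 = admissible_nonzero[OF L]
  have "\<exists>C. C > 0 \<and> (\<forall>r. norm (eta k i (- int r)) \<le> C * (q * norm beN) ^ r)" if "i \<le> N" for i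
    using row_bounded[OF eta_row[OF k] be_nonzero[OF k] that eta_tendsto[OF k]] by metis
  then obtain C1 where C1: "\<And>i. i \<le> N \<Longrightarrow> C1 i > 0 \<and> (\<forall>r. norm (eta k i (- int r)) \<le> C1 i * (q * norm beN) ^ r)"
    by metis
  obtain C2 K2 where C2: "C2 \<ge> 0" "K2 > 0" "\<And>i r. i \<le> N \<Longrightarrow> norm (gcoeff l i r) \<le> C2 * K2 ^ r"
    using gcoeff_bound[OF l] by blast
  obtain \<rho> where \<rho>: "\<rho> > 0" "\<And>i x. i \<le> N \<Longrightarrow> norm x < \<rho> \<Longrightarrow> (\<lambda>r. gcoeff l i r * x ^ r) sums gfun l i x"
    using gfun[OF l] unfolding borel_cont_def by blast
  define K1 where "K1 = q * norm beN"
  have K1: "K1 > 0" using q by (simp add: K1_def)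
  \<comment> \<open>Within this radius the Borel series and both geometric majorants converge. The
    sample points L q^m fall below it only for large m, which is why nothing is claimed for small
    ones; the pairing recursion makes up for that.\<close>
  define R where "R = min \<rho> (min (1 / K1) (1 / K2))"
  have R: "R > 0" "R \<le> \<rho>" "R \<le> 1 / K1" "R \<le> 1 / K2" using \<rho> K1 C2 by (auto simp: R_def)
  have "(\<lambda>m. norm L * q ^ m) \<longlonglongrightarrow> norm L * 0"
    using q by (intro tendsto_mult tendsto_const LIMSEQ_realpow_zero) auto
  then have "\<forall>\<^sub>F m in sequentially. norm L * q ^ m < R" using R by (intro order_tendstoD) auto
  then obtain M where M: "\<And>m. m \<ge> M \<Longrightarrow> norm L * q ^ m < R" unfolding eventually_sequentially by auto
  show ?thesis
  proof (rule that[of M])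
    fix m assume "m \<ge> M"
    define x where "x = L * Q ^ m"
    have nx: "norm x < R" using M[OF \<open>m \<ge> M\<close>] q by (simp add: x_def norm_mult norm_power)
    have nx1: "K1 * norm x < 1" "K2 * norm x < 1"
    proof -
      have "K1 * norm x < K1 * R" "K2 * norm x < K2 * R"
        using nx K1 C2(2) by (auto intro: mult_strict_left_mono)
      moreover have "K1 * R \<le> 1" "K2 * R \<le> 1" using R K1 C2(2) by (auto simp: field_simps)
      ultimately show "K1 * norm x < 1" "K2 * norm x < 1" by linarith+
    qed
    define f where "f = (\<lambda>(r, s). \<Sum>i\<le>N. eta k i (- int r) * hcol l i s * (x ^ (r + s) * Q powi tri (int (r + s))))"
    define C where "C = (\<Sum>i\<le>N. C1 i * C2)"
    have fb: "norm (f (r, s)) \<le> C * ((K1 * norm x) ^ r * (K2 * norm x) ^ s)" for r s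
    proof -
      \<comment> \<open>For the majorant the cross term q^(r s) is simply bounded by 1. In
        \<open>rows\<close> below the same cross term is what turns g(x) into g(q^r x).\<close>
      have tr: "Q powi tri (int (r + s)) = Q powi tri (int r) * Q powi tri (int s) * Q ^ (r * s)"
      proof -
        have "tri (int (r + s)) = tri (int r) + tri (int s) + int (r * s)" by (simp add: tri_add)
        then show ?thesis by (simp add: power_int_add del: of_nat_mult)
      qed
      have "norm (eta k i (- int r) * hcol l i s * (x ^ (r + s) * Q powi tri (int (r + s))))
          \<le> C1 i * C2 * ((K1 * norm x) ^ r * (K2 * norm x) ^ s)" if i: "i \<le> N" for i
      proof -
        have "norm (eta k i (- int r) * hcol l i s * (x ^ (r + s) * Q powi tri (int (r + s))))
          = norm (eta k i (- int r)) * norm (gcoeff l i s) * (norm (Q powi tri (int r)) * norm (Q ^ (r * s))) * norm x ^ (r + s)"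
          unfolding tr gcoeff_def norm_mult norm_power by (simp only: mult_ac)
        also have "\<dots> \<le> (C1 i * K1 ^ r) * (C2 * K2 ^ s) * (1 * 1) * norm x ^ (r + s)"
        proof (intro mult_mono)
          show "norm (Q ^ (r * s)) \<le> 1" using q by (simp add: norm_power power_le_one)
        qed (use C1[OF i] C2 K1 i norm_Q_powi_tri_le in \<open>auto simp: K1_def\<close>)
        also have "\<dots> = C1 i * C2 * ((K1 * norm x) ^ r * (K2 * norm x) ^ s)"
          by (simp add: power_add power_mult_distrib)
        finally show ?thesis .
      qed
      then show ?thesis unfolding f_def C_def sum_distrib_right prod.case by (intro sum_norm_le) auto
    qed
    have "f summable_on UNIV \<times> UNIV"
    proof -
      let ?G = "\<lambda>(r, s). complex_of_real ((K1 * norm x) ^ r) * complex_of_real ((K2 * norm x) ^ s)"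
      have g1: "((\<lambda>r. complex_of_real ((K1 * norm x) ^ r)) summable_on UNIV)"
        by (rule summable_on_geometric_bound[where C = 1 and s = "K1 * norm x"]) (use K1 nx1 in \<open>auto simp: norm_mult norm_power\<close>)
      have g2: "((\<lambda>r. complex_of_real ((K2 * norm x) ^ r)) summable_on UNIV)"
        by (rule summable_on_geometric_bound[where C = 1 and s = "K2 * norm x"]) (use C2 nx1 in \<open>auto simp: norm_mult norm_power\<close>)
      have "?G summable_on UNIV \<times> UNIV"
        using g1 g2 by (rule summable_on_times)
      then have "(\<lambda>z. of_real C * ?G z) summable_on UNIV \<times> UNIV"
        by (rule summable_on_cmult_right)
      then have h: "(\<lambda>z. norm (of_real C * ?G z)) summable_on UNIV \<times> UNIV"
        by (simp only: summable_on_iff_abs_summable_on_complex)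
      have "(\<lambda>z. norm (f z)) summable_on UNIV \<times> UNIV"
      proof (rule Infinite_Sum.abs_summable_on_comparison_test'[OF h])
        fix z :: "nat \<times> nat"
        obtain r s where z: "z = (r, s)" by (cases z)
        have "C \<ge> 0" unfolding C_def using C1 C2 by (intro sum_nonneg) (auto intro: less_imp_le mult_nonneg_nonneg)
        then show "norm (f z) \<le> norm (of_real C * ?G z)"
          using fb[of r s] K1 C2 unfolding z by (simp add: norm_mult norm_power)
      qed
      then show ?thesis by (simp only: summable_on_iff_abs_summable_on_complex)
    qed
    then have F: "(f has_sum infsum f (UNIV \<times> UNIV)) (UNIV \<times> UNIV)" by simp
    have rows: "((\<lambda>s. f (r, s)) has_sum (\<Sum>i\<le>N. eta k i (- int r) * Lcol L l i (int m + int r)) / (Q powi tri (int m) * L powi int m)) UNIV" for r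
    proof -
      define y where "y = x * Q ^ r"
      have ny: "norm y < \<rho>"
      proof -
        have "norm y \<le> norm x" using q by (simp add: y_def norm_mult norm_power mult_left_le power_le_one)
        then show ?thesis using nx R by linarith
      qed
      have ny2: "K2 * norm y < 1"
      proof -
        have "norm y \<le> norm x" using q by (simp add: y_def norm_mult norm_power mult_left_le power_le_one)
        then have "K2 * norm y \<le> K2 * norm x" using C2 by (intro mult_left_mono) auto
        then show ?thesis using nx1 by linarith
      qed
      have hs: "((\<lambda>s. gcoeff l i s * y ^ s) has_sum gfun l i y) UNIV" if i: "i \<le> N" for i
      proof (rule norm_summable_imp_has_sum[OF _ \<rho>(2)[OF i ny]])
        have "summable (\<lambda>s. C2 * (K2 * norm y) ^ s)"
          using ny2 C2 by (intro summable_mult summable_geometric) auto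
        then show "summable (\<lambda>s. norm (gcoeff l i s * y ^ s))"
        proof (rule summable_comparison_test'[where N = 0])
          fix s show "norm (norm (gcoeff l i s * y ^ s)) \<le> C2 * (K2 * norm y) ^ s"
            using mult_right_mono[OF C2(3)[OF i, of s], of "norm y ^ s"]
            by (simp add: norm_mult norm_power power_mult_distrib mult.assoc)
        qed
      qed
      have val: "eta k i (- int r) * Lcol L l i (int m + int r) / (Q powi tri (int m) * L powi int m)
          = eta k i (- int r) * (x ^ r * Q powi tri (int r)) * gfun l i y" for i
      proof -
        have "L * Q powi (int m + int r) = y" by (simp add: y_def x_def power_int_add)
        moreover have "Q powi tri (int m + int r) = Q powi tri (int m) * Q powi tri (int r) * (Q ^ m) ^ r"
        proof -
          have "tri (int m + int r) = tri (int m) + tri (int r) + int (m * r)" by (simp add: tri_add)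
          then show ?thesis by (simp add: power_int_add power_mult del: of_nat_mult)
        qed
        moreover have "L powi (int m + int r) = L powi int m * L ^ r" using L0 by (simp add: power_int_add)
        ultimately have "Lcol L l i (int m + int r)
          = (Q powi tri (int m) * L powi int m) * ((L ^ r * (Q ^ m) ^ r) * Q powi tri (int r) * gfun l i y)"
          unfolding Lcol_def by (simp only: mult_ac)
        moreover have "L ^ r * (Q ^ m) ^ r = x ^ r" by (simp add: x_def power_mult_distrib)
        ultimately show ?thesis using L0 by simp
      qed
      have "((\<lambda>s. \<Sum>i\<le>N. eta k i (- int r) * (x ^ r * Q powi tri (int r)) * (gcoeff l i s * y ^ s)) has_sum
          (\<Sum>i\<le>N. eta k i (- int r) * (x ^ r * Q powi tri (int r)) * gfun l i y)) UNIV"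
        by (intro has_sum_finite_sum has_sum_cmult_right hs) auto
      moreover have "(\<Sum>i\<le>N. eta k i (- int r) * (x ^ r * Q powi tri (int r)) * (gcoeff l i s * y ^ s)) = f (r, s)" for s
      proof -
        have tr: "Q powi tri (int (r + s)) = Q powi tri (int r) * Q powi tri (int s) * (Q ^ r) ^ s"
        proof -
          have "tri (int (r + s)) = tri (int r) + tri (int s) + int (r * s)" by (simp add: tri_add)
          then show ?thesis by (simp add: power_int_add power_mult del: of_nat_mult)
        qed
        show ?thesis unfolding f_def prod.case tr gcoeff_def y_def
          by (intro sum.cong refl) (simp add: power_add power_mult_distrib mult_ac)
      qed
      ultimately show ?thesis unfolding sum_divide_distrib val by simp
    qed
    have "((\<lambda>r. (\<Sum>i\<le>N. eta k i (- int r) * Lcol L l i (int m + int r)) / (Q powi tri (int m) * L powi int m))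
        has_sum infsum f (UNIV \<times> UNIV)) UNIV"
      by (rule has_sum_SigmaD[OF F rows])
    moreover have "((\<lambda>r. (\<Sum>i\<le>N. eta k i (- int r) * Lcol L l i (int m + int r)) / (Q powi tri (int m) * L powi int m))
        has_sum (pairing (eta k) (Lcol L l) (int m) / (Q powi tri (int m) * L powi int m))) UNIV"
    proof -
      define u where "u = complex_of_real (K1 + 1)"
      have u: "K1 < norm u" "u \<noteq> 0" using K1 unfolding u_def norm_of_real by (auto simp: of_real_eq_0_iff[symmetric] simp del: of_real_add)
      have "((\<lambda>p. \<Sum>i\<le>N. eta k i p * Lcol L l i (int m - p)) has_sum pairing (eta k) (Lcol L l) (int m)) UNIV"
        by (rule pairing_summable(1)[where u = u])
          (use eta_summable[OF k] Lcol_summable[OF L l] u in \<open>auto simp: K1_def\<close>)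
      also have "?this \<longleftrightarrow> ((\<lambda>p. \<Sum>i\<le>N. eta k i p * Lcol L l i (int m - p)) has_sum pairing (eta k) (Lcol L l) (int m)) {..0}"
        by (rule has_sum_cong_neutral) (auto simp: eta_def)
      also have "\<dots> \<longleftrightarrow> ((\<lambda>r. \<Sum>i\<le>N. eta k i (- int r) * Lcol L l i (int m + int r)) has_sum pairing (eta k) (Lcol L l) (int m)) UNIV"
        by (rule has_sum_reindex_bij_witness[of _ "\<lambda>r. - int r" "\<lambda>p. nat (- p)"]) auto
      finally show ?thesis by (rule has_sum_divide_const)
    qed
    ultimately have v1: "pairing (eta k) (Lcol L l) (int m) / (Q powi tri (int m) * L powi int m) = infsum f (UNIV \<times> UNIV)"
      using has_sum_unique by blast
    have "(f has_sum infsum f (UNIV \<times> UNIV)) (UNIV \<times> UNIV) \<longleftrightarrow>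
        ((\<lambda>(p, r). f (r, p - r)) has_sum infsum f (UNIV \<times> UNIV)) (SIGMA p:UNIV. {..p})"
      by (rule has_sum_reindex_bij_witness[of _ "\<lambda>(p, r). (r, p - r)" "\<lambda>(r, s). (r + s, r)"]) auto
    with F have F2: "((\<lambda>(p, r). f (r, p - r)) has_sum infsum f (UNIV \<times> UNIV)) (SIGMA p:UNIV. {..p})" by blast
    \<comment> \<open>Along r + s = p the weight is constant and can be taken out, so the formal
      duality applies to the finite inner sum.\<close>
    have diag: "((\<lambda>r. case (p, r) of (p, r) \<Rightarrow> f (r, p - r)) has_sum (if p = 0 \<and> k = l then 1 else 0)) {..p}" for p
    proof (rule has_sum_finiteI)
      have "(\<Sum>r\<le>p. f (r, p - r)) = (\<Sum>r\<le>p. (\<Sum>i\<le>N. eta k i (- int r) * hcol l i (p - r)) * (x ^ p * Q powi tri (int p)))"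
        unfolding f_def by (intro sum.cong refl) (auto simp: sum_distrib_right)
      also have "\<dots> = (if p = 0 \<and> k = l then 1 else 0) * (x ^ p * Q powi tri (int p))"
        unfolding sum_distrib_right[symmetric] eta_hcol_formal[OF k l] ..
      also have "\<dots> = (if p = 0 \<and> k = l then 1 else 0)" by simp
      finally show "(if p = 0 \<and> k = l then 1 else 0) = (\<Sum>r\<le>p. case (p, r) of (p, r) \<Rightarrow> f (r, p - r))" by simp
    qed simp
    have "((\<lambda>p::nat. if p = 0 \<and> k = l then 1 else 0 :: complex) has_sum infsum f (UNIV \<times> UNIV)) UNIV"
    proof (rule has_sum_SigmaD[OF F2])
      fix p show "((\<lambda>r. case (p, r) of (p, r) \<Rightarrow> f (r, p - r)) has_sum (if p = 0 \<and> k = l then 1 else 0)) {..p}"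
        by (rule diag)
    qed
    moreover have "((\<lambda>p. if p = 0 \<and> k = l then 1 else 0 :: complex) has_sum (if k = l then 1 else 0)) (UNIV :: nat set)"
    proof -
      have "((\<lambda>p. if p = 0 \<and> k = l then 1 else 0 :: complex) has_sum (if k = l then 1 else 0)) {0 :: nat}"
        by (rule has_sum_finiteI) auto
      also have "?this \<longleftrightarrow> ?thesis" by (rule has_sum_cong_neutral) auto
      finally show ?thesis .
    qed
    ultimately have "infsum f (UNIV \<times> UNIV) = (if k = l then 1 else 0)" using has_sum_unique by blast
    then show "pairing (eta k) (Lcol L l) (int m) = (if k = l then 1 else 0) * (Q powi tri (int m) * L powi int m)"
      using v1 L0 by (simp add: field_simps)
  qed
qed

text \<open>The coefficients of a pairing determine each other through \<open>pairing_eq\<close>, so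
  one large index suffices. The conversion factor is a power of be_l / be_k, hence 1 in the only
  case with a nonzero value.\<close>

lemma eta_Lcol_sum:
  assumes L: "admissible L" and k: "k < N" and l: "l < N" and u: "q * norm beN < norm u"
  shows "(\<Sum>i\<le>N. laurent_sum (eta k i) u * laurent_sum (Lcol L l i) u) = (if k = l then theta_q q (L * u) else 0)"
proof -
  note L0 = admissible_nonzero[OF L]
  have nz: "be k \<noteq> 0" "be l * L \<noteq> 0" using be_nonzero k l L0 by auto
  have u0: "u \<noteq> 0" by (rule nonzero_if_large[OF u])
  obtain M where M: "\<And>m. m \<ge> M \<Longrightarrow>
    pairing (eta k) (Lcol L l) (int m) = (if k = l then 1 else 0) * (Q powi tri (int m) * L powi int m)"
    using eta_Lcol_pairing_large[OF L k l] by blast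
  note es = eta_summable[OF k _ u] and Ls = Lcol_summable[OF L l]
  have "pairing (eta k) (Lcol L l) 0 * (be l * L / be k) powi int M * Q powi tri (int M)
      = (if k = l then 1 else 0) * (Q powi tri (int M) * L powi int M)"
    using pairing_eq[OF eta_row[OF k] Lcol_col[OF L l] es Ls u0 nz, of "int M"] M[of M] by simp
  moreover have "(be l * L / be k) powi int M = (be l / be k) powi int M * L powi int M"
    by (simp add: power_divide power_mult_distrib)
  ultimately have "pairing (eta k) (Lcol L l) 0 * (be l / be k) powi int M = (if k = l then 1 else 0)"
    using L0 by simp
  then have p: "pairing (eta k) (Lcol L l) 0 = (if k = l then 1 else 0)"
    using nz be_nonzero[OF l] by (auto split: if_splits)
  have "(\<Sum>i\<le>N. laurent_sum (eta k i) u * laurent_sum (Lcol L l i) u)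
      = pairing (eta k) (Lcol L l) 0 * theta_q q (be l * L / be k * u)"
    by (rule pairing_laurent_sum[OF eta_row[OF k] Lcol_col[OF L l] es Ls u0 nz])
  then show ?thesis unfolding p using nz by auto
qed

text \<open>Neither factor contains positive powers of u, so the coefficient of u vanishes; the
  two-term recursion has nonzero factors and spreads this zero to all coefficients.\<close>

lemma eta_ycol_sum:
  assumes k: "k < N" and u: "q * norm beN < norm u"
  shows "(\<Sum>i\<le>N. laurent_sum (eta k i) u * laurent_sum (ycol_ext i) u) = 0"
proof -
  have nz: "be k \<noteq> 0" "(- 1 :: complex) \<noteq> 0" using be_nonzero k by auto
  have u0: "u \<noteq> 0" by (rule nonzero_if_large[OF u])
  note es = eta_summable[OF k _ u]
  have "laurent_conv (eta k i) (ycol_ext i) 1 = 0" for i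
    unfolding laurent_conv_def by (rule infsum_0) (auto simp: eta_def ycol_ext_def)
  then have "pairing (eta k) ycol_ext 1 = 0" by (simp add: pairing_def)
  then have "pairing (eta k) ycol_ext 0 = 0"
    using pairing_eq[OF eta_row[OF k] ycol_ext_col es ycol_ext_summable u0 nz, of 1] nz by simp
  then show ?thesis
    using pairing_laurent_sum[OF eta_row[OF k] ycol_ext_col es ycol_ext_summable u0 nz] by simp
qed

text \<open>Divided by its weight, every coefficient of the pairing equals the same constant. At
  index m the leading vector of \<open>ycol\<close> contributes the normalized row coefficient,
  which tends to 1, and a term r > 0 carries the cross factor q^(m r), so the rest is
  O(q^m).\<close>

lemma mrow_ycol_sum:
  assumes L: "admissible L" and u: "q * norm beN < norm u"
  shows "(\<Sum>i\<le>N. laurent_sum (mrow L i) u * laurent_sum (ycol_ext i) u) = theta_q q (L * u)"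
proof -
  note L0 = admissible_nonzero[OF L]
  have nz: "- (1 / L) \<noteq> 0" "(- 1 :: complex) \<noteq> 0" using L0 by auto
  have u0: "u \<noteq> 0" by (rule nonzero_if_large[OF u])
  note ms = mrow_summable[OF L _ u]
  obtain K where K: "K \<ge> 0" "\<And>i m. i \<le> N \<Longrightarrow> norm (ycol_ext i m) \<le> 1 * K ^ nat \<bar>m\<bar> * q powi tri m"
    using ycol_ext_bound by blast
  have "\<exists>c. \<forall>k. norm (mrow L i (int k) / (Q powi tri (int k) * L ^ k)) \<le> c" if "i \<le> N" for i
    using convergent_imp_Bseq[OF convergentI[OF mrow_pos_tendsto[OF L that]]] unfolding Bseq_def by auto
  then obtain c where c: "\<And>i k. i \<le> N \<Longrightarrow> norm (mrow L i (int k) / (Q powi tri (int k) * L ^ k)) \<le> c i" by metis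
  have c0: "c i \<ge> 0" if "i \<le> N" for i using order.trans[OF norm_ge_zero c[OF that]] .
  define C where "C = (\<Sum>i\<le>N. c i)"
  have C: "C \<ge> 0" unfolding C_def using c0 by (intro sum_nonneg) auto
  define P where "P = pairing (mrow L) ycol_ext 0"
  define G where "G = (\<lambda>m r. (\<Sum>i\<le>N. mrow L i (int m + int r) * ycol_ext i (- int r)) / (Q powi tri (int m) * L ^ m))"
  obtain C3 where C3: "C3 \<ge> 0" "\<And>k. (norm L * K) ^ k * q powi tri (int k) \<le> C3 * (1 / 2) ^ k"
    by (rule gauss_bound[of q "1/2" "norm L * K"]) (use q K in auto)
  have Gs: "((\<lambda>r. G m r) has_sum P) UNIV" for m
  proof -
    have "((\<lambda>p. \<Sum>i\<le>N. mrow L i p * ycol_ext i (int m - p)) has_sum pairing (mrow L) ycol_ext (int m)) UNIV"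
      by (rule pairing_summable(1)[where u = u]) (use ms ycol_ext_summable u0 in auto)
    also have "?this \<longleftrightarrow> ((\<lambda>p. \<Sum>i\<le>N. mrow L i p * ycol_ext i (int m - p)) has_sum pairing (mrow L) ycol_ext (int m)) {int m..}"
      by (rule has_sum_cong_neutral) (auto simp: ycol_ext_def)
    also have "\<dots> \<longleftrightarrow> ((\<lambda>r. \<Sum>i\<le>N. mrow L i (int m + int r) * ycol_ext i (- int r)) has_sum pairing (mrow L) ycol_ext (int m)) UNIV"
      by (rule has_sum_reindex_bij_witness[of _ "\<lambda>r. int m + int r" "\<lambda>p. nat (p - int m)"]) auto
    finally have "((\<lambda>r. G m r) has_sum pairing (mrow L) ycol_ext (int m) / (Q powi tri (int m) * L ^ m)) UNIV"
      unfolding G_def by (rule has_sum_divide_const)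
    moreover have "pairing (mrow L) ycol_ext (int m) = P * L powi int m * Q powi tri (int m)"
      using pairing_eq[OF mrow_row[OF L] ycol_ext_col ms ycol_ext_summable u0 nz, of "int m"] by (simp add: P_def)
    ultimately show ?thesis using L0 by simp
  qed
  have G0: "G m 0 = mrow L N (int m) / (Q powi tri (int m) * L ^ m)" for m
  proof -
    have "(\<Sum>i\<le>N. mrow L i (int m + int 0) * ycol_ext i (- int 0)) = (\<Sum>i\<le>N. if i = N then mrow L N (int m) else 0)"
      by (intro sum.cong refl) (auto simp: ycol_ext_def)
    also have "\<dots> = mrow L N (int m)" by simp
    finally show ?thesis unfolding G_def by simp
  qed
  have GS: "norm (G m (Suc r)) \<le> q ^ m * (C * C3) * (1 / 2) ^ r" for m r
  proof -
    have 1: "norm (mrow L i (int m + int (Suc r)) * ycol_ext i (- int (Suc r)) / (Q powi tri (int m) * L ^ m))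
        \<le> c i * (q ^ m * (C3 * (1 / 2) ^ r))" if i: "i \<le> N" for i
    proof -
      let ?R = "Suc r"
      have t: "Q powi tri (int m + int ?R) = Q powi tri (int m) * Q powi tri (int ?R) * Q ^ (m * ?R)"
      proof -
        have "tri (int m + int ?R) = tri (int m) + tri (int ?R) + int (m * ?R)" by (simp add: tri_add algebra_simps)
        moreover have "Q powi int (m * ?R) = Q ^ (m * ?R)" by (simp only: power_int_of_nat)
        ultimately show ?thesis by (simp only: power_int_add power_int_add_1 q_nonzero of_real_eq_0_iff simp_thms)
      qed
      have e: "mrow L i (int m + int ?R) * ycol_ext i (- int ?R) / (Q powi tri (int m) * L ^ m)
        = (mrow L i (int (m + ?R)) / (Q powi tri (int (m + ?R)) * L ^ (m + ?R))) * (Q ^ (m * ?R) * (Q powi tri (int ?R) * L ^ ?R * ycol_ext i (- int ?R)))"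
      proof -
        have nz: "Q powi tri (int m) * L ^ m \<noteq> 0" "Q powi tri (int ?R) * Q ^ (m * ?R) * L ^ ?R \<noteq> 0" using L0 by auto
        have "x * y / a = (x / (a * b)) * (b * y)" if "b \<noteq> 0" for x y a b :: complex using that by simp
        note this[OF nz(2), of "mrow L i (int m + int ?R)" "ycol_ext i (- int ?R)" "Q powi tri (int m) * L ^ m"]
        then show ?thesis unfolding of_nat_add t power_add by (simp only: mult_ac)
      qed
      have y: "norm (ycol_ext i (- int ?R)) \<le> K ^ ?R"
      proof -
        have "norm (ycol_ext i (- int ?R)) \<le> K ^ ?R * q powi tri (- int ?R)"
          using K(2)[OF i, of "- int ?R"] by (simp del: of_nat_Suc)
        also have "\<dots> \<le> K ^ ?R * 1"
          using norm_Q_powi_tri_le[of "- int ?R"] K q by (intro mult_left_mono) (auto simp: norm_power_int simp del: of_nat_Suc)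
        finally show ?thesis by simp
      qed
      have qm: "norm (Q ^ (m * ?R)) \<le> q ^ m"
      proof -
        have "q ^ (m * ?R) \<le> q ^ m" using q by (intro power_decreasing) auto
        then show ?thesis using q by (simp add: norm_power)
      qed
      have "norm (Q powi tri (int ?R) * L ^ ?R * ycol_ext i (- int ?R)) \<le> q powi tri (int ?R) * norm L ^ ?R * K ^ ?R"
        unfolding norm_mult norm_power norm_power_int using y q by (intro mult_mono) auto
      also have "\<dots> \<le> C3 * (1 / 2) ^ ?R"
        using C3(2)[of ?R] by (simp add: power_mult_distrib mult_ac del: of_nat_Suc)
      also have "\<dots> \<le> C3 * (1 / 2) ^ r" using C3(1) by simp
      finally have z: "norm (Q powi tri (int ?R) * L ^ ?R * ycol_ext i (- int ?R)) \<le> C3 * (1 / 2) ^ r" .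
      show ?thesis unfolding e norm_mult[of "mrow L i (int (m + ?R)) / (Q powi tri (int (m + ?R)) * L ^ (m + ?R))"] norm_mult[of "Q ^ (m * ?R)"]
        using c[OF i, of "m + ?R"] qm z q c0[OF i] C3 by (intro mult_mono) auto
    qed
    have "norm (G m (Suc r)) \<le> (\<Sum>i\<le>N. c i * (q ^ m * (C3 * (1 / 2) ^ r)))"
      unfolding G_def sum_divide_distrib by (rule sum_norm_le) (use 1 in auto)
    also have "\<dots> = q ^ m * (C * C3) * (1 / 2) ^ r" unfolding C_def sum_distrib_right[symmetric] by simp
    finally show ?thesis .
  qed
  have bound: "norm (P - mrow L N (int m) / (Q powi tri (int m) * L ^ m)) \<le> q ^ m * (C * C3 * 2)" for m
  proof -
    have "((\<lambda>r. G m r) has_sum (P - G m 0)) (UNIV - {0})"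
      by (rule has_sum_Diff[OF Gs]) (auto intro: has_sum_finiteI)
    also have "?this \<longleftrightarrow> ((\<lambda>r. G m (Suc r)) has_sum (P - G m 0)) UNIV"
      by (rule has_sum_reindex_bij_witness[of _ Suc "\<lambda>r. r - 1"]) auto
    finally have hs: "((\<lambda>r. G m (Suc r)) has_sum (P - G m 0)) UNIV" .
    have "(\<lambda>r. q ^ m * (C * C3) * (1 / 2) ^ r) sums (q ^ m * (C * C3) * (1 / (1 - 1 / 2)))"
      by (intro sums_mult geometric_sums) auto
    then have gs: "((\<lambda>r. q ^ m * (C * C3) * (1 / 2) ^ r) has_sum (q ^ m * (C * C3) * (1 / (1 - 1 / 2)))) UNIV"
      by (rule sums_nonneg_imp_has_sum) (use q C C3 in auto)
    have "norm (P - G m 0) \<le> q ^ m * (C * C3) * (1 / (1 - 1 / 2))"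
      by (rule norm_infsum_le[OF hs gs]) (use GS in auto)
    then show ?thesis unfolding G0 by simp
  qed
  have "(\<lambda>m. q ^ m * (C * C3 * 2)) \<longlonglongrightarrow> 0"
    using q by (intro tendsto_mult_left_zero LIMSEQ_realpow_zero) auto
  then have "(\<lambda>m. P - mrow L N (int m) / (Q powi tri (int m) * L ^ m)) \<longlonglongrightarrow> 0"
    by (rule Lim_null_comparison[OF always_eventually, rotated]) (use bound in auto)
  moreover have "(\<lambda>m. P - mrow L N (int m) / (Q powi tri (int m) * L ^ m)) \<longlonglongrightarrow> P - 1"
    using mrow_pos_tendsto[OF L order_refl] by (intro tendsto_intros) simp
  ultimately have "P = 1" using LIMSEQ_unique by fastforce
  then show ?thesis
    using pairing_laurent_sum[OF mrow_row[OF L] ycol_ext_col ms ycol_ext_summable u0 nz] by (simp add: P_def)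
qed

end

lemma laurent_sum_at_infinity:
  assumes c: "\<And>m. m > 0 \<Longrightarrow> c m = 0" and s: "laurent_summable c u0" and u0: "u0 \<noteq> 0"
  shows "(laurent_sum c \<longlongrightarrow> c 0) at_infinity"
proof -
  define F where "F = (\<lambda>x. \<Sum>n. c (- int n) * x ^ n)"
  have re: "((\<lambda>m. c m * u powi m) has_sum t) UNIV \<longleftrightarrow> ((\<lambda>n. c (- int n) * inverse u ^ n) has_sum t) UNIV" for u t
  proof -
    have "((\<lambda>m. c m * u powi m) has_sum t) UNIV \<longleftrightarrow> ((\<lambda>m. c m * u powi m) has_sum t) {..0}"
      by (rule has_sum_cong_neutral) (use c in auto)
    also have "\<dots> \<longleftrightarrow> ((\<lambda>n. c (- int n) * inverse u ^ n) has_sum t) UNIV"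
      by (rule has_sum_reindex_bij_witness[of _ "\<lambda>n. - int n" "\<lambda>m. nat (- m)"])
        (auto simp: power_int_def)
    finally show ?thesis .
  qed
  have sm: "summable (\<lambda>n. c (- int n) * inverse u0 ^ n)"
    by (rule sums_summable, rule has_sum_imp_sums, rule re[THEN iffD1]) (rule laurent_has_sum[OF s])
  have "isCont F 0" unfolding F_def by (rule isCont_powser[OF sm]) (use u0 in auto)
  then have "((\<lambda>u. F (inverse u)) \<longlongrightarrow> F 0) at_infinity"
    by (rule isCont_tendsto_compose[OF _ tendsto_inverse_0])
  moreover have "F 0 = c 0"
  proof -
    have "(\<lambda>n. c (- int n) * 0 ^ n) sums c (- int 0)" using powser_sums_zero[of "\<lambda>n. c (- int n)"] by simp
    then show ?thesis unfolding F_def by (simp add: sums_iff)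
  qed
  moreover have "\<forall>\<^sub>F u in at_infinity. F (inverse u) = laurent_sum c u"
    unfolding eventually_at_infinity
  proof (intro exI[of _ "norm u0 + 1"] allI impI)
    fix u :: complex assume u: "norm u0 + 1 \<le> norm u"
    have "norm u0 > 0" "norm u0 < norm u" using u u0 by simp_all
    then have "norm (inverse u) < norm (inverse u0)" unfolding norm_inverse by (rule less_imp_inverse_less[rotated])
    then have ns: "summable (\<lambda>n. norm (c (- int n) * inverse u ^ n))" by (rule powser_insidea[OF sm])
    have "((\<lambda>n. c (- int n) * inverse u ^ n) has_sum F (inverse u)) UNIV"
      unfolding F_def by (rule norm_summable_imp_has_sum[OF ns summable_sums[OF summable_norm_cancel[OF ns]]])
    then have "((\<lambda>m. c m * u powi m) has_sum F (inverse u)) UNIV" by (simp only: re)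
    from laurent_sumI[OF this] show "F (inverse u) = laurent_sum c u" by simp
  qed
  ultimately show ?thesis by (simp add: tendsto_cong)
qed

context q_system
begin

definition row_value :: "complex \<Rightarrow> nat \<Rightarrow> nat \<Rightarrow> complex \<Rightarrow> complex" where
  "row_value L k i u = (if k < N then laurent_sum (eta k i) u else laurent_sum (mrow L i) u)"

definition col_value :: "complex \<Rightarrow> nat \<Rightarrow> nat \<Rightarrow> complex \<Rightarrow> complex" where
  "col_value L l i u = (if l < N then laurent_sum (Lcol L l i) u else laurent_sum (ycol_ext i) u)"

text \<open>The square block of the rows \<open>eta k\<close> tends to the identity. Once every
  entry is within 1 / (N + 1) of it, the deviation is a strict contraction in the sum norm, so the
  kernel is trivial.\<close>

lemma eta_kernel_large:
  "\<forall>\<^sub>F u in at_infinity. \<forall>w. (\<forall>k<N. (\<Sum>i<N. laurent_sum (eta k i) u * w i) = 0) \<longrightarrow> (\<forall>i<N. w i = 0)"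
proof -
  let ?e = "\<lambda>k i u. laurent_sum (eta k i) u - (if i = k then 1 else 0)"
  have big: "q * norm beN < norm (of_real (q * norm beN + 1) :: complex)" "(of_real (q * norm beN + 1) :: complex) \<noteq> 0"
  proof -
    have p: "0 < q * norm beN + 1" using q by (simp add: add_pos_pos)
    show "q * norm beN < norm (of_real (q * norm beN + 1) :: complex)" unfolding norm_of_real using p by linarith
    show "(of_real (q * norm beN + 1) :: complex) \<noteq> 0" using p unfolding of_real_eq_0_iff by linarith
  qed
  define \<epsilon> where "\<epsilon> = 1 / real (N + 1)"
  have ev: "\<forall>\<^sub>F u in at_infinity. norm (?e k i u) < \<epsilon>"
    if "k < N" "i < N" for k i
  proof -
    have "(laurent_sum (eta k i) \<longlongrightarrow> eta k i 0) at_infinity"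
      by (rule laurent_sum_at_infinity[OF _ eta_summable[OF that(1) _ big(1)] big(2)]) (use that in \<open>auto simp: eta_def\<close>)
    moreover have "eta k i 0 = (if i = k then 1 else 0)" using that by (auto simp: eta_def)
    ultimately show ?thesis unfolding tendsto_iff dist_norm by (simp add: \<epsilon>_def)
  qed
  have "\<forall>\<^sub>F u in at_infinity. \<forall>k\<in>{..<N}. \<forall>i\<in>{..<N}. norm (?e k i u) < \<epsilon>"
    by (intro eventually_ball_finite ballI ev) auto
  then show ?thesis
  proof eventually_elim
    case (elim u)
    show ?case
    proof (intro allI impI)
      fix w i assume w: "\<forall>k<N. (\<Sum>i<N. laurent_sum (eta k i) u * w i) = 0" and i: "i < N"
      define S where "S = (\<Sum>i<N. norm (w i))"
      have "norm (w k) \<le> \<epsilon> * S" if k: "k < N" for k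
      proof -
        have "(\<Sum>i<N. ?e k i u * w i) = - w k"
        proof -
          have "(\<Sum>i<N. ?e k i u * w i)
            = (\<Sum>i<N. laurent_sum (eta k i) u * w i) - (\<Sum>i<N. if i = k then w k else 0)"
            unfolding sum_subtractf[symmetric] by (intro sum.cong) (auto simp: algebra_simps)
          then show ?thesis using w k by simp
        qed
        then have "norm (w k) = norm (\<Sum>i<N. ?e k i u * w i)" by simp
        also have "\<dots> \<le> (\<Sum>i<N. \<epsilon> * norm (w i))"

        proof (rule sum_norm_le)
          fix i assume "i \<in> {..<N}"
          then have "norm (?e k i u) \<le> \<epsilon>" using elim k by (metis lessThan_iff less_imp_le)
          then show "norm (?e k i u * w i) \<le> \<epsilon> * norm (w i)"
            unfolding norm_mult by (rule mult_right_mono) simp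
        qed
        finally show ?thesis by (simp add: S_def sum_distrib_left)
      qed
      then have "S \<le> (\<Sum>k<N. \<epsilon> * S)" by (subst S_def, intro sum_mono) auto
      then have "S * (1 - real N * \<epsilon>) \<le> 0" by (simp add: algebra_simps)
      moreover have "1 - real N * \<epsilon> > 0" by (simp add: \<epsilon>_def field_simps)
      ultimately have "S \<le> 0" by (metis mult_pos_pos not_le)
      moreover have "S \<ge> 0" by (simp add: S_def sum_nonneg)
      ultimately have "S = 0" by simp
      then show "w i = 0" using i unfolding S_def by (simp add: sum_nonneg_eq_0_iff)
    qed
  qed
qed

text \<open>Here the constant is found by evaluating at a point instead of comparing coefficients.
  At a large zero of theta(L u) all rows \<open>eta k\<close> annihilate both this column and the
  last one, so the first is a multiple of the second. As \<open>mrow\<close> also annihilates the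
  last column there, the pairing vanishes at this point, while the theta function it is a multiple
  of does not, by admissibility.\<close>

lemma mrow_Lcol_sum:
  assumes L: "admissible L" and l: "l < N" and u: "q * norm beN < norm u"
  shows "(\<Sum>i\<le>N. laurent_sum (mrow L i) u * laurent_sum (Lcol L l i) u) = 0"
proof -
  note L0 = admissible_nonzero[OF L]
  have nz: "- (1 / L) \<noteq> 0" "be l * L \<noteq> 0" using be_nonzero l L0 by auto
  define P where "P = pairing (mrow L) (Lcol L l) 0"
  have P: "(\<Sum>i\<le>N. laurent_sum (mrow L i) v * laurent_sum (Lcol L l i) v) = P * theta_q q (be l * L / (- (1 / L)) * v)"
    if v: "q * norm beN < norm v" for v
  proof -
    have v0: "v \<noteq> 0" by (rule nonzero_if_large[OF v])
    show ?thesis unfolding P_def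
      by (rule pairing_laurent_sum[OF mrow_row[OF L] Lcol_col[OF L l] mrow_summable[OF L _ v] Lcol_summable[OF L l] v0 nz])
  qed
  have "(laurent_sum (ycol_ext N) \<longlongrightarrow> ycol_ext N 0) at_infinity"
    by (rule laurent_sum_at_infinity[OF _ ycol_ext_summable[OF order_refl, of 1]]) (auto simp: ycol_ext_def)
  then have "(laurent_sum (ycol_ext N) \<longlongrightarrow> 1) at_infinity" by (simp add: ycol_ext_def)
  then have "\<forall>\<^sub>F u in at_infinity. laurent_sum (ycol_ext N) u \<noteq> 0" by (rule tendsto_imp_eventually_ne) simp
  with eta_kernel_large
  have "\<forall>\<^sub>F u in at_infinity. laurent_sum (ycol_ext N) u \<noteq> 0 \<and>
     (\<forall>w. (\<forall>k<N. (\<Sum>i<N. laurent_sum (eta k i) u * w i) = 0) \<longrightarrow> (\<forall>i<N. w i = 0)) \<and> q * norm beN + 1 \<le> norm u"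
    by (intro eventually_conj) (auto simp: eventually_at_infinity)
  then obtain R where R: "\<And>u. R \<le> norm u \<Longrightarrow> laurent_sum (ycol_ext N) u \<noteq> 0 \<and>
     (\<forall>w. (\<forall>k<N. (\<Sum>i<N. laurent_sum (eta k i) u * w i) = 0) \<longrightarrow> (\<forall>i<N. w i = 0)) \<and> q * norm beN + 1 \<le> norm u"
    unfolding eventually_at_infinity by blast
  have "1 < inverse q" using q by (simp add: one_less_inverse)
  then obtain s where s: "R * norm L < inverse q ^ s" using real_arch_pow by blast
  \<comment> \<open>A zero of theta(L u), since L v = - q^(-s), moved beyond the bound
    \<open>R\<close> by the choice of \<open>s\<close>.\<close>
  define v where "v = - (inverse Q ^ s / L)"
  have nv: "norm v = inverse q ^ s / norm L" using q by (simp add: v_def norm_divide norm_power norm_inverse)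
  have "R \<le> norm v" unfolding nv using s L0 by (simp add: pos_le_divide_eq)
  note Rv = R[OF this]
  have v: "q * norm beN < norm v" using Rv by linarith
  have th: "theta_q q (L * v) = 0"
  proof -
    have "L * v = - (Q powi (- int s))" using L0 by (simp add: v_def power_int_minus power_inverse)
    then show ?thesis using theta_q_eq_0_iff[OF q, of "L * v"] L0 by (auto simp: v_def)
  qed
  define t where "t = laurent_sum (Lcol L l N) v / laurent_sum (ycol_ext N) v"
  define w where "w = (\<lambda>i. laurent_sum (Lcol L l i) v - t * laurent_sum (ycol_ext i) v)"
  have wN: "w N = 0" using Rv by (simp add: w_def t_def)
  have split: "(\<Sum>i\<le>N. r i * w i) = (\<Sum>i\<le>N. r i * laurent_sum (Lcol L l i) v) - t * (\<Sum>i\<le>N. r i * laurent_sum (ycol_ext i) v)" for r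
    by (simp add: w_def right_diff_distrib sum_subtractf sum_distrib_left mult_ac)
  have "(\<Sum>i<N. laurent_sum (eta k i) v * w i) = 0" if k: "k < N" for k
  proof -
    have "(\<Sum>i\<le>N. laurent_sum (eta k i) v * w i) = 0"
      unfolding split eta_Lcol_sum[OF L k l v] eta_ycol_sum[OF k v] th by simp
    then show ?thesis by (simp add: wN lessThan_Suc_atMost[symmetric])
  qed
  then have w0: "w i = 0" if "i \<le> N" for i using Rv wN that by (cases "i = N") auto
  have "(\<Sum>i\<le>N. laurent_sum (mrow L i) v * w i) = 0" using w0 by simp
  then have "P * theta_q q (be l * L / (- (1 / L)) * v) = 0"
    unfolding split mrow_ycol_sum[OF L v] th P[OF v] by simp
  moreover have "be l * L / (- (1 / L)) * v = Q powi (- int s) * (be l * L)"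
    using L0 by (simp add: v_def power_int_minus power_inverse)
  moreover have "theta_q q (Q powi (- int s) * (be l * L)) \<noteq> 0"
    unfolding theta_q_shift_powi[OF q nz(2)] using admissible_theta[OF L l] nz(2) by simp
  ultimately have "P = 0" by simp
  then show ?thesis using P[OF u] by simp
qed

lemma row_col_sum:
  assumes L: "admissible L" and k: "k \<le> N" and l: "l \<le> N" and u: "q * norm beN < norm u"
  shows "(\<Sum>i\<le>N. row_value L k i u * col_value L l i u) = (if k = l then theta_q q (L * u) else 0)"
proof -
  have "\<not> k < N \<Longrightarrow> k = N" "\<not> l < N \<Longrightarrow> l = N" using k l by auto
  then show ?thesis
    unfolding row_value_def col_value_def
    using eta_Lcol_sum[OF L _ _ u, of k l] eta_ycol_sum[OF _ u, of k] mrow_Lcol_sum[OF L _ u, of l] mrow_ycol_sum[OF L u]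
    by (cases "k < N"; cases "l < N") auto
qed

text \<open>The rows are a left inverse of the square matrix of columns up to theta(L u), hence also
  a right inverse. Thus row pairings are coordinates with respect to the columns.\<close>

lemma expand_in_columns:
  assumes L: "admissible L" and u: "q * norm beN < norm u" and th: "theta_q q (L * u) \<noteq> 0" and i: "i \<le> N"
  shows "v i * theta_q q (L * u) = (\<Sum>l\<le>N. col_value L l i u * (\<Sum>k\<le>N. row_value L l k u * v k))"
proof -
  let ?t = "theta_q q (L * u)"
  define C where "C = mat (Suc N) (Suc N) (\<lambda>(i, l). col_value L l i u / ?t)"
  define R where "R = mat (Suc N) (Suc N) (\<lambda>(k, i). row_value L k i u)"
  have cm: "C \<in> carrier_mat (Suc N) (Suc N)" "R \<in> carrier_mat (Suc N) (Suc N)" by (auto simp: C_def R_def)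
  have "R * C = 1\<^sub>m (Suc N)"
  proof (rule eq_matI)
    fix k l assume kl: "k < dim_row (1\<^sub>m (Suc N))" "l < dim_col (1\<^sub>m (Suc N))"
    then have "(R * C) $$ (k, l) = (\<Sum>i\<le>N. row_value L k i u * col_value L l i u) / ?t"
      by (simp add: C_def R_def scalar_prod_def atLeast0LessThan lessThan_Suc_atMost sum_divide_distrib)
    then show "(R * C) $$ (k, l) = 1\<^sub>m (Suc N) $$ (k, l)"
      using kl th by (simp add: row_col_sum[OF L _ _ u])
  qed (use cm in auto)
  then have "C * R = 1\<^sub>m (Suc N)" using mat_mult_left_right_inverse[OF cm(2,1)] by simp
  then have CR: "(\<Sum>l\<le>N. col_value L l i u / ?t * row_value L l k u) = (if i = k then 1 else 0)" if "k \<le> N" for k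
  proof -
    have "(C * R) $$ (i, k) = (\<Sum>l\<le>N. col_value L l i u / ?t * row_value L l k u)"
      using i that by (simp add: C_def R_def scalar_prod_def atLeast0LessThan lessThan_Suc_atMost)
    then show ?thesis using \<open>C * R = 1\<^sub>m (Suc N)\<close> i that by simp
  qed
  have "(\<Sum>l\<le>N. col_value L l i u * (\<Sum>k\<le>N. row_value L l k u * v k))
      = (\<Sum>k\<le>N. (\<Sum>l\<le>N. col_value L l i u / ?t * row_value L l k u) * (v k * ?t))"
    unfolding sum_distrib_left sum_distrib_right by (subst sum.swap) (use th in \<open>simp add: mult_ac\<close>)
  also have "\<dots> = (\<Sum>k\<le>N. if k = i then v i * ?t else 0)"
    by (rule sum.cong[OF refl]) (subst CR, auto)
  also have "\<dots> = v i * ?t" using i by simp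
  finally show ?thesis by simp
qed

section \<open>The identity between the solutions at the origin and at infinity\<close>

definition conn_value :: "complex \<Rightarrow> nat \<Rightarrow> nat \<Rightarrow> complex \<Rightarrow> complex" where
  "conn_value L l j u = (if l < N then conn_top l j * theta_q q (- (al j / be l) * (u / beN))
     else q_poch_inf Q q * conn_bot L j * theta_q q (al j * L * (u / beN)))"

lemma col_value_holomorphic:
  assumes "admissible L" "i \<le> N"
  shows "col_value L l i holomorphic_on - {0}"
  unfolding col_value_def
  using laurent_sum_holomorphic_punctured[OF Lcol_summable[OF assms(1) _ assms(2)]]
    laurent_sum_holomorphic_punctured[OF ycol_ext_summable[OF assms(2)]]
  by (cases "l < N") auto

lemma theta_q_scaled_holomorphic:
  assumes "c \<noteq> 0"
  shows "(\<lambda>u. theta_q q (c * u)) holomorphic_on - {0}"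
  using holomorphic_on_compose_gen[OF _ theta_q_holomorphic[OF q], of "\<lambda>u. c * u" "- {0}"] assms
  by (force simp: o_def intro: holomorphic_intros)

lemma conn_value_holomorphic:
  assumes "admissible L" "j \<le> N" "l \<le> N"
  shows "conn_value L l j holomorphic_on - {0}"
proof -
  have "- (al j / (be l * beN)) \<noteq> 0" if "l < N" using that al_nonzero assms be_nonzero by simp
  moreover have "al j * L / beN \<noteq> 0" using assms al_nonzero by (simp add: admissible_def)
  ultimately show ?thesis
    using theta_q_scaled_holomorphic[of "- (al j / (be l * beN))"] theta_q_scaled_holomorphic[of "al j * L / beN"]
    unfolding conn_value_def by (cases "l < N") (auto intro!: holomorphic_intros)
qed

lemma laurent_sum_psi_holomorphic:
  assumes "j \<le> N" "i \<le> N"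
  shows "laurent_sum (psi_ext j i) holomorphic_on {u. 0 < norm u \<and> norm u < norm beN}"
proof -
  have "laurent_sum (psi_ext j i) analytic_on {u}" if u: "0 < norm u" "norm u < norm beN" for u
  proof -
    define r1 where "r1 = norm u / 2"
    define r2 where "r2 = (norm u + norm beN) / 2"
    have r: "0 < r1" "r1 < norm u" "norm u < r2" "r2 < norm beN" "r1 < norm beN" "0 < r2"
      using u unfolding r1_def r2_def by (simp_all add: field_simps del: zero_less_norm_iff)
    have "laurent_sum (psi_ext j i) holomorphic_on {u. r1 < norm u \<and> norm u < r2}"
      by (rule laurent_sum_holomorphic) (use r psi_ext_summable[OF assms] in auto)
    moreover have "open {u :: complex. r1 < norm u \<and> norm u < r2}"
      by (intro open_Collect_conj open_Collect_less continuous_intros)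
    ultimately show ?thesis using r unfolding analytic_at by blast
  qed
  then show ?thesis by (intro analytic_imp_holomorphic) (auto simp: analytic_on_def)
qed

text \<open>On the annulus common to the rows and the solution at the origin, away from zeros of
  theta(L u), this is \<open>expand_in_columns\<close> with the known pairings as coordinates. With
  both theta functions multiplied out, each side is holomorphic on the punctured disc, so the
  identity theorem removes both restrictions.\<close>

theorem connection_identity:
  assumes L: "admissible L" and j: "j \<le> N" and i: "i \<le> N" and u: "u \<noteq> 0" "norm u < norm beN"
  shows "laurent_sum (psi_ext j i) u * (theta_q q (L * u) * theta_q q (- (u / beN)))
     = (\<Sum>l\<le>N. col_value L l i u * conn_value L l j u)"
proof -
  note L0 = admissible_nonzero[OF L]
  have tc: "(\<lambda>u. theta_q q (L * u)) holomorphic_on - {0}" "(\<lambda>u. theta_q q (- (u / beN))) holomorphic_on - {0}"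
    using theta_q_scaled_holomorphic[of L] theta_q_scaled_holomorphic[of "- (1 / beN)"] L0 by auto
  define S where "S = {u :: complex. 0 < norm u \<and> norm u < norm beN}"
  define A where "A = {u. q * norm beN < norm u \<and> norm u < norm beN} \<inter> {u \<in> - {0}. theta_q q (L * u) \<in> - {0}}"
  have "open (- {0} \<inter> (\<lambda>u. theta_q q (L * u)) -` (- {0}))"
    by (rule continuous_open_preimage[OF holomorphic_on_imp_continuous_on[OF tc(1)]]) auto
  moreover have "open {u :: complex. q * norm beN < norm u \<and> norm u < norm beN}"
    by (intro open_Collect_conj open_Collect_less continuous_intros)
  moreover have "A = {u. q * norm beN < norm u \<and> norm u < norm beN} \<inter> (- {0} \<inter> (\<lambda>u. theta_q q (L * u)) -` (- {0}))"
    by (auto simp: A_def)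
  ultimately have oA: "open A" by auto
  have oS: "open S" unfolding S_def by (intro open_Collect_conj open_Collect_less continuous_intros)
  have cS: "connected S"
  proof -
    have "S = ball 0 (norm beN) - {0}" by (auto simp: S_def)
    moreover have "connected (ball (0::complex) (norm beN) - {0})" by (rule connected_open_delete) auto
    ultimately show ?thesis by (simp only:)
  qed
  have AS: "A \<subseteq> S" using q by (auto simp: A_def S_def intro: le_less_trans[rotated])
  have ne: "A \<noteq> {}"
  proof -
    \<comment> \<open>The witness u = t / L makes L u positive, whereas zeros of theta are negative;
      its modulus is the middle radius of the annulus.\<close>
    define t where "t = norm beN * ((q + 1) / 2) * norm L"
    have t: "t > 0" using q L0 by (simp add: t_def)
    have "theta_q q (L * (of_real t / L)) \<noteq> 0"
    proof
      assume "theta_q q (L * (of_real t / L)) = 0"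
      then obtain k :: int where "complex_of_real t = - (of_real q powi k)" using theta_q_eq_0_iff[OF q, of "of_real t"] t L0 by auto
      then have "complex_of_real t = of_real (- (q powi k))" by simp
      then have "t = - (q powi k)" by (simp only: of_real_eq_iff)
      moreover have "q powi k > 0" using q by simp
      ultimately show False using t by simp
    qed
    moreover have nt: "norm (of_real t / L) = norm beN * ((q + 1) / 2)"
      unfolding norm_divide norm_of_real using t L0 by (simp add: abs_of_pos) (simp add: t_def)
    moreover have "q * norm beN < norm beN * ((q + 1) / 2)" "norm beN * ((q + 1) / 2) < norm beN" using q by (auto simp: field_simps)
    ultimately have "of_real t / L \<in> A" unfolding A_def Int_iff mem_Collect_eq nt using t L0 by auto
    then show ?thesis by blast
  qed
  have hS: "S \<subseteq> - {0}" by (auto simp: S_def)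
  show ?thesis
  proof (rule analytic_continuation_open[OF oA oS ne cS AS, of "\<lambda>u. laurent_sum (psi_ext j i) u * (theta_q q (L * u) * theta_q q (- (u / beN)))" "\<lambda>u. \<Sum>l\<le>N. col_value L l i u * conn_value L l j u"])
    show "(\<lambda>u. laurent_sum (psi_ext j i) u * (theta_q q (L * u) * theta_q q (- (u / beN)))) holomorphic_on S"
      by (intro holomorphic_on_mult laurent_sum_psi_holomorphic[OF j i, folded S_def]
          holomorphic_on_subset[OF tc(1) hS] holomorphic_on_subset[OF tc(2) hS])
    show "(\<lambda>u. \<Sum>l\<le>N. col_value L l i u * conn_value L l j u) holomorphic_on S"
      by (intro holomorphic_on_sum holomorphic_on_mult holomorphic_on_subset[OF col_value_holomorphic[OF L i] hS]
          holomorphic_on_subset[OF conn_value_holomorphic[OF L j] hS]) auto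
    show "u \<in> S" using u by (auto simp: S_def)
  next
    fix v assume v: "v \<in> A"
    then have v1: "q * norm beN < norm v" "norm v < norm beN" and th: "theta_q q (L * v) \<noteq> 0" by (auto simp: A_def)
    have r: "(\<Sum>k\<le>N. row_value L l k v * laurent_sum (psi_ext j k) v) * theta_q q (- (v / beN)) = conn_value L l j v"
      if "l \<le> N" for l
      using eta_psi_pairing[OF _ j v1, of l] mrow_psi_pairing[OF L j v1] by (auto simp: row_value_def conn_value_def)
    show "laurent_sum (psi_ext j i) v * (theta_q q (L * v) * theta_q q (- (v / beN))) = (\<Sum>l\<le>N. col_value L l i v * conn_value L l j v)"
    proof -
      have "laurent_sum (psi_ext j i) v * (theta_q q (L * v) * theta_q q (- (v / beN)))
        = (\<Sum>l\<le>N. col_value L l i v * (\<Sum>k\<le>N. row_value L l k v * laurent_sum (psi_ext j k) v)) * theta_q q (- (v / beN))"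
        unfolding mult.assoc[symmetric]
        by (rule arg_cong[where f = "\<lambda>x. x * _"]) (rule expand_in_columns[OF L v1(1) th i, unfolded mult.assoc[symmetric]])
      also have "\<dots> = (\<Sum>l\<le>N. col_value L l i v * conn_value L l j v)"
        unfolding sum_distrib_right by (intro sum.cong refl) (simp only: mult.assoc r atMost_iff)
      finally show ?thesis .
    qed
  qed
qed

section \<open>Linear independence of the columns\<close>

lemma col_value_qshift:
  assumes L: "admissible L" and l: "l \<le> N" and u: "u \<noteq> 0"
  defines "w \<equiv> (if l < N then be l * L else - 1)"
  shows "i < N \<Longrightarrow> w * u * col_value L l i (Q * u) = be i * col_value L l i u - a i * col_value L l N u"
    and "w * u * col_value L l N (Q * u) = (d - u) * col_value L l N u - (\<Sum>i<N. b i * col_value L l i u)"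
proof -
  define c where "c = (if l < N then Lcol L l else ycol_ext)"
  have cv: "col_value L l i = laurent_sum (c i)" for i by (auto simp: col_value_def c_def)
  have cs: "laurent_summable (c i) u" if "i \<le> N" "u \<noteq> 0" for i u
    using Lcol_summable[OF L _ that] ycol_ext_summable[OF that] by (auto simp: c_def)
  have c: "col_solution w c" using Lcol_col[OF L] ycol_ext_col by (auto simp: c_def w_def)
  have sh: "laurent_sum (\<lambda>m. w * (c i (m - 1) * Q powi (m - 1))) u = w * u * laurent_sum (c i) (Q * u)" if "i \<le> N" for i
  proof -
    have "laurent_summable (\<lambda>m. c i m * Q powi m) u" unfolding laurent_sum_scale using cs that u by simp
    note 1 = laurent_sum_shift[OF this u]
    show ?thesis unfolding laurent_sum_cmult(2)[OF 1(1)] 1(2) laurent_sum_scale by simp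
  qed
  have s1: "laurent_summable (\<lambda>m. k * c i m) u" if "i \<le> N" for i k by (rule laurent_sum_cmult(1)[OF cs[OF that u]])
  {
    assume i: "i < N"
    have "laurent_sum (\<lambda>m. w * (c i (m - 1) * Q powi (m - 1))) u = laurent_sum (\<lambda>m. be i * c i m - a i * c N m) u"
      using c i by (intro arg_cong[of _ _ "\<lambda>f. laurent_sum f u"] ext) (simp add: col_solution_def mult_ac)
    also have "\<dots> = be i * laurent_sum (c i) u - a i * laurent_sum (c N) u"
      using i by (simp add: laurent_sum_diff[OF s1 s1] laurent_sum_cmult(2)[OF cs[OF _ u]])
    finally show "w * u * col_value L l i (Q * u) = be i * col_value L l i u - a i * col_value L l N u"
      using sh i by (simp add: cv)
  }
  have s2: "laurent_summable (\<lambda>m. \<Sum>i<N. b i * c i m) u" by (rule laurent_sum_sum(1)) (use s1 in auto)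
  have "laurent_sum (\<lambda>m. w * (c N (m - 1) * Q powi (m - 1))) u
      = laurent_sum (\<lambda>m. (d * c N m - (\<Sum>i<N. b i * c i m)) - c N (m - 1)) u"
    using c by (intro arg_cong[of _ _ "\<lambda>f. laurent_sum f u"] ext) (simp add: col_solution_def mult_ac)
  also have "\<dots> = d * laurent_sum (c N) u - (\<Sum>i<N. b i * laurent_sum (c i) u) - u * laurent_sum (c N) u"
  proof -
    have "laurent_sum (\<lambda>m. \<Sum>i<N. b i * c i m) u = (\<Sum>i<N. laurent_sum (\<lambda>m. b i * c i m) u)"
      by (rule laurent_sum_sum(2)) (use s1 in auto)
    also have "\<dots> = (\<Sum>i<N. b i * laurent_sum (c i) u)"
      by (intro sum.cong refl laurent_sum_cmult(2) cs u) auto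
    finally show ?thesis
      using s1 s2 laurent_sum_shift[OF cs[OF order_refl u] u] cs u
      by (simp add: laurent_sum_diff laurent_sum_cmult(2))
  qed
  finally show "w * u * col_value L l N (Q * u) = (d - u) * col_value L l N u - (\<Sum>i<N. b i * col_value L l i u)"
    using sh[of N] by (simp add: cv algebra_simps)
qed

text \<open>This provides the uniqueness on which the definition of the connection matrix relies.
  For large u the rows invert the columns. Smaller points are reached by induction: a relation at u
  = q u' is the image under B - u' E of a relation at u', and this matrix is invertible for u'
  different from beN, which is guaranteed by theta(- u / beN) being nonzero.\<close>

lemma col_value_independent:
  assumes L: "admissible L" and u: "u \<noteq> 0" and th: "theta_q q (L * u) \<noteq> 0" and thb: "theta_q q (- (u / beN)) \<noteq> 0"
    and v: "\<And>i. i \<le> N \<Longrightarrow> (\<Sum>l\<le>N. col_value L l i u * v l) = 0" and l: "l \<le> N"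
  shows "v l = 0"
proof -
  note L0 = admissible_nonzero[OF L]
  obtain s where s: "q ^ s < norm u / (q * norm beN)"
    using real_arch_pow_inv[of "norm u / (q * norm beN)" q] u q by auto
  have "v l = 0" if "q * norm beN * q ^ s < norm u" "u \<noteq> 0" "theta_q q (L * u) \<noteq> 0" "theta_q q (- (u / beN)) \<noteq> 0"
    "\<And>i. i \<le> N \<Longrightarrow> (\<Sum>l\<le>N. col_value L l i u * v l) = 0" "l \<le> N" for u v l
    using that
  proof (induction s arbitrary: u v l)
    case 0
    then have u: "q * norm beN < norm u" by simp
    have "(\<Sum>i\<le>N. row_value L l i u * (\<Sum>k\<le>N. col_value L k i u * v k)) = 0" using 0 by simp
    then have "(\<Sum>k\<le>N. (\<Sum>i\<le>N. row_value L l i u * col_value L k i u) * v k) = 0"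
      unfolding sum_distrib_left sum_distrib_right by (subst sum.swap) (simp add: mult_ac)
    moreover have "(\<Sum>k\<le>N. (\<Sum>i\<le>N. row_value L l i u * col_value L k i u) * v k)
        = (\<Sum>k\<le>N. if k = l then theta_q q (L * u) * v l else 0)"
      by (rule sum.cong[OF refl]) (subst row_col_sum[OF L \<open>l \<le> N\<close> _ u], auto)
    ultimately show ?case using 0 by simp
  next
    case (Suc s)
    define u' where "u' = u / Q"
    have Qu: "Q * u' = u" and u0: "u' \<noteq> 0" using Suc.prems by (auto simp: u'_def)
    \<comment> \<open>Each column has its own multiplier in the q-shift, so the coefficients of the
      relation are divided by \<open>w l\<close> when it is transported to u'.\<close>
    define w where "w = (\<lambda>l. if l < N then be l * L else - 1)"
    have w0: "w l \<noteq> 0" if "l \<le> N" for l using be_nonzero L0 by (auto simp: w_def)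
    have canc: "w * u * x * (y / w) = u * (x * y)" if "w \<noteq> 0" for w u x y :: complex using that by simp
    define t where "t = (\<lambda>i. \<Sum>l\<le>N. col_value L l i u' * (v l / w l))"
    have nb: "u' \<noteq> beN"
    proof
      assume "u' = beN"
      then have "- (u / beN) = - (Q powi 1)" using Qu by (metis beN_nonzero nonzero_mult_div_cancel_right power_int_1_right)
      then show False using Suc.prems(4) theta_q_eq_0_iff[OF q, of "- (u / beN)"] Suc.prems(2)
        by (metis beN_nonzero divide_eq_0_iff neg_equal_0_iff_equal)
    qed
    have e1: "be i * t i - a i * t N = 0" if i: "i < N" for i
    proof -
      have "be i * t i - a i * t N = (\<Sum>l\<le>N. (be i * col_value L l i u' - a i * col_value L l N u') * (v l / w l))"
        unfolding t_def sum_distrib_left sum_subtractf[symmetric] by (simp only: left_diff_distrib mult.assoc)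
      also have "\<dots> = (\<Sum>l\<le>N. u' * (col_value L l i u * v l))"
      proof (intro sum.cong refl)
        fix l assume "l \<in> {..N}"
        then show "(be i * col_value L l i u' - a i * col_value L l N u') * (v l / w l) = u' * (col_value L l i u * v l)"
          using col_value_qshift(1)[OF L _ u0 i, of l, folded w_def[THEN fun_cong]] w0[of l] unfolding Qu by (auto simp: canc dest!: sym[of "_ * u' * _"])
      qed
      also have "\<dots> = 0" using Suc.prems(5)[of i] i by (simp add: sum_distrib_left[symmetric])
      finally show ?thesis .
    qed
    have e2: "(d - u') * t N - (\<Sum>i<N. b i * t i) = 0"
    proof -
      have bb: "(\<Sum>i<N. b i * t i) = (\<Sum>l\<le>N. (\<Sum>i<N. b i * col_value L l i u') * (v l / w l))"
        unfolding t_def sum_distrib_left sum_distrib_right by (subst sum.swap) (simp only: mult.assoc)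
      have bt: "(d - u') * t N = (\<Sum>l\<le>N. (d - u') * col_value L l N u' * (v l / w l))"
        unfolding t_def sum_distrib_left by (simp only: mult.assoc)
      have "(d - u') * t N - (\<Sum>i<N. b i * t i)
          = (\<Sum>l\<le>N. ((d - u') * col_value L l N u' - (\<Sum>i<N. b i * col_value L l i u')) * (v l / w l))"
        unfolding bb bt sum_subtractf[symmetric] by (simp only: left_diff_distrib)
      also have "\<dots> = (\<Sum>l\<le>N. u' * (col_value L l N u * v l))"
      proof (intro sum.cong refl)
        fix l assume "l \<in> {..N}"
        then show "((d - u') * col_value L l N u' - (\<Sum>i<N. b i * col_value L l i u')) * (v l / w l) = u' * (col_value L l N u * v l)"
          using col_value_qshift(2)[OF L _ u0, of l, folded w_def[THEN fun_cong]] w0[of l] unfolding Qu by (auto simp: canc dest!: sym[of "_ * u' * _"])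
      qed
      also have "\<dots> = 0" using Suc.prems(5)[of N] by (simp add: sum_distrib_left[symmetric])
      finally show ?thesis .
    qed
    have ti: "t i = a i / be i * t N" if "i < N" for i using e1[OF that] be_nonzero[OF that] by (simp add: field_simps)
    have "(\<Sum>i<N. b i * t i) = (\<Sum>i<N. a i * b i / be i) * t N"
      unfolding sum_distrib_right by (intro sum.cong refl) (simp add: ti)
    moreover have "d - (\<Sum>i<N. a i * b i / be i) = beN" using D_eq[of 0] be_nonzero D_0 by simp
    ultimately have "(beN - u') * t N = 0"
      using e2 by (simp add: algebra_simps flip: \<open>d - (\<Sum>i<N. a i * b i / be i) = beN\<close>)
    then have "t N = 0" using nb by simp
    then have tz: "t i = 0" if "i \<le> N" for i using ti[of i] that by (cases "i = N") auto
    have qm: "theta_q q (L * u') \<noteq> 0" "theta_q q (- (u' / beN)) \<noteq> 0"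
    proof -
      have "theta_q q (Q * (L * u')) \<noteq> 0" using Suc.prems(3) unfolding Qu[symmetric] by (simp add: mult_ac)
      then show "theta_q q (L * u') \<noteq> 0" using theta_q_shift[OF q, of "L * u'"] L0 u0 by auto
      have "Q * - (u' / beN) = - (u / beN)" using Qu by auto
      then have "theta_q q (Q * - (u' / beN)) \<noteq> 0" using Suc.prems(4) by metis
      then show "theta_q q (- (u' / beN)) \<noteq> 0" using theta_q_shift[OF q, of "- (u' / beN)"] u0 by auto
    qed
    have "v l / w l = 0"
    proof (rule Suc.IH[OF _ u0 qm _ \<open>l \<le> N\<close>])
      show "q * norm beN * q ^ s < norm u'" using Suc.prems(1) q by (simp add: u'_def norm_divide field_simps)
      show "(\<Sum>l\<le>N. col_value L l i u' * (v l / w l)) = 0" if "i \<le> N" for i using tz[OF that] by (simp add: t_def)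
    qed
    then show ?case using w0[OF \<open>l \<le> N\<close>] by simp
  qed
  moreover have "q * norm beN * q ^ s < norm u" using s q by (simp add: field_simps)
  ultimately show ?thesis using u th thb v l by blast
qed

end

section \<open>Meromorphic continuation and q-summation\<close>

text \<open>The difference with its singularities removed vanishes identically on the connected set,
  so both functions agree near every point apart from the point itself. The prescribed values at
  poles and removable singularities settle the point.\<close>

lemma nicely_meromorphic_eqI:
  assumes f: "f nicely_meromorphic_on A" and g: "g nicely_meromorphic_on A" and A: "open A" "connected A"
    and z0: "z0 \<in> A" "\<exists>\<^sub>F z in at z0. f z = g z" and w: "w \<in> A"
  shows "f w = g w"
proof -
  have mero: "f meromorphic_on A" "g meromorphic_on A" using f g by (auto simp: nicely_meromorphic_on_def)
  then have m: "(\<lambda>z. f z - g z) meromorphic_on A" by (intro meromorphic_intros)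
  have ev: "\<forall>\<^sub>F z in at x. remove_sings (\<lambda>z. f z - g z) z = f z - g z" if "x \<in> A" for x
    by (rule eventually_remove_sings_eq_at) (use m that in \<open>meson meromorphic_on_isolated_singularity meromorphic_on_meromorphic_at\<close>)
  have "\<exists>\<^sub>F z in at z0. remove_sings (\<lambda>z. f z - g z) z = 0"
    by (rule frequently_rev_mp[OF z0(2)]) (use ev[OF z0(1)] in \<open>auto elim!: eventually_mono\<close>)
  then have z: "remove_sings (\<lambda>z. f z - g z) x = 0" if "x \<in> A" for x
    using frequently_eq_meromorphic_imp_constant[OF _ remove_sings_nicely_meromorphic[OF m] A z0(1)] that by blast
  have "\<forall>\<^sub>F x in at w. x \<in> A" using eventually_at_in_open'[OF A(1) w] .
  with ev[OF w] have eq: "\<forall>\<^sub>F x in at w. f x = g x" by eventually_elim (use z in auto)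
  have "is_pole f w \<longleftrightarrow> is_pole g w" by (rule is_pole_cong[OF eq refl])
  moreover have "is_pole f w \<and> f w = 0 \<or> f \<midarrow>w\<rightarrow> f w" "is_pole g w \<and> g w = 0 \<or> g \<midarrow>w\<rightarrow> g w"
    using f g w by (auto simp: nicely_meromorphic_on_def)
  moreover have "\<not> is_pole h w" if "h \<midarrow>w\<rightarrow> h w" for h :: "complex \<Rightarrow> complex"
    using that by (metis at_neq_bot not_tendsto_and_filterlim_at_infinity is_pole_def)
  moreover have "f w = g w" if "f \<midarrow>w\<rightarrow> f w" "g \<midarrow>w\<rightarrow> g w"
    using that tendsto_cong[OF eq] LIM_unique by blast
  ultimately show ?thesis by metis
qed

lemma q_hyp_eqI:
  assumes F: "F nicely_meromorphic_on UNIV" "\<And>x. norm x < 1 \<Longrightarrow> (\<lambda>k. q_hyp_coeff as bs q k * x ^ k) sums F x"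
  shows "q_hyp as bs q = F"
  unfolding q_hyp_def
proof (rule the_equality)
  fix G assume G: "G nicely_meromorphic_on UNIV \<and> (\<forall>x. norm x < 1 \<longrightarrow> (\<lambda>k. q_hyp_coeff as bs q k * x ^ k) sums G x)"
  have "\<forall>\<^sub>F x in at (0 :: complex). x \<in> ball 0 1" by (rule eventually_at_in_open') auto
  then have "\<forall>\<^sub>F x in at 0. G x = F x" by eventually_elim (use G F(2) sums_unique2 in fastforce)
  then have "\<exists>\<^sub>F x in at 0. G x = F x" by (rule eventually_frequently[rotated]) simp
  then show "G = F" using nicely_meromorphic_eqI[of G UNIV F 0] F(1) G by auto
qed (use F in auto)

text \<open>Two descriptions are glued: \<open>f\<close> on the disc, holomorphic even where
  \<open>h\<close> vanishes, and \<open>g / h\<close> on the punctured plane, meromorphic because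
  \<open>h\<close> does not vanish identically. Off the zeros of \<open>h\<close> they agree on the
  overlap.\<close>

lemma power_series_quotient_continuation:
  fixes f g h :: "complex \<Rightarrow> complex"
  assumes f: "f holomorphic_on ball 0 R" and R: "R > 0" and g: "g holomorphic_on - {0}" and h: "h holomorphic_on - {0}"
    and h0: "w0 \<noteq> 0" "h w0 \<noteq> 0" and eq: "\<And>u. u \<noteq> 0 \<Longrightarrow> norm u < R \<Longrightarrow> f u * h u = g u"
  obtains F where "F nicely_meromorphic_on UNIV" "\<And>u. norm u < R \<Longrightarrow> F u = f u"
    "\<And>u. u \<noteq> 0 \<Longrightarrow> h u \<noteq> 0 \<Longrightarrow> F u * h u = g u"
proof -
  define F where "F = (\<lambda>u. if norm u < R then f u else g u / h u)"
  have con: "connected (- {0 :: complex})" by (rule connected_punctured_universe) simp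
  have an: "f analytic_on {u}" if "norm u < R" for u
    unfolding analytic_at using f that by (intro exI[of _ "ball 0 R"]) simp
  have F1: "F analytic_on {u}" if u: "norm u < R" for u
  proof -
    have "\<forall>\<^sub>F v in nhds u. v \<in> ball 0 R" using u by (intro eventually_nhds_in_open) auto
    then have "\<forall>\<^sub>F v in nhds u. F v = f v" by eventually_elim (auto simp: F_def)
    then show ?thesis using an[OF u] analytic_at_cong by blast
  qed
  have hn: "\<forall>\<^sub>F v in at u. h v \<noteq> 0" if u: "u \<noteq> 0" for u
  proof -
    have "\<forall>\<^sub>F v in at u. h v \<noteq> 0 \<and> v \<in> - {0}"
      by (rule non_zero_neighbour_alt[OF h _ con, of u w0]) (use u h0 in auto)
    then show ?thesis by eventually_elim simp
  qed
  have Fq: "F v = g v / h v" if "v \<noteq> 0" "h v \<noteq> 0" for v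
    using eq[of v] that by (auto simp: F_def field_simps)
  have F2: "F analytic_on {u}" if u: "u \<noteq> 0" "h u \<noteq> 0" for u
  proof -
    have hu: "h analytic_on {u}" "g analytic_on {u}" using g h u(1) by (auto simp: analytic_at intro!: exI[of _ "- {0}"])
    have "isCont h u" using hu(1) by (rule analytic_at_imp_isCont)
    then have "\<forall>\<^sub>F v in at u. h v \<noteq> 0" using u(2) unfolding isCont_def by (rule tendsto_imp_eventually_ne)
    then have "\<forall>\<^sub>F v in nhds u. h v \<noteq> 0" using u(2) by (simp add: eventually_nhds_conv_at)
    moreover have "\<forall>\<^sub>F v in nhds u. v \<in> - {0}" using u by (intro eventually_nhds_in_open) auto
    ultimately have "\<forall>\<^sub>F v in nhds u. F v = g v / h v" by eventually_elim (use Fq in auto)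
    moreover have "(\<lambda>v. g v / h v) analytic_on {u}" using hu u by (intro analytic_intros) auto
    ultimately show ?thesis by (subst analytic_at_cong) auto
  qed
  have "F meromorphic_on UNIV"
  proof -
    have "F meromorphic_on {u}" for u
    proof (cases "norm u < R")
      case True then show ?thesis using F1 analytic_on_imp_meromorphic_on by blast
    next
      case False
      then have u: "u \<noteq> 0" using R by auto
      have "(\<lambda>v. g v / h v) meromorphic_on {u}"
        using g h u by (intro meromorphic_intros analytic_on_imp_meromorphic_on) (auto simp: analytic_at intro!: exI[of _ "- {0}"])
      moreover have "\<forall>\<^sub>F v in at u. v \<in> - {0}" using u by (intro eventually_at_in_open') auto
      with hn[OF u] have "\<forall>\<^sub>F v in at u. F v = g v / h v" by eventually_elim (use Fq in auto)
      ultimately show ?thesis by (subst meromorphic_on_cong) auto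
    qed
    then show ?thesis using meromorphic_on_meromorphic_at by blast
  qed
  then have "remove_sings F nicely_meromorphic_on UNIV" by (rule remove_sings_nicely_meromorphic)
  moreover have "remove_sings F u = f u" if "norm u < R" for u
    using remove_sings_at_analytic[OF F1[OF that]] that by (simp add: F_def)
  moreover have "remove_sings F u * h u = g u" if "u \<noteq> 0" "h u \<noteq> 0" for u
    using remove_sings_at_analytic[OF F2[OF that]] Fq[OF that] that by simp
  ultimately show ?thesis using that by blast
qed

lemma theta_q_spiral:
  assumes "0 < q" "q < 1" "c \<noteq> 0" "z \<noteq> 0"
  shows "theta_q q (c * z) = 0 \<longleftrightarrow> (\<exists>k::int. z = - 1 / c * of_real q powi k)"
proof -
  have "c * z = - (of_real q powi k) \<longleftrightarrow> z = - 1 / c * of_real q powi k" for k :: int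
    using assms by (auto simp: field_simps)
  then show ?thesis using theta_q_eq_0_iff[OF assms(1,2), of "c * z"] assms by simp
qed

text \<open>Two neighbourhoods of the ray that are star-shaped about 0 intersect in a set of the
  same kind, which is connected. Both continuations have the same power series at 0 and are analytic
  at the sample points, so removing singularities does not change their values there.\<close>

lemma borel_continuation_unique:
  fixes m :: int
  assumes g: "is_borel_continuation q lam f g" and g': "is_borel_continuation q lam f g'" and q: "0 < q"
  shows "g (lam * of_real q powi m) = g' (lam * of_real q powi m)"
proof -
  obtain S where S: "open S" "\<And>t. t \<ge> 0 \<Longrightarrow> of_real t * lam \<in> S" "\<And>x. x \<in> S \<Longrightarrow> closed_segment 0 x \<subseteq> S" "g meromorphic_on S"
    using g unfolding is_borel_continuation_def by blast
  obtain S' where S': "open S'" "\<And>t. t \<ge> 0 \<Longrightarrow> of_real t * lam \<in> S'" "\<And>x. x \<in> S' \<Longrightarrow> closed_segment 0 x \<subseteq> S'" "g' meromorphic_on S'"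
    using g' unfolding is_borel_continuation_def by blast
  define T where "T = S \<inter> S'"
  have "0 \<in> T" using S(2)[of 0] S'(2)[of 0] by (simp add: T_def)
  moreover have "closed_segment 0 x \<subseteq> T" if "x \<in> T" for x using S(3)[of x] S'(3)[of x] that by (simp add: T_def)
  ultimately have "starlike T" unfolding starlike_def by blast
  then have T: "open T" "connected T" "0 \<in> T"
    using S S' S(2)[of 0] S'(2)[of 0] starlike_imp_connected by (auto simp: T_def)
  have m: "g meromorphic_on T" "g' meromorphic_on T" using S(4) S'(4) by (auto simp: T_def intro: meromorphic_on_subset)
  define x where "x = lam * of_real q powi m"
  have xT: "x \<in> T"
  proof -
    have "x = of_real (q powi m) * lam" by (simp add: x_def)
    then show ?thesis using S(2)[of "q powi m"] S'(2)[of "q powi m"] q by (simp add: T_def)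
  qed
  have "\<forall>\<^sub>F x in nhds 0. g x = g' x"
  proof -
    have "\<forall>\<^sub>F x in nhds 0. (\<lambda>m. fps_nth (q_borel q f) m * x ^ m) sums g x"
      "\<forall>\<^sub>F x in nhds 0. (\<lambda>m. fps_nth (q_borel q f) m * x ^ m) sums g' x"
      using g g' by (auto simp: is_borel_continuation_def)
    then show ?thesis by eventually_elim (rule sums_unique2)
  qed
  then have "\<forall>\<^sub>F x in at 0. g x = g' x" by (simp add: eventually_nhds_conv_at)
  moreover have "\<forall>\<^sub>F x in at 0. remove_sings g x = g x" "\<forall>\<^sub>F x in at 0. remove_sings g' x = g' x"
    using m T(3) by - (rule eventually_remove_sings_eq_at, meson meromorphic_on_isolated_singularity meromorphic_on_meromorphic_at)+
  ultimately have "\<forall>\<^sub>F x in at 0. remove_sings g x = remove_sings g' x" by eventually_elim simp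
  then have "\<exists>\<^sub>F x in at 0. remove_sings g x = remove_sings g' x" by (rule eventually_frequently[rotated]) simp
  then have "remove_sings g x = remove_sings g' x"
    using nicely_meromorphic_eqI[OF remove_sings_nicely_meromorphic[OF m(1)] remove_sings_nicely_meromorphic[OF m(2)] T(1,2,3)] xT by blast
  then show ?thesis using g g' by (auto simp: is_borel_continuation_def x_def)
qed

text \<open>Any two candidates are built from Borel continuations with equal values on the spiral,
  so they coincide for large z off the zeros of theta, and then on the connected punctured
  plane.\<close>

lemma q_sum_eqI:
  assumes q: "0 < q" "q < 1" and lam: "lam \<noteq> 0" and F: "is_q_sum q lam f F" and z: "z \<noteq> 0"
  shows "q_sum q lam f z = F z"
  unfolding q_sum_def
proof (rule the_equality)
  fix v assume "\<exists>F'. is_q_sum q lam f F' \<and> v = F' z"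
  then obtain F' where F': "is_q_sum q lam f F'" "v = F' z" by blast
  let ?sum = "\<lambda>g F. \<forall>\<^sub>F z in at_infinity. (\<forall>k::int. z \<noteq> - 1 / lam * of_real q powi k) \<longrightarrow>
           ((\<lambda>m::int. g (lam * of_real q powi m) / theta_q q (lam * of_real q powi m * z)) has_sum F z) UNIV"
  from F obtain g where g: "is_borel_continuation q lam f g" "?sum g F" unfolding is_q_sum_def by blast
  from F' obtain g' where g': "is_borel_continuation q lam f g'" "?sum g' F'" unfolding is_q_sum_def by blast
  have gg: "g' (lam * of_real q powi m) = g (lam * of_real q powi m)" for m :: int
    by (rule borel_continuation_unique[OF g'(1) g(1) q(1)])
  have "\<forall>\<^sub>F z in at_infinity. (\<forall>k::int. z \<noteq> - 1 / lam * of_real q powi k) \<longrightarrow> F' z = F z"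
    using g(2) g'(2) unfolding gg by eventually_elim (use has_sum_unique in blast)
  then obtain R where R: "\<And>z. norm z \<ge> R \<Longrightarrow> (\<forall>k::int. z \<noteq> - 1 / lam * of_real q powi k) \<Longrightarrow> F' z = F z"
    unfolding eventually_at_infinity by blast
  \<comment> \<open>With lam z0 = t positive, z0 avoids the zeros of theta(lam z), and the second
    entry of the maximum pushes it beyond \<open>R\<close>.\<close>
  define t where "t = max 1 (norm lam * (R + 1))"
  define z0 where "z0 = of_real t / lam"
  have t: "t > 0" "norm lam * (R + 1) \<le> t" by (auto simp: t_def)
  have z0: "z0 \<noteq> 0" "norm z0 > R"
  proof -
    have "norm z0 = t / norm lam" using t by (simp add: z0_def norm_divide)
    moreover have "R + 1 \<le> t / norm lam" using t lam by (simp add: field_simps)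
    ultimately show "norm z0 > R" by linarith
  qed (use t lam in \<open>auto simp: z0_def\<close>)
  have "theta_q q (lam * z0) \<noteq> 0"
  proof
    assume "theta_q q (lam * z0) = 0"
    then obtain k :: int where "lam * z0 = - (of_real q powi k)" using theta_q_eq_0_iff[OF q, of "lam * z0"] z0 lam by auto
    then have "complex_of_real t = of_real (- (q powi k))" using lam by (simp add: z0_def)
    then have "t = - (q powi k)" by (simp only: of_real_eq_iff)
    moreover have "q powi k > 0" using q by simp
    ultimately show False using t by simp
  qed
  moreover have "isCont (\<lambda>z. theta_q q (lam * z)) z0"
  proof -
    have "(\<lambda>z. theta_q q (lam * z)) holomorphic_on - {0}"
      using holomorphic_on_compose_gen[OF _ theta_q_holomorphic[OF q], of "\<lambda>u. lam * u" "- {0}"] lam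
      by (force simp: o_def intro: holomorphic_intros)
    then show ?thesis using z0 by (metis ComplI continuous_on_eq_continuous_at holomorphic_on_imp_continuous_on open_Compl closed_singleton singletonD)
  qed
  ultimately have "\<forall>\<^sub>F z in at z0. theta_q q (lam * z) \<noteq> 0" unfolding isCont_def by (rule tendsto_imp_eventually_ne[rotated])
  moreover have "\<forall>\<^sub>F z in at z0. z \<in> {z. norm z > R} \<inter> - {0}"
    by (rule eventually_at_in_open'[OF open_Int]) (use z0 in \<open>auto intro!: open_Collect_less continuous_intros\<close>)
  ultimately have "\<forall>\<^sub>F z in at z0. F' z = F z"
    by eventually_elim (use R theta_q_spiral[OF q lam] in force)
  then have "\<exists>\<^sub>F z in at z0. F' z = F z" by (rule eventually_frequently[rotated]) simp
  then have "F' z = F z"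
    using nicely_meromorphic_eqI[of F' "- {0}" F z0 z] F F'(1) z z0 connected_punctured_universe[of "0 :: complex"]
    by (auto simp: is_q_sum_def)
  then show "v = F z" using F'(2) by simp
qed (use F in blast)

text \<open>
  For a convergent series the order of summation can be exchanged, and
  \<open>\<Sum>\<^sub>m (lam q\<^sup>m)\<^sup>k q\<^bsup>k(k-1)/2\<^esup> / \<theta>(lam q\<^sup>m z) = z\<^sup>-\<^sup>k\<close> by the shift property of \<open>\<theta>\<close>.
\<close>

lemma is_q_sum_convergent:
  assumes q: "0 < q" "q < 1" and lam: "lam \<noteq> 0" and F: "F nicely_meromorphic_on - {0}"
    and c: "\<And>m. norm (fps_nth f m) \<le> C * K ^ m" "K > 0"
    and s: "\<And>z. norm z > R \<Longrightarrow> (\<lambda>m. fps_nth f m * inverse z ^ m) sums F z"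
  shows "is_q_sum q lam f F"
proof -
  let ?Q = "complex_of_real q"
  have C: "C \<ge> 0" using c(1)[of 0] order.trans[OF norm_ge_zero] by simp
  have trn: "tri (int k) = int (k * (k - 1) div 2)" for k by (rule tri_nat)
  have cf: "fps_nth (q_borel q f) m = fps_nth f m * ?Q powi tri (int m)" for m
    by (simp add: q_borel_def trn)
  define g where "g = (\<lambda>x. \<Sum>m. fps_nth (q_borel q f) m * x ^ m)"
  have sg: "summable (\<lambda>m. norm (fps_nth (q_borel q f) m * x ^ m))" for x
  proof -
    obtain C3 where C3: "C3 \<ge> 0" "\<And>k. (K * norm x) ^ k * q powi tri (int k) \<le> C3 * (1 / 2) ^ k"
      by (rule gauss_bound[of q "1/2" "K * norm x"]) (use q c in auto)
    have "summable (\<lambda>k. C * (C3 * (1 / 2) ^ k))" by (intro summable_mult summable_geometric) auto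
    then show ?thesis
    proof (rule summable_comparison_test'[where N = 0])
      fix k
      have "norm (fps_nth (q_borel q f) k * x ^ k) = norm (fps_nth f k) * (q powi tri (int k) * norm x ^ k)"
        using q by (simp add: cf norm_mult norm_power norm_power_int)
      also have "\<dots> \<le> C * K ^ k * (q powi tri (int k) * norm x ^ k)" by (rule mult_right_mono[OF c(1)]) (use q in auto)
      also have "\<dots> = C * ((K * norm x) ^ k * q powi tri (int k))" by (simp add: power_mult_distrib mult_ac)
      also have "\<dots> \<le> C * (C3 * (1 / 2) ^ k)" by (rule mult_left_mono[OF C3(2) C])
      finally show "norm (norm (fps_nth (q_borel q f) k * x ^ k)) \<le> C * (C3 * (1 / 2) ^ k)" by simp
    qed
  qed
  have gs: "(\<lambda>m. fps_nth (q_borel q f) m * x ^ m) sums g x" for x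
    unfolding g_def by (rule summable_sums[OF summable_norm_cancel[OF sg]])
  have gh: "((\<lambda>m. fps_nth (q_borel q f) m * x ^ m) has_sum g x) UNIV" for x
    by (rule norm_summable_imp_has_sum[OF sg gs])
  have "g holomorphic_on ball 0 r" for r
    by (rule power_series_holomorphic[of 0 r "fps_nth (q_borel q f)"]) (use gs in auto)
  then have ga: "g analytic_on {x}" for x
    unfolding analytic_at by (metis centre_in_ball dist_0_norm mem_ball open_ball less_add_one)
  have bc: "is_borel_continuation q lam f g"
    unfolding is_borel_continuation_def using gs ga
    by (intro conjI exI[of _ UNIV]) (auto intro!: analytic_on_imp_meromorphic_on simp: analytic_on_def)
  have "((\<lambda>m::int. g (lam * ?Q powi m) / theta_q q (lam * ?Q powi m * z)) has_sum F z) UNIV"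
    if z: "norm z \<ge> max R K + 1" and nz: "\<forall>k::int. z \<noteq> - 1 / lam * ?Q powi k" for z
  proof -
    have z0: "z \<noteq> 0" "norm z > R" "norm z > K" using z c by auto
    have th: "theta_q q (lam * z) \<noteq> 0" using theta_q_spiral[OF q lam z0(1)] nz by blast
    have fz: "((\<lambda>k. fps_nth f k * inverse z ^ k) has_sum F z) UNIV"
    proof (rule norm_summable_imp_has_sum[OF _ s[OF z0(2)]])
      have "summable (\<lambda>k. C * (K / norm z) ^ k)" by (intro summable_mult summable_geometric) (use z0 c in auto)
      then show "summable (\<lambda>k. norm (fps_nth f k * inverse z ^ k))"
      proof (rule summable_comparison_test'[where N = 0])
        fix k show "norm (norm (fps_nth f k * inverse z ^ k)) \<le> C * (K / norm z) ^ k"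
          using mult_right_mono[OF c(1)[of k], of "norm (inverse z ^ k)"]
          by (simp add: norm_mult norm_power norm_inverse divide_inverse power_inverse power_mult_distrib mult.assoc)
      qed
    qed
    have th_sum: "((\<lambda>m. theta_coeff q m * (lam * z) powi m) has_sum theta_q q (lam * z)) UNIV"
      unfolding theta_q_laurent by (rule laurent_has_sum[OF theta_summable[OF q]]) (use lam z0 in auto)
    have "((\<lambda>(k, m). (fps_nth f k * inverse z ^ k) * (theta_coeff q m * (lam * z) powi m))
        has_sum (F z * theta_q q (lam * z))) (UNIV \<times> UNIV)"
      by (rule has_sum_times[OF fz th_sum])
    also have "?this \<longleftrightarrow> ((\<lambda>(m, k). (fps_nth f k * inverse z ^ k) * (theta_coeff q (m + int k) * (lam * z) powi (m + int k)))
        has_sum (F z * theta_q q (lam * z))) (UNIV \<times> UNIV)"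
      by (rule has_sum_reindex_bij_witness[of _ "\<lambda>(m, k). (k, m + int k)" "\<lambda>(k, m). (m - int k, k)"]) auto
    finally have dbl: "((\<lambda>(m, k). (fps_nth f k * inverse z ^ k) * (theta_coeff q (m + int k) * (lam * z) powi (m + int k)))
        has_sum (F z * theta_q q (lam * z))) (UNIV \<times> UNIV)" .
    have "((\<lambda>m. ?Q powi tri m * (lam * z) powi m * g (lam * ?Q powi m)) has_sum (F z * theta_q q (lam * z))) UNIV"
    proof (rule has_sum_SigmaD[OF dbl])
      fix m :: int
      have e: "?Q powi tri m * (lam * z) powi m * (fps_nth (q_borel q f) k * (lam * ?Q powi m) ^ k)
        = (fps_nth f k * inverse z ^ k) * (theta_coeff q (m + int k) * (lam * z) powi (m + int k))" for k
      proof -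
        have "tri (m + int k) = tri m + tri (int k) + m * int k" by (rule tri_add)
        then have E1: "?Q powi tri (m + int k) = ?Q powi tri m * ?Q powi tri (int k) * (?Q powi m) ^ k"
          using q by (simp add: power_int_add power_int_mult)
        have E2: "(lam * z) powi (m + int k) = (lam * z) powi m * (lam ^ k * z ^ k)"
          using lam z0 by (simp add: power_int_add power_mult_distrib)
        have E3: "inverse z ^ k * z ^ k = 1" using z0 by (simp add: power_mult_distrib[symmetric])
        have E4: "A * P * (c * B * (l * X)) = c * I * (A * B * X * (P * (l * Z)))" if "I * Z = 1" for A P c B l X I Z :: complex
        proof -
          have "c * I * (A * B * X * (P * (l * Z))) = A * P * (c * B * (l * X)) * (I * Z)" by (simp only: mult_ac)
          then show ?thesis using that by simp
        qed
        show ?thesis unfolding cf theta_coeff_def power_mult_distrib E1 E2 by (rule E4[OF E3])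
      qed
      show "((\<lambda>k. case (m, k) of (m, k) \<Rightarrow> (fps_nth f k * inverse z ^ k) * (theta_coeff q (m + int k) * (lam * z) powi (m + int k)))
          has_sum (?Q powi tri m * (lam * z) powi m * g (lam * ?Q powi m))) UNIV"
        unfolding prod.case e[symmetric] by (rule has_sum_cmult_right[OF gh])
    qed
    then have "((\<lambda>m. ?Q powi tri m * (lam * z) powi m * g (lam * ?Q powi m) / theta_q q (lam * z)) has_sum
        (F z * theta_q q (lam * z) / theta_q q (lam * z))) UNIV" by (rule has_sum_divide_const)
    moreover have "?Q powi tri m * (lam * z) powi m * g (lam * ?Q powi m) / theta_q q (lam * z)
        = g (lam * ?Q powi m) / theta_q q (lam * ?Q powi m * z)" for m
    proof -
      have "theta_q q (lam * ?Q powi m * z) = ?Q powi (- tri m) * (lam * z) powi (- m) * theta_q q (lam * z)"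
        using theta_q_shift_powi[OF q, of "lam * z" m] lam z0 by (simp add: mult_ac)
      then show ?thesis by (simp add: power_int_minus field_simps)
    qed
    ultimately show ?thesis using th by simp
  qed
  then have "\<forall>\<^sub>F z in at_infinity. (\<forall>k::int. z \<noteq> - 1 / lam * ?Q powi k) \<longrightarrow>
      ((\<lambda>m::int. g (lam * ?Q powi m) / theta_q q (lam * ?Q powi m * z)) has_sum F z) UNIV"
    unfolding eventually_at_infinity by blast
  then show ?thesis unfolding is_q_sum_def using F bc by blast
qed

section \<open>The formal solution at infinity\<close>

lemma fps_to_fls_sum: "fps_to_fls (sum f A) = (\<Sum>x\<in>A. fps_to_fls (f x))"
  by (induction A rule: infinite_finite_induct) auto

text \<open>Multiplication by X = 1/z and by the denominator of the q-derivative leaves an identity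
  of power series. Its coefficient of degree 0 is a consequence of the initial condition; degree
  \<open>Suc m\<close> is the stated recurrence.\<close>

lemma is_formal_solution_iff:
  fixes M :: "complex mat"
  assumes q: "0 < q" "q < 1" and M: "M \<in> carrier_mat (Suc N) (Suc N)"
  defines "Q \<equiv> complex_of_real q"
  shows "is_formal_solution q (Suc N) M nu H \<longleftrightarrow> H \<in> carrier_mat (Suc N) (Suc N) \<and>
     (\<forall>i\<le>N. \<forall>j\<le>N. fps_nth (H $$ (i, j)) 0 = (if i = j then 1 else 0)) \<and>
     (\<forall>i\<le>N. \<forall>j\<le>N. \<forall>m. Q powr nu j * inverse Q ^ m * fps_nth (H $$ (i, j)) m
        - (if j < N then 0 else (1 - Q) * inverse Q ^ Suc m * fps_nth (H $$ (i, j)) (Suc m)) - fps_nth (H $$ (i, j)) m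
        = (Q - 1) * ((if i = N then fps_nth (H $$ (N, j)) (Suc m) else 0) + (\<Sum>k\<le>N. M $$ (i, k) * fps_nth (H $$ (k, j)) m)))"
    (is "_ \<longleftrightarrow> _ \<and> ?init \<and> ?rec")
proof -
  let ?W = "\<lambda>i j. twisted_q_deriv q (norm_multiplier q (Suc N) nu j) (fps_to_fls (H $$ (i, j)))"
  let ?A = "map_mat fls_const (E_last (Suc N)) + inverse fls_X_inv \<cdot>\<^sub>m map_mat fls_const M"
  have Q: "Q \<noteq> 0" "Q - 1 \<noteq> 0" using q by (auto simp: Q_def)
  define c where "c = (\<lambda>j. if j < N then 0 else (1 - Q) * Q powr (- nu j))"
  define Qs where "Qs = (\<lambda>F. Abs_fps (\<lambda>m. inverse Q ^ m * fps_nth F m))"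
  have key: "?W i j
       = (?A * map_mat fps_to_fls H) $$ (i, j)
     \<longleftrightarrow> (\<forall>p. (case p of 0 \<Rightarrow> - (Q powr nu j * c j * fps_nth (H $$ (i, j)) 0) = (Q - 1) * (if i = N then fps_nth (H $$ (N, j)) 0 else 0)
        | Suc m \<Rightarrow> Q powr nu j * (inverse Q ^ m * fps_nth (H $$ (i, j)) m - c j * (inverse Q ^ Suc m * fps_nth (H $$ (i, j)) (Suc m)))
          - fps_nth (H $$ (i, j)) m = (Q - 1) * ((if i = N then fps_nth (H $$ (N, j)) (Suc m) else 0) + (\<Sum>k\<le>N. M $$ (i, k) * fps_nth (H $$ (k, j)) m))))"
    if H: "H \<in> carrier_mat (Suc N) (Suc N)" and ij: "i \<le> N" "j \<le> N" for i j
  proof -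
    let ?F = "\<lambda>k. H $$ (k, j)"
    let ?S = "\<Sum>k\<le>N. (fls_const (if i = N \<and> k = N then 1 else 0) + fls_X * fls_const (M $$ (i, k))) * fps_to_fls (?F k)" and ?T = "\<Sum>k\<le>N. (fps_const (if i = N \<and> k = N then 1 else 0) + fps_X * fps_const (M $$ (i, k))) * ?F k" and ?L = "fps_const (Q powr nu j) * (fps_X * Qs (?F i) - fps_const (c j) * Qs (?F i)) - fps_X * ?F i"
    have qs: "fls_qshift q (fps_to_fls F) = fps_to_fls (Qs F)" for F :: "complex fps"
      using Q by (simp add: fls_qshift_def Qs_def Q_def[symmetric] fps_compose_linear)
    have mult: "norm_multiplier q (Suc N) nu j = fls_const (Q powr nu j) * (1 - fls_const (c j) * fls_X_inv)"
      by (auto simp: norm_multiplier_def c_def Q_def)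
    have rhs: "(?A * map_mat fps_to_fls H) $$ (i, j)
        = ?S"
    proof -
      have "(?A * map_mat fps_to_fls H) $$ (i, j) = (\<Sum>k\<le>N. ?A $$ (i, k) * map_mat fps_to_fls H $$ (k, j))"
        using H M ij by (subst index_mult_mat) (auto simp: scalar_prod_def atLeast0LessThan lessThan_Suc_atMost less_Suc_eq_le simp del: row_add intro!: sum.cong)
      also have "\<dots> = ?S"
        using H M ij by (intro sum.cong refl) (auto simp: E_last_def fls_inverse_X_inv)
      finally show ?thesis .
    qed
    have den: "fls_const (complex_of_real q) * fls_X_inv - fls_X_inv = fls_const (Q - 1) * fls_X_inv"
      by (simp only: Q_def fls_minus_const[symmetric] left_diff_distrib fls_const_1 mult_1)
    have den0: "fls_const (Q - 1) * fls_X_inv \<noteq> 0" using Q by simp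
    have XX: "fls_X * (fls_X_inv :: complex fls) = 1" by (metis fls_X_nonzero fls_inverse_X right_inverse)
    have "(?W i j
       = ?S)
      \<longleftrightarrow> fps_to_fls (Qs (?F i)) * (fls_const (Q powr nu j) * (1 - fls_const (c j) * fls_X_inv)) - fps_to_fls (?F i)
       = ?S * (fls_const (Q - 1) * fls_X_inv)"
      unfolding twisted_q_deriv_def qs mult den using den0 by (simp add: nonzero_divide_eq_eq)
    also have "\<dots> \<longleftrightarrow> fls_X * (fps_to_fls (Qs (?F i)) * (fls_const (Q powr nu j) * (1 - fls_const (c j) * fls_X_inv)) - fps_to_fls (?F i))
       = fls_X * (?S * (fls_const (Q - 1) * fls_X_inv))"
      by (simp only: mult_cancel_left fls_X_nonzero simp_thms)
    also have "fls_X * (fps_to_fls (Qs (?F i)) * (fls_const (Q powr nu j) * (1 - fls_const (c j) * fls_X_inv)) - fps_to_fls (?F i))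
       = fps_to_fls ?L"
    proof -
      have "X * (F * (C * (1 - D * Y)) - G) = C * (X * F - D * F) - X * G" if "X * Y = 1" for X Y F C D G :: "complex fls"
      proof -
        have "X * (F * (C * (1 - D * Y)) - G) = C * (X * F - D * F * (X * Y)) - X * G" by (simp add: algebra_simps)
        then show ?thesis using that by simp
      qed
      from this[OF XX] show ?thesis by (simp add: fls_times_fps_to_fls)
    qed
    also have "fls_X * (?S * (fls_const (Q - 1) * fls_X_inv))
       = fps_to_fls (fps_const (Q - 1) * ?T)"
    proof -
      have E: "X * (S * (C * Y)) = C * S" if "X * Y = 1" for X S C Y :: "complex fls"
      proof -
        have "X * (S * (C * Y)) = C * S * (X * Y)" by (simp add: algebra_simps)
        then show ?thesis using that by simp
      qed
      show ?thesis by (subst E[OF XX]) (simp add: fls_times_fps_to_fls fps_to_fls_sum)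
    qed
    also have "(fps_to_fls ?L
        = fps_to_fls (fps_const (Q - 1) * ?T))
      \<longleftrightarrow> (\<forall>p. fps_nth ?L p
        = fps_nth (fps_const (Q - 1) * ?T) p)"
      by (simp only: fps_to_fls_eq_iff fps_eq_iff)
    also have "\<dots> \<longleftrightarrow> (\<forall>p. (case p of 0 \<Rightarrow> - (Q powr nu j * c j * fps_nth (?F i) 0) = (Q - 1) * (if i = N then fps_nth (?F N) 0 else 0)
        | Suc m \<Rightarrow> Q powr nu j * (inverse Q ^ m * fps_nth (?F i) m - c j * (inverse Q ^ Suc m * fps_nth (?F i) (Suc m)))
          - fps_nth (?F i) m = (Q - 1) * ((if i = N then fps_nth (?F N) (Suc m) else 0) + (\<Sum>k\<le>N. M $$ (i, k) * fps_nth (?F k) m))))"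
    proof (intro all_cong1)
      fix p
      have del: "(\<Sum>k\<le>N. (if i = N \<and> k = N then 1 else 0) * f k) = (if i = N then f N else 0)" for f :: "nat \<Rightarrow> complex"
      proof -
        have "(\<Sum>k\<le>N. (if i = N \<and> k = N then 1 else 0) * f k) = (\<Sum>k\<le>N. if k = N then (if i = N then f N else 0) else 0)"
          by (intro sum.cong) auto
        then show ?thesis by simp
      qed
      have "fps_nth ?T p
        = (\<Sum>k\<le>N. (if i = N \<and> k = N then 1 else 0) * fps_nth (?F k) p) + (\<Sum>k\<le>N. case p of 0 \<Rightarrow> 0 | Suc m \<Rightarrow> M $$ (i, k) * fps_nth (?F k) m)"
        unfolding sum.distrib[symmetric] fps_sum_nth
        by (intro sum.cong refl) (auto simp: distrib_right mult.assoc split: nat.split)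
      then show "(fps_nth ?L p
        = fps_nth (fps_const (Q - 1) * ?T) p)
        \<longleftrightarrow> (case p of 0 \<Rightarrow> - (Q powr nu j * c j * fps_nth (?F i) 0) = (Q - 1) * (if i = N then fps_nth (?F N) 0 else 0)
        | Suc m \<Rightarrow> Q powr nu j * (inverse Q ^ m * fps_nth (?F i) m - c j * (inverse Q ^ Suc m * fps_nth (?F i) (Suc m)))
          - fps_nth (?F i) m = (Q - 1) * ((if i = N then fps_nth (?F N) (Suc m) else 0) + (\<Sum>k\<le>N. M $$ (i, k) * fps_nth (?F k) m)))"
        unfolding del by (cases p) (simp_all add: Qs_def mult.assoc del: power_Suc)
    qed
    finally show ?thesis unfolding rhs .
  qed
  have cj: "Q powr nu j * c j = (if j < N then 0 else 1 - Q)" for j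
    using Q by (simp add: c_def powr_minus)
  have eqm: "mat (Suc N) (Suc N) f = A \<longleftrightarrow> (\<forall>i\<le>N. \<forall>j\<le>N. f (i, j) = A $$ (i, j))"
    if "A \<in> carrier_mat (Suc N) (Suc N)" for f and A :: "'z mat"
  proof
    assume "\<forall>i\<le>N. \<forall>j\<le>N. f (i, j) = A $$ (i, j)"
    then show "mat (Suc N) (Suc N) f = A" using that by (intro eq_matI) (auto simp: less_Suc_eq_le)
  qed auto
  have init: "map_mat (\<lambda>f. fps_nth f 0) H = 1\<^sub>m (Suc N) \<longleftrightarrow> ?init" if H: "H \<in> carrier_mat (Suc N) (Suc N)"
  proof -
    have "map_mat (\<lambda>f. fps_nth f 0) H = mat (Suc N) (Suc N) (\<lambda>(i, j). fps_nth (H $$ (i, j)) 0)"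
      using H by (intro eq_matI) auto
    then show ?thesis by (simp add: eqm less_Suc_eq_le)
  qed
  have rec: "mat (Suc N) (Suc N) (\<lambda>(i, j). ?W i j)
       = ?A * map_mat fps_to_fls H \<longleftrightarrow> ?rec"
    if H: "H \<in> carrier_mat (Suc N) (Suc N)" and i: ?init
  proof -
    have "?A * map_mat fps_to_fls H \<in> carrier_mat (Suc N) (Suc N)"
      using H M by auto
    then have "mat (Suc N) (Suc N) (\<lambda>(i, j). ?W i j)
       = ?A * map_mat fps_to_fls H
      \<longleftrightarrow> (\<forall>i\<le>N. \<forall>j\<le>N. ?W i j
       = (?A * map_mat fps_to_fls H) $$ (i, j))"
      by (subst eqm) auto
    also have "\<dots> \<longleftrightarrow> ?rec"
    proof (intro all_cong1 imp_cong refl)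
      fix i j assume ij: "i \<le> N" "j \<le> N"
      have split: "(\<forall>p. case p of 0 \<Rightarrow> P | Suc m \<Rightarrow> R m) \<longleftrightarrow> P \<and> (\<forall>m. R m)" for P R
        by (metis nat.case nat.exhaust)
      have 0: "- (Q powr nu j * c j * fps_nth (H $$ (i, j)) 0) = (Q - 1) * (if i = N then fps_nth (H $$ (N, j)) 0 else 0)"
        using i ij by (auto simp: cj)
      have "Q powr nu j * (x - c j * y) = Q powr nu j * x - (if j < N then 0 else (1 - Q) * y)" for x y
        using cj[of j] by (auto simp: right_diff_distrib mult.assoc[symmetric])
      then show "?W i j
         = (?A * map_mat fps_to_fls H) $$ (i, j)
        \<longleftrightarrow> (\<forall>m. Q powr nu j * inverse Q ^ m * fps_nth (H $$ (i, j)) m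
        - (if j < N then 0 else (1 - Q) * inverse Q ^ Suc m * fps_nth (H $$ (i, j)) (Suc m)) - fps_nth (H $$ (i, j)) m
        = (Q - 1) * ((if i = N then fps_nth (H $$ (N, j)) (Suc m) else 0) + (\<Sum>k\<le>N. M $$ (i, k) * fps_nth (H $$ (k, j)) m)))"
        unfolding key[OF H ij] split using 0 by (simp add: mult.assoc del: power_Suc)
    qed
    finally show ?thesis .
  qed
  show ?thesis unfolding is_formal_solution_def using init rec by blast
qed

lemma quotient_nicely_meromorphic:
  fixes f g :: "complex \<Rightarrow> complex"
  assumes f: "f holomorphic_on - {0}" and g: "g holomorphic_on - {0}"
  obtains F where "F nicely_meromorphic_on - {0}" "\<And>z. z \<noteq> 0 \<Longrightarrow> g z \<noteq> 0 \<Longrightarrow> F z = f z / g z"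
proof
  have a: "f analytic_on - {0}" "g analytic_on - {0}" using f g by (simp_all add: analytic_on_open open_Compl)
  have "(\<lambda>z. f z / g z) meromorphic_on - {0}"
    using a by (intro meromorphic_intros analytic_on_imp_meromorphic_on)
  then show "remove_sings (\<lambda>z. f z / g z) nicely_meromorphic_on - {0}" by (rule remove_sings_nicely_meromorphic)
  fix z assume "z \<noteq> 0" "g z \<noteq> 0"
  moreover from this have "f analytic_on {z}" "g analytic_on {z}" using a by (auto elim: analytic_on_subset)
  ultimately have "(\<lambda>z. f z / g z) analytic_on {z}" by (intro analytic_intros) auto
  then show "remove_sings (\<lambda>z. f z / g z) z = f z / g z" by (rule remove_sings_at_analytic)
qed

text \<open>Euler's second expansion. The series satisfies e(x) (1 - x) = e(q x), and iterating
  moves the argument to 0, where its value is 1.\<close>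

lemma q_exponential_series:
  assumes q: "0 < q" "q < 1" and a: "norm a < 1"
  shows "summable (\<lambda>k. norm (a ^ k / q_poch (of_real q) q k))"
    and "(\<Sum>k. a ^ k / q_poch (of_real q) q k) * q_poch_inf a q = 1"
proof -
  let ?Q = "complex_of_real q"
  define e where "e = (\<lambda>a. \<Sum>k. a ^ k / q_poch ?Q q k)"
  have "(\<lambda>k. 1 / q_poch ?Q q k) \<longlonglongrightarrow> 1 / q_poch_inf ?Q q"
    by (intro tendsto_intros q_poch_tendsto q q_poch_inf_q_nonzero)
  then have "Bseq (\<lambda>k. 1 / q_poch ?Q q k)" by (rule convergent_imp_Bseq[OF convergentI])
  then obtain B where B: "\<And>k. norm (1 / q_poch ?Q q k) \<le> B" unfolding Bseq_def by auto
  have sm: "summable (\<lambda>k. norm (a ^ k / q_poch ?Q q k))" if "norm a < 1" for a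
  proof (rule summable_comparison_test'[where N = 0])
    show "summable (\<lambda>k. B * norm a ^ k)" using that by (intro summable_mult summable_geometric) auto
    fix k show "norm (norm (a ^ k / q_poch ?Q q k)) \<le> B * norm a ^ k"
      using mult_right_mono[OF B[of k], of "norm a ^ k"] by (simp add: norm_divide norm_power)
  qed
  then show "summable (\<lambda>k. norm (a ^ k / q_poch ?Q q k))" using a by blast
  have es: "(\<lambda>k. a ^ k / q_poch ?Q q k) sums e a" if "norm a < 1" for a
    unfolding e_def by (rule summable_sums[OF summable_norm_cancel[OF sm[OF that]]])
  have qa: "norm (a * ?Q ^ k) < 1" for k
  proof -
    have "norm a * q ^ k \<le> norm a * 1" using q by (intro mult_left_mono power_le_one) auto
    then show ?thesis using a q by (simp add: norm_mult norm_power)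
  qed
  have step: "e x * (1 - x) = e (x * ?Q)" if x: "norm x < 1" "norm (x * ?Q) < 1" for x
  proof -
    have "(\<lambda>k. x ^ k / q_poch ?Q q k - (x * ?Q) ^ k / q_poch ?Q q k) sums (e x - e (x * ?Q))"
      by (intro sums_diff es x)
    then have "(\<lambda>k. x ^ Suc k / q_poch ?Q q (Suc k) - (x * ?Q) ^ Suc k / q_poch ?Q q (Suc k)) sums (e x - e (x * ?Q))"
      by (subst sums_Suc_iff) simp
    moreover have "x ^ Suc k / q_poch ?Q q (Suc k) - (x * ?Q) ^ Suc k / q_poch ?Q q (Suc k) = x * (x ^ k / q_poch ?Q q k)" for k
    proof -
      have nz: "q_poch ?Q q k \<noteq> 0" "1 - ?Q * ?Q ^ k \<noteq> 0"
        using q_poch_q_nonzero[OF q, of k] q_poch_q_nonzero[OF q, of "Suc k"] by (auto simp: q_poch_Suc)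
      have "x ^ Suc k / q_poch ?Q q (Suc k) - (x * ?Q) ^ Suc k / q_poch ?Q q (Suc k)
          = x ^ Suc k * (1 - ?Q * ?Q ^ k) / (q_poch ?Q q k * (1 - ?Q * ?Q ^ k))"
        by (simp add: q_poch_Suc power_mult_distrib diff_divide_distrib[symmetric] right_diff_distrib mult_ac)
      then show ?thesis using nz by simp
    qed
    ultimately have "(\<lambda>k. x * (x ^ k / q_poch ?Q q k)) sums (e x - e (x * ?Q))" by simp
    moreover have "(\<lambda>k. x * (x ^ k / q_poch ?Q q k)) sums (x * e x)" by (intro sums_mult es x)
    ultimately have "e x - e (x * ?Q) = x * e x" by (rule sums_unique2)
    then show ?thesis by (simp add: algebra_simps)
  qed
  have "e a * q_poch a q k = e (a * ?Q ^ k)" for k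
  proof (induction k)
    case (Suc k)
    have "e a * q_poch a q (Suc k) = e (a * ?Q ^ k) * (1 - a * ?Q ^ k)"
      unfolding q_poch_Suc mult.assoc[symmetric] Suc.IH ..
    also have "\<dots> = e (a * ?Q ^ k * ?Q)" by (rule step) (use qa[of k] qa[of "Suc k"] in \<open>auto simp: mult_ac\<close>)
    finally show ?case by (simp add: mult_ac)
  qed simp
  moreover have "(\<lambda>k. e a * q_poch a q k) \<longlonglongrightarrow> e a * q_poch_inf a q"
    by (intro tendsto_intros q_poch_tendsto q)
  moreover have "(\<lambda>k. e (a * ?Q ^ k)) \<longlonglongrightarrow> e 0"
  proof (rule isCont_tendsto_compose[of 0 e])
    have "(\<lambda>x. \<Sum>k. (1 / q_poch ?Q q k) * x ^ k) = e" by (simp add: e_def fun_eq_iff)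
    moreover have "isCont (\<lambda>x. \<Sum>k. (1 / q_poch ?Q q k) * x ^ k) 0"
      by (rule isCont_powser[where K = "1 / 2"]) (use summable_norm_cancel[OF sm[of "1 / 2"]] in auto)
    ultimately show "isCont e 0" by simp
    show "(\<lambda>k. a * ?Q ^ k) \<longlonglongrightarrow> 0" using q by (intro tendsto_mult_right_zero LIMSEQ_power_zero) auto
  qed
  moreover have "e 0 = 1"
  proof -
    have "(\<lambda>k. (1 / q_poch ?Q q k) * 0 ^ k) sums (1 / q_poch ?Q q 0)" by (rule powser_sums_zero)
    moreover have "(\<lambda>k. (1 / q_poch ?Q q k) * 0 ^ k) sums e 0" using es[of 0] by simp
    ultimately have "1 / q_poch ?Q q 0 = e 0" by (rule sums_unique2)
    then show ?thesis by simp
  qed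
  ultimately have "e a * q_poch_inf a q = 1" using LIMSEQ_unique by (metis (no_types, lifting) ext)
  then show "(\<Sum>k. a ^ k / q_poch ?Q q k) * q_poch_inf a q = 1" by (simp add: e_def)
qed

text \<open>The assumptions on \<open>M\<close> say B = 1 - (1 - q) M entry by entry; those on the
  exponents relate q^mu and q^nu to \<open>al\<close>, \<open>be\<close> and
  \<open>beN\<close>.\<close>

locale q_connection = q_system +
  fixes M :: "complex mat" and mu nu :: "nat \<Rightarrow> complex"
  assumes M: "M \<in> carrier_mat (Suc N) (Suc N)"
    and M_diag: "\<And>i k. i < N \<Longrightarrow> k < N \<Longrightarrow> (1 - Q) * M $$ (i, k) = (if i = k then 1 - be i else 0)"
    and M_col: "\<And>i. i < N \<Longrightarrow> (1 - Q) * M $$ (i, N) = a i"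
    and M_row: "\<And>i. i < N \<Longrightarrow> (1 - Q) * M $$ (N, i) = b i"
    and M_corner: "(1 - Q) * M $$ (N, N) = 1 - d"
    and q_nu: "\<And>i. i < N \<Longrightarrow> Q powr nu i = be i" "Q powr nu N = beN"
    and q_mu: "\<And>l. l \<le> N \<Longrightarrow> Q powr mu l = al l"
begin

lemma q_neq_1 [simp]: "q \<noteq> 1" "1 \<noteq> q" using q by auto

lemma M_mult_top:
  assumes "i < N"
  shows "(Q - 1) * (\<Sum>k\<le>N. M $$ (i, k) * v k) = be i * v i - a i * v N - v i"
proof -
  have "(1 - Q) * (\<Sum>k\<le>N. M $$ (i, k) * v k) = (\<Sum>k<N. ((1 - Q) * M $$ (i, k)) * v k) + (1 - Q) * M $$ (i, N) * v N"
    by (simp add: lessThan_Suc_atMost[symmetric] sum_distrib_left distrib_left mult_ac)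
  also have "(\<Sum>k<N. ((1 - Q) * M $$ (i, k)) * v k) = (\<Sum>k<N. if k = i then (1 - be i) * v i else 0)"
    by (intro sum.cong refl) (use assms in \<open>auto simp: M_diag\<close>)
  finally have "(1 - Q) * (\<Sum>k\<le>N. M $$ (i, k) * v k) = (1 - be i) * v i + a i * v N"
    using assms by (simp add: M_col)
  then show ?thesis by (simp add: algebra_simps)
qed

lemma M_mult_bottom: "(Q - 1) * (\<Sum>k\<le>N. M $$ (N, k) * v k) = d * v N - (\<Sum>i<N. b i * v i) - v N"
proof -
  have "(1 - Q) * (\<Sum>k\<le>N. M $$ (N, k) * v k) = (\<Sum>k<N. ((1 - Q) * M $$ (N, k)) * v k) + (1 - Q) * M $$ (N, N) * v N"
    by (simp add: lessThan_Suc_atMost[symmetric] sum_distrib_left distrib_left mult_ac)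
  also have "\<dots> = (\<Sum>k<N. b k * v k) + (1 - d) * v N" by (simp add: M_row M_corner cong: sum.cong_simp)
  finally show ?thesis by (simp add: algebra_simps)
qed

lemma formal_solution_recurrence:
  "is_formal_solution q (Suc N) M nu H \<longleftrightarrow> H \<in> carrier_mat (Suc N) (Suc N) \<and>
     (\<forall>i\<le>N. \<forall>j\<le>N. fps_nth (H $$ (i, j)) 0 = (if i = j then 1 else 0)) \<and>
     (\<forall>j\<le>N. \<forall>m. let h = \<lambda>i. fps_nth (H $$ (i, j)) m; h' = \<lambda>i. fps_nth (H $$ (i, j)) (Suc m);
         s = \<lambda>i. (if j < N then be j else beN) * inverse Q ^ m * h i - (if j < N then 0 else (1 - Q) * inverse Q ^ Suc m * h' i)
       in (\<forall>i<N. s i = be i * h i - a i * h N) \<and> s N = d * h N - (\<Sum>i<N. b i * h i) - (1 - Q) * h' N)"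
proof -
  have nu: "Q powr nu j = (if j < N then be j else beN)" if "j \<le> N" for j using q_nu that by auto
  have e: "(s - h i = (Q - 1) * ((if i = N then h' else 0) + (\<Sum>k\<le>N. M $$ (i, k) * h k))) \<longleftrightarrow>
      (if i < N then s = be i * h i - a i * h N else s = d * h N - (\<Sum>i<N. b i * h i) - (1 - Q) * h')" if "i \<le> N" for s h h' i
    using that M_mult_top[of i h] M_mult_bottom[of h] by (auto simp: distrib_left left_diff_distrib)
  have split: "(\<forall>i\<le>N. if i < N then P i else R) \<longleftrightarrow> (\<forall>i<N. P i) \<and> R" for P R by (auto simp: le_less)
  show ?thesis
    unfolding is_formal_solution_iff[OF q M] Let_def
  proof (intro conj_cong refl, goal_cases)
    case 1
    let ?h = "\<lambda>i j m. fps_nth (H $$ (i, j)) m"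
    let ?s = "\<lambda>i j m. Q powr nu j * inverse Q ^ m * ?h i j m - (if j < N then 0 else (1 - Q) * inverse Q ^ Suc m * ?h i j (Suc m))"
    have "(\<forall>i\<le>N. \<forall>j\<le>N. \<forall>m. ?s i j m - ?h i j m = (Q - 1) * ((if i = N then ?h N j (Suc m) else 0) + (\<Sum>k\<le>N. M $$ (i, k) * ?h k j m)))
      \<longleftrightarrow> (\<forall>j\<le>N. \<forall>m. \<forall>i\<le>N. ?s i j m - ?h i j m = (Q - 1) * ((if i = N then ?h N j (Suc m) else 0) + (\<Sum>k\<le>N. M $$ (i, k) * ?h k j m)))"
      by blast
    also have "\<dots> \<longleftrightarrow> (\<forall>j\<le>N. \<forall>m. \<forall>i\<le>N. if i < N then ?s i j m = be i * ?h i j m - a i * ?h N j m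
        else ?s N j m = d * ?h N j m - (\<Sum>i<N. b i * ?h i j m) - (1 - Q) * ?h N j (Suc m))"
    proof (intro all_cong1 imp_cong refl)
      fix i j m assume "i \<le> N"
      from e[OF this, of "?s i j m" "\<lambda>i. ?h i j m" "?h N j (Suc m)"] \<open>i \<le> N\<close>
      show "(?s i j m - ?h i j m = (Q - 1) * ((if i = N then ?h N j (Suc m) else 0) + (\<Sum>k\<le>N. M $$ (i, k) * ?h k j m)))
        \<longleftrightarrow> (if i < N then ?s i j m = be i * ?h i j m - a i * ?h N j m
        else ?s N j m = d * ?h N j m - (\<Sum>i<N. b i * ?h i j m) - (1 - Q) * ?h N j (Suc m))"
        by (cases "i < N") auto
    qed
    also have "\<dots> \<longleftrightarrow> (\<forall>j\<le>N. \<forall>m. (\<forall>i<N. ?s i j m = be i * ?h i j m - a i * ?h N j m)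
        \<and> ?s N j m = d * ?h N j m - (\<Sum>i<N. b i * ?h i j m) - (1 - Q) * ?h N j (Suc m))"
      unfolding split ..
    finally show ?case
      by (simp only: nu cong: all_cong1 imp_cong)
  qed
qed

text \<open>For \<open>j < N\<close> the last equation at m determines the last entry at m + 1, and
  the upper equations at m + 1 then determine the others, since be_i differs from be_j q^(-m-1). For
  \<open>j = N\<close> the equations at m already contain all entries at m + 1, with the nonzero
  factors q^(-m-1) above and 1 - q^(-m-1) below.\<close>

lemma formal_solution_unique:
  assumes H: "is_formal_solution q (Suc N) M nu H" and H': "is_formal_solution q (Suc N) M nu H'"
  shows "H = H'"
proof -
  have l1: "w = z - x" if "x = z - w" for x z w :: complex using that by simp
  have l2: "v - w = z - x" if "x - w = z - v" for x z v w :: complex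
  proof -
    have "v - w = (x - w) - (z - v) + (z - x)" by simp
    then show ?thesis using that by simp
  qed
  have l3: "w = x - z" if "x - w = z" for x z w :: complex using that by auto
  have A1: "c * y = c * y'" if "x = z - c * y" "x = z - c * y'" for x z c y y' :: complex
    using l1[OF that(1)] l1[OF that(2)] by simp
  have A2: "c * (1 - p) * y = c * (1 - p) * y'" if "x - c * p * y = z - c * y" "x - c * p * y' = z - c * y'" for x z c y y' p :: complex
    using l2[OF that(1)] l2[OF that(2)] by (simp only: right_diff_distrib left_diff_distrib mult_1_right)
  have A3: "w = w'" if "x - w = z" "x - w' = z" for x z w w' :: complex using l3[OF that(1)] l3[OF that(2)] by simp
  have c: "H \<in> carrier_mat (Suc N) (Suc N)" "H' \<in> carrier_mat (Suc N) (Suc N)"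
    using H H' by (auto simp: formal_solution_recurrence)
  have "fps_nth (H $$ (i, j)) m = fps_nth (H' $$ (i, j)) m" if "i \<le> N" and j: "j \<le> N" for i j m
    using that(1)
  proof (induction m arbitrary: i)
    case 0 then show ?case using H H' j by (simp add: formal_solution_recurrence)
  next
    case (Suc m)
    note IH = Suc.IH
    let ?g = "\<lambda>H i m. fps_nth (H $$ (i, j)) m"
    have rec1: "(if j < N then be j else beN) * inverse Q ^ m * ?g H i m
        - (if j < N then 0 else (1 - Q) * inverse Q ^ Suc m * ?g H i (Suc m))
        = be i * ?g H i m - a i * ?g H N m"
      if "is_formal_solution q (Suc N) M nu H" "i < N" for H i m
      using that j unfolding formal_solution_recurrence Let_def by blast
    have rec2: "(if j < N then be j else beN) * inverse Q ^ m * ?g H N m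
        - (if j < N then 0 else (1 - Q) * inverse Q ^ Suc m * ?g H N (Suc m))
        = d * ?g H N m - (\<Sum>i<N. b i * ?g H i m) - (1 - Q) * ?g H N (Suc m)"
      if "is_formal_solution q (Suc N) M nu H" for H m
      using that j unfolding formal_solution_recurrence Let_def by blast
    let ?h = "?g H" and ?h' = "?g H'"
    have s: "(\<Sum>i<N. b i * ?h i m) = (\<Sum>i<N. b i * ?h' i m)" by (intro sum.cong refl) (use IH in auto)
    show ?case
    proof (cases "j < N")
      case True
      have r1: "be j * inverse Q ^ m * ?g H i m = be i * ?g H i m - a i * ?g H N m"
        if "is_formal_solution q (Suc N) M nu H" "i < N" for H i m
        using rec1[OF that(1,2), of m] True by (simp only: if_True diff_zero)
      have r2: "be j * inverse Q ^ m * ?g H N m = d * ?g H N m - (\<Sum>i<N. b i * ?g H i m) - (1 - Q) * ?g H N (Suc m)"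
        if "is_formal_solution q (Suc N) M nu H" for H m
        using rec2[OF that(1), of m] True by (simp only: if_True diff_zero)
      note r = r1[OF H] r2[OF H] r1[OF H'] r2[OF H']
      have "(1 - Q) * ?h N (Suc m) = (1 - Q) * ?h' N (Suc m)"
        using r(2)[of m] r(4)[of m] unfolding IH[OF order_refl] s by (rule A1)
      then have N: "?h N (Suc m) = ?h' N (Suc m)" by simp
      show ?thesis
      proof (cases "i = N")
        case False
        then have i: "i < N" using Suc.prems by simp
        have "(be i - be j * inverse Q ^ Suc m) * ?h i (Suc m) = (be i - be j * inverse Q ^ Suc m) * ?h' i (Suc m)"
          using r(1)[OF i, of "Suc m"] r(3)[OF i, of "Suc m"] N by (simp add: left_diff_distrib del: power_Suc)
        then show ?thesis using be_power_neq'[OF i True, of "Suc m"] by (simp del: power_Suc)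
      qed (use N in simp)
    next
      case False
      have Qm: "1 - inverse Q ^ Suc m \<noteq> 0"
      proof
        assume "1 - inverse Q ^ Suc m = 0"
        then have "Q ^ Suc m = 1" by (simp add: power_inverse del: power_Suc)
        then have "norm (Q ^ Suc m) = 1" by simp
        then have "q ^ Suc m = 1" using q by (simp add: norm_power norm_mult del: power_Suc)
        then show False using power_Suc_less_one[of q m] q by simp
      qed
      have r1: "beN * inverse Q ^ m * ?g H i m - (1 - Q) * inverse Q ^ Suc m * ?g H i (Suc m)
          = be i * ?g H i m - a i * ?g H N m"
        if "is_formal_solution q (Suc N) M nu H" "i < N" for H i m
        using rec1[OF that(1,2), of m] False by (simp only: if_False)
      have r2: "beN * inverse Q ^ m * ?g H N m - (1 - Q) * inverse Q ^ Suc m * ?g H N (Suc m)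
          = d * ?g H N m - (\<Sum>i<N. b i * ?g H i m) - (1 - Q) * ?g H N (Suc m)"
        if "is_formal_solution q (Suc N) M nu H" for H m
        using rec2[OF that(1), of m] False by (simp only: if_False)
      note r = r1[OF H] r2[OF H] r1[OF H'] r2[OF H']
      show ?thesis
      proof (cases "i = N")
        case True
        have "(1 - Q) * (1 - inverse Q ^ Suc m) * ?h N (Suc m) = (1 - Q) * (1 - inverse Q ^ Suc m) * ?h' N (Suc m)"
          using r(2)[of m] r(4)[of m] unfolding IH[OF order_refl] s by (rule A2)
        then show ?thesis using Qm True by (simp del: power_Suc)
      next
        case False
        then have i: "i < N" using Suc.prems by simp
        have "(1 - Q) * inverse Q ^ Suc m * ?h i (Suc m) = (1 - Q) * inverse Q ^ Suc m * ?h' i (Suc m)"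
          using r(1)[OF i, of m] r(3)[OF i, of m] unfolding IH[OF order_refl] IH[OF less_imp_le[OF i]] by (rule A3)
        then show ?thesis by simp
      qed
    qed
  qed
  then show ?thesis using c by (intro eq_matI) (auto simp: fps_eq_iff less_Suc_eq_le)
qed

section \<open>The formal solution in closed form\<close>

text \<open>Coefficients in 1/u of 1 / (q beN / u; q)_inf, the factor by which the last formal
  column differs from the series of \<open>ycol\<close>.\<close>

definition ecoeff :: "nat \<Rightarrow> complex" where
  "ecoeff k = (Q * beN) ^ k / q_poch Q q k"

definition zcol :: "nat \<Rightarrow> nat \<Rightarrow> complex" where
  "zcol i m = (\<Sum>k\<le>m. ycol (m - k) i * ecoeff k)"

lemma ycol_top: "i < N \<Longrightarrow> - (inverse Q ^ Suc r * ycol (Suc r) i) = be i * ycol r i - a i * ycol r N"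
  by (simp add: field_simps)

lemma ycol_bottom: "- (inverse Q ^ Suc r * ycol (Suc r) N) = d * ycol r N - (\<Sum>i<N. b i * ycol r i) - ycol (Suc r) N"
proof -
  have "1 - Q ^ Suc r \<noteq> 0"
  proof
    assume "1 - Q ^ Suc r = 0"
    then have "norm (Q ^ Suc r) = 1" by simp
    then have "q ^ Suc r = 1" using q by (simp add: norm_power norm_mult del: power_Suc)
    then show False using power_Suc_less_one[of q r] q by simp
  qed
  moreover have "- (inverse P * (- (P / (1 - P)) * x)) = x - (- (P / (1 - P)) * x)" if "1 - P \<noteq> 0" "P \<noteq> 0" for P x :: complex
    using that by (simp add: field_simps)
  ultimately show ?thesis unfolding ycol.simps if_True power_inverse by (simp del: power_Suc)
qed

text \<open>The generating series E of \<open>ecoeff\<close> satisfies (1 - beN / u) E(q u) = E(u).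
  The combination on the left therefore strips the factor of its shift and leaves a shift of
  \<open>ycol\<close> alone.\<close>

lemma zcol_step: "beN * inverse Q ^ m * zcol i m - inverse Q ^ Suc m * zcol i (Suc m)
    = - (\<Sum>k\<le>Suc m. inverse Q ^ (Suc m - k) * ycol (Suc m - k) i * ecoeff k)"
proof -
  have e: "inverse Q ^ Suc k * ecoeff (Suc k) = ecoeff (Suc k) + beN * (inverse Q ^ k * ecoeff k)" for k
  proof -
    have nz: "q_poch Q q k \<noteq> 0" "1 - Q * Q ^ k \<noteq> 0"
      using q_poch_q_nonzero[OF q, of k] q_poch_q_nonzero[OF q, of "Suc k"] by (auto simp: q_poch_Suc)
    have "ecoeff (Suc k) * (1 - Q * Q ^ k) = Q * beN * ecoeff k" using nz by (simp add: ecoeff_def q_poch_Suc)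
    then have "inverse Q ^ Suc k * (ecoeff (Suc k) * (1 - Q ^ Suc k)) = inverse Q ^ Suc k * (Q * beN * ecoeff k)" by simp
    moreover have 1: "inverse Q ^ Suc k * Q ^ Suc k = 1" unfolding power_mult_distrib[symmetric] by simp
    moreover have "inverse Q ^ Suc k * (Q * beN * ecoeff k) = (inverse Q * Q) * (beN * (inverse Q ^ k * ecoeff k))"
      by (simp only: power_Suc mult_ac)
    moreover have "I * (E * (1 - P)) = I * E - (I * P) * E" for I E P :: complex by (simp add: algebra_simps)
    ultimately show ?thesis by (simp add: diff_eq_eq del: power_Suc)
  qed
  have "inverse Q ^ Suc m * zcol i (Suc m) = (\<Sum>k\<le>Suc m. (inverse Q ^ (Suc m - k) * ycol (Suc m - k) i) * (inverse Q ^ k * ecoeff k))"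
    unfolding zcol_def sum_distrib_left
  proof (intro sum.cong refl)
    fix k assume "k \<in> {..Suc m}"
    then have "inverse Q ^ Suc m = inverse Q ^ (Suc m - k) * inverse Q ^ k" by (simp add: power_add[symmetric] del: power_Suc)
    then show "inverse Q ^ Suc m * (ycol (Suc m - k) i * ecoeff k) = (inverse Q ^ (Suc m - k) * ycol (Suc m - k) i) * (inverse Q ^ k * ecoeff k)"
      by (simp only: mult_ac)
  qed
  also have "\<dots> = (\<Sum>k\<le>Suc m. (inverse Q ^ (Suc m - k) * ycol (Suc m - k) i) * ecoeff k)
      + (\<Sum>k\<le>m. (inverse Q ^ (m - k) * ycol (m - k) i) * (beN * (inverse Q ^ k * ecoeff k)))"
    unfolding sum.atMost_Suc_shift e by (simp add: distrib_left sum.distrib)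
  also have "(\<Sum>k\<le>m. (inverse Q ^ (m - k) * ycol (m - k) i) * (beN * (inverse Q ^ k * ecoeff k))) = beN * inverse Q ^ m * zcol i m"
    unfolding zcol_def sum_distrib_left
  proof (intro sum.cong refl)
    fix k assume "k \<in> {..m}"
    then have "inverse Q ^ m = inverse Q ^ (m - k) * inverse Q ^ k" by (simp add: power_add[symmetric])
    then show "(inverse Q ^ (m - k) * ycol (m - k) i) * (beN * (inverse Q ^ k * ecoeff k)) = beN * inverse Q ^ m * (ycol (m - k) i * ecoeff k)"
      by (simp only: mult_ac)
  qed
  finally show ?thesis by simp
qed

lemma zcol_top:
  assumes "i < N"
  shows "beN * inverse Q ^ m * zcol i m - inverse Q ^ Suc m * zcol i (Suc m) = be i * zcol i m - a i * zcol N m"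
proof -
  have "- (\<Sum>k\<le>Suc m. inverse Q ^ (Suc m - k) * ycol (Suc m - k) i * ecoeff k)
      = (\<Sum>k\<le>m. (- (inverse Q ^ Suc (m - k) * ycol (Suc (m - k)) i)) * ecoeff k)"
    using assms by (simp add: sum_negf[symmetric] Suc_diff_le del: power_Suc ycol.simps(2) cong: sum.cong_simp)
  also have "\<dots> = (\<Sum>k\<le>m. (be i * ycol (m - k) i - a i * ycol (m - k) N) * ecoeff k)"
    unfolding ycol_top[OF assms] ..
  also have "\<dots> = be i * zcol i m - a i * zcol N m"
    by (simp add: zcol_def sum_distrib_left sum_subtractf[symmetric] left_diff_distrib mult.assoc)
  finally show ?thesis unfolding zcol_step .
qed

lemma zcol_bottom:
  "beN * inverse Q ^ m * zcol N m - inverse Q ^ Suc m * zcol N (Suc m) = d * zcol N m - (\<Sum>i<N. b i * zcol i m) - zcol N (Suc m)"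
proof -
  have "- (\<Sum>k\<le>Suc m. inverse Q ^ (Suc m - k) * ycol (Suc m - k) N * ecoeff k)
      = (\<Sum>k\<le>m. (- (inverse Q ^ Suc (m - k) * ycol (Suc (m - k)) N)) * ecoeff k) - ecoeff (Suc m)"
    by (simp add: sum_negf[symmetric] Suc_diff_le del: power_Suc ycol.simps(2) cong: sum.cong_simp)
  also have "\<dots> = (\<Sum>k\<le>m. (d * ycol (m - k) N - (\<Sum>i<N. b i * ycol (m - k) i) - ycol (Suc (m - k)) N) * ecoeff k) - ecoeff (Suc m)"
    unfolding ycol_bottom ..
  also have "\<dots> = d * zcol N m - (\<Sum>k\<le>m. (\<Sum>i<N. b i * ycol (m - k) i) * ecoeff k) - ((\<Sum>k\<le>m. ycol (Suc (m - k)) N * ecoeff k) + ecoeff (Suc m))"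
    by (simp add: zcol_def sum_distrib_left sum_subtractf[symmetric] sum.distrib[symmetric] left_diff_distrib distrib_right mult.assoc diff_diff_eq del: ycol.simps(2))
  also have "(\<Sum>k\<le>m. (\<Sum>i<N. b i * ycol (m - k) i) * ecoeff k) = (\<Sum>i<N. b i * zcol i m)"
    unfolding zcol_def sum_distrib_left sum_distrib_right by (subst sum.swap) (simp add: mult.assoc)
  also have "(\<Sum>k\<le>m. ycol (Suc (m - k)) N * ecoeff k) + ecoeff (Suc m) = zcol N (Suc m)"
    by (simp add: zcol_def Suc_diff_le del: ycol.simps(2) cong: sum.cong_simp)
  finally show ?thesis unfolding zcol_step .
qed

text \<open>The power of \<open>1 - Q\<close> converts an expansion in 1/u, u = (1 - q) z, into one
  in 1/z.\<close>

definition formal_coeff :: "nat \<Rightarrow> nat \<Rightarrow> nat \<Rightarrow> complex" where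
  "formal_coeff i j m = (if j < N then hcol j i m else zcol i m) / (1 - Q) ^ m"

lemma formal_H_eq:
  assumes "i \<le> N" "j \<le> N"
  shows "fps_nth (formal_H q (Suc N) M nu $$ (i, j)) m = formal_coeff i j m"
proof -
  define H where "H = mat (Suc N) (Suc N) (\<lambda>(i, j). Abs_fps (formal_coeff i j))"
  have h: "fps_nth (H $$ (i, j)) m = formal_coeff i j m" if "i \<le> N" "j \<le> N" for i j m
    using that by (simp add: H_def)
  have "is_formal_solution q (Suc N) M nu H"
    unfolding formal_solution_recurrence Let_def
  proof (intro conjI allI impI)
    show "H \<in> carrier_mat (Suc N) (Suc N)" by (simp add: H_def)
    show "fps_nth (H $$ (i, j)) 0 = (if i = j then 1 else 0)" if "i \<le> N" "j \<le> N" for i j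
      using that by (auto simp: h formal_coeff_def hcol_def zcol_def ecoeff_def)
  next
    fix j m assume j: "j \<le> N"
    let ?s = "\<lambda>i. (if j < N then be j else beN) * inverse Q ^ m * fps_nth (H $$ (i, j)) m - (if j < N then 0 else (1 - Q) * inverse Q ^ Suc m * fps_nth (H $$ (i, j)) (Suc m))"
    define c where "c = (\<lambda>i m. if j < N then hcol j i m else zcol i m)"
    have fc: "fps_nth (H $$ (i, j)) m = c i m / (1 - Q) ^ m" if "i \<le> N" for i m
      using h[OF that j] by (simp add: formal_coeff_def c_def)
    have c': "(1 - Q) * (c i (Suc m) / (1 - Q) ^ Suc m) = c i (Suc m) / (1 - Q) ^ m" for i
      unfolding power_Suc by simp
    have s: "?s i = ((if j < N then be j else beN) * inverse Q ^ m * c i m - (if j < N then 0 else inverse Q ^ Suc m * c i (Suc m))) / (1 - Q) ^ m"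
      if "i \<le> N" for i
    proof (cases "j < N")
      case False
      have "(1 - Q) * inverse Q ^ Suc m * (c i (Suc m) / (1 - Q) ^ Suc m) = inverse Q ^ Suc m * ((1 - Q) * (c i (Suc m) / (1 - Q) ^ Suc m))"
        by (simp only: mult_ac)
      then show ?thesis using False unfolding fc[OF that] c' by (simp add: diff_divide_distrib del: power_Suc)
    qed (simp add: fc[OF that])
    show "?s i = be i * fps_nth (H $$ (i, j)) m - a i * fps_nth (H $$ (N, j)) m" if i: "i < N" for i
    proof -
      have "(if j < N then be j else beN) * inverse Q ^ m * c i m - (if j < N then 0 else inverse Q ^ Suc m * c i (Suc m)) = be i * c i m - a i * c N m"
        using hcol_top[of j i m] zcol_top[OF i, of m] i by (simp add: c_def del: power_Suc)
      then show ?thesis using i by (simp only: s less_imp_le) (simp add: fc diff_divide_distrib)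
    qed
    show "?s N = d * fps_nth (H $$ (N, j)) m - (\<Sum>i<N. b i * fps_nth (H $$ (i, j)) m) - (1 - Q) * fps_nth (H $$ (N, j)) (Suc m)"
    proof -
      have "(if j < N then be j else beN) * inverse Q ^ m * c N m - (if j < N then 0 else inverse Q ^ Suc m * c N (Suc m))
          = d * c N m - (\<Sum>i<N. b i * c i m) - c N (Suc m)"
        using hcol_bottom[of j m] zcol_bottom[of m] by (simp add: c_def del: power_Suc)
      then have "?s N = (d * c N m - (\<Sum>i<N. b i * c i m) - c N (Suc m)) / (1 - Q) ^ m"
        unfolding s[OF order_refl] by (simp only:)
      also have "\<dots> = d * fps_nth (H $$ (N, j)) m - (\<Sum>i<N. b i * fps_nth (H $$ (i, j)) m) - (1 - Q) * fps_nth (H $$ (N, j)) (Suc m)"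
        unfolding fc[OF order_refl] c' by (simp add: fc diff_divide_distrib sum_divide_distrib cong: sum.cong_simp)
      finally show ?thesis .
    qed
  qed
  then have "formal_H q (Suc N) M nu = H" unfolding formal_H_def by (intro the_equality) (auto intro: formal_solution_unique)
  then show ?thesis using h assms by simp
qed

section \<open>The connection matrix\<close>

text \<open>The Borel transform in z is \<open>gfun\<close> at xi / (1 - q). With L = lam / (1 - q)
  one has L u = lam z, and each term of the q-Laplace sum, multiplied by theta(lam z), is a term of
  the Laurent series of \<open>Lcol\<close>. The sum is thus a quotient of functions holomorphic on
  the punctured plane.\<close>

lemma q_sum_top:
  assumes L: "admissible (lam / (1 - Q))" and l: "l < N" and i: "i \<le> N" and lam: "lam \<noteq> 0" and z: "z \<noteq> 0"
    and th: "theta_q q (lam * z) \<noteq> 0"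
  shows "q_sum q lam (formal_H q (Suc N) M nu $$ (i, l)) z * theta_q q (lam * z) = col_value (lam / (1 - Q)) l i ((1 - Q) * z)"
proof -
  let ?L = "lam / (1 - Q)" and ?f = "formal_H q (Suc N) M nu $$ (i, l)"
  define g where "g = (\<lambda>\<xi>. gfun l i (\<xi> / (1 - Q)))"
  note gf = gfun[OF l, unfolded borel_cont_def]
  have lin: "(\<lambda>\<xi>. \<xi> / (1 - Q)) analytic_on A" for A by (intro analytic_intros) simp
  have pt: "lam * Q powi m / (1 - Q) = ?L * Q powi m" for m by simp
  have bc: "is_borel_continuation q lam ?f g"
    unfolding is_borel_continuation_def
  proof (intro conjI allI)
    have "g meromorphic_on UNIV" unfolding g_def
      by (rule meromorphic_on_compose[OF _ lin, of "gfun l i" UNIV]) (use gf[THEN conjunct1] i in auto)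
    then show "\<exists>S. open S \<and> (\<forall>t\<ge>0. complex_of_real t * lam \<in> S) \<and> (\<forall>x\<in>S. closed_segment 0 x \<subseteq> S) \<and> g meromorphic_on S"
      by (intro exI[of _ UNIV]) auto
    obtain \<rho> where \<rho>: "\<rho> > 0" "\<And>x. norm x < \<rho> \<Longrightarrow> (\<lambda>r. gcoeff l i r * x ^ r) sums gfun l i x"
    proof -
      from gf[THEN conjunct2, THEN conjunct2, THEN conjunct1] obtain \<rho> where "\<rho> > 0" "\<forall>i\<le>N. \<forall>x. norm x < \<rho> \<longrightarrow> (\<lambda>r. gcoeff l i r * x ^ r) sums gfun l i x" by metis
      then show ?thesis using that[of \<rho>] i by simp
    qed
    have "fps_nth (q_borel q ?f) m * x ^ m = gcoeff l i m * (x / (1 - Q)) ^ m" for m x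
      using l i by (simp add: q_borel_def formal_H_eq formal_coeff_def gcoeff_def tri_nat power_divide)
    moreover have "\<forall>\<^sub>F x in nhds 0. norm (x / (1 - Q)) < \<rho>"
    proof -
      have "open {x :: complex. norm (x / (1 - Q)) < \<rho>}" by (intro open_Collect_less continuous_intros) simp
      from eventually_nhds_in_open[OF this, of 0] show ?thesis using \<rho>(1) by simp
    qed
    ultimately show "\<forall>\<^sub>F x in nhds 0. (\<lambda>m. fps_nth (q_borel q ?f) m * x ^ m) sums g x"
      unfolding g_def by (auto elim!: eventually_mono intro!: \<rho>(2))
    fix m
    have "gfun l i analytic_on {?L * Q powi m}"
      using gf[THEN conjunct2, THEN conjunct1, rule_format, OF i admissible_poch'[OF L l, of m]] .
    then have "gfun l i \<circ> (\<lambda>\<xi>. \<xi> / (1 - Q)) analytic_on {lam * Q powi m}"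
      by (intro analytic_on_compose[OF lin]) (simp only: image_insert image_empty pt)
    then show "g analytic_on {lam * Q powi m}" by (simp add: g_def o_def)
  qed
  have hol: "(\<lambda>z. col_value ?L l i ((1 - Q) * z)) holomorphic_on - {0}" "(\<lambda>z. theta_q q (lam * z)) holomorphic_on - {0}"
  proof -
    have "(col_value ?L l i \<circ> (\<lambda>z. (1 - Q) * z)) holomorphic_on - {0}"
      by (rule holomorphic_on_compose_gen[OF _ col_value_holomorphic[OF L i]]) (auto intro: holomorphic_intros)
    then show "(\<lambda>z. col_value ?L l i ((1 - Q) * z)) holomorphic_on - {0}" by (simp add: o_def)
  qed (rule theta_q_scaled_holomorphic[OF lam])
  obtain F where F: "F nicely_meromorphic_on - {0}"
    "\<And>z. z \<noteq> 0 \<Longrightarrow> theta_q q (lam * z) \<noteq> 0 \<Longrightarrow> F z = col_value ?L l i ((1 - Q) * z) / theta_q q (lam * z)"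
    using quotient_nicely_meromorphic[OF hol] by blast
  have "((\<lambda>m::int. g (lam * Q powi m) / theta_q q (lam * Q powi m * z)) has_sum F z) UNIV"
    if z: "z \<noteq> 0" and nz: "\<forall>k::int. z \<noteq> - 1 / lam * Q powi k" for z
  proof -
    have th: "theta_q q (lam * z) \<noteq> 0" using theta_q_spiral[OF q lam z] nz by blast
    have "((\<lambda>m. Lcol ?L l i m * ((1 - Q) * z) powi m) has_sum col_value ?L l i ((1 - Q) * z)) UNIV"
      unfolding col_value_def using l laurent_has_sum[OF Lcol_summable[OF L l i]] z by simp
    then have "((\<lambda>m. Lcol ?L l i m * ((1 - Q) * z) powi m / theta_q q (lam * z)) has_sum F z) UNIV"
      unfolding F(2)[OF z th] by (rule has_sum_divide_const)
    moreover have "Lcol ?L l i m * ((1 - Q) * z) powi m / theta_q q (lam * z) = g (lam * Q powi m) / theta_q q (lam * Q powi m * z)" for m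
    proof -
      have "theta_q q (lam * Q powi m * z) = Q powi (- tri m) * (lam * z) powi (- m) * theta_q q (lam * z)"
        using theta_q_shift_powi[OF q, of "lam * z" m] lam z by (simp add: mult_ac)
      then have t: "theta_q q (lam * Q powi m * z) = theta_q q (lam * z) / (Q powi tri m * (lam * z) powi m)"
        by (simp add: power_int_minus field_simps)
      have w: "?L powi m * ((1 - Q) * z) powi m = (lam * z) powi m"
        unfolding power_int_mult_distrib[symmetric] by simp
      have "Lcol ?L l i m * ((1 - Q) * z) powi m = g (lam * Q powi m) * (Q powi tri m * (?L powi m * ((1 - Q) * z) powi m))"
        unfolding Lcol_def g_def pt by (simp only: mult_ac)
      then show ?thesis unfolding w t by simp
    qed
    ultimately show ?thesis by simp
  qed
  moreover have "\<forall>\<^sub>F z :: complex in at_infinity. z \<noteq> 0" by (auto simp: eventually_at_infinity intro!: exI[of _ 1])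
  ultimately have "is_q_sum q lam ?f F"
    unfolding is_q_sum_def using F(1) bc by (auto elim!: eventually_mono intro!: exI[of _ g])
  then have "q_sum q lam ?f z = F z" by (rule q_sum_eqI[OF q lam _ z])
  then show ?thesis using F(2)[OF z th] th by simp
qed

lemma zcol_sums:
  assumes i: "i \<le> N" and u: "q * norm beN < norm u"
  shows "(\<lambda>m. zcol i m * inverse u ^ m) sums (laurent_sum (ycol_ext i) u / q_poch_inf (Q * beN / u) q)"
proof -
  have u0: "u \<noteq> 0" by (rule nonzero_if_large[OF u])
  have a: "norm (Q * beN / u) < 1" using u u0 q by (simp add: norm_divide norm_mult)
  have ee: "(Q * beN / u) ^ k / q_poch Q q k = ecoeff k * inverse u ^ k" for k
    by (simp add: ecoeff_def power_mult_distrib power_inverse divide_inverse mult_ac)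
  note es = q_exponential_series[OF q a, unfolded ee]
  have "((\<lambda>m. ycol_ext i m * u powi m) has_sum laurent_sum (ycol_ext i) u) UNIV"
    by (rule laurent_has_sum[OF ycol_ext_summable[OF i u0]])
  also have "?this \<longleftrightarrow> ((\<lambda>m. ycol_ext i m * u powi m) has_sum laurent_sum (ycol_ext i) u) {..0}"
    by (rule has_sum_cong_neutral) (auto simp: ycol_ext_def)
  also have "\<dots> \<longleftrightarrow> ((\<lambda>r. ycol r i * inverse u ^ r) has_sum laurent_sum (ycol_ext i) u) UNIV"
    by (rule has_sum_reindex_bij_witness[of _ "\<lambda>r. - int r" "\<lambda>m. nat (- m)"]) (auto simp: ycol_ext_def power_int_def)
  finally have ys: "((\<lambda>r. ycol r i * inverse u ^ r) has_sum laurent_sum (ycol_ext i) u) UNIV" .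
  then have "(\<lambda>r. ycol r i * inverse u ^ r) summable_on UNIV" by (rule has_sum_imp_summable)
  then have "(\<lambda>r. norm (ycol r i * inverse u ^ r)) summable_on UNIV" by (simp only: summable_on_iff_abs_summable_on_complex)
  then have yn: "summable (\<lambda>r. norm (ycol r i * inverse u ^ r))" by (rule summable_on_imp_summable)
  have "(\<lambda>m. \<Sum>k\<le>m. (ecoeff k * inverse u ^ k) * (ycol (m - k) i * inverse u ^ (m - k)))
      sums ((\<Sum>k. ecoeff k * inverse u ^ k) * (\<Sum>r. ycol r i * inverse u ^ r))"
    by (rule Cauchy_product_sums[OF es(1) yn])
  moreover have "(\<Sum>k\<le>m. (ecoeff k * inverse u ^ k) * (ycol (m - k) i * inverse u ^ (m - k))) = zcol i m * inverse u ^ m" for m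
    unfolding zcol_def sum_distrib_right
  proof (intro sum.cong refl)
    fix k assume "k \<in> {..m}"
    then have "inverse u ^ m = inverse u ^ k * inverse u ^ (m - k)" by (simp add: power_add[symmetric])
    then show "(ecoeff k * inverse u ^ k) * (ycol (m - k) i * inverse u ^ (m - k)) = ycol (m - k) i * ecoeff k * inverse u ^ m"
      by (simp only: mult_ac)
  qed
  moreover have "(\<Sum>r. ycol r i * inverse u ^ r) = laurent_sum (ycol_ext i) u"
    using has_sum_imp_sums[OF ys] by (simp add: sums_iff)
  moreover have "(\<Sum>k. ecoeff k * inverse u ^ k) = 1 / q_poch_inf (Q * beN / u) q"
    using es(2) by (metis mult_eq_0_iff nonzero_eq_divide_eq zero_neq_one)
  ultimately show ?thesis by simp
qed

text \<open>The last column converges for large z, so its \<open>[lam; q]\<close>-sum is the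
  ordinary sum for every direction; \<open>zcol_sums\<close> identifies it as a quotient that
  continues to the punctured plane.\<close>

lemma q_sum_last:
  assumes i: "i \<le> N" and lam: "lam \<noteq> 0" and z: "z \<noteq> 0"
    and nz: "q_poch_inf (Q * beN / ((1 - Q) * z)) q \<noteq> 0"
  shows "q_sum q lam (formal_H q (Suc N) M nu $$ (i, N)) z * q_poch_inf (Q * beN / ((1 - Q) * z)) q
    = laurent_sum (ycol_ext i) ((1 - Q) * z)"
proof -
  let ?f = "formal_H q (Suc N) M nu $$ (i, N)"
  have hol: "(\<lambda>z. laurent_sum (ycol_ext i) ((1 - Q) * z)) holomorphic_on - {0}"
    "(\<lambda>z. q_poch_inf (Q * beN / ((1 - Q) * z)) q) holomorphic_on - {0}"
  proof -
    have "(laurent_sum (ycol_ext i) \<circ> (\<lambda>z. (1 - Q) * z)) holomorphic_on - {0}"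
      by (rule holomorphic_on_compose_gen[OF _ laurent_sum_holomorphic_punctured[OF ycol_ext_summable[OF i]]])
        (auto intro: holomorphic_intros)
    then show "(\<lambda>z. laurent_sum (ycol_ext i) ((1 - Q) * z)) holomorphic_on - {0}" by (simp add: o_def)
    have "((\<lambda>a. q_poch_inf a q) \<circ> (\<lambda>z. Q * beN / ((1 - Q) * z))) holomorphic_on - {0}"
      by (rule holomorphic_on_compose_gen[OF _ q_poch_inf_holomorphic[OF q]]) (auto intro!: holomorphic_intros)
    then show "(\<lambda>z. q_poch_inf (Q * beN / ((1 - Q) * z)) q) holomorphic_on - {0}" by (simp add: o_def)
  qed
  obtain F where F: "F nicely_meromorphic_on - {0}"
    "\<And>z. z \<noteq> 0 \<Longrightarrow> q_poch_inf (Q * beN / ((1 - Q) * z)) q \<noteq> 0 \<Longrightarrow>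
       F z = laurent_sum (ycol_ext i) ((1 - Q) * z) / q_poch_inf (Q * beN / ((1 - Q) * z)) q"
    using quotient_nicely_meromorphic[OF hol] by blast
  \<comment> \<open>A radius strictly beyond q |beN|: convergence there bounds the coefficients
    geometrically, as \<open>is_q_sum_convergent\<close> demands.\<close>
  define \<rho> where "\<rho> = q * norm beN + 1"
  have \<rho>: "\<rho> > 0" "q * norm beN < \<rho>" using q by (auto simp: \<rho>_def add_nonneg_pos)
  have nf: "norm (complex_of_real \<rho>) = \<rho>" using \<rho> by simp
  have "(\<lambda>m. zcol i m * inverse (complex_of_real \<rho>) ^ m) \<longlonglongrightarrow> 0"
    by (rule summable_LIMSEQ_zero[OF sums_summable[OF zcol_sums[OF i]]]) (use \<rho> nf in simp)
  then have "Bseq (\<lambda>m. zcol i m * inverse (complex_of_real \<rho>) ^ m)" by (rule convergent_imp_Bseq[OF convergentI])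
  then obtain B where B: "\<And>m. norm (zcol i m * inverse (complex_of_real \<rho>) ^ m) \<le> B" unfolding Bseq_def by auto
  have n1: "norm (1 - Q) = 1 - q"
  proof -
    have "1 - Q = of_real (1 - q)" by simp
    then show ?thesis using q by (simp only: norm_of_real abs_of_pos diff_gt_0_iff_gt)
  qed
  have "is_q_sum q lam ?f F"
  proof (rule is_q_sum_convergent[OF q lam F(1)])
    show "norm (fps_nth ?f m) \<le> B * (\<rho> / (1 - q)) ^ m" for m
    proof -
      have "norm (zcol i m) = norm (zcol i m * inverse (complex_of_real \<rho>) ^ m) * \<rho> ^ m"
        using \<rho> by (simp add: norm_mult norm_power norm_inverse power_inverse)
      also have "\<dots> \<le> B * \<rho> ^ m" using \<rho> by (intro mult_right_mono B) auto
      finally have "norm (zcol i m) / (1 - q) ^ m \<le> B * \<rho> ^ m / (1 - q) ^ m" using q by (intro divide_right_mono) auto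
      then show ?thesis using i by (simp add: formal_H_eq formal_coeff_def norm_divide norm_power n1 power_divide)
    qed
    show "0 < \<rho> / (1 - q)" using \<rho> q by simp
    fix z :: complex assume z: "norm z > \<rho> / (1 - q)"
    have u: "q * norm beN < norm ((1 - Q) * z)"
    proof -
      have "\<rho> < (1 - q) * norm z" using z q by (simp add: field_simps)
      then show ?thesis using \<rho> by (simp add: norm_mult n1)
    qed
    have z0: "z \<noteq> 0"
    proof
      assume "z = 0"
      then have "q * norm beN < 0" using u by simp
      then show False using q by (simp add: mult_less_0_iff)
    qed
    have "norm (Q * beN / ((1 - Q) * z)) < 1" using u z0 q by (simp add: norm_divide norm_mult)
    then have "q_poch_inf (Q * beN / ((1 - Q) * z)) q \<noteq> 0" using q_exponential_series(2)[OF q] by (metis mult_zero_right zero_neq_one)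
    then have "F z = laurent_sum (ycol_ext i) ((1 - Q) * z) / q_poch_inf (Q * beN / ((1 - Q) * z)) q" by (rule F(2)[OF z0])
    moreover have "fps_nth ?f m * inverse z ^ m = zcol i m * inverse ((1 - Q) * z) ^ m" for m
      using i by (simp add: formal_H_eq formal_coeff_def power_mult_distrib power_inverse divide_inverse)
    ultimately show "(\<lambda>m. fps_nth ?f m * inverse z ^ m) sums F z" using zcol_sums[OF i u] by simp
  qed
  then have "q_sum q lam ?f z = F z" by (rule q_sum_eqI[OF q lam _ z])
  then show ?thesis using F(2)[OF z nz] nz by simp
qed

text \<open>In units of beN^(-p) all products over \<open>D\<close> become q-Pochhammer symbols. For
  \<open>i < N\<close> the parameter lowered by delta_il comes from (a; q)_(k+1) = (1 - a) (q a;
  q)_k with a = al_j / be_i, because \<open>psi\<close> omits the last factor of that symbol. The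
  parameter 0 contributes only factors 1.\<close>

lemma psi_hypergeometric:
  assumes i: "i \<le> N" and j: "j \<le> N"
  shows "psi j i p * beN ^ p = (if i = N then 1 else a i / (be i - al j)) *
     q_hyp_coeff (map (\<lambda>l. Q powr (1 + mu j - nu l - (if l = i then 1 else 0))) [0..<N] @ [0])
       (map (\<lambda>l. Q powr (1 + mu j - mu l)) (filter (\<lambda>l. l \<noteq> j) [0..<Suc N])) q p"
proof -
  let ?as = "map (\<lambda>l. Q powr (1 + mu j - nu l - (if l = i then 1 else 0))) [0..<N] @ [0]" and ?bs = "map (\<lambda>l. Q powr (1 + mu j - mu l)) (filter (\<lambda>l. l \<noteq> j) [0..<Suc N])"
  define x where "x = (\<lambda>l. if l = i then al j / be l else Q * al j / be l)"
  have as: "Q powr (1 + mu j - nu l - (if l = i then 1 else 0)) = x l" if "l < N" for l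
  proof -
    have "Q powr (1 + mu j - nu l - (if l = i then 1 else 0)) = Q powr 1 * Q powr mu j / Q powr nu l / Q powr (if l = i then 1 else 0)"
      unfolding powr_diff powr_add ..
    then show ?thesis using that j by (auto simp: q_nu q_mu x_def)
  qed
  have bs: "Q powr (1 + mu j - mu l) = Q * al j / al l" if "l \<le> N" for l
  proof -
    have "Q powr (1 + mu j - mu l) = Q powr 1 * Q powr mu j / Q powr mu l" unfolding powr_diff powr_add ..
    then show ?thesis using that j by (simp add: q_mu)
  qed
  have pl: "(\<Prod>y\<leftarrow>map f xs. g y) = (\<Prod>l\<in>set xs. g (f l))" if "distinct xs" for f :: "nat \<Rightarrow> complex" and g :: "complex \<Rightarrow> complex" and xs
    using prod.distinct_set_conv_list[OF that, of "\<lambda>l. g (f l)"] by (simp add: o_def)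
  have num: "(\<Prod>y\<leftarrow>?as. q_poch y q p) = (\<Prod>l<N. q_poch (x l) q p)"
    by (simp only: map_append prod_list.append pl distinct_upt) (auto intro!: prod.cong simp: as atLeast0LessThan)
  have "(\<Prod>y\<leftarrow>?bs. q_poch y q p)
      = (\<Prod>l\<in>{..N} - {j}. q_poch (Q * al j / al l) q p)"
    by (subst pl) (auto intro!: prod.cong simp: bs less_Suc_eq_le simp del: upt_Suc)
  moreover have "q_poch Q q p * (\<Prod>l\<in>{..N} - {j}. q_poch (Q * al j / al l) q p) = (\<Prod>l\<le>N. q_poch (Q * al j / al l) q p)"
    using prod.remove[of "{..N}" j "\<lambda>l. q_poch (Q * al j / al l) q p"] j al_nonzero[OF j] by simp
  ultimately have coeff: "q_hyp_coeff ?as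
       ?bs q p
     = (\<Prod>l<N. q_poch (x l) q p) / (\<Prod>l\<le>N. q_poch (Q * al j / al l) q p)"
    unfolding q_hyp_coeff_def num by simp
  show ?thesis
  proof (cases "i = N")
    case True
    then show ?thesis unfolding coeff by (simp add: psi_def psi_last_poch x_def cong: prod.cong_simp)
  next
    case False
    then have iN: "i < N" using i by simp
    have bi: "be i \<noteq> 0" "be i - al j \<noteq> 0" using be_nonzero[OF iN] al_neq_be[OF j iN] by auto
    show ?thesis
    proof (cases p)
      case 0 then show ?thesis unfolding coeff using False by (simp add: psi_def)
    next
      case (Suc k)
      define P where "P = (\<Prod>l\<in>{..<N} - {i}. q_poch (Q * al j / be l) q k)"
      define R where "R = (\<Prod>l\<in>{..<N} - {i}. 1 - al j * Q ^ Suc k / be l)"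
      define A where "A = (\<Prod>l\<le>N. q_poch (Q * al j / al l) q k)"
      define S where "S = (\<Prod>l\<le>N. 1 - al j * Q ^ Suc k / al l)"
      have shift: "q_poch (al j / be i) q (Suc k) = (1 - al j / be i) * q_poch (Q * al j / be i) q k"
        unfolding q_poch_def prod.lessThan_Suc_shift by (simp add: mult_ac)
      have "(\<Prod>l<N. q_poch (x l) q (Suc k)) = q_poch (x i) q (Suc k) * (\<Prod>l\<in>{..<N} - {i}. q_poch (x l) q (Suc k))"
        using iN by (intro prod.remove) auto
      also have "(\<Prod>l\<in>{..<N} - {i}. q_poch (x l) q (Suc k)) = P * R"
        unfolding P_def R_def prod.distrib[symmetric] by (intro prod.cong refl) (auto simp: x_def q_poch_Suc mult_ac)
      finally have n: "(\<Prod>l<N. q_poch (x l) q (Suc k)) = (1 - al j / be i) * q_poch (Q * al j / be i) q k * (P * R)"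
        by (simp add: x_def shift)
      have m: "(\<Prod>l\<le>N. q_poch (Q * al j / al l) q (Suc k)) = A * S"
        unfolding A_def S_def prod.distrib[symmetric] by (intro prod.cong refl) (simp add: q_poch_Suc mult_ac)
      have pl: "psi_last j k * beN ^ k = q_poch (Q * al j / be i) q k * P / A"
        unfolding psi_last_poch A_def P_def using iN by (subst prod.remove[of "{..<N}" i]) auto
      have "(\<Prod>l\<in>{..<N} - {i}. be l - al j * Q ^ Suc k) = (\<Prod>l\<in>{..<N} - {i}. be l) * R"
        unfolding R_def prod.distrib[symmetric] using be_nonzero by (intro prod.cong) (auto simp: right_diff_distrib)
      moreover have "(\<Prod>l\<le>N. al l - al j * Q ^ Suc k) = (\<Prod>l\<le>N. al l) * S"
        unfolding S_def prod.distrib[symmetric] using al_nonzero by (intro prod.cong) (auto simp: right_diff_distrib)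
      moreover have "beN * (\<Prod>l\<in>{..<N} - {i}. be l) / (\<Prod>l\<le>N. al l) = 1 / be i"
      proof -
        have "(\<Prod>l<N. be l) = be i * (\<Prod>l\<in>{..<N} - {i}. be l)" using iN by (intro prod.remove) auto
        moreover have "(\<Prod>l\<in>{..<N} - {i}. be l) \<noteq> 0" "(\<Prod>l\<le>N. al l) \<noteq> 0" using be_nonzero al_nonzero by auto
        ultimately show ?thesis using bi by (simp add: beN_def)
      qed
      ultimately have r: "beN * ((\<Prod>l\<in>{..<N} - {i}. be l - al j * Q ^ Suc k) / (\<Prod>l\<le>N. al l - al j * Q ^ Suc k)) = R / (be i * S)"
      proof -
        assume 1: "(\<Prod>l\<in>{..<N} - {i}. be l - al j * Q ^ Suc k) = (\<Prod>l\<in>{..<N} - {i}. be l) * R"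
          and 2: "(\<Prod>l\<le>N. al l - al j * Q ^ Suc k) = (\<Prod>l\<le>N. al l) * S"
          and 3: "beN * (\<Prod>l\<in>{..<N} - {i}. be l) / (\<Prod>l\<le>N. al l) = 1 / be i"
        have "beN * (X * R / (Y * S)) = beN * X / Y * (R / S)" for X Y by simp
        then show ?thesis unfolding 1 2 by (simp only: 3) simp
      qed
      have "psi j i p * beN ^ p = a i * (beN * ((\<Prod>l\<in>{..<N} - {i}. be l - al j * Q ^ Suc k) / (\<Prod>l\<le>N. al l - al j * Q ^ Suc k))) * (psi_last j k * beN ^ k)"
        using False Suc by (simp add: psi_def mult_ac)
      also have "\<dots> = a i / (be i - al j) * ((1 - al j / be i) * q_poch (Q * al j / be i) q k * (P * R) / (A * S))"
      proof -
        have "1 - al j / be i = (be i - al j) / be i" using bi by (simp add: diff_divide_distrib)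
        then show ?thesis unfolding r pl using bi by (simp add: mult_ac)
      qed
      finally show ?thesis unfolding coeff using False Suc n m by simp
    qed
  qed
qed

text \<open>In the unit disc of x = u / beN the hypergeometric series is \<open>psi\<close> up to a
  nonzero constant, so \<open>connection_identity\<close> exhibits it as a quotient. That quotient
  is its meromorphic continuation, hence the identity holds for all z at which the theta functions
  do not vanish.\<close>

lemma H_zero_connection:
  assumes L: "admissible L" and i: "i \<le> N" and j: "j \<le> N" and z: "z \<noteq> 0"
    and th: "theta_q q (L * ((1 - Q) * z)) \<noteq> 0" "theta_q q (- ((1 - Q) * z / beN)) \<noteq> 0"
    and ev: "\<And>l. l \<le> N \<Longrightarrow> al l = 1 - (1 - Q) * ev (Suc N) l" "\<And>l. l < N \<Longrightarrow> be l = 1 - (1 - Q) * ev N l"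
  shows "H_zero q (Suc N) M ev mu nu z $$ (i, j) * (theta_q q (L * ((1 - Q) * z)) * theta_q q (- ((1 - Q) * z / beN)))
    = (\<Sum>l\<le>N. col_value L l i ((1 - Q) * z) * conn_value L l j ((1 - Q) * z))"
proof -
  note L0 = admissible_nonzero[OF L]
  define c where "c = (if i = N then 1 else a i / (be i - al j))"
  have c0: "c \<noteq> 0" using a_nonzero[of i] al_neq_be[OF j, of i] i by (auto simp: c_def)
  define as where "as = map (\<lambda>l. Q powr (1 + mu j - nu l - (if l = i then 1 else 0))) [0..<N] @ [0]"
  define bs where "bs = map (\<lambda>l. Q powr (1 + mu j - mu l)) (filter (\<lambda>l. l \<noteq> j) [0..<Suc N])"
  have pref: "(if i = N then 1 else M $$ (i, N) / (ev (Suc N) j - ev N i)) = c"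
  proof (cases "i = N")
    case False
    then have "i < N" using i by simp
    then have "be i - al j = (1 - Q) * (ev (Suc N) j - ev N i)"
      unfolding ev(1)[OF j] ev(2)[OF \<open>i < N\<close>] by (simp add: algebra_simps)
    then have "c = (1 - Q) * M $$ (i, N) / ((1 - Q) * (ev (Suc N) j - ev N i))"
      using False \<open>i < N\<close> by (simp add: c_def M_col)
    then show ?thesis using False by simp
  qed (simp add: c_def)
  define f where "f = (\<lambda>x. \<Sum>k. q_hyp_coeff as bs q k * x ^ k)"
  have pc: "psi j i p * beN ^ p = c * q_hyp_coeff as bs q p" for p
    unfolding psi_hypergeometric[OF i j] c_def as_def bs_def ..
  have fs: "(\<lambda>k. q_hyp_coeff as bs q k * x ^ k) sums f x \<and> (x \<noteq> 0 \<longrightarrow> laurent_sum (psi_ext j i) (beN * x) = c * f x)"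
    if x: "norm x < 1" for x
  proof (cases "x = 0")
    case True
    then show ?thesis using powser_sums_zero[of "q_hyp_coeff as bs q"] by (simp add: f_def sums_iff)
  next
    case False
    have "((\<lambda>m. psi_ext j i m * (beN * x) powi m) has_sum laurent_sum (psi_ext j i) (beN * x)) UNIV"
      by (rule laurent_has_sum[OF psi_ext_summable[OF j i]]) (use x False in \<open>auto simp: norm_mult\<close>)
    also have "?this \<longleftrightarrow> ((\<lambda>m. psi_ext j i m * (beN * x) powi m) has_sum laurent_sum (psi_ext j i) (beN * x)) {0..}"
      by (rule has_sum_cong_neutral) (auto simp: psi_ext_def)
    also have "\<dots> \<longleftrightarrow> ((\<lambda>p. c * (q_hyp_coeff as bs q p * x ^ p)) has_sum laurent_sum (psi_ext j i) (beN * x)) UNIV"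
      by (rule has_sum_reindex_bij_witness[of _ int nat])
        (auto simp: psi_ext_def power_int_def power_mult_distrib mult.assoc[symmetric] pc[symmetric])
    finally have "(\<lambda>p. c * (q_hyp_coeff as bs q p * x ^ p)) sums laurent_sum (psi_ext j i) (beN * x)"
      by (rule has_sum_imp_sums)
    then have "(\<lambda>p. inverse c * (c * (q_hyp_coeff as bs q p * x ^ p))) sums (inverse c * laurent_sum (psi_ext j i) (beN * x))"
      by (rule sums_mult)
    then have "(\<lambda>p. q_hyp_coeff as bs q p * x ^ p) sums (inverse c * laurent_sum (psi_ext j i) (beN * x))"
      using c0 by (simp add: mult.assoc[symmetric])
    then show ?thesis using c0 by (simp add: f_def sums_iff)
  qed
  have fh: "f holomorphic_on ball 0 1"
    by (rule power_series_holomorphic[of 0 1 "q_hyp_coeff as bs q"]) (use fs in auto)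
  define h where "h = (\<lambda>x. theta_q q (L * (beN * x)) * theta_q q (- x))"
  define g where "g = (\<lambda>x. inverse c * (\<Sum>l\<le>N. col_value L l i (beN * x) * conn_value L l j (beN * x)))"
  have comp: "(\<lambda>x. k (beN * x)) holomorphic_on - {0}" if "k holomorphic_on - {0}" for k
    using holomorphic_on_compose_gen[OF _ that, of "\<lambda>x. beN * x" "- {0}"] by (force simp: o_def intro: holomorphic_intros)
  have hh: "h holomorphic_on - {0}"
    unfolding h_def using theta_q_scaled_holomorphic[of "L * beN"] theta_q_scaled_holomorphic[of "- 1"] L0
    by (auto intro!: holomorphic_on_mult simp: mult.assoc)
  have gh: "g holomorphic_on - {0}"
    unfolding g_def
    by (intro holomorphic_on_mult holomorphic_on_sum holomorphic_on_const comp[OF col_value_holomorphic[OF L i]] comp[OF conn_value_holomorphic[OF L j]]) auto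
  define w where "w = (1 - Q) * z / beN"
  have w: "w \<noteq> 0" "beN * w = (1 - Q) * z" using z by (auto simp: w_def)
  have hw: "h w \<noteq> 0" using th w by (simp add: h_def w_def)
  have fg: "f u * h u = g u" if u: "u \<noteq> 0" "norm u < 1" for u
  proof -
    have "laurent_sum (psi_ext j i) (beN * u) * (theta_q q (L * (beN * u)) * theta_q q (- (beN * u / beN)))
        = (\<Sum>l\<le>N. col_value L l i (beN * u) * conn_value L l j (beN * u))"
      by (rule connection_identity[OF L j i]) (use u in \<open>auto simp: norm_mult\<close>)
    then have "c * f u * h u = (\<Sum>l\<le>N. col_value L l i (beN * u) * conn_value L l j (beN * u))"
      using fs[OF u(2)] u(1) by (simp add: h_def)
    then show ?thesis using c0 by (simp add: g_def field_simps)
  qed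
  obtain F where F: "F nicely_meromorphic_on UNIV" "\<And>u. norm u < 1 \<Longrightarrow> F u = f u"
    "\<And>u. u \<noteq> 0 \<Longrightarrow> h u \<noteq> 0 \<Longrightarrow> F u * h u = g u"
    using power_series_quotient_continuation[OF fh _ gh hh w(1) hw fg] by auto
  have "q_hyp as bs q = F" by (rule q_hyp_eqI[OF F(1)]) (use F(2) fs in auto)
  moreover have "(1 - complex_of_real q) * z / complex_of_real q powr nu N = w" by (simp add: w_def q_nu)
  ultimately have "H_zero q (Suc N) M ev mu nu z $$ (i, j) = c * F w"
    using i j unfolding pref[symmetric] as_def bs_def by (simp add: H_zero_def del: upt_Suc filter.simps)
  then have "H_zero q (Suc N) M ev mu nu z $$ (i, j) * h w = (\<Sum>l\<le>N. col_value L l i (beN * w) * conn_value L l j (beN * w))"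
    using F(3)[OF w(1) hw] c0 by (simp add: g_def field_simps)
  then show ?thesis unfolding h_def w(2) by (simp add: w_def)
qed

text \<open>\<open>F_inf\<close> is the matrix of columns times a diagonal matrix. After removal of
  the diagonal factors \<open>H_zero_connection\<close> is the defining equation of the connection
  matrix, and \<open>col_value_independent\<close> excludes a second solution.\<close>

theorem connection_matrix_entries:
  assumes L: "admissible (lam / (1 - Q))" and lam: "lam \<noteq> 0" and z: "z \<noteq> 0"
    and thL: "theta_q q (lam * z) \<noteq> 0" and thx: "theta_q q (- ((1 - Q) * z / beN)) \<noteq> 0"
    and ev: "\<And>l. l \<le> N \<Longrightarrow> al l = 1 - (1 - Q) * ev (Suc N) l" "\<And>l. l < N \<Longrightarrow> be l = 1 - (1 - Q) * ev N l"
    and j: "j \<le> N"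
  defines "x \<equiv> (1 - Q) * z / beN"
  shows "l < N \<Longrightarrow> connection_matrix q (Suc N) M ev mu nu lg lam z $$ (l, j)
      = conn_top l j * (theta_q q (- (al j / be l) * x) / theta_q q (- x)) * exp ((mu j - nu l) * lg z)"
    and "connection_matrix q (Suc N) M ev mu nu lg lam z $$ (N, j)
      = conn_bot (lam / (1 - Q)) j * (theta_q q (al j * (lam / (1 - Q)) * x) / theta_q q (lam * z)) * exp ((mu j - nu N) * lg z)"
proof -
  let ?L = "lam / (1 - Q)" and ?u = "(1 - Q) * z"
  have x0: "x \<noteq> 0" using z by (simp add: x_def)
  have Lu: "?L * ?u = lam * z" by simp
  define PX where "PX = q_poch_inf x q * q_poch_inf (Q / x) q"
  have jt: "theta_q q (- x) = q_poch_inf Q q * PX"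
    using jacobi_triple_product[OF q, of "- x"] x0 by (simp add: PX_def mult.assoc)
  have PX: "PX \<noteq> 0" using jt thx by (auto simp: x_def)
  \<comment> \<open>The last column is divided by (x; q)_inf, coming from the q-exponential, and by
    (q / x; q)_inf, coming from its q-sum. By the triple product this is theta(- x) divided by (q;
    q)_inf, which absorbs the constant (q; q)_inf in \<open>conn_value\<close> and removes theta(-
    x) from the last row.\<close>
  define \<kappa> where "\<kappa> = (\<lambda>l. if l < N then theta_q q (lam * z) else PX)"
  have \<kappa>: "\<kappa> l \<noteq> 0" for l using thL PX by (simp add: \<kappa>_def)
  define F where "F = F_inf q (Suc N) M nu lg lam z"
  define F0 where "F0 = F_zero q (Suc N) M ev mu nu lg z"
  have Hc: "H_zero q (Suc N) M ev mu nu z \<in> carrier_mat (Suc N) (Suc N)" unfolding H_zero_def by (rule mat_carrier)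
  have Fc: "F \<in> carrier_mat (Suc N) (Suc N)" "F0 \<in> carrier_mat (Suc N) (Suc N)"
    unfolding F_def F_inf_def F0_def F_zero_def using Hc by auto
  have Fe: "F $$ (i, l) = col_value ?L l i ?u * (exp (nu l * lg z) / \<kappa> l)" if i: "i \<le> N" and l: "l \<le> N" for i l
  proof (cases "l < N")
    case True
    have "q_sum q lam (formal_H q (Suc N) M nu $$ (i, l)) z = col_value ?L l i ?u / theta_q q (lam * z)"
      using q_sum_top[OF L True i lam z thL] thL by (simp add: nonzero_eq_divide_eq)
    then show ?thesis using i l True by (simp add: F_def F_inf_def norm_factor_def \<kappa>_def)
  next
    case False
    then have lN: "l = N" using l by simp
    have qx: "Q * beN / ?u = Q / x" by (simp add: x_def)
    have nz: "q_poch_inf (Q / x) q \<noteq> 0" using PX by (simp add: PX_def)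
    have "q_sum q lam (formal_H q (Suc N) M nu $$ (i, N)) z = col_value ?L N i ?u / q_poch_inf (Q / x) q"
      using q_sum_last[OF i lam z] nz unfolding qx by (simp add: nonzero_eq_divide_eq col_value_def)
    moreover have "(1 - Q) * (Q powr (- nu N) * z) = x" by (simp add: powr_minus q_nu x_def divide_inverse mult_ac)
    then have "norm_factor q (Suc N) nu lg N z = exp (nu N * lg z) / q_poch_inf x q"
      by (simp add: norm_factor_def exp_q_def)
    ultimately show ?thesis using i l False lN by (simp add: F_def F_inf_def \<kappa>_def PX_def)
  qed
  have F0e: "F0 $$ (i, j) = H_zero q (Suc N) M ev mu nu z $$ (i, j) * exp (mu j * lg z)" if i: "i \<le> N" and j: "j \<le> N" for i j
  proof -
    have "F0 $$ (i, j) = (\<Sum>k\<le>N. if k = j then H_zero q (Suc N) M ev mu nu z $$ (i, j) * exp (mu j * lg z) else 0)"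
      unfolding F0_def F_zero_def using i j Hc
      by (subst index_mult_mat) (auto simp: scalar_prod_def atLeast0LessThan lessThan_Suc_atMost less_Suc_eq_le if_distrib[of "\<lambda>x. _ * x"] cong: if_cong)
    then show ?thesis using j by simp
  qed
  define T where "T = theta_q q (lam * z) * theta_q q (- x)"
  have T: "T \<noteq> 0" using thL thx by (simp add: T_def x_def)
  define U where "U = mat (Suc N) (Suc N) (\<lambda>(l, j). conn_value ?L l j ?u * \<kappa> l / T * exp ((mu j - nu l) * lg z))"
  have Uc: "U \<in> carrier_mat (Suc N) (Suc N)" by (simp add: U_def)
  have me: "(F * V) $$ (i, j) = (\<Sum>l\<le>N. col_value ?L l i ?u * (exp (nu l * lg z) / \<kappa> l) * V $$ (l, j))"
    if i: "i \<le> N" and j: "j \<le> N" and V: "V \<in> carrier_mat (Suc N) (Suc N)" for i j V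
    using i j V Fc by (subst index_mult_mat) (auto simp: scalar_prod_def Fe atLeast0LessThan lessThan_Suc_atMost less_Suc_eq_le intro!: sum.cong)
  have FU: "F * U = F0"
  proof (rule eq_matI)
    fix i j assume "i < dim_row F0" "j < dim_col F0"
    then have ij: "i \<le> N" "j \<le> N" using Fc by auto
    have "(F * U) $$ (i, j) = (\<Sum>l\<le>N. col_value ?L l i ?u * (exp (nu l * lg z) / \<kappa> l) * (conn_value ?L l j ?u * \<kappa> l / T * exp ((mu j - nu l) * lg z)))"
      unfolding me[OF ij Uc] using ij by (intro sum.cong refl) (simp add: U_def)
    also have "\<dots> = (\<Sum>l\<le>N. col_value ?L l i ?u * conn_value ?L l j ?u * (exp (mu j * lg z) / T))"
    proof (intro sum.cong refl)
      fix l
      have e: "exp (nu l * lg z) * exp ((mu j - nu l) * lg z) = exp (mu j * lg z)"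
        by (simp add: exp_add[symmetric] algebra_simps)
      have "c * (a / k) * (v * k / t * b) = c * v * (a * b / t)" if "k \<noteq> 0" for c a k v t b :: complex using that by simp
      from this[OF \<kappa>] show "col_value ?L l i ?u * (exp (nu l * lg z) / \<kappa> l) * (conn_value ?L l j ?u * \<kappa> l / T * exp ((mu j - nu l) * lg z))
        = col_value ?L l i ?u * conn_value ?L l j ?u * (exp (mu j * lg z) / T)" unfolding e[symmetric] .
    qed
    also have "\<dots> = (\<Sum>l\<le>N. col_value ?L l i ?u * conn_value ?L l j ?u) * (exp (mu j * lg z) / T)" by (rule sum_distrib_right[symmetric])
    also have "(\<Sum>l\<le>N. col_value ?L l i ?u * conn_value ?L l j ?u) = H_zero q (Suc N) M ev mu nu z $$ (i, j) * T"
      using H_zero_connection[OF L ij z _ thx ev] thL unfolding Lu T_def x_def by simp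
    also have "H_zero q (Suc N) M ev mu nu z $$ (i, j) * T * (exp (mu j * lg z) / T) = F0 $$ (i, j)"
      unfolding F0e[OF ij] using T by simp
    finally show "(F * U) $$ (i, j) = F0 $$ (i, j)" .
  qed (use Fc Uc in auto)
  have uniq: "V = U" if V: "V \<in> carrier_mat (Suc N) (Suc N)" "F * V = F0" for V
  proof (rule eq_matI)
    fix l j assume "l < dim_row U" "j < dim_col U"
    then have lj: "l \<le> N" "j \<le> N" using Uc by auto
    define v where "v = (\<lambda>l. exp (nu l * lg z) / \<kappa> l * (V $$ (l, j) - U $$ (l, j)))"
    have "v l = 0"
    proof (rule col_value_independent[OF L, of ?u])
      fix i assume i: "i \<le> N"
      have "(\<Sum>l\<le>N. col_value ?L l i ?u * v l) = (F * V) $$ (i, j) - (F * U) $$ (i, j)"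
        unfolding me[OF i lj(2) V(1)] me[OF i lj(2) Uc] sum_subtractf[symmetric] v_def
        by (simp add: right_diff_distrib mult.assoc)
      then show "(\<Sum>l\<le>N. col_value ?L l i ?u * v l) = 0" using V FU by simp
    qed (use z thL thx lj in auto)
    then show "V $$ (l, j) = U $$ (l, j)" using \<kappa>[of l] by (simp add: v_def)
  qed (use V Uc in auto)
  have cm: "connection_matrix q (Suc N) M ev mu nu lg lam z = U"
    unfolding connection_matrix_def F_def[symmetric] F0_def[symmetric]
  proof (rule the_equality)
    show "U \<in> carrier_mat (Suc N) (Suc N) \<and> F * U = F0" using Uc FU by blast
    show "V = U" if "V \<in> carrier_mat (Suc N) (Suc N) \<and> F * V = F0" for V using uniq that by blast
  qed
  show "connection_matrix q (Suc N) M ev mu nu lg lam z $$ (l, j)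
      = conn_top l j * (theta_q q (- (al j / be l) * x) / theta_q q (- x)) * exp ((mu j - nu l) * lg z)" if l: "l < N"
    unfolding cm using l j thL by (simp add: U_def conn_value_def \<kappa>_def T_def x_def)
  have Q0: "q_poch_inf Q q \<noteq> 0" using jt thx by (auto simp: x_def)
  have "q_poch_inf Q q * b * t * PX / (theta_q q (lam * z) * theta_q q (- x)) * e = b * (t / theta_q q (lam * z)) * e" for b t e
    unfolding jt using PX Q0 by simp
  note this[of "conn_bot ?L j" "theta_q q (al j * ?L * x)" "exp ((mu j - nu N) * lg z)"]
  moreover have "conn_value ?L N j ?u = q_poch_inf Q q * conn_bot ?L j * theta_q q (al j * ?L * x)"
    by (simp add: conn_value_def x_def)
  ultimately show "connection_matrix q (Suc N) M ev mu nu lg lam z $$ (N, j)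
      = conn_bot (lam / (1 - Q)) j * (theta_q q (al j * (lam / (1 - Q)) * x) / theta_q q (lam * z)) * exp ((mu j - nu N) * lg z)"
    unfolding cm U_def using j by (simp only: index_mat less_Suc_eq_le order_refl prod.case \<kappa>_def T_def less_irrefl if_False)
qed

end

section \<open>Diagonalization of the corner\<close>

lemma pick_lessThan: "i < k \<Longrightarrow> pick {..<k} i = i"
proof -
  assume "i < k"
  moreover from this have "{a \<in> {..<k}. a < i} = {..<i}" by auto
  ultimately show ?thesis using pick_card_in_set[of i "{..<k}"] by simp
qed

lemma pick_lessThan_remove:
  assumes "i < N" "j < N - 1"
  shows "pick ({..<N} - {i}) j = (if j < i then j else Suc j)"
proof -
  define t where "t = (if j < i then j else Suc j)"
  have "t \<in> {..<N} - {i}" using assms by (auto simp: t_def)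
  moreover have "card {a \<in> {..<N} - {i}. a < t} = j"
  proof (cases "j < i")
    case True
    then have "{a \<in> {..<N} - {i}. a < t} = {..<j}" using assms by (auto simp: t_def)
    then show ?thesis by simp
  next
    case False
    then have "{a \<in> {..<N} - {i}. a < t} = {..<Suc j} - {i}" using assms by (auto simp: t_def)
    then show ?thesis using False by simp
  qed
  ultimately show ?thesis using pick_card_in_set[of t "{..<N} - {i}"] by (simp add: t_def)
qed

lemma submatrix_corner:
  assumes "A \<in> carrier_mat n n" "k \<le> n"
  shows "submatrix A {..<k} {..<k} = mat k k (\<lambda>(i, j). A $$ (i, j))"
proof -
  have "{i. i < n \<and> i \<in> {..<k}} = {..<k}" using assms by auto
  then show ?thesis using assms by (intro eq_matI) (auto simp: submatrix_def pick_lessThan)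
qed

definition shifted_corner :: "complex mat \<Rightarrow> nat \<Rightarrow> complex \<Rightarrow> complex mat" where
  "shifted_corner A k e = mat k k (\<lambda>(i, j). A $$ (i, j) - (if i = j then e else 0))"

lemma shifted_corner_carrier [simp]: "shifted_corner A k e \<in> carrier_mat k k"
  by (simp add: shifted_corner_def)

lemma det_shifted_corner:
  assumes A: "A \<in> carrier_mat n n" and k: "k \<le> n" and sp: "is_corner_spectrum n A ev"
  shows "det (shifted_corner A k e) = (- 1) ^ k * (\<Prod>i<k. e - ev k i)"
proof -
  let ?C = "mat k k (\<lambda>(i, j). A $$ (i, j))"
  have "char_poly ?C = (\<Prod>i<k. [:- ev k i, 1:])"
    using sp k unfolding is_corner_spectrum_def submatrix_corner[OF A k, symmetric] by simp
  then have "(\<Prod>i<k. e - ev k i) = det (- (char_matrix ?C e))"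
    using char_poly_matrix[of ?C k e] by (simp add: poly_prod)
  moreover have "shifted_corner A k e = (- 1) \<cdot>\<^sub>m (- (char_matrix ?C e))"
    by (intro eq_matI) (auto simp: shifted_corner_def char_matrix_def)
  ultimately show ?thesis by (simp add: char_matrix_def)
qed

text \<open>Turns the minors in \<open>diag_P\<close> into cofactors along the last row of the
  shifted corner, so that the adjugate identity applies.\<close>

lemma minor_shifted_corner:
  assumes A: "A \<in> carrier_mat (Suc N) (Suc N)" and i: "i < N"
  shows "minor (A - e \<cdot>\<^sub>m 1\<^sub>m (Suc N)) {..<N - 1} ({..<N} - {i}) = det (mat_delete (shifted_corner A N e) (N - 1) i)"
proof -
  have "{a. a < Suc N \<and> a \<in> {..<N} - {i}} = {..<N} - {i}" "{a. a < Suc N \<and> a \<in> {..<N - 1}} = {..<N - 1}" using i by auto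
  then have "submatrix (A - e \<cdot>\<^sub>m 1\<^sub>m (Suc N)) {..<N - 1} ({..<N} - {i}) = mat_delete (shifted_corner A N e) (N - 1) i"
    using A i by (intro eq_matI)
      (auto simp: submatrix_def mat_delete_def shifted_corner_def pick_lessThan pick_lessThan_remove)
  then show ?thesis by (simp add: minor_def)
qed

text \<open>The product of a matrix with its adjugate is its determinant times the identity, here 0;
  so any row of cofactors is a kernel vector.\<close>

lemma cofactor_kernel:
  assumes B: "B \<in> carrier_mat N N" and det: "det B = (0 :: complex)" and ij: "i < N" "j < N"
  shows "(\<Sum>k<N. B $$ (i, k) * cofactor B j k) = 0"
proof -
  have "(\<Sum>k<N. B $$ (i, k) * cofactor B j k) = (B * adj_mat B) $$ (i, j)"
    using B ij by (simp add: adj_mat_def scalar_prod_def atLeast0LessThan)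
  then show ?thesis using adj_mat(2)[OF B] det ij by simp
qed

lemma eigenvectors_independent:
  fixes v :: "nat \<Rightarrow> nat \<Rightarrow> complex"
  assumes eig: "\<And>j i. j \<in> S \<Longrightarrow> i < N \<Longrightarrow> (\<Sum>k<N. A i k * v j k) = e j * v j i"
    and nz: "\<And>j. j \<in> S \<Longrightarrow> \<exists>i<N. v j i \<noteq> 0" and dist: "inj_on e S" and fin: "finite S"
    and z: "\<And>i. i < N \<Longrightarrow> (\<Sum>j\<in>S. c j * v j i) = 0" and j: "j \<in> S"
  shows "c j = 0"
  using fin eig nz dist z j
proof (induction S arbitrary: c j)
  case (insert s S)
  have z0: "(\<Sum>j\<in>insert s S. c j * v j i) = 0" if "i < N" for i using insert.prems(4) that by blast
  have "(\<Sum>j\<in>S. (c j * (e j - e s)) * v j i) = 0" if i: "i < N" for i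
  proof -
    have "0 = (\<Sum>k<N. A i k * (\<Sum>j\<in>insert s S. c j * v j k))" using z0 by simp
    also have "\<dots> = (\<Sum>j\<in>insert s S. c j * (\<Sum>k<N. A i k * v j k))"
      unfolding sum_distrib_left by (subst sum.swap) (simp add: mult_ac)
    also have "\<dots> = (\<Sum>j\<in>insert s S. c j * (e j * v j i))"
      by (intro sum.cong refl) (use insert.prems(1) i in auto)
    finally have "(\<Sum>j\<in>insert s S. c j * (e j * v j i)) - e s * (\<Sum>j\<in>insert s S. c j * v j i) = 0"
      using z0[OF i] by simp
    then have "(\<Sum>j\<in>insert s S. c j * (e j - e s) * v j i) = 0"
      unfolding sum_distrib_left sum_subtractf[symmetric] by (simp add: algebra_simps)
    then show ?thesis using insert.hyps by simp
  qed
  then have "c j * (e j - e s) = 0" if "j \<in> S" for j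
    using insert.IH[of "\<lambda>j. c j * (e j - e s)" j] insert.prems that by (auto simp: inj_on_insert)
  moreover have "e j \<noteq> e s" if "j \<in> S" for j
    using insert.prems(3) insert.hyps that by (metis inj_onD insertCI)
  ultimately have S0: "c j = 0" if "j \<in> S" for j using that by simp
  obtain i where i: "i < N" "v s i \<noteq> 0" using insert.prems(2) by blast
  have "c s * v s i = 0" using z0[OF i(1)] insert.hyps S0 by simp
  then show ?case using i S0 insert.prems(5) by auto
qed simp

text \<open>One unipotent elimination clears the last row and leaves the Schur complement in the
  corner. This divides by the diagonal entries, so the points where one of them vanishes have to be
  recovered by continuity later.\<close>

lemma det_arrow:
  fixes X :: "complex mat"
  assumes X: "X \<in> carrier_mat (Suc N) (Suc N)"
    and D: "\<And>i k. i < N \<Longrightarrow> k < N \<Longrightarrow> X $$ (i, k) = (if i = k then \<delta> i else 0)" and nz: "\<And>i. i < N \<Longrightarrow> \<delta> i \<noteq> 0"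
  shows "det X = X $$ (N, N) * (\<Prod>i<N. \<delta> i) - (\<Sum>i<N. X $$ (i, N) * X $$ (N, i) * (\<Prod>j\<in>{..<N} - {i}. \<delta> j))"
proof -
  define s where "s = X $$ (N, N) - (\<Sum>i<N. X $$ (N, i) * X $$ (i, N) / \<delta> i)"
  define L where "L = mat (Suc N) (Suc N) (\<lambda>(i, j). if i = j then 1 else if i = N then - X $$ (N, j) / \<delta> j else 0)"
  define Y where "Y = mat (Suc N) (Suc N) (\<lambda>(i, j). if i < N then X $$ (i, j) else if j < N then 0 else s)"
  have Lc: "L \<in> carrier_mat (Suc N) (Suc N)" and Yc: "Y \<in> carrier_mat (Suc N) (Suc N)" by (auto simp: L_def Y_def)
  have "L * X = Y"
  proof (rule eq_matI)
    fix i j assume "i < dim_row Y" "j < dim_col Y"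
    then have ij: "i \<le> N" "j \<le> N" by (auto simp: Y_def)
    have "(L * X) $$ (i, j) = (\<Sum>k\<le>N. L $$ (i, k) * X $$ (k, j))"
      using ij X Lc by (subst index_mult_mat) (auto simp: scalar_prod_def atLeast0LessThan lessThan_Suc_atMost less_Suc_eq_le intro!: sum.cong)
    also have "\<dots> = Y $$ (i, j)"
    proof (cases "i < N")
      case True
      have "(\<Sum>k\<le>N. L $$ (i, k) * X $$ (k, j)) = (\<Sum>k\<le>N. if k = i then X $$ (i, j) else 0)"
        using True ij by (intro sum.cong refl) (auto simp: L_def)
      then show ?thesis using True ij by (simp add: Y_def)
    next
      case False
      then have iN: "i = N" using ij by simp
      have "(\<Sum>k\<le>N. L $$ (i, k) * X $$ (k, j)) = (\<Sum>k<N. - X $$ (N, k) / \<delta> k * X $$ (k, j)) + X $$ (N, j)"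
        using iN by (auto simp: lessThan_Suc_atMost[symmetric] L_def intro!: sum.cong)
      also have "\<dots> = Y $$ (i, j)"
      proof (cases "j < N")
        case True
        have "(\<Sum>k<N. - X $$ (N, k) / \<delta> k * X $$ (k, j)) = (\<Sum>k<N. if k = j then - X $$ (N, j) else 0)"
          by (intro sum.cong refl) (use D True nz in auto)
        then show ?thesis using True iN by (simp add: Y_def)
      next
        case False
        then have "j = N" using ij by simp
        then show ?thesis using iN by (simp add: Y_def s_def sum_negf)
      qed
      finally show ?thesis .
    qed
    finally show "(L * X) $$ (i, j) = Y $$ (i, j)" .
  qed (use X Lc Yc in auto)
  then have "det L * det X = det Y" using det_mult[OF Lc X] by simp
  moreover have "det L = 1"
  proof -
    have "diag_mat L = map (\<lambda>_. 1) [0..<Suc N]" by (auto simp: diag_mat_def L_def simp del: upt_Suc)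
    then have "diag_mat L = replicate (Suc N) 1" by (simp add: map_replicate_const del: upt_Suc)
    moreover have "det L = prod_list (diag_mat L)" by (rule det_lower_triangular[OF _ Lc]) (auto simp: L_def)
    ultimately show ?thesis by simp
  qed
  moreover have "det Y = (\<Prod>i<N. \<delta> i) * s"
  proof -
    have "det Y = prod_list (diag_mat Y)"
      by (rule det_upper_triangular[OF _ Yc]) (auto simp: upper_triangular_def Y_def D)
    also have "diag_mat Y = map \<delta> [0..<N] @ [s]"
      by (auto simp: diag_mat_def Y_def D)
    finally show ?thesis by (simp add: prod.distinct_set_conv_list[symmetric] atLeast0LessThan)
  qed
  moreover have "(\<Prod>i<N. \<delta> i) * (X $$ (N, i) * X $$ (i, N) / \<delta> i) = X $$ (i, N) * X $$ (N, i) * (\<Prod>j\<in>{..<N} - {i}. \<delta> j)" if "i < N" for i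
    using that nz[OF that] prod.remove[of "{..<N}" i \<delta>] by simp
  ultimately show ?thesis by (simp add: s_def right_diff_distrib sum_distrib_left mult.commute[of "X $$ (N, N)"] cong: sum.cong_simp)
qed

text \<open>The columns of \<open>diag_P\<close> are kernel vectors of shifted corners, hence
  eigenvectors for distinct eigenvalues. Their last entries are, up to nonzero factors, the products
  of differences between the spectra of sizes N and N - 1; since these do not vanish, the
  eigenvectors are nonzero and the matrix is invertible.\<close>

lemma diag_A_structure:
  assumes A: "A \<in> carrier_mat (Suc N) (Suc N)" and sp: "is_corner_spectrum (Suc N) A ev"
    and r: "diag_sqrt (Suc N) ev r"
    and d1: "\<And>i j. i < N \<Longrightarrow> j < N \<Longrightarrow> i \<noteq> j \<Longrightarrow> ev N i \<noteq> ev N j"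
    and d2: "\<And>j l. j < N \<Longrightarrow> l < N - 1 \<Longrightarrow> ev N j \<noteq> ev (N - 1) l"
  defines "M \<equiv> diag_A (Suc N) A ev r"
  shows "M \<in> carrier_mat (Suc N) (Suc N)" "char_poly M = char_poly A"
    "\<And>i k. i < N \<Longrightarrow> k < N \<Longrightarrow> M $$ (i, k) = (if i = k then ev N i else 0)"
proof -
  let ?D = "mat N N (\<lambda>(i, j). if i = j then ev N i else 0)"
  define P where "P = diag_P (Suc N) A ev r"
  define A1 where "A1 = mat N N (\<lambda>(i, j). A $$ (i, j))"
  have Pc: "P \<in> carrier_mat N N" and A1c: "A1 \<in> carrier_mat N N" by (simp_all add: P_def diag_P_def A1_def)
  have r0: "r j \<noteq> 0" if j: "j < N" for j
  proof -
    have "(r j)\<^sup>2 = (\<Prod>l\<in>{..<N} - {j}. ev N l - ev N j) * (\<Prod>l<N - 1. ev (N - 1) l - ev N j)"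
      using r j by (simp add: diag_sqrt_def)
    moreover have "(\<Prod>l\<in>{..<N} - {j}. ev N l - ev N j) \<noteq> 0" "(\<Prod>l<N - 1. ev (N - 1) l - ev N j) \<noteq> 0"
      using d1[OF _ j] d2[OF j, THEN not_sym] by auto
    ultimately show ?thesis by auto
  qed
  let ?B = "\<lambda>j. shifted_corner A N (ev N j)"
  \<comment> \<open>The sign in \<open>diag_P\<close> differs from the cofactor sign by a factor
    that depends only on the column, so each column remains an eigenvector.\<close>
  have Pe: "P $$ (i, j) = (- 1) ^ (N - 1 + j) / r j * cofactor (?B j) (N - 1) i" if ij: "i < N" "j < N" for i j
  proof -
    have "P $$ (i, j) = (- 1) ^ (i + j) * det (mat_delete (?B j) (N - 1) i) / r j"
      using ij by (simp add: P_def diag_P_def minor_shifted_corner[OF A ij(1), unfolded One_nat_def])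
    moreover have "(- 1) ^ (N - 1 + j) * (- 1) ^ (N - 1 + i) = ((- 1) ^ (i + j) :: complex)"
    proof -
      have "(- 1) ^ (N - 1 + j) * (- 1) ^ (N - 1 + i) = ((- 1) ^ (N - 1) * (- 1) ^ (N - 1)) * ((- 1) ^ (i + j) :: complex)"
        by (simp add: power_add mult_ac)
      then show ?thesis by (simp flip: power_mult_distrib)
    qed
    ultimately show ?thesis by (simp add: cofactor_def mult.assoc[symmetric])
  qed
  have Bd: "det (?B j) = 0" if j: "j < N" for j
    unfolding det_shifted_corner[OF A le_SucI[OF order_refl] sp] using j by auto
  have eig: "(\<Sum>k<N. A1 $$ (i, k) * P $$ (k, j)) = ev N j * P $$ (i, j)" if ij: "i < N" "j < N" for i j
  proof -
    let ?s = "(- 1) ^ (N - 1 + j) / r j"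
    have "0 = ?s * (\<Sum>k<N. ?B j $$ (i, k) * cofactor (?B j) (N - 1) k)"
      using cofactor_kernel[OF shifted_corner_carrier Bd[OF ij(2)] ij(1), of "N - 1"] ij by simp
    also have "\<dots> = (\<Sum>k<N. ?B j $$ (i, k) * P $$ (k, j))"
      unfolding sum_distrib_left using ij by (intro sum.cong refl) (simp add: Pe)
    also have "\<dots> = (\<Sum>k<N. A1 $$ (i, k) * P $$ (k, j)) - (\<Sum>k<N. if k = i then ev N j * P $$ (i, j) else 0)"
      unfolding sum_subtractf[symmetric] using ij
      by (intro sum.cong refl) (auto simp: shifted_corner_def A1_def left_diff_distrib)
    finally show ?thesis using ij by simp
  qed
  have Pnz: "P $$ (N - 1, j) \<noteq> 0" if j: "j < N" for j
  proof -
    have "mat_delete (?B j) (N - 1) (N - 1) = shifted_corner A (N - 1) (ev N j)"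
      by (intro eq_matI) (auto simp: mat_delete_def shifted_corner_def)
    then have "det (mat_delete (?B j) (N - 1) (N - 1)) = (- 1) ^ (N - 1) * (\<Prod>l<N - 1. ev N j - ev (N - 1) l)"
      using det_shifted_corner[OF A _ sp, of "N - 1" "ev N j"] by simp
    moreover have "(\<Prod>l<N - 1. ev N j - ev (N - 1) l) \<noteq> 0" using d2 j by auto
    ultimately show ?thesis using Pe[of "N - 1" j] j r0[OF j] by (simp add: cofactor_def)
  qed
  have "det P \<noteq> 0"
  proof
    assume "det P = 0"
    then obtain v where v: "v \<in> carrier_vec N" "v \<noteq> 0\<^sub>v N" "P *\<^sub>v v = 0\<^sub>v N"
      using det_0_iff_vec_prod_zero[OF Pc] by blast
    have "v $ j = 0" if j: "j \<in> {..<N}" for j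
    proof (rule eigenvectors_independent[where A = "\<lambda>i k. A1 $$ (i, k)" and v = "\<lambda>j k. P $$ (k, j)" and e = "ev N" and S = "{..<N}" and N = N and c = "\<lambda>j. v $ j"])
      show "\<exists>i<N. P $$ (i, j) \<noteq> 0" if "j \<in> {..<N}" for j using Pnz[of j] that by (intro exI[of _ "N - 1"]) auto
      show "inj_on (ev N) {..<N}" using d1 by (auto simp: inj_on_def)
      show "(\<Sum>j<N. v $ j * P $$ (i, j)) = 0" if "i < N" for i
      proof -
        have "(P *\<^sub>v v) $ i = (\<Sum>j<N. v $ j * P $$ (i, j))"
          using Pc v(1) that by (simp add: scalar_prod_def atLeast0LessThan mult.commute)
        then show ?thesis using v(3) that by simp
      qed
    qed (use eig j in auto)
    then have "v = 0\<^sub>v N" using v(1) by (intro eq_vecI) auto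
    then show False using v(2) by simp
  qed
  then have "P \<in> Units (ring_mat TYPE(complex) N ())" by (rule det_non_zero_imp_unit[OF Pc])
  then obtain P' where P': "mat_inverse P = Some P'" using mat_inverse(1)[OF Pc, of "()"] by (cases "mat_inverse P") auto
  have inv: "P * P' = 1\<^sub>m N" "P' * P = 1\<^sub>m N" "P' \<in> carrier_mat N N" using mat_inverse(2)[OF Pc P'] by auto
  define c where "c = mat N 1 (\<lambda>(i, j). A $$ (i, N))"
  define w where "w = mat 1 N (\<lambda>(i, j). A $$ (N, j))"
  define t where "t = mat 1 1 (\<lambda>(i, j). A $$ (N, N))"
  have bc: "c \<in> carrier_mat N 1" "w \<in> carrier_mat 1 N" "t \<in> carrier_mat 1 1" by (simp_all add: c_def w_def t_def)
  have Ab: "A = four_block_mat A1 c w t"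
    using A by (intro eq_matI) (auto simp: A1_def c_def w_def t_def less_Suc_eq)
  define E where "E = diag_extend (Suc N) P"
  define E' where "E' = diag_extend (Suc N) P'"
  have Ec: "E = four_block_mat P (0\<^sub>m N 1) (0\<^sub>m 1 N) (1\<^sub>m 1)" "E' = four_block_mat P' (0\<^sub>m N 1) (0\<^sub>m 1 N) (1\<^sub>m 1)"
    by (simp_all add: E_def E'_def diag_extend_def)
  have EE: "E \<in> carrier_mat (Suc N) (Suc N)" "E' \<in> carrier_mat (Suc N) (Suc N)"
    using Pc inv by (auto simp: Ec)
  have one: "four_block_mat (1\<^sub>m N) (0\<^sub>m N 1) (0\<^sub>m 1 N) (1\<^sub>m 1) = (1\<^sub>m (Suc N) :: complex mat)"
    by (intro eq_matI) auto
  have prod1: "E * E' = 1\<^sub>m (Suc N)"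
    unfolding Ec by (subst mult_four_block_mat[of _ N N _ 1 _ 1 _ _ N _ 1]) (use Pc inv one in auto)
  then have prod2: "E' * E = 1\<^sub>m (Suc N)" by (rule mat_mult_left_right_inverse[OF EE])
  have M: "M = E' * A * E" by (simp add: M_def diag_A_def E_def E'_def P_def[symmetric] P')
  show Mc: "M \<in> carrier_mat (Suc N) (Suc N)" using EE A by (simp add: M)
  have "similar_mat M A"
    unfolding similar_mat_def similar_mat_wit_def Let_def
    by (intro exI[of _ E'] exI[of _ E]) (use Mc EE A prod1 prod2 M in auto)
  then show "char_poly M = char_poly A" by (rule char_poly_similar)
  fix i k assume ik: "i < N" "k < N"
  have "E' * A = four_block_mat (P' * A1) (P' * c) w t"
    unfolding Ec Ab by (subst mult_four_block_mat[of _ N N _ 1 _ 1 _ _ N _ 1]) (use inv A1c bc in auto)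
  then have "M = four_block_mat (P' * A1 * P) (P' * c) (w * P) t"
    unfolding M Ec(1) by (simp only:) (subst mult_four_block_mat[of _ N N _ 1 _ 1 _ _ N _ 1], use inv A1c bc Pc in auto)
  then have "M $$ (i, k) = (P' * A1 * P) $$ (i, k)" using ik inv Pc bc by simp
  also have "P' * A1 * P = P' * (A1 * P)" by (rule assoc_mult_mat[OF inv(3) A1c Pc])
  also have "A1 * P = P * ?D"
  proof (rule eq_matI)
    fix i j assume "i < dim_row (P * ?D)" "j < dim_col (P * ?D)"
    then have ij: "i < N" "j < N" using Pc by auto
    have "(A1 * P) $$ (i, j) = ev N j * P $$ (i, j)"
      unfolding eig[OF ij, symmetric] using ij A1c Pc by (simp add: scalar_prod_def atLeast0LessThan)
    moreover have "(P * ?D) $$ (i, j) = ev N j * P $$ (i, j)"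
      using ij Pc by (simp add: scalar_prod_def atLeast0LessThan if_distrib[of "\<lambda>x. _ * x"] cong: if_cong)
    ultimately show "(A1 * P) $$ (i, j) = (P * ?D) $$ (i, j)" by simp
  qed (use A1c Pc in auto)
  also have "P' * (P * ?D) = ?D"
    by (subst assoc_mult_mat[OF inv(3) Pc, symmetric]) (auto simp: inv)
  finally show "M $$ (i, k) = (if i = k then ev N i else 0)" using ik by simp
qed

section \<open>Exponents and the formula for the original data\<close>

lemma q_powr_log_q:
  assumes "0 < q" "q < 1" "w \<noteq> 0"
  shows "of_real q powr log_q q w = w"
proof -
  have "ln q \<noteq> 0" using assms by simp
  then have "log_q q w * Ln (of_real q) = Ln w" using assms by (simp add: log_q_def Ln_of_real)
  then show ?thesis using assms by (simp add: powr_def mult.commute)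
qed

text \<open>The exponents come from the principal logarithm, so ratios in \<open>q\<^sup>\<int>\<close> have integer exponent differences.\<close>

lemma log_q_resonance:
  assumes q: "0 < q" "q < 1" and w: "w \<noteq> 0" and e: "w' = w * of_real q powi k"
  shows "log_q q w' - log_q q w \<in> \<int>"
proof -
  have "Ln w' = Ln (of_real (q powi k) * w)" by (simp add: e mult.commute)
  also have "\<dots> = of_real (ln (q powi k)) + Ln w" using Ln_times_of_real[of "q powi k" w] q w by (simp add: Ln_of_real del: of_real_power_int)
  also have "ln (q powi k) = of_int k * ln q"
    using q by (cases k rule: int_cases2) (simp_all add: power_int_minus ln_realpow ln_inverse)
  finally have "log_q q w' - log_q q w = of_int k * (of_real (ln q) / of_real (ln q))"
    by (simp add: log_q_def add_divide_distrib)
  moreover have "ln q \<noteq> 0" using q by simp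
  ultimately show ?thesis by simp
qed

text \<open>The assumptions \<open>log_defined\<close> and \<open>quot_defined\<close> express that
  the logarithms in the exponents and the quotients in the formula are meaningful. All powers of z
  are formed with the one logarithm \<open>lg\<close>.\<close>

theorem theorem3p8:
  fixes q :: real and n :: nat and A M :: "complex mat"
    and ev :: "nat \<Rightarrow> nat \<Rightarrow> complex" and r mu nu :: "nat \<Rightarrow> complex"
    and lg :: "complex \<Rightarrow> complex" and lam z :: complex
  assumes q: "0 < q" "q < 1"
    and n: "0 < n"
    and A: "A \<in> carrier_mat n n"
    and branch: "\<And>w. w \<noteq> 0 \<Longrightarrow> exp (lg w) = w"
    and spectrum: "is_corner_spectrum n A ev"
    and mu: "mu = mu_exp q n ev"
    and nu: "nu = nu_exp q n ev"
    and r: "diag_sqrt n ev r"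
    and M: "M = diag_A n A ev r"
    and log_defined: "\<And>i. i < n \<Longrightarrow> 1 - (1 - of_real q) * ev n i \<noteq> 0"
      "\<And>i. i < n - 1 \<Longrightarrow> 1 - (1 - of_real q) * ev (n - 1) i \<noteq> 0"
    and quot_defined: "\<And>i j. i < n - 1 \<Longrightarrow> j < n \<Longrightarrow> ev n j \<noteq> ev (n - 1) i"
    and mu_nonres: "\<And>i j. i < n \<Longrightarrow> j < n \<Longrightarrow> i \<noteq> j \<Longrightarrow> mu i - mu j \<notin> \<int>"
    and nu_nonres: "\<And>i j. i < n - 1 \<Longrightarrow> j < n - 1 \<Longrightarrow> i \<noteq> j \<Longrightarrow> nu i - nu j \<notin> \<int>"
    and ev_distinct: "\<And>j l. j < n - 1 \<Longrightarrow> l < n - 2 \<Longrightarrow> ev (n - 1) j \<noteq> ev (n - 2) l"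
    and lam: "lam \<noteq> 0"
      "\<And>l (k::int). l < n - 1 \<Longrightarrow>
         lam \<noteq> - ((1 - of_real q) / of_real q powr nu l) * of_real q powi k"
    and z: "z \<noteq> 0"
      "\<And>k::int. z \<noteq> of_real q powr nu (n - 1) / (1 - of_real q) * of_real q powi k"
      "\<And>k::int. z \<noteq> - (1 / lam) * of_real q powi k"
  shows
    "(\<forall>i<n - 1. \<forall>j<n.
        connection_matrix q n M ev mu nu lg lam z $$ (i, j) =
          M $$ (i, n - 1) / (ev n j - ev (n - 1) i)
          * (((\<Prod>l\<in>{..<n - 1} - {i}. q_poch_inf (of_real q powr (1 + mu j - nu l)) q)
                * (\<Prod>l\<in>{..<n} - {j}. q_poch_inf (of_real q powr (1 + nu i - mu l)) q))
             / ((\<Prod>l\<in>{..<n} - {j}. q_poch_inf (of_real q powr (1 + mu j - mu l)) q)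
                * (\<Prod>l\<in>{..<n - 1} - {i}. q_poch_inf (of_real q powr (1 + nu i - nu l)) q)))
          * (theta_q q (- (of_real q powr (mu j - nu i - nu (n - 1))) * (1 - of_real q) * z)
             / theta_q q (- (of_real q powr (- nu (n - 1))) * (1 - of_real q) * z))
          * exp ((mu j - nu i) * lg z)) \<and>
     (\<forall>j<n.
        connection_matrix q n M ev mu nu lg lam z $$ (n - 1, j) =
          ((\<Prod>l<n - 1. q_poch_inf (of_real q powr (1 + mu j - nu l)) q)
             / (\<Prod>l\<in>{..<n} - {j}. q_poch_inf (of_real q powr (1 + mu j - mu l)) q))
          * ((\<Prod>l\<in>{..<n} - {j}. theta_q q ((1 - of_real q) * of_real q powr (1 - mu l) / lam))
             / (\<Prod>l<n - 1. theta_q q ((1 - of_real q) * of_real q powr (1 - nu l) / lam)))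
          * (theta_q q (of_real q powr (mu j - nu (n - 1)) * lam * z) / theta_q q (lam * z))
          * exp ((mu j - nu (n - 1)) * lg z))"
proof -
  obtain N where nN: "n = Suc N" using n by (cases n) auto
  let ?Q = "complex_of_real q"
  have Q: "?Q \<noteq> 0" "1 - ?Q \<noteq> 0" using q by auto
  define al where "al = (\<lambda>l. 1 - (1 - ?Q) * ev (Suc N) l)"
  define be where "be = (\<lambda>i. 1 - (1 - ?Q) * ev N i)"
  define a where "a = (\<lambda>i. (1 - ?Q) * M $$ (i, N))"
  define b where "b = (\<lambda>i. (1 - ?Q) * M $$ (N, i))"
  define d where "d = 1 - (1 - ?Q) * M $$ (N, N)"
  have al0: "al l \<noteq> 0" if "l \<le> N" for l using log_defined(1)[of l] that by (simp add: al_def nN)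
  have be0: "be i \<noteq> 0" if "i < N" for i using log_defined(2)[of i] that by (simp add: be_def nN)
  have mu_l: "mu l = log_q q (al l)" for l by (simp add: mu mu_exp_def al_def nN)
  have nu_l: "nu i = log_q q (be i)" if "i < N" for i using that by (simp add: nu nu_exp_def be_def nN)
  have qmu: "?Q powr mu l = al l" if "l \<le> N" for l
    unfolding mu_l by (rule q_powr_log_q[OF q al0[OF that]])
  have qnu: "?Q powr nu i = be i" if "i < N" for i
    unfolding nu_l[OF that] by (rule q_powr_log_q[OF q be0[OF that]])
  have al_nonres: "al l \<noteq> al l' * ?Q powi k" if "l \<le> N" "l' \<le> N" "l \<noteq> l'" for l l' and k :: int
    using log_q_resonance[OF q al0[OF that(2)], of "al l" k] mu_nonres[of l l'] that
    by (auto simp: mu_l nN)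
  have be_nonres: "be l \<noteq> be l' * ?Q powi k" if "l < N" "l' < N" "l \<noteq> l'" for l l' and k :: int
    using log_q_resonance[OF q be0[OF that(2)], of "be l" k] nu_nonres[of l l'] that
    by (auto simp: nu_l nN)
  have d1: "ev N i \<noteq> ev N j" if "i < N" "j < N" "i \<noteq> j" for i j
    using be_nonres[OF that, of 0] by (auto simp: be_def)
  have d2: "ev N j \<noteq> ev (N - 1) l" if "j < N" "l < N - 1" for j l
    using ev_distinct[of j l] that by (simp add: nN numeral_2_eq_2)
  have M': "M = diag_A (Suc N) A ev r" by (simp add: M nN)
  note hyps = A[unfolded nN] spectrum[unfolded nN] r[unfolded nN]
  have str: "M \<in> carrier_mat (Suc N) (Suc N)" "char_poly M = char_poly A"
    unfolding M' by (rule diag_A_structure[OF hyps]; use d1 d2 in blast)+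
  have str3: "M $$ (i, k) = (if i = k then ev N i else 0)" if "i < N" "k < N" for i k
    unfolding M' by (rule diag_A_structure(3)[OF hyps _ _ that]) (use d1 d2 in blast)+
  have A_corner: "submatrix A {..<n} {..<n} = A"
    using A by (subst submatrix_corner[OF A order_refl]) (intro eq_matI, auto)
  have char_M: "char_poly M = (\<Prod>l\<le>N. [:- ev (Suc N) l, 1:])"
  proof -
    have "char_poly (submatrix A {..<Suc N} {..<Suc N}) = (\<Prod>l<Suc N. [:- ev (Suc N) l, 1:])"
      using spectrum unfolding is_corner_spectrum_def nN by blast
    then show ?thesis using A_corner unfolding str(2) nN lessThan_Suc_atMost by (simp only:)
  qed
  let ?f = "\<lambda>v. (d - v) * (\<Prod>i<N. be i - v) - (\<Sum>i<N. a i * b i * (\<Prod>j\<in>{..<N} - {i}. be j - v))"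
  have det_v: "?f v = (\<Prod>l\<le>N. al l - v)"
    if v: "\<And>i. i < N \<Longrightarrow> be i - v \<noteq> 0" for v
  proof -
    \<comment> \<open>With (1 - q) x = 1 - v one has (1 - q) (x - M) = B - v, which relates the
      characteristic polynomial of \<open>M\<close> at x to the determinant of the arrow
      matrix.\<close>
    define x where "x = (1 - v) / (1 - ?Q)"
    define X where "X = (1 - ?Q) \<cdot>\<^sub>m (- (char_matrix M x))"
    have Qx: "(1 - ?Q) * x = 1 - v" using Q by (simp add: x_def)
    have Xc: "X \<in> carrier_mat (Suc N) (Suc N)" using str(1) by (simp add: X_def char_matrix_def)
    have Xe: "X $$ (i, k) = (if i = k then 1 - v else 0) - (1 - ?Q) * M $$ (i, k)" if "i \<le> N" "k \<le> N" for i k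
      using that str(1) Qx by (auto simp: X_def char_matrix_def algebra_simps)
    have "det X = X $$ (N, N) * (\<Prod>i<N. be i - v) - (\<Sum>i<N. X $$ (i, N) * X $$ (N, i) * (\<Prod>j\<in>{..<N} - {i}. be j - v))"
      by (rule det_arrow[OF Xc _ v]) (auto simp: Xe str3 be_def)
    moreover have "X $$ (N, N) = d - v" by (simp add: Xe d_def)
    moreover have "X $$ (i, N) * X $$ (N, i) = a i * b i" if "i < N" for i using that by (simp add: Xe a_def b_def)
    moreover have "det X = (1 - ?Q) ^ Suc N * poly (char_poly M) x"
    proof -
      have "dim_col (- char_matrix M x) = Suc N" using str(1) by (simp add: char_matrix_def)
      then show ?thesis unfolding X_def det_smult by (simp only: char_poly_matrix[OF str(1), of x])
    qed
    moreover have "(1 - ?Q) ^ Suc N * poly (char_poly M) x = (\<Prod>l\<le>N. (1 - ?Q) * (x - ev (Suc N) l))"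
      by (simp add: char_M poly_prod prod.distrib)
    moreover have "(1 - ?Q) * (x - ev (Suc N) l) = al l - v" for l using Qx by (simp add: al_def right_diff_distrib)
    ultimately show ?thesis by (simp cong: sum.cong_simp)
  qed
  \<comment> \<open>Both sides are polynomials in v; the determinant formula is valid off the
    finitely many \<open>be i\<close>, and passing to the limit covers these.\<close>
  have char_id: "?f v = (\<Prod>l\<le>N. al l - v)" for v
  proof (rule tendsto_unique[of "at v"])
    show "(\<lambda>v. ?f v) \<midarrow>v\<rightarrow> ?f v" by (intro tendsto_intros)
    have "(\<lambda>v. \<Prod>l\<le>N. al l - v) \<midarrow>v\<rightarrow> (\<Prod>l\<le>N. al l - v)" by (intro tendsto_intros)
    moreover have "\<forall>\<^sub>F w in at v. \<forall>i\<in>{..<N}. be i - w \<noteq> 0"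
    proof (intro eventually_ball_finite ballI finite_lessThan)
      fix i
      have "\<forall>\<^sub>F w in at v. w \<noteq> be i"
      proof (cases "v = be i")
        case True then show ?thesis by (simp add: eventually_at_filter)
      next
        case False then show ?thesis by (rule tendsto_imp_eventually_ne[OF tendsto_ident_at])
      qed
      then show "\<forall>\<^sub>F w in at v. be i - w \<noteq> 0" by eventually_elim auto
    qed
    then have "\<forall>\<^sub>F w in at v. ?f w = (\<Prod>l\<le>N. al l - w)" by eventually_elim (rule det_v, auto)
    ultimately show "(\<lambda>v. ?f v) \<midarrow>v\<rightarrow> (\<Prod>l\<le>N. al l - v)" by (simp add: tendsto_cong)
  qed simp
  have al_be: "al l \<noteq> be i" if "l \<le> N" "i < N" for l i
    using quot_defined[of i l] that Q by (simp add: al_def be_def nN)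
  interpret q_system q N al be a b d
    using q al0 be0 al_nonres be_nonres al_be char_id by unfold_locales auto
  have qnuN: "?Q powr nu N = beN"
  proof -
    have "nu N = (\<Sum>l\<le>N. mu l) - (\<Sum>l<N. nu l)"
      by (simp add: nu nu_exp_def nN mu_exp_def mu lessThan_Suc_atMost)
    then have "?Q powr nu N = (\<Prod>l\<le>N. ?Q powr mu l) / (\<Prod>l<N. ?Q powr nu l)"
      using Q by (simp add: powr_diff powr_sum)
    then show ?thesis by (simp add: qmu qnu beN_def cong: prod.cong_simp)
  qed
  interpret q_connection q N al be a b d M mu nu
    using str(1) str3 qmu qnu qnuN by unfold_locales (auto simp: a_def b_def d_def be_def)
  have lamL: "lam / (1 - ?Q) \<noteq> 0" using lam(1) Q by simp
  have adm: "admissible (lam / (1 - ?Q))"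
    unfolding admissible_def
  proof (intro conjI allI impI lamL)
    fix i m assume i: "i < N"
    show "1 + be i * (lam / (1 - ?Q) * ?Q powi m) \<noteq> 0"
    proof
      assume "1 + be i * (lam / (1 - ?Q) * ?Q powi m) = 0"
      then have "lam * (be i * ?Q powi m) = - (1 - ?Q)" using Q by (simp add: field_simps add_eq_0_iff)
      then have "lam = - ((1 - ?Q) / be i) * ?Q powi (- m)" using Q be0[OF i] by (simp add: power_int_minus field_simps)
      then show False using lam(2)[of i "- m"] i unfolding nN diff_Suc_1 qnu[OF i] by blast
    qed
  qed
  have thL: "theta_q q (lam * z) \<noteq> 0" using theta_q_spiral[OF q lam(1) z(1)] z(3) by auto
  have thx: "theta_q q (- ((1 - ?Q) * z / beN)) \<noteq> 0"
  proof
    assume "theta_q q (- ((1 - ?Q) * z / beN)) = 0"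
    then obtain k :: int where "(1 - ?Q) * z / beN = ?Q powi k"
      using theta_q_eq_0_iff[OF q, of "- ((1 - ?Q) * z / beN)"] z(1) Q by auto
    then have "z = beN / (1 - ?Q) * ?Q powi k" using Q by (simp add: field_simps)
    then show False using z(2)[of k] qnuN by (simp add: nN)
  qed
  have ev: "\<And>l. al l = 1 - (1 - ?Q) * ev (Suc N) l" "\<And>l. be l = 1 - (1 - ?Q) * ev N l"
    by (simp_all add: al_def be_def)
  note entries = connection_matrix_entries[where ev = ev and lg = lg, OF adm lam(1) z(1) thL thx ev]
  have pw: "?Q powr (1 + mu j - nu l) = ?Q * al j / be l" if "j \<le> N" "l < N" for j l
    using that Q by (simp add: powr_add powr_diff qmu qnu)
  have pw2: "?Q powr (1 + nu l - mu j) = ?Q * be l / al j" if "j \<le> N" "l < N" for j l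
    using that Q by (simp add: powr_add powr_diff qmu qnu)
  have pw3: "?Q powr (1 + mu j - mu l) = ?Q * al j / al l" if "j \<le> N" "l \<le> N" for j l
    using that Q by (simp add: powr_add powr_diff qmu)
  have pw4: "?Q powr (1 + nu j - nu l) = ?Q * be j / be l" if "j < N" "l < N" for j l
    using that Q by (simp add: powr_add powr_diff qnu)
  \<comment> \<open>The argument is q / (al_l L) with L = lam / (1 - q); the inversion theta(q / x)
    = theta(x) converts it into the one produced by the row.\<close>
  have t1: "theta_q q ((1 - ?Q) * ?Q powr (1 - mu l) / lam) = theta_q q (al l * (lam / (1 - ?Q)))" if "l \<le> N" for l
  proof -
    have "(1 - ?Q) * ?Q powr (1 - mu l) / lam = ?Q / (al l * (lam / (1 - ?Q)))"
      using that Q by (simp add: powr_diff qmu)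
    then show ?thesis using theta_q_inversion[OF q, of "al l * (lam / (1 - ?Q))"] al0[OF that] lamL by simp
  qed
  have t2: "theta_q q ((1 - ?Q) * ?Q powr (1 - nu l) / lam) = theta_q q (be l * (lam / (1 - ?Q)))" if "l < N" for l
  proof -
    have "(1 - ?Q) * ?Q powr (1 - nu l) / lam = ?Q / (be l * (lam / (1 - ?Q)))"
      using that Q by (simp add: powr_diff qnu)
    then show ?thesis using theta_q_inversion[OF q, of "be l * (lam / (1 - ?Q))"] be0[OF that] lamL by simp
  qed
  show ?thesis
    unfolding nN diff_Suc_1
  proof (intro conjI allI impI, goal_cases)
    case (1 i j)
    then have i: "i < N" and j: "j \<le> N" by auto
    have "a i / (be i - al j) = M $$ (i, N) / (ev (Suc N) j - ev N i)"
    proof -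
      have "be i - al j = (1 - ?Q) * (ev (Suc N) j - ev N i)" by (simp add: al_def be_def algebra_simps)
      then show ?thesis using Q by (simp add: a_def)
    qed
    moreover have "- (?Q powr (mu j - nu i - nu N)) * (1 - ?Q) * z = - (al j / be i) * ((1 - ?Q) * z / beN)"
      using i j by (simp add: powr_diff qmu qnu qnuN)
    moreover have "- (?Q powr (- nu N)) * (1 - ?Q) * z = - ((1 - ?Q) * z / beN)"
      by (simp add: powr_minus qnuN divide_inverse mult_ac)
    moreover have "(\<Prod>l\<in>{..<N} - {i}. q_poch_inf (?Q powr (1 + mu j - nu l)) q) = (\<Prod>l\<in>{..<N} - {i}. q_poch_inf (?Q * al j / be l) q)"
      "(\<Prod>l\<in>{..<Suc N} - {j}. q_poch_inf (?Q powr (1 + nu i - mu l)) q) = (\<Prod>l\<in>{..N} - {j}. q_poch_inf (?Q * be i / al l) q)"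
      "(\<Prod>l\<in>{..<Suc N} - {j}. q_poch_inf (?Q powr (1 + mu j - mu l)) q) = (\<Prod>l\<in>{..N} - {j}. q_poch_inf (?Q * al j / al l) q)"
      "(\<Prod>l\<in>{..<N} - {i}. q_poch_inf (?Q powr (1 + nu i - nu l)) q) = (\<Prod>l\<in>{..<N} - {i}. q_poch_inf (?Q * be i / be l) q)"
      using i j by (auto intro!: prod.cong simp: pw pw2 pw3 pw4)
    ultimately show ?case
      using entries(1)[OF j i] by (simp only: conn_top_def)
  next
    case (2 j)
    then have j: "j \<le> N" by simp
    have "?Q powr (mu j - nu N) * lam * z = al j * (lam / (1 - ?Q)) * ((1 - ?Q) * z / beN)"
      using j Q by (simp add: powr_diff qmu qnuN)
    moreover have "(\<Prod>l<N. q_poch_inf (?Q powr (1 + mu j - nu l)) q) = (\<Prod>l<N. q_poch_inf (?Q * al j / be l) q)"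
      "(\<Prod>l\<in>{..<Suc N} - {j}. q_poch_inf (?Q powr (1 + mu j - mu l)) q) = (\<Prod>l\<in>{..N} - {j}. q_poch_inf (?Q * al j / al l) q)"
      "(\<Prod>l\<in>{..<Suc N} - {j}. theta_q q ((1 - ?Q) * ?Q powr (1 - mu l) / lam)) = (\<Prod>l\<in>{..N} - {j}. theta_q q (al l * (lam / (1 - ?Q))))"
      "(\<Prod>l<N. theta_q q ((1 - ?Q) * ?Q powr (1 - nu l) / lam)) = (\<Prod>l<N. theta_q q (be l * (lam / (1 - ?Q))))"
      using j by (auto intro!: prod.cong simp: pw pw3 t1 t2)
    ultimately show ?case
      using entries(2)[OF j] by (simp only: conn_bot_def)
  qed
qed

end
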